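(* Let $\hat f_{\lambda,n,M}$ be the random forest regression estimator built from $n$ samples using $M$ i.i.d. random tessellations induced by a stationary Poisson hyperplane process in $\mathbb{R}^D$ with intensity $\lambda>0$ and normalized associated zonoid $\Pi$. Assume that $X$ has intrinsic dimension $d$, i.e. the support of the distribution $\mu$ of $X$ is contained in a $d$-dimensional linear subspace $\mathcal S$ of $\mathbb{R}^D$. Let $\beta\in(0,1]$ and $L>0$. (1) If $f\in\mathcal C^{0,\beta}(L)$ and $\lambda_n\sim L^{2/(d+2\beta)}n^{1/(d+2\beta)}$ as $n\to\infty$, then for every $M\ge1$, $$\mathbb{E}\big[(\hat f_{\lambda_n,n,M}(X)-f(X))^2\big]=O\left(L^{2d/(d+2\beta)}n^{-2\beta/(d+2\beta)}\right).$$ (2) Suppose $f\in\mathcal C^{1,\beta}(L)$, the support $K$ of $\mu$ is convex and $d$-dimensional, and $\mu$ has a positive and Lipschitz density with respect to ($d$-dimensional) Lebesgue measure on $K$. Let $r(K)$ be the inradius of $K$ and $K_\varepsilon:=\{x\in K:d(x,\partial K)\ge\varepsilon\}$. If, as $n\to\infty$, $\lambda_n\sim L^{2/(d+2\beta+2)}n^{1/(d+2\beta+2)}$ and $M_n\gtrsim L^{4\beta/(d+2\beta+2)}n^{2\beta/(d+2\beta+2)}$, then for every $\varepsilon\in(0,r(K))$, $$\mathbb{E}\big[(\hat f_{\lambda_n,n,M_n}(X)-f(X))^2\,\big|\,X\in K_\varepsilon\big]=O\left(L^{2d/(d+2\beta+2)}n^{-(2\beta+2)/(d+2\beta+2)}\right),$$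 and, if $\beta\le1/2$, the same rate holds for the unconditional risk $\mathbb{E}\big[(\hat f_{\lambda_n,n,M_n}(X)-f(X))^2\big]$.
   Context: Poisson hyperplane tessellations. Let $\varphi$ be an even Borel probability measure on the unit sphere $\mathbb{S}^{D-1}$ whose support contains $D$ linearly independent vectors, and $H(u,t)=\{x\in\mathbb{R}^D:\langle x,u\rangle=t\}$. The stationary Poisson hyperplane process with intensity $\lambda>0$ and directional distribution $\varphi$ is the Poisson point process on the space of affine hyperplanes of $\mathbb{R}^D$ with intensity measure $\lambda\int_{\mathbb{R}}\int_{\mathbb{S}^{D-1}}1_{\{H(u,t)\in\,\cdot\}}\,d\varphi(u)\,dt$. The induced Poisson hyperplane tessellation is the collection of closures of the connected components of the complement of the union of its hyperplanes. Its normalized associated zonoid is the convex body $\Pi$ with support function $h(\Pi,v)=\frac12\int_{\mathbb{S}^{D-1}}|\langle u,v\rangle|\,d\varphi(u)$, $v\in\mathbb{R}^D$. Regression setting. $W\subset\mathbb{R}^D$ is a non-empty compact convex $D$-dimensional set. The data $\mathcal D_n=\{(X_1,Y_1),\dots,(X_n,Y_n)\}$ are i.i.d. copies of $(X,Y)\in W\times\mathbb{R}$ with $\mathbb{E}[Y^2]<\infty$; $X$ has law $\mu$; $Y=f(X)+\epsilon$ with $f(X)=\mathbb{E}[Y|X]$, $\mathbb{E}[\epsilon|X]=0$, $\mathrm{Var}(\epsilon|X)=\sigma^2<\infty$ a.s. For a random tessellation $\mathcal P$, the tree estimator is $\hat f_n(x,\mathcal P)=\frac{1}{\mathcal N_n(x)}\sum_{i=1}^n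 1_{\{X_i\in Z_x\}}Y_i$, where $Z_x$ is the cell of $\mathcal P$ containing $x$ and $\mathcal N_n(x)=\sum_{i=1}^n1_{\{X_i\in Z_x\}}$, with value $0$ if $\mathcal N_n(x)=0$. The forest estimator is $\hat f_{\lambda,n,M}(x)=\frac1M\sum_{m=1}^M\hat f_n(x,\mathcal P_m)$, where $\mathcal P_1,\dots,\mathcal P_M$ are i.i.d. copies of the Poisson hyperplane tessellation of intensity $\lambda$ restricted to $W$, independent of $\mathcal D_n$ and of $X$; in the expectations $X\sim\mu$ is independent of $\mathcal D_n$. Hölder classes. For $k\in\{0,1\}$, $\mathcal C^{k,\beta}(L)$ is the set of $k$ times differentiable $f:W\to\mathbb{R}$ such that for every multi-index $\alpha$ with $|\alpha|\le k$ and all $x,y\in W$, $|D^\alpha f(x)-D^\alpha f(y)|\le L\|x-y\|^\beta$ and $|D^\alpha f(x)|\le L$. The boundary $\partial K$ and the inradius $r(K)$ are taken relative to $\mathcal S$. $a_n\gtrsim b_n$ means $a_n\ge c\,b_n$ for some constant $c>0$ and all large $n$. All $O(\cdot)$ are as $n\to\infty$ with everything else ($d,D,\beta,L,\Pi,\mathcal S,W,\mu,f,\sigma,\varepsilon$) fixed. *)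

theory Defs
  imports "HOL-Probability.Probability" "HOL-Library.Landau_Symbols"
begin

definition measure_support :: "'a::topological_space measure \<Rightarrow> 'a set" where
  "measure_support N =
     {x \<in> space N. \<forall>U. open U \<and> x \<in> U \<longrightarrow> emeasure N (U \<inter> space N) > 0}"

definition support_function :: "'a::real_inner set \<Rightarrow> 'a \<Rightarrow> real" where
  "support_function K v = (SUP x\<in>K. x \<bullet> v)"

definition directional_distribution :: "(real ^ 'n) measure \<Rightarrow> bool" where
  "directional_distribution \<phi> \<longleftrightarrow>
     prob_space \<phi> \<and>
     sets \<phi> = sets (restrict_space borel (sphere 0 1)) \<and>
     distr \<phi> \<phi> uminus = \<phi> \<and>
     (\<exists>B \<subseteq> measure_support \<phi>. independent B \<and> card B = CARD('n))"

definition normalized_associated_zonoid :: "(real ^ 'n) measure \<Rightarrow> (real ^ 'n) set \<Rightarrow> bool" where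
  "normalized_associated_zonoid \<phi> K \<longleftrightarrow>
     convex K \<and> compact K \<and> K \<noteq> {} \<and>
     (\<forall>v. support_function K v = 1/2 * (LINT u|\<phi>. \<bar>u \<bullet> v\<bar>))"

definition hyperplane :: "real ^ 'n \<Rightarrow> real \<Rightarrow> (real ^ 'n) set" where
  "hyperplane u t = {x. x \<bullet> u = t}"

definition hyperplanes :: "(real ^ 'n) set set" where
  "hyperplanes = {hyperplane u t | u t. u \<in> sphere 0 1}"

text \<open>The space of hyperplanes is the quotient of \<open>sphere 0 1 \<times> \<real>\<close> by \<open>(u, t) \<sim> (-u, -t)\<close>; it
  carries the quotient sigma-algebra, which is its Borel sigma-algebra.\<close>

definition hyperplane_space :: "(real ^ 'n) set measure" where
  "hyperplane_space = sigma hyperplanes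
     {A. A \<subseteq> hyperplanes \<and>
         {p \<in> sphere 0 1 \<times> UNIV. hyperplane (fst p) (snd p) \<in> A}
           \<in> sets (restrict_space borel (sphere 0 1) \<Otimes>\<^sub>M borel)}"

definition hyperplane_intensity :: "(real ^ 'n) measure \<Rightarrow> real \<Rightarrow> (real ^ 'n) set measure" where
  "hyperplane_intensity \<phi> lam = scale_measure (ennreal lam)
     (distr (\<phi> \<Otimes>\<^sub>M lborel) hyperplane_space (\<lambda>(u, t). hyperplane u t))"

text \<open>The intensity measure has no atoms, so a point process with this intensity measure is simple
  and is represented by its random locally finite set of hyperplanes. Such sets carry the
  sigma-algebra generated by the counting variables.\<close>

definition hyperplane_configs :: "(real ^ 'n) set set set" where
  "hyperplane_configs =
     {h. h \<subseteq> hyperplanes \<and> (\<forall>C. compact C \<longrightarrow> finite {E \<in> h. E \<inter> C \<noteq> {}})}"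

definition hits :: "(real ^ 'n) set set \<Rightarrow> (real ^ 'n) set set \<Rightarrow> ennreal" where
  "hits A h = emeasure (count_space UNIV) (h \<inter> A)"

definition config_space :: "(real ^ 'n) set set measure" where
  "config_space = sigma hyperplane_configs
     {{h \<in> hyperplane_configs. hits A h \<in> U} | A U. A \<in> sets hyperplane_space \<and> U \<in> sets borel}"

definition poisson_hyperplane_process ::
  "'w measure \<Rightarrow> (real ^ 'n) measure \<Rightarrow> real \<Rightarrow> ('w \<Rightarrow> (real ^ 'n) set set) \<Rightarrow> bool" where
  "poisson_hyperplane_process Pr \<phi> lam H \<longleftrightarrow>
     prob_space Pr \<and> H \<in> Pr \<rightarrow>\<^sub>M config_space \<and>
     (\<forall>A \<in> sets hyperplane_space. emeasure (hyperplane_intensity \<phi> lam) A < \<infinity> \<longrightarrow>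
        (\<forall>k. measure Pr {w \<in> space Pr. hits A (H w) = of_nat k} =
               (let r = measure (hyperplane_intensity \<phi> lam) A in r ^ k / fact k * exp (- r)))) \<and>
     (\<forall>(A :: nat \<Rightarrow> _) k. (\<forall>i<k. A i \<in> sets hyperplane_space) \<and> disjoint_family_on A {..<k} \<longrightarrow>
        prob_space.indep_vars Pr (\<lambda>_. borel) (\<lambda>i w. hits (A i) (H w)) {..<k})"

definition induced_tessellation ::
  "(real ^ 'n) set \<Rightarrow> (real ^ 'n) set set \<Rightarrow> (real ^ 'n) set set" where
  "induced_tessellation W h =
     {closure C \<inter> W | C. C \<in> components (- \<Union>h) \<and> closure C \<inter> W \<noteq> {}}"

text \<open>A fixed point almost surely lies on no hyperplane, and then lies in exactly one cell. On the
  exceptional null event, where the cell containing the point is ambiguous, it is set to be empty.\<close>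

definition cell_of :: "(real ^ 'n) set set \<Rightarrow> real ^ 'n \<Rightarrow> (real ^ 'n) set" where
  "cell_of T x = (if \<exists>!C. C \<in> T \<and> x \<in> C then THE C. C \<in> T \<and> x \<in> C else {})"

definition cell_count ::
  "nat \<Rightarrow> (nat \<Rightarrow> (real ^ 'n) \<times> real) \<Rightarrow> (real ^ 'n) set set \<Rightarrow> real ^ 'n \<Rightarrow> real" where
  "cell_count n Z T x = (\<Sum>i<n. indicator (cell_of T x) (fst (Z i)))"

definition tree_estimator ::
  "nat \<Rightarrow> (nat \<Rightarrow> (real ^ 'n) \<times> real) \<Rightarrow> (real ^ 'n) set set \<Rightarrow> real ^ 'n \<Rightarrow> real" where
  "tree_estimator n Z T x =
     (if cell_count n Z T x = 0 then 0
      else 1 / cell_count n Z T x * (\<Sum>i<n. indicator (cell_of T x) (fst (Z i)) * snd (Z i)))"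

definition forest_estimator ::
  "nat \<Rightarrow> nat \<Rightarrow> (nat \<Rightarrow> (real ^ 'n) \<times> real) \<Rightarrow> (nat \<Rightarrow> (real ^ 'n) set set) \<Rightarrow> real ^ 'n \<Rightarrow> real"
  where
  "forest_estimator n M Z T x = 1 / real M * (\<Sum>m<M. tree_estimator n Z (T m) x)"

definition cond_var :: "'a measure \<Rightarrow> 'a measure \<Rightarrow> ('a \<Rightarrow> real) \<Rightarrow> 'a \<Rightarrow> real" where
  "cond_var N F g = real_cond_exp N F (\<lambda>x. (g x - real_cond_exp N F g x)\<^sup>2)"

text \<open>\<open>\<rho>\<close> is the law of \<open>(X, Y)\<close> on \<open>W \<times> \<real>\<close>; conditioning on \<open>X\<close> is conditioning on \<open>fst\<close>.\<close>

definition regression_model ::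
  "(real ^ 'n) set \<Rightarrow> ((real ^ 'n) \<times> real) measure \<Rightarrow> (real ^ 'n \<Rightarrow> real) \<Rightarrow> real \<Rightarrow> bool" where
  "regression_model W \<rho> f \<sigma> \<longleftrightarrow>
     prob_space \<rho> \<and>
     sets \<rho> = sets (restrict_space borel W \<Otimes>\<^sub>M borel) \<and>
     integrable \<rho> (\<lambda>z. (snd z)\<^sup>2) \<and>
     (let F = vimage_algebra (space \<rho>) fst borel; noise = (\<lambda>z. snd z - f (fst z))
      in (AE z in \<rho>. real_cond_exp \<rho> F snd z = f (fst z)) \<and>
         (AE z in \<rho>. real_cond_exp \<rho> F noise z = 0) \<and>
         (AE z in \<rho>. cond_var \<rho> F noise z = \<sigma>\<^sup>2))"

definition covariate_law :: "((real ^ 'n) \<times> real) measure \<Rightarrow> (real ^ 'n) measure" where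
  "covariate_law \<rho> = distr \<rho> borel fst"

datatype source = Test | Sample nat | Hyperplanes nat

text \<open>On the probability space \<open>Pr\<close>: a test point \<open>X\<close>, the sample \<open>Z 0, \<dots>, Z (n-1)\<close> and the
  hyperplane processes \<open>H 0, \<dots>, H (M-1)\<close>, all mutually independent.\<close>

definition forest_experiment ::
  "(real ^ 'n) set \<Rightarrow> ((real ^ 'n) \<times> real) measure \<Rightarrow> (real ^ 'n) measure \<Rightarrow> real \<Rightarrow> nat \<Rightarrow> nat \<Rightarrow>
   'w measure \<Rightarrow> ('w \<Rightarrow> real ^ 'n) \<Rightarrow> (nat \<Rightarrow> 'w \<Rightarrow> (real ^ 'n) \<times> real) \<Rightarrow>
   (nat \<Rightarrow> 'w \<Rightarrow> (real ^ 'n) set set) \<Rightarrow> bool" where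
  "forest_experiment W \<rho> \<phi> lam n M Pr X Z H \<longleftrightarrow>
     lam > 0 \<and> M \<ge> 1 \<and> prob_space Pr \<and>
     X \<in> Pr \<rightarrow>\<^sub>M restrict_space borel W \<and> distr Pr borel X = covariate_law \<rho> \<and>
     (\<forall>i<n. Z i \<in> Pr \<rightarrow>\<^sub>M \<rho> \<and> distr Pr \<rho> (Z i) = \<rho>) \<and>
     (\<forall>m<M. poisson_hyperplane_process Pr \<phi> lam (H m)) \<and>
     prob_space.indep_sets Pr
       (\<lambda>s. case s of
          Test \<Rightarrow> sets (vimage_algebra (space Pr) X borel)
        | Sample i \<Rightarrow> sets (vimage_algebra (space Pr) (Z i) \<rho>)
        | Hyperplanes m \<Rightarrow> sets (vimage_algebra (space Pr) (H m) config_space))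
       ({Test} \<union> Sample ` {..<n} \<union> Hyperplanes ` {..<M})"

definition squared_error ::
  "(real ^ 'n) set \<Rightarrow> (real ^ 'n \<Rightarrow> real) \<Rightarrow> nat \<Rightarrow> nat \<Rightarrow> ('w \<Rightarrow> real ^ 'n) \<Rightarrow>
   (nat \<Rightarrow> 'w \<Rightarrow> (real ^ 'n) \<times> real) \<Rightarrow> (nat \<Rightarrow> 'w \<Rightarrow> (real ^ 'n) set set) \<Rightarrow> 'w \<Rightarrow> real" where
  "squared_error W f n M X Z H w =
     (forest_estimator n M (\<lambda>i. Z i w) (\<lambda>m. induced_tessellation W (H m w)) (X w) - f (X w))\<^sup>2"

definition expectation_given :: "'w measure \<Rightarrow> 'w set \<Rightarrow> ('w \<Rightarrow> real) \<Rightarrow> real" where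
  "expectation_given Pr A V = (LINT w:A|Pr. V w) / measure Pr A"

definition holder_bounded :: "(real ^ 'n) set \<Rightarrow> real \<Rightarrow> real \<Rightarrow> (real ^ 'n \<Rightarrow> real) \<Rightarrow> bool" where
  "holder_bounded W \<beta> L g \<longleftrightarrow>
     (\<forall>x\<in>W. \<forall>y\<in>W. \<bar>g x - g y\<bar> \<le> L * norm (x - y) powr \<beta>) \<and> (\<forall>x\<in>W. \<bar>g x\<bar> \<le> L)"

definition holder_class_0 :: "(real ^ 'n) set \<Rightarrow> real \<Rightarrow> real \<Rightarrow> (real ^ 'n \<Rightarrow> real) set" where
  "holder_class_0 W \<beta> L = {f. holder_bounded W \<beta> L f}"

text \<open>The derivative is unique at every point of a convex \<open>W\<close> of full dimension, also at boundary
  points, where it is taken within \<open>W\<close>.\<close>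

definition holder_class_1 :: "(real ^ 'n) set \<Rightarrow> real \<Rightarrow> real \<Rightarrow> (real ^ 'n \<Rightarrow> real) set" where
  "holder_class_1 W \<beta> L =
     {f. holder_bounded W \<beta> L f \<and>
         (\<exists>f'. (\<forall>x\<in>W. (f has_derivative f' x) (at x within W)) \<and>
               (\<forall>i. holder_bounded W \<beta> L (\<lambda>x. f' x (axis i 1))))}"

text \<open>Lebesgue measure on the subspace \<open>S\<close>, in the coordinates of an orthonormal basis of \<open>S\<close>; by
  rotation invariance the choice of the basis does not matter.\<close>

definition orthonormal_basis_of :: "(real ^ 'n) set \<Rightarrow> (real ^ 'n) set" where
  "orthonormal_basis_of S =
     (SOME B. B \<subseteq> S \<and> pairwise orthogonal B \<and> (\<forall>b\<in>B. norm b = 1) \<and> span B = S)"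

definition subspace_lborel :: "(real ^ 'n) set \<Rightarrow> (real ^ 'n) measure" where
  "subspace_lborel S =
     (let B = orthonormal_basis_of S
      in distr (\<Pi>\<^sub>M b\<in>B. lborel) borel (\<lambda>c. \<Sum>b\<in>B. c b *\<^sub>R b))"

definition positive_lipschitz_density_on ::
  "(real ^ 'n) set \<Rightarrow> (real ^ 'n) set \<Rightarrow> (real ^ 'n) measure \<Rightarrow> bool" where
  "positive_lipschitz_density_on S K \<mu> \<longleftrightarrow>
     (\<exists>p. (\<forall>x\<in>K. p x > 0) \<and> (\<exists>C. C-lipschitz_on K p) \<and>
          \<mu> = density (subspace_lborel S) (\<lambda>x. ennreal (indicator K x * p x)))"

definition inradius_in :: "(real ^ 'n) set \<Rightarrow> (real ^ 'n) set \<Rightarrow> real" where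
  "inradius_in S K = Sup {r. r \<ge> 0 \<and> (\<exists>x\<in>S. cball x r \<inter> S \<subseteq> K)}"

definition inner_part_in :: "(real ^ 'n) set \<Rightarrow> (real ^ 'n) set \<Rightarrow> real \<Rightarrow> (real ^ 'n) set" where
  "inner_part_in S K \<epsilon> = {x \<in> K. infdist x (top_of_set S frontier_of K) \<ge> \<epsilon>}"

end

(* The risk splits into a variance and a bias part, the trees being compared with the averages of f
   over the cells with respect to the law mu of X.

   Variance: given the tessellation, a tree has conditional risk of order 1 / (n mu(cell)), and the
   integral of 1 / mu(cell) against mu is the number of cells met by the support. The bounded support
   is covered by O(lam^d) balls of radius 1 / lam, and k hyperplanes cut a ball into at most 2^k
   pieces, where k is Poisson with bounded mean, so the expected number of cells is O(lam^d).

   Bias: the void probabilities of the hyperplane process show that the radius of the cell of a fixed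
   point has exponential tails on the scale 1 / lam, so a single tree has squared bias
   O(lam^(-2 beta)), respectively O(lam^(-2)) for f of class C^1. For part (2) the M^2 - M
   off-diagonal terms of the squared forest bias only involve the mean bias at a point x. The law of
   the process is invariant under the reflection at x, so averaging over a cell and its reflection
   cancels the linear term of f up to the Lipschitz oscillation of the density, which leaves
   O(lam^(-1-beta)) whenever the cell and its reflection stay inside K. Near the boundary this fails,
   but only on a layer of mass O(1 / lam), which is affordable when beta <= 1/2. *)

theory Submission
  imports Defs
begin

subsection \<open>Hyperplanes and void events\<close>

text \<open>The obstacle is measurability: \<open>config_space\<close> only provides counting
  variables, and neither cells nor their radii or masses are evidently random objects. The cell is
  therefore replaced by the relation \<open>same_cell\<close>, which agrees with membership in
  \<open>cell_of\<close> for points of \<open>W\<close> off the hyperplanes, hence almost surely,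
  and which is jointly measurable in both points and the configuration. Void events suffice for
  this, so the law of the process is transported to the sigma-algebra \<open>void_space\<close>, on
  which void probabilities determine it. Reflection invariance thereby becomes a computation with
  the intensity measure, and all trees get literally the same law. Reflexivity
  \<open>same_cell h x x\<close> expresses that \<open>x\<close> lies on no hyperplane and is
  carried along as the genericity condition. Constants are chosen before the probability space, the
  intensity and the point, because every sample size brings its own experiment and the rates need
  uniformity.\<close>

definition same_cell :: "(real ^ 'n) set set \<Rightarrow> real ^ 'n \<Rightarrow> real ^ 'n \<Rightarrow> bool" where
  "same_cell h x y \<longleftrightarrow> (\<forall>E\<in>h. E \<inter> closed_segment x y = {})"

text \<open>Since all members hit one ball, their intensity is bounded by a multiple of its radius
  (\<open>emeasure_hyperplanes_le\<close>). It is thus finite, and the Poisson void probability is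
  available.\<close>

definition window :: "(real ^ 'n) set set \<Rightarrow> bool" where
  "window A \<longleftrightarrow> A \<in> sets hyperplane_space \<and> (\<exists>r. \<forall>E\<in>A. E \<inter> cball 0 r \<noteq> {})"

text \<open>The generators are the events that a count is zero, so they are events of
  \<open>config_space\<close>. They are stable under intersection, because the void events of
  \<open>A\<close> and \<open>B\<close> meet in the void event of the union; hence void
  probabilities alone determine a law on this space.\<close>

definition void_space :: "(real ^ 'n) set set measure" where
  "void_space = sigma hyperplane_configs {{h \<in> hyperplane_configs. h \<inter> A = {}} | A. window A}"

lemma space_void_space [simp]: "space void_space = hyperplane_configs"
  unfolding void_space_def by (rule space_measure_of) auto

lemma void_event_in_void_space: "window A \<Longrightarrow> {h \<in> hyperplane_configs. h \<inter> A = {}} \<in> sets void_space"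
  unfolding void_space_def by (subst sets_measure_of) auto

lemma space_hyperplane_space [simp]: "space hyperplane_space = hyperplanes"
  unfolding hyperplane_space_def by (rule space_measure_of) auto

lemma sets_hyperplane_spaceI:
  assumes "A \<subseteq> hyperplanes"
    "{p \<in> sphere 0 1 \<times> UNIV. hyperplane (fst p) (snd p) \<in> A}
       \<in> sets (restrict_space borel (sphere 0 1) \<Otimes>\<^sub>M borel)"
  shows "A \<in> sets hyperplane_space"
  unfolding hyperplane_space_def by (subst sets_measure_of) (use assms in auto)

text \<open>The parametrisation by a unit normal and an offset is two-to-one. This controls the
  preimages through which the sigma-algebra of \<open>hyperplane_space\<close> is defined.\<close>

lemma hyperplane_eq_cases:
  fixes u v :: "real ^ 'n"
  assumes u: "norm u = 1" and v: "norm v = 1" and eq: "hyperplane u t = hyperplane v s"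
  shows "v = u \<and> s = t \<or> v = - u \<and> s = - t"
proof -
  have uu: "u \<bullet> u = 1" using u by (simp add: dot_square_norm)
  have vv: "v \<bullet> v = 1" using v by (simp add: dot_square_norm)
  have mem: "(t *\<^sub>R u + w) \<bullet> v = s" if "w \<bullet> u = 0" for w
  proof -
    have "t *\<^sub>R u + w \<in> hyperplane u t"
      using that uu by (simp add: hyperplane_def inner_add_left)
    then have "t *\<^sub>R u + w \<in> hyperplane v s" using eq by simp
    then show ?thesis by (simp add: hyperplane_def)
  qed
  have s: "s = t * (u \<bullet> v)" using mem[of 0] by simp
  \<comment> \<open>The component of \<open>v\<close> orthogonal to \<open>u\<close>. Moving along
    it stays in the first hyperplane, hence in the second, and this forces it to vanish.\<close>
  define w where "w = v - (v \<bullet> u) *\<^sub>R u"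
  have wu: "w \<bullet> u = 0" by (simp add: w_def inner_diff_left uu)
  have "w \<bullet> v = 0" using mem[OF wu] s by (simp add: inner_add_left)
  then have "w \<bullet> w = 0" using wu by (simp add: w_def inner_diff_right inner_commute)
  then have veq: "v = (v \<bullet> u) *\<^sub>R u" by (simp add: w_def)
  then have "\<bar>v \<bullet> u\<bar> = 1" using u v by (metis mult.right_neutral norm_scaleR)
  then have "v \<bullet> u = 1 \<or> v \<bullet> u = -1" by linarith
  then show ?thesis
  proof
    assume "v \<bullet> u = 1"
    then show ?thesis using veq s by (simp add: inner_commute)
  next
    assume "v \<bullet> u = -1"
    then show ?thesis using veq s by (simp add: inner_commute)
  qed
qed

text \<open>\<open>R\<close> may distinguish \<open>(u, t)\<close> from \<open>(- u, - t)\<close>: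
  by \<open>hyperplane_eq_cases\<close> the preimage of the family is the union of the region of
  \<open>R\<close> with its mirror image, and both are measurable.\<close>

lemma hyperplane_family_measurable:
  fixes R :: "real ^ 'n \<Rightarrow> real \<Rightarrow> bool"
  assumes [measurable]: "Measurable.pred (borel \<Otimes>\<^sub>M borel) (\<lambda>p. R (fst p) (snd p))"
  shows "{hyperplane u t |u t. norm u = 1 \<and> R u t} \<in> sets hyperplane_space" (is "?A \<in> _")
proof (rule sets_hyperplane_spaceI)
  show "?A \<subseteq> hyperplanes" by (auto simp: hyperplanes_def)
  let ?N = "restrict_space borel (sphere 0 1) \<Otimes>\<^sub>M borel :: ((real ^ 'n) \<times> real) measure"
  have [measurable]: "(\<lambda>p. fst p) \<in> ?N \<rightarrow>\<^sub>M borel" "(\<lambda>p. snd p) \<in> ?N \<rightarrow>\<^sub>M borel"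
    by (rule measurable_compose[OF measurable_fst measurable_restrict_space1]) auto
  have sp: "space ?N = sphere 0 1 \<times> UNIV" by (simp add: space_pair_measure space_restrict_space)
  have "(\<lambda>p. (fst p, snd p)) \<in> ?N \<rightarrow>\<^sub>M borel \<Otimes>\<^sub>M borel" by measurable
  from measurable_compose[OF this assms]
  have 1 [measurable]: "Measurable.pred ?N (\<lambda>p. R (fst p) (snd p))" by simp
  have "(\<lambda>p. (- fst p, - snd p)) \<in> ?N \<rightarrow>\<^sub>M borel \<Otimes>\<^sub>M borel" by measurable
  from measurable_compose[OF this assms]
  have 2 [measurable]: "Measurable.pred ?N (\<lambda>p. R (- fst p) (- snd p))" by simp
  have "{p \<in> sphere 0 1 \<times> UNIV. hyperplane (fst p) (snd p) \<in> ?A} =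
      {p \<in> space ?N. R (fst p) (snd p) \<or> R (- fst p) (- snd p)}"
  proof (intro set_eqI iffI)
    fix p :: "(real ^ 'n) \<times> real"
    assume p: "p \<in> {p \<in> sphere 0 1 \<times> UNIV. hyperplane (fst p) (snd p) \<in> ?A}"
    then obtain u t where *: "hyperplane (fst p) (snd p) = hyperplane u t" "norm u = 1" "R u t"
      by auto
    from hyperplane_eq_cases[OF _ *(2) *(1)] p * show
      "p \<in> {p \<in> space ?N. R (fst p) (snd p) \<or> R (- fst p) (- snd p)}"
      unfolding sp by auto
  next
    fix p :: "(real ^ 'n) \<times> real"
    assume "p \<in> {p \<in> space ?N. R (fst p) (snd p) \<or> R (- fst p) (- snd p)}"
    then have p: "norm (fst p) = 1" "R (fst p) (snd p) \<or> R (- fst p) (- snd p)"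
      unfolding sp by auto
    have "hyperplane (- fst p) (- snd p) = hyperplane (fst p) (snd p)"
      by (auto simp: hyperplane_def)
    then have "hyperplane (fst p) (snd p) \<in> ?A"
      using p by (metis (mono_tags, lifting) mem_Collect_eq norm_minus_cancel)
    then show "p \<in> {p \<in> sphere 0 1 \<times> UNIV. hyperplane (fst p) (snd p) \<in> ?A}"
      using p by (cases p) auto
  qed
  also have "\<dots> \<in> sets ?N" by measurable
  finally show "{p \<in> sphere 0 1 \<times> UNIV. hyperplane (fst p) (snd p) \<in> ?A} \<in> sets ?N" .
qed

section \<open>Joint measurability of \<open>same_cell\<close>\<close>

definition near_segment :: "real ^ 'n \<Rightarrow> real ^ 'n \<Rightarrow> real \<Rightarrow> (real ^ 'n) set set" where
  "near_segment x y r = {E \<in> hyperplanes. \<exists>p\<in>E. \<exists>q\<in>closed_segment x y. dist p q < r}"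

lemma hyperplane_point_near:
  fixes u q :: "real ^ 'n"
  assumes u: "norm u = 1"
  shows "(\<exists>p\<in>hyperplane u t. dist p q < r) \<longleftrightarrow> \<bar>q \<bullet> u - t\<bar> < r"
proof
  assume "\<exists>p\<in>hyperplane u t. dist p q < r"
  then obtain p where p: "p \<bullet> u = t" "dist p q < r" by (auto simp: hyperplane_def)
  have "\<bar>q \<bullet> u - t\<bar> = \<bar>(q - p) \<bullet> u\<bar>" using p by (simp add: inner_diff_left)
  also have "\<dots> \<le> norm (q - p) * norm u" by (rule Cauchy_Schwarz_ineq2)
  finally show "\<bar>q \<bullet> u - t\<bar> < r" using p u by (simp add: dist_norm norm_minus_commute)
next
  assume *: "\<bar>q \<bullet> u - t\<bar> < r"
  let ?p = "q + (t - q \<bullet> u) *\<^sub>R u"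
  have "?p \<in> hyperplane u t"
    using u by (simp add: hyperplane_def inner_add_left dot_square_norm)
  moreover have "dist ?p q < r" using * u by (simp add: dist_norm abs_minus_commute)
  ultimately show "\<exists>p\<in>hyperplane u t. dist p q < r" by blast
qed

text \<open>The inner product with \<open>u\<close> maps the segment onto an interval, so closeness
  to the segment becomes an explicit condition on \<open>u\<close> and \<open>t\<close> to which
  \<open>hyperplane_family_measurable\<close> applies.\<close>

lemma near_segment_eq:
  fixes x y :: "real ^ 'n"
  assumes r: "r > 0"
  shows "near_segment x y r =
    {hyperplane u t |u t. norm u = 1 \<and> (min (x \<bullet> u) (y \<bullet> u) - r < t \<and> t < max (x \<bullet> u) (y \<bullet> u) + r)}"
proof -
  have key: "(\<exists>q\<in>closed_segment x y. \<bar>q \<bullet> u - t\<bar> < r) \<longleftrightarrow>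
      (min (x \<bullet> u) (y \<bullet> u) - r < t \<and> t < max (x \<bullet> u) (y \<bullet> u) + r)" for u t
  proof -
    have img: "(\<lambda>q. q \<bullet> u) ` closed_segment x y = closed_segment (x \<bullet> u) (y \<bullet> u)"
      by (intro closed_segment_linear_image[symmetric]) (auto intro: bounded_linear.linear bounded_linear_inner_left)
    have "(\<exists>q\<in>closed_segment x y. \<bar>q \<bullet> u - t\<bar> < r) \<longleftrightarrow> (\<exists>s\<in>(\<lambda>q. q \<bullet> u) ` closed_segment x y. \<bar>s - t\<bar> < r)"
      by auto
    also have "\<dots> \<longleftrightarrow> (\<exists>s. min (x \<bullet> u) (y \<bullet> u) \<le> s \<and> s \<le> max (x \<bullet> u) (y \<bullet> u) \<and> \<bar>s - t\<bar> < r)"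
      unfolding img by (auto simp: closed_segment_eq_real_ivl min_def max_def split: if_splits)
    also have "\<dots> \<longleftrightarrow> (min (x \<bullet> u) (y \<bullet> u) - r < t \<and> t < max (x \<bullet> u) (y \<bullet> u) + r)"
    proof (intro iffI)
      assume *: "min (x \<bullet> u) (y \<bullet> u) - r < t \<and> t < max (x \<bullet> u) (y \<bullet> u) + r"
      let ?a = "min (x \<bullet> u) (y \<bullet> u)" and ?b = "max (x \<bullet> u) (y \<bullet> u)"
      \<comment> \<open>The witness is the projection of \<open>t\<close> to the interval, that is,
        its nearest point there.\<close>
      have "?a \<le> max ?a (min t ?b) \<and> max ?a (min t ?b) \<le> ?b \<and> \<bar>max ?a (min t ?b) - t\<bar> < r"
        using * r by linarith
      then show "\<exists>s. ?a \<le> s \<and> s \<le> ?b \<and> \<bar>s - t\<bar> < r" by blast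
    qed linarith
    finally show ?thesis .
  qed
  have "(\<exists>p\<in>hyperplane u t. \<exists>q\<in>closed_segment x y. dist p q < r) \<longleftrightarrow>
      (min (x \<bullet> u) (y \<bullet> u) - r < t \<and> t < max (x \<bullet> u) (y \<bullet> u) + r)" if "norm u = 1" for u t
    unfolding key[symmetric] using hyperplane_point_near[OF that] by blast
  note eq = this
  show ?thesis
  proof (intro set_eqI iffI)
    fix E assume "E \<in> near_segment x y r"
    then obtain u t where "E = hyperplane u t" "norm u = 1"
      "\<exists>p\<in>hyperplane u t. \<exists>q\<in>closed_segment x y. dist p q < r"
      by (auto simp: near_segment_def hyperplanes_def)
    with eq[of u t] show "E \<in> {hyperplane u t |u t. norm u = 1 \<and>
        (min (x \<bullet> u) (y \<bullet> u) - r < t \<and> t < max (x \<bullet> u) (y \<bullet> u) + r)}" by blast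
  next
    fix E assume "E \<in> {hyperplane u t |u t. norm u = 1 \<and>
        (min (x \<bullet> u) (y \<bullet> u) - r < t \<and> t < max (x \<bullet> u) (y \<bullet> u) + r)}"
    then obtain u t where "E = hyperplane u t" "norm u = 1"
      "min (x \<bullet> u) (y \<bullet> u) - r < t \<and> t < max (x \<bullet> u) (y \<bullet> u) + r" by blast
    with eq[of u t] show "E \<in> near_segment x y r"
      by (auto simp: near_segment_def hyperplanes_def)
  qed
qed

lemma window_near_segment:
  fixes x y :: "real ^ 'n"
  assumes r: "r > 0"
  shows "window (near_segment x y r)"
  unfolding window_def
proof
  show "near_segment x y r \<in> sets hyperplane_space"
    unfolding near_segment_eq[OF r] by (rule hyperplane_family_measurable) measurable
  have "E \<inter> cball 0 (norm x + norm y + r) \<noteq> {}" if E: "E \<in> near_segment x y r" for E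
  proof -
    obtain p q where p: "p \<in> E" and q: "q \<in> closed_segment x y" "dist p q < r"
      using E by (auto simp: near_segment_def)
    obtain s where s: "0 \<le> s" "s \<le> 1" "q = (1 - s) *\<^sub>R x + s *\<^sub>R y"
      using q(1) by (auto simp: in_segment)
    have "norm q \<le> (1 - s) * norm x + s * norm y"
      using norm_triangle_ineq[of "(1 - s) *\<^sub>R x" "s *\<^sub>R y"] s by simp
    also have "\<dots> \<le> norm x + norm y"
      using s by (intro add_mono mult_left_le_one_le) auto
    finally have "norm q \<le> norm x + norm y" .
    then have "norm p \<le> norm x + norm y + r"
      using q(2) norm_triangle_ineq2[of p q] by (simp add: dist_norm)
    then show ?thesis using p by auto
  qed
  then show "\<exists>R. \<forall>E\<in>near_segment x y r. E \<inter> cball 0 R \<noteq> {}" by blast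
qed

text \<open>Points with equal parameter on the two segments are compared; their difference is a
  convex combination of the two end point displacements.\<close>

lemma segment_perturb:
  fixes x y x' y' :: "real ^ 'n"
  assumes "p \<in> closed_segment x y" "dist x x' < e" "dist y y' < e"
  shows "\<exists>q\<in>closed_segment x' y'. dist p q < e"
proof -
  obtain s where s: "0 \<le> s" "s \<le> 1" "p = (1 - s) *\<^sub>R x + s *\<^sub>R y"
    using assms(1) by (auto simp: in_segment)
  let ?q = "(1 - s) *\<^sub>R x' + s *\<^sub>R y'"
  have "p - ?q = (1 - s) *\<^sub>R (x - x') + s *\<^sub>R (y - y')" by (simp add: s algebra_simps)
  then have "norm (p - ?q) \<le> (1 - s) * norm (x - x') + s * norm (y - y')"
    using norm_triangle_ineq[of "(1 - s) *\<^sub>R (x - x')" "s *\<^sub>R (y - y')"] s by simp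
  also have "\<dots> < e"
    using assms(2,3) s by (intro convex_bound_lt) (auto simp: dist_norm)
  finally show ?thesis using s by (intro bexI[of _ ?q]) (auto simp: dist_norm in_segment)
qed

text \<open>Rational approximation of the end points replaces joint measurability of counting variables:
  by local finiteness a hyperplane of \<open>h\<close> meets a segment iff hyperplanes of \<open>h\<close> come
  arbitrarily close to it.\<close>

lemma not_same_cell_iff:
  fixes x y :: "real ^ 'n"
  assumes h: "h \<in> hyperplane_configs"
    and Q: "\<And>x e. e > 0 \<Longrightarrow> \<exists>q\<in>Q. dist x q < (e::real)"
  shows "\<not> same_cell h x y \<longleftrightarrow> (\<forall>m::nat. \<exists>x'\<in>Q. \<exists>y'\<in>Q. dist x x' < 1 / (real m + 1) \<and>
     dist y y' < 1 / (real m + 1) \<and> h \<inter> near_segment x' y' (2 / (real m + 1)) \<noteq> {})"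
proof
  assume "\<not> same_cell h x y"
  then obtain E p where E: "E \<in> h" "p \<in> E" "p \<in> closed_segment x y" by (auto simp: same_cell_def)
  show "\<forall>m::nat. \<exists>x'\<in>Q. \<exists>y'\<in>Q. dist x x' < 1 / (real m + 1) \<and>
     dist y y' < 1 / (real m + 1) \<and> h \<inter> near_segment x' y' (2 / (real m + 1)) \<noteq> {}"
  proof
    fix m :: nat
    have pos: "(0::real) < 1 / (real m + 1)" by simp
    obtain x' y' where *: "x' \<in> Q" "dist x x' < 1 / (real m + 1)" "y' \<in> Q" "dist y y' < 1 / (real m + 1)"
      using Q[OF pos] by blast
    obtain q where q: "q \<in> closed_segment x' y'" "dist p q < 1 / (real m + 1)"
      using segment_perturb[OF E(3) *(2,4)] by blast
    have "dist p q < 2 / (real m + 1)" using q(2) by (simp add: field_simps)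
    then have "E \<in> near_segment x' y' (2 / (real m + 1))"
      using E q(1) h by (auto simp: near_segment_def hyperplane_configs_def)
    then have "h \<inter> near_segment x' y' (2 / (real m + 1)) \<noteq> {}" using E(1) by auto
    with * show "\<exists>x'\<in>Q. \<exists>y'\<in>Q. dist x x' < 1 / (real m + 1) \<and>
     dist y y' < 1 / (real m + 1) \<and> h \<inter> near_segment x' y' (2 / (real m + 1)) \<noteq> {}"
      by (intro bexI[of _ x'] bexI[of _ y'] conjI)
  qed
next
  assume R: "\<forall>m::nat. \<exists>x'\<in>Q. \<exists>y'\<in>Q. dist x x' < 1 / (real m + 1) \<and>
     dist y y' < 1 / (real m + 1) \<and> h \<inter> near_segment x' y' (2 / (real m + 1)) \<noteq> {}"
  have near: "\<exists>E\<in>h. \<exists>p\<in>E. \<exists>q\<in>closed_segment x y. dist p q < 3 / (real m + 1)" for m :: nat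
  proof -
    obtain x' y' E where *: "dist x x' < 1 / (real m + 1)" "dist y y' < 1 / (real m + 1)"
      "E \<in> h" "E \<in> near_segment x' y' (2 / (real m + 1))" using R[rule_format, of m] by blast
    then obtain p q' where q': "p \<in> E" "q' \<in> closed_segment x' y'" "dist p q' < 2 / (real m + 1)"
      by (auto simp: near_segment_def)
    obtain q where q: "q \<in> closed_segment x y" "dist q' q < 1 / (real m + 1)"
      using segment_perturb[OF q'(2), of x "1 / (real m + 1)" y] *(1,2) by (auto simp: dist_commute)
    have "dist p q \<le> dist p q' + dist q' q" by (rule dist_triangle)
    also have "\<dots> < 2 / (real m + 1) + 1 / (real m + 1)" using q q' by linarith
    also have "\<dots> = 3 / (real m + 1)" by (simp add: field_simps)
    finally show ?thesis using *(3) q' q by blast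
  qed
  show "\<not> same_cell h x y"
  proof
    assume same: "same_cell h x y"
    \<comment> \<open>The distance \<open>3 / (real m + 1)\<close> never exceeds 3, so every
      hyperplane that comes near the segment hits this fixed compact neighbourhood. Only finitely
      many members of \<open>h\<close> do.\<close>
    let ?C = "\<Union>q\<in>closed_segment x y. cball q 3"
    have "compact ((\<lambda>(a, b). a + b) ` (closed_segment x y \<times> cball 0 3))"
      by (intro compact_continuous_image compact_Times) (auto simp: split_beta intro!: continuous_intros)
    moreover have "?C = (\<lambda>(a, b). a + b) ` (closed_segment x y \<times> cball 0 3)"
    proof (intro set_eqI iffI)
      fix z assume "z \<in> ?C"
      then obtain q where "q \<in> closed_segment x y" "dist q z \<le> 3" by auto
      then show "z \<in> (\<lambda>(a, b). a + b) ` (closed_segment x y \<times> cball 0 3)"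
        by (intro image_eqI[of _ _ "(q, z - q)"]) (auto simp: dist_norm norm_minus_commute)
  next
      fix z assume "z \<in> (\<lambda>(a, b). a + b) ` (closed_segment x y \<times> cball 0 3)"
      then obtain a b where "a \<in> closed_segment x y" "norm b \<le> 3" "z = a + b" by auto
      then show "z \<in> ?C" by (auto intro!: bexI[of _ a] simp: dist_norm)
    qed
    ultimately have "compact ?C" by simp
    then have fin: "finite {E \<in> h. E \<inter> ?C \<noteq> {}}" (is "finite ?F")
      using h by (simp add: hyperplane_configs_def)
    have pos: "0 < setdist E (closed_segment x y)" if "E \<in> ?F" for E
    proof -
      have "E \<in> hyperplanes" using that h by (auto simp: hyperplane_configs_def)
      then obtain u t where "E = {x. u \<bullet> x = t}" by (auto simp: hyperplanes_def hyperplane_def inner_commute)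
      then have "closed E" by (simp add: closed_hyperplane)
      moreover have "E \<noteq> {}" "E \<inter> closed_segment x y = {}" using that same by (auto simp: same_cell_def)
      ultimately show ?thesis
        by (subst setdist_sym, subst setdist_gt_0_compact_closed) auto
    qed
    \<comment> \<open>The inserted 1 keeps the minimum defined and positive when no hyperplane hits
      \<open>?C\<close>.\<close>
    define d where "d = Min (insert 1 ((\<lambda>E. setdist E (closed_segment x y)) ` ?F))"
    have d: "d > 0" "\<And>E. E \<in> ?F \<Longrightarrow> d \<le> setdist E (closed_segment x y)"
      unfolding d_def using fin pos by auto
    obtain m :: nat where m: "3 / d < real m" using reals_Archimedean2 by blast
    then have md: "3 / (real m + 1) < d" using d(1) by (simp add: field_simps)
    obtain E p q where E: "E \<in> h" "p \<in> E" "q \<in> closed_segment x y" "dist p q < 3 / (real m + 1)"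
      using near[of m] by blast
    have "(3::real) / (real m + 1) \<le> 3" by (simp add: field_simps)
    then have "p \<in> ?C" using E by (auto simp: dist_commute intro!: bexI[of _ q])
    then have "E \<in> ?F" using E by blast
    from d(2)[OF this] setdist_le_dist[OF E(2,3)] E(4) md show False by linarith
  qed
qed

lemma ex_countable_dense:
  "\<exists>Q :: (real ^ 'n) set. countable Q \<and> (\<forall>x e. e > 0 \<longrightarrow> (\<exists>q\<in>Q. dist x q < e))"
proof -
  obtain Q :: "(real ^ 'n) set" where Q: "countable Q" "\<And>X. open X \<Longrightarrow> X \<noteq> {} \<Longrightarrow> \<exists>d\<in>Q. d \<in> X"
    using countable_dense_exists by metis
  have "\<exists>q\<in>Q. dist x q < e" if "e > 0" for x and e :: real
    using Q(2)[of "ball x e"] that by auto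
  with Q(1) show ?thesis by blast
qed

text \<open>A countable dense \<open>Q\<close> turns the quantifiers of
  \<open>not_same_cell_iff\<close> into countable ones. What remains are distances to fixed points
  and void events of fixed windows, each involving only one of the three variables.\<close>

lemma measurable_same_cell [measurable]:
  "Measurable.pred (borel \<Otimes>\<^sub>M borel \<Otimes>\<^sub>M void_space) (\<lambda>(x :: real ^ 'n, y, h). same_cell h x y)"
proof -
  obtain Q :: "(real ^ 'n) set" where Q: "countable Q" "\<And>x e. e > 0 \<Longrightarrow> \<exists>q\<in>Q. dist x q < (e::real)"
    using ex_countable_dense by metis
  let ?N = "borel \<Otimes>\<^sub>M borel \<Otimes>\<^sub>M void_space :: ((real ^ 'n) \<times> (real ^ 'n) \<times> (real ^ 'n) set set) measure"
  have [measurable]: "Measurable.pred void_space (\<lambda>h. h \<inter> near_segment x' y' (2 / (real m + 1)) \<noteq> {})"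
    for x' y' :: "real ^ 'n" and m
  proof -
    have "{h \<in> hyperplane_configs. h \<inter> near_segment x' y' (2 / (real m + 1)) = {}} \<in> sets void_space"
      by (intro void_event_in_void_space window_near_segment) simp
    then have "Measurable.pred void_space (\<lambda>h. h \<inter> near_segment x' y' (2 / (real m + 1)) = {})"
      by (simp add: pred_def)
    then show ?thesis by measurable
  qed
  have meas: "Measurable.pred ?N (\<lambda>p. \<not> (\<forall>m::nat. \<exists>x'\<in>Q. \<exists>y'\<in>Q. dist (fst p) x' < 1 / (real m + 1) \<and>
     dist (fst (snd p)) y' < 1 / (real m + 1) \<and> snd (snd p) \<inter> near_segment x' y' (2 / (real m + 1)) \<noteq> {}))"
    using Q(1) by measurable
  have eq: "case_prod (\<lambda>x. case_prod (\<lambda>y h. same_cell h x y)) p =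
      (\<not> (\<forall>m::nat. \<exists>x'\<in>Q. \<exists>y'\<in>Q. dist (fst p) x' < 1 / (real m + 1) \<and>
     dist (fst (snd p)) y' < 1 / (real m + 1) \<and> snd (snd p) \<inter> near_segment x' y' (2 / (real m + 1)) \<noteq> {}))"
    if "p \<in> space ?N" for p
  proof -
    have "snd (snd p) \<in> hyperplane_configs" using that by (auto simp: space_pair_measure)
    from not_same_cell_iff[OF this Q(2)] show ?thesis unfolding split_beta by blast
  qed
  show ?thesis by (rule iffD2[OF measurable_cong[OF eq] meas])
qed

subsection \<open>Cells of the tessellation\<close>

lemma closed_hyperplane_set:
  assumes "E \<in> hyperplanes" shows "closed E"
proof -
  obtain u t where "E = {x. u \<bullet> x = t}"
    using assms by (auto simp: hyperplanes_def hyperplane_def inner_commute)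
  then show ?thesis by (simp add: closed_hyperplane)
qed

text \<open>By local finiteness only finitely many hyperplanes meet the unit ball around a given
  point, and their union is closed.\<close>

lemma open_complement_config:
  assumes h: "h \<in> hyperplane_configs" shows "open (- \<Union>h)"
proof (rule openI)
  fix x assume x: "x \<in> - \<Union>h"
  let ?F = "{E \<in> h. E \<inter> cball x 1 \<noteq> {}}"
  have fin: "finite ?F" using h by (simp add: hyperplane_configs_def)
  have "closed (\<Union>?F)"
    using h by (intro closed_Union fin) (auto intro!: closed_hyperplane_set simp: hyperplane_configs_def)
  then have "open (ball x 1 - \<Union>?F)" by (intro open_Diff open_ball)
  moreover have "x \<in> ball x 1 - \<Union>?F" using x by auto
  moreover have "ball x 1 - \<Union>?F \<subseteq> - \<Union>h" using ball_subset_cball[of x 1] by blast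
  ultimately show "\<exists>e>0. ball x e \<subseteq> - \<Union>h"
    unfolding open_contains_ball by (meson subset_trans)
qed

text \<open>A connected set that avoids a hyperplane stays on one side of it, so it cannot contain
  two points that the hyperplane separates. Components are therefore described by straight
  segments.\<close>

lemma connected_component_iff_same_cell:
  assumes h: "h \<in> hyperplane_configs"
  shows "connected_component (- \<Union>h) x y \<longleftrightarrow> same_cell h x y"
proof
  assume "same_cell h x y"
  then show "connected_component (- \<Union>h) x y"
    unfolding connected_component_def same_cell_def
    by (intro exI[of _ "closed_segment x y"]) auto
next
  assume "connected_component (- \<Union>h) x y"
  then obtain T where T: "connected T" "T \<subseteq> - \<Union>h" "x \<in> T" "y \<in> T"
    unfolding connected_component_def by blast
  show "same_cell h x y"
    unfolding same_cell_def
  proof (intro ballI equals0I)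
    fix E p assume E: "E \<in> h" and p: "p \<in> E \<inter> closed_segment x y"
    obtain u t where Eut: "E = {x. u \<bullet> x = t}"
    proof -
      have "E \<in> hyperplanes" using h E by (auto simp: hyperplane_configs_def)
      then obtain u t where "E = hyperplane u t" by (auto simp: hyperplanes_def)
      then show ?thesis by (intro that[of u t]) (auto simp: hyperplane_def inner_commute)
    qed
    obtain s where s: "0 \<le> s" "s \<le> 1" "p = (1 - s) *\<^sub>R x + s *\<^sub>R y"
      using p by (auto simp: in_segment)
    have t: "t = (1 - s) * (u \<bullet> x) + s * (u \<bullet> y)"
      using p s unfolding Eut by (auto simp: inner_add_right)
    \<comment> \<open>A point of the segment on \<open>E\<close> places the offset between the
      values at the end points, which is what the intermediate value argument asks for.\<close>
    have "u \<bullet> x \<le> t \<and> t \<le> u \<bullet> y \<or> u \<bullet> y \<le> t \<and> t \<le> u \<bullet> x"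
    proof (cases "u \<bullet> x \<le> u \<bullet> y")
      case True
      have "t - u \<bullet> x = s * (u \<bullet> y - u \<bullet> x)" "u \<bullet> y - t = (1 - s) * (u \<bullet> y - u \<bullet> x)"
        unfolding t by (simp_all add: algebra_simps)
      moreover have "0 \<le> s * (u \<bullet> y - u \<bullet> x)" "0 \<le> (1 - s) * (u \<bullet> y - u \<bullet> x)"
        using True s by auto
      ultimately have "0 \<le> t - u \<bullet> x" "0 \<le> u \<bullet> y - t" by metis+
      then show ?thesis by simp
    next
      case False
      have "u \<bullet> x - t = s * (u \<bullet> x - u \<bullet> y)" "t - u \<bullet> y = (1 - s) * (u \<bullet> x - u \<bullet> y)"
        unfolding t by (simp_all add: algebra_simps)
      moreover have "0 \<le> s * (u \<bullet> x - u \<bullet> y)" "0 \<le> (1 - s) * (u \<bullet> x - u \<bullet> y)"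
        using False s by auto
      ultimately have "0 \<le> u \<bullet> x - t" "0 \<le> t - u \<bullet> y" by metis+
      then show ?thesis by simp
    qed
    then have "\<exists>z\<in>T. u \<bullet> z = t"
      using connected_ivt_hyperplane[OF T(1,3,4)] connected_ivt_hyperplane[OF T(1,4,3)] by blast
    then show False using T(2) E Eut by blast
  qed
qed

text \<open>A component is relatively closed in the complement of the hyperplanes, so taking
  closures adds no point off the hyperplanes. Hence \<open>x\<close> lies in exactly one cell, the
  default branch of \<open>cell_of\<close> is not taken, and membership of \<open>y\<close> is
  membership in the component.\<close>

lemma mem_cell_of_iff:
  assumes h: "h \<in> hyperplane_configs"
    and x: "x \<in> W" "same_cell h x x" and y: "y \<in> W" "same_cell h y y"
  shows "y \<in> cell_of (induced_tessellation W h) x \<longleftrightarrow> same_cell h x y"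
proof -
  let ?U = "- \<Union>h" and ?T = "induced_tessellation W h"
  have off: "z \<in> ?U" if "same_cell h z z" for z using that by (auto simp: same_cell_def)
  have cl: "C \<in> components ?U \<Longrightarrow> z \<in> closure C \<Longrightarrow> z \<in> ?U \<Longrightarrow> z \<in> C" for C z
  proof -
    assume C: "C \<in> components ?U" and z: "z \<in> closure C" "z \<in> ?U"
    obtain D where "closed D" "C = ?U \<inter> D"
      using closedin_component[OF C] by (auto simp: closedin_closed)
    then show "z \<in> C" using z closure_minimal[of C D] by blast
  qed
  define C where "C = connected_component_set ?U x"
  have CC: "C \<in> components ?U" using off[OF x(2)] by (auto simp: C_def components_def)
  have xC: "x \<in> C" using off[OF x(2)] by (simp add: C_def)
  have mem: "closure C \<inter> W \<in> ?T" "x \<in> closure C \<inter> W"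
  proof -
    show m: "x \<in> closure C \<inter> W" using xC x(1) closure_subset[of C] by blast
    show "closure C \<inter> W \<in> ?T" unfolding induced_tessellation_def
      using CC m by (intro CollectI exI[of _ C]) auto
  qed
  have uniq: "D = closure C \<inter> W" if D: "D \<in> ?T" "x \<in> D" for D
  proof -
    obtain C' where C': "D = closure C' \<inter> W" "C' \<in> components ?U"
      using D(1) by (auto simp: induced_tessellation_def)
    then have "x \<in> C'" using cl[OF C'(2)] off[OF x(2)] D(2) by blast
    then have "C' = C" using components_eq[OF C'(2) CC] xC by blast
    then show ?thesis using C' by simp
  qed
  have ex: "\<exists>!D. D \<in> ?T \<and> x \<in> D"
    by (rule ex1I[of _ "closure C \<inter> W"]) (use mem in simp, use uniq in simp)
  have "(THE D. D \<in> ?T \<and> x \<in> D) = closure C \<inter> W"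
    by (rule the_equality) (use mem in simp, use uniq in simp)
  then have "cell_of ?T x = closure C \<inter> W" using ex by (simp add: cell_of_def)
  then have "y \<in> cell_of ?T x \<longleftrightarrow> y \<in> C"
    using y(1) cl[OF CC] off[OF y(2)] closure_subset[of C] by blast
  also have "\<dots> \<longleftrightarrow> same_cell h x y"
    by (simp add: C_def connected_component_iff_same_cell[OF h])
  finally show ?thesis .
qed

subsection \<open>The Poisson law on void events\<close>

text \<open>The intensity measure at intensity one, evaluated in the parameter space, where it is a
  product measure and Fubini is available.\<close>

definition hyperplane_measure :: "(real ^ 'n) measure \<Rightarrow> (real ^ 'n) set set \<Rightarrow> real" where
  "hyperplane_measure \<phi> A =
     measure (\<phi> \<Otimes>\<^sub>M lborel) {p \<in> sphere 0 1 \<times> UNIV. hyperplane (fst p) (snd p) \<in> A}"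

text \<open>A property of a law rather than of a process on a given space. It can be checked for
  image measures such as the reflected law, and compared between different trees.\<close>

definition void_law :: "(real ^ 'n) measure \<Rightarrow> real \<Rightarrow> (real ^ 'n) set set measure \<Rightarrow> bool" where
  "void_law \<phi> lam Q \<longleftrightarrow> prob_space Q \<and> sets Q = sets void_space \<and>
     (\<forall>A. window A \<longrightarrow>
        measure Q {h \<in> hyperplane_configs. h \<inter> A = {}} = exp (- lam * hyperplane_measure \<phi> A))"

lemma directional_distributionD:
  assumes "directional_distribution \<phi>"
  shows "prob_space \<phi>" "sets \<phi> = sets (restrict_space borel (sphere 0 1))" "space \<phi> = sphere 0 1"
proof -
  show 1: "prob_space \<phi>" and 2: "sets \<phi> = sets (restrict_space borel (sphere 0 1))"
    using assms by (auto simp: directional_distribution_def)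
  show "space \<phi> = sphere 0 1" using sets_eq_imp_space_eq[OF 2] by (simp add: space_restrict_space)
qed

lemma measurable_hyperplane:
  "(\<lambda>p. hyperplane (fst p) (snd p)) \<in> restrict_space borel (sphere 0 1) \<Otimes>\<^sub>M borel \<rightarrow>\<^sub>M hyperplane_space"
  unfolding hyperplane_space_def
proof (rule measurable_measure_of)
  let ?N = "restrict_space borel (sphere 0 1) \<Otimes>\<^sub>M borel :: ((real ^ 'n) \<times> real) measure"
  have sp: "space ?N = sphere 0 1 \<times> UNIV" by (simp add: space_pair_measure space_restrict_space)
  show "(\<lambda>p. hyperplane (fst p) (snd p)) \<in> space ?N \<rightarrow> hyperplanes"
    unfolding sp by (auto simp: hyperplanes_def)
  fix A :: "(real ^ 'n) set set"
  assume "A \<in> {A. A \<subseteq> hyperplanes \<and> {p \<in> sphere 0 1 \<times> UNIV. hyperplane (fst p) (snd p) \<in> A} \<in> sets ?N}"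
  moreover have "(\<lambda>p. hyperplane (fst p) (snd p)) -` A \<inter> space ?N =
      {p \<in> sphere 0 1 \<times> UNIV. hyperplane (fst p) (snd p) \<in> A}" unfolding sp by auto
  ultimately show "(\<lambda>p. hyperplane (fst p) (snd p)) -` A \<inter> space ?N \<in> sets ?N" by auto
qed auto

lemma sets_pair_directional:
  assumes "directional_distribution \<phi>"
  shows "sets (\<phi> \<Otimes>\<^sub>M lborel) = sets (restrict_space borel (sphere 0 1) \<Otimes>\<^sub>M (borel :: real measure))"
  using directional_distributionD(2)[OF assms] by (intro sets_pair_measure_cong) auto

lemma preimage_in_sets:
  assumes A: "A \<in> sets hyperplane_space" and \<phi>: "directional_distribution \<phi>"
  shows "{p \<in> sphere 0 1 \<times> UNIV. hyperplane (fst p) (snd p) \<in> A} \<in> sets (\<phi> \<Otimes>\<^sub>M lborel)"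
proof -
  let ?N = "restrict_space borel (sphere 0 1) \<Otimes>\<^sub>M borel :: ((real ^ 'n) \<times> real) measure"
  have "(\<lambda>p. hyperplane (fst p) (snd p)) -` A \<inter> space ?N \<in> sets ?N"
    by (rule measurable_sets[OF measurable_hyperplane A])
  moreover have "(\<lambda>p. hyperplane (fst p) (snd p)) -` A \<inter> space ?N =
      {p \<in> sphere 0 1 \<times> UNIV. hyperplane (fst p) (snd p) \<in> A}"
    by (auto simp: space_pair_measure space_restrict_space)
  ultimately show ?thesis using sets_pair_directional[OF \<phi>] by simp
qed

text \<open>For a fixed unit normal \<open>u\<close> the admissible offsets lie in an interval of
  length \<open>2 * r\<close> centred at \<open>c \<bullet> u\<close>; integration over the
  probability measure \<phi> preserves the bound.\<close>

lemma emeasure_hyperplanes_le: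
  fixes c :: "real ^ 'n"
  assumes A: "A \<in> sets hyperplane_space" and \<phi>: "directional_distribution \<phi>"
    and hit: "\<And>E. E \<in> A \<Longrightarrow> E \<inter> cball c r \<noteq> {}" and r: "r \<ge> 0"
  shows "emeasure (\<phi> \<Otimes>\<^sub>M lborel) {p \<in> sphere 0 1 \<times> UNIV. hyperplane (fst p) (snd p) \<in> A} \<le> ennreal (2 * r)"
proof -
  interpret prob_space \<phi> using directional_distributionD[OF \<phi>] by simp
  let ?P = "{p \<in> sphere 0 1 \<times> UNIV. hyperplane (fst p) (snd p) \<in> A}"
  have "emeasure (\<phi> \<Otimes>\<^sub>M lborel) ?P = (\<integral>\<^sup>+ u. emeasure lborel (Pair u -` ?P) \<partial>\<phi>)"
    by (rule lborel.emeasure_pair_measure_alt[OF preimage_in_sets[OF A \<phi>]])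
  also have "\<dots> \<le> (\<integral>\<^sup>+ u. ennreal (2 * r) \<partial>\<phi>)"
  proof (rule nn_integral_mono)
    fix u assume "u \<in> space \<phi>"
    have "Pair u -` ?P \<subseteq> {c \<bullet> u - r..c \<bullet> u + r}"
    proof
      fix t assume "t \<in> Pair u -` ?P"
      then have u: "norm u = 1" and "hyperplane u t \<in> A" by auto
      then obtain p where "p \<in> hyperplane u t" "dist c p \<le> r"
        using hit[of "hyperplane u t"] by auto
      then have "p \<bullet> u = t" "dist c p \<le> r" by (auto simp: hyperplane_def)
      then have "\<bar>(c - p) \<bullet> u\<bar> \<le> r"
        using Cauchy_Schwarz_ineq2[of "c - p" u] u by (simp add: dist_norm)
      then show "t \<in> {c \<bullet> u - r..c \<bullet> u + r}"
        using \<open>p \<bullet> u = t\<close> by (auto simp: inner_diff_left)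
    qed
    then have "emeasure lborel (Pair u -` ?P) \<le> emeasure lborel {c \<bullet> u - r..c \<bullet> u + r}"
      by (intro emeasure_mono) auto
    then show "emeasure lborel (Pair u -` ?P) \<le> ennreal (2 * r)" using r by simp
  qed
  also have "\<dots> = ennreal (2 * r)" by (simp add: emeasure_space_1)
  finally show ?thesis .
qed

lemma hyperplane_measure_le:
  fixes c :: "real ^ 'n"
  assumes "A \<in> sets hyperplane_space" "directional_distribution \<phi>"
    "\<And>E. E \<in> A \<Longrightarrow> E \<inter> cball c r \<noteq> {}" "r \<ge> 0"
  shows "hyperplane_measure \<phi> A \<le> 2 * r"
  unfolding hyperplane_measure_def measure_def
  using emeasure_hyperplanes_le[OF assms] assms(4) by (intro enn2real_leI) auto

lemma window_radius:
  assumes "window A" obtains r where "r \<ge> 0" "\<And>E. E \<in> A \<Longrightarrow> E \<inter> cball 0 r \<noteq> {}"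
proof -
  obtain r where "\<And>E. E \<in> A \<Longrightarrow> E \<inter> cball 0 r \<noteq> {}" using assms unfolding window_def by blast
  moreover have "cball (0 :: real ^ 'n) r \<subseteq> cball 0 (max r 0)" by (rule subset_cball) simp
  ultimately have "\<And>E. E \<in> A \<Longrightarrow> E \<inter> cball 0 (max r 0) \<noteq> {}" by blast
  then show ?thesis using that[of "max r 0"] by auto
qed

lemma emeasure_window:
  assumes A: "window A" and \<phi>: "directional_distribution \<phi>"
  shows "emeasure (\<phi> \<Otimes>\<^sub>M lborel) {p \<in> sphere 0 1 \<times> UNIV. hyperplane (fst p) (snd p) \<in> A}
    = ennreal (hyperplane_measure \<phi> A)"
proof -
  obtain r where r: "r \<ge> 0" "\<And>E. E \<in> A \<Longrightarrow> E \<inter> cball 0 r \<noteq> {}" using window_radius[OF A] by metis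
  have "emeasure (\<phi> \<Otimes>\<^sub>M lborel) {p \<in> sphere 0 1 \<times> UNIV. hyperplane (fst p) (snd p) \<in> A} < \<infinity>"
    using emeasure_hyperplanes_le[of A \<phi> 0 r] r A \<phi> by (auto simp: window_def intro: le_less_trans)
  then show ?thesis unfolding hyperplane_measure_def by (intro emeasure_eq_ennreal_measure) auto
qed

lemma hyperplane_intensity_window:
  fixes \<phi> :: "(real ^ 'n) measure"
  assumes A: "window A" and \<phi>: "directional_distribution \<phi>" and lam: "lam > 0"
  shows "emeasure (hyperplane_intensity \<phi> lam) A = ennreal (lam * hyperplane_measure \<phi> A)"
proof -
  let ?P = "{p \<in> sphere 0 1 \<times> UNIV. hyperplane (fst p) (snd p) \<in> A}"
  have AS: "A \<in> sets hyperplane_space" using A by (simp add: window_def)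
  have meas: "(\<lambda>(u, t). hyperplane u t) \<in> \<phi> \<Otimes>\<^sub>M lborel \<rightarrow>\<^sub>M hyperplane_space"
    unfolding split_beta measurable_cong_sets[OF sets_pair_directional[OF \<phi>] refl]
    by (rule measurable_hyperplane)
  have "(\<lambda>(u, t). hyperplane u t) -` A \<inter> space (\<phi> \<Otimes>\<^sub>M lborel) = ?P"
    by (auto simp: space_pair_measure directional_distributionD(3)[OF \<phi>])
  then have "emeasure (hyperplane_intensity \<phi> lam) A = ennreal lam * emeasure (\<phi> \<Otimes>\<^sub>M lborel) ?P"
    unfolding hyperplane_intensity_def by (simp add: emeasure_distr[OF meas AS])
  then show ?thesis using emeasure_window[OF A \<phi>] lam by (simp add: ennreal_mult')
qed

lemma hits_eq_0_iff: "hits A h = 0 \<longleftrightarrow> h \<inter> A = {}"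
  by (auto simp: hits_def emeasure_count_space)

lemma measurable_config_void:
  fixes H :: "'w \<Rightarrow> (real ^ 'n) set set"
  assumes H: "H \<in> Pr \<rightarrow>\<^sub>M config_space"
  shows "H \<in> Pr \<rightarrow>\<^sub>M void_space"
  unfolding void_space_def
proof (rule measurable_measure_of)
  have sp: "space (config_space :: (real ^ 'n) set set measure) = hyperplane_configs"
    unfolding config_space_def by (rule space_measure_of) auto
  have Hc: "H w \<in> hyperplane_configs" if "w \<in> space Pr" for w
    using measurable_space[OF H that] sp by simp
  then show "H \<in> space Pr \<rightarrow> hyperplane_configs" by auto
  fix V :: "(real ^ 'n) set set set" assume "V \<in> {{h \<in> hyperplane_configs. h \<inter> A = {}} |A. window A}"
  then obtain A where V: "V = {h \<in> hyperplane_configs. h \<inter> A = {}}" "window A" by auto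
  then have "V = {h \<in> hyperplane_configs. hits A h \<in> {0}}" by (auto simp: hits_eq_0_iff)
  moreover have "A \<in> sets hyperplane_space" using V(2) by (simp add: window_def)
  moreover have "{0 :: ennreal} \<in> sets borel" by simp
  ultimately have "V \<in> {{h \<in> hyperplane_configs. hits A h \<in> U} |A U. A \<in> sets hyperplane_space \<and> U \<in> sets borel}"
    by blast
  then have "V \<in> sets config_space"
    unfolding config_space_def by (subst sets_measure_of) auto
  then show "H -` V \<inter> space Pr \<in> sets Pr" by (rule measurable_sets[OF H])
qed auto

text \<open>The void probability is the case \<open>k = 0\<close> of the Poisson counts, and windows
  have the finite intensity which that clause demands.\<close>

lemma poisson_void_law:
  fixes H :: "'w \<Rightarrow> (real ^ 'n) set set"
  assumes H: "poisson_hyperplane_process Pr \<phi> lam H" and \<phi>: "directional_distribution \<phi>" and lam: "lam > 0"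
  shows "H \<in> Pr \<rightarrow>\<^sub>M void_space" "void_law \<phi> lam (distr Pr void_space H)"
proof -
  have Hm: "H \<in> Pr \<rightarrow>\<^sub>M config_space" using H by (simp add: poisson_hyperplane_process_def)
  interpret prob_space Pr using H by (simp add: poisson_hyperplane_process_def)
  show HV: "H \<in> Pr \<rightarrow>\<^sub>M void_space" by (rule measurable_config_void[OF Hm])
  show "void_law \<phi> lam (distr Pr void_space H)"
    unfolding void_law_def
  proof (intro conjI allI impI prob_space_distr HV)
    fix A :: "(real ^ 'n) set set" assume A: "window A"
    then have AS: "A \<in> sets hyperplane_space" by (simp add: window_def)
    have r: "measure (hyperplane_intensity \<phi> lam) A = lam * hyperplane_measure \<phi> A"
      using hyperplane_intensity_window[OF A \<phi> lam] lam unfolding measure_def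
      by (simp add: hyperplane_measure_def)
    have "measure Pr {w \<in> space Pr. hits A (H w) = of_nat 0} = exp (- (lam * hyperplane_measure \<phi> A))"
    proof -
      have "emeasure (hyperplane_intensity \<phi> lam) A < \<infinity>"
        using hyperplane_intensity_window[OF A \<phi> lam] by simp
      then have "\<forall>k. measure Pr {w \<in> space Pr. hits A (H w) = of_nat k} =
          (let r = measure (hyperplane_intensity \<phi> lam) A in r ^ k / fact k * exp (- r))"
        using H AS unfolding poisson_hyperplane_process_def by blast
      from this[rule_format, of 0] show ?thesis unfolding r by simp
    qed
    moreover have "H -` {h \<in> hyperplane_configs. h \<inter> A = {}} \<inter> space Pr = {w \<in> space Pr. hits A (H w) = of_nat 0}"
      using measurable_space[OF HV] by (auto simp: hits_eq_0_iff)
    ultimately show "measure (distr Pr void_space H) {h \<in> hyperplane_configs. h \<inter> A = {}} =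
        exp (- lam * hyperplane_measure \<phi> A)"
      by (simp add: measure_distr[OF HV void_event_in_void_space[OF A]])
  qed simp
qed

text \<open>The void events form a generating system stable under intersection on which both laws
  agree. The window \<open>{}\<close> has the whole space as its void event, which supplies the
  exhausting sequence for the uniqueness theorem.\<close>

lemma void_law_unique:
  fixes \<phi> :: "(real ^ 'n) measure"
  assumes 1: "void_law \<phi> lam Q1" and 2: "void_law \<phi> lam Q2"
  shows "Q1 = Q2"
proof (rule measure_eqI_generator_eq)
  let ?E = "{{h \<in> hyperplane_configs. h \<inter> A = {}} |A. window A} :: (real ^ 'n) set set set set"
  interpret Q1: prob_space Q1 using 1 by (simp add: void_law_def)
  interpret Q2: prob_space Q2 using 2 by (simp add: void_law_def)
  show "Int_stable ?E"
  proof (rule Int_stableI)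
    fix a b assume "a \<in> ?E" "b \<in> ?E"
    then obtain A B :: "(real ^ 'n) set set" where AB: "a = {h \<in> hyperplane_configs. h \<inter> A = {}}" "window A"
      "b = {h \<in> hyperplane_configs. h \<inter> B = {}}" "window B" by blast
    obtain r s where rs: "\<And>E. E \<in> A \<Longrightarrow> E \<inter> cball 0 r \<noteq> {}" "\<And>E. E \<in> B \<Longrightarrow> E \<inter> cball 0 s \<noteq> {}"
      using AB(2,4) unfolding window_def by meson
    have "E \<inter> cball 0 (max r s) \<noteq> {}" if "E \<in> A \<union> B" for E
    proof -
      have "cball (0 :: real ^ 'n) r \<subseteq> cball 0 (max r s)" "cball (0 :: real ^ 'n) s \<subseteq> cball 0 (max r s)"
        by (intro subset_cball; simp)+
      then show ?thesis using rs(1)[of E] rs(2)[of E] that by (elim UnE) fast+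
    qed
    moreover have "A \<union> B \<in> sets hyperplane_space" using AB(2,4) by (intro sets.Un) (simp_all add: window_def)
    ultimately have "window (A \<union> B)" unfolding window_def by blast
    moreover have "a \<inter> b = {h \<in> hyperplane_configs. h \<inter> (A \<union> B) = {}}" using AB(1,3) by auto
    ultimately show "a \<inter> b \<in> ?E" by (intro CollectI exI[of _ "A \<union> B"]) simp
  qed
  show P: "?E \<subseteq> Pow hyperplane_configs" by auto
  show "sets Q1 = sigma_sets hyperplane_configs ?E" "sets Q2 = sigma_sets hyperplane_configs ?E"
    using 1 2 sets_measure_of[OF P, of "\<lambda>_. 0"] unfolding void_law_def void_space_def by simp_all
  have "window {}" by (simp add: window_def)
  then have "{h \<in> hyperplane_configs. h \<inter> {} = {}} \<in> ?E" by blast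
  then show "range (\<lambda>_::nat. hyperplane_configs :: (real ^ 'n) set set set) \<subseteq> ?E" by auto
  show "emeasure Q1 V = emeasure Q2 V" if V: "V \<in> ?E" for V
  proof -
    obtain A where "V = {h \<in> hyperplane_configs. h \<inter> A = {}}" "window A" using V by auto
    then show ?thesis
      using 1 2 by (simp add: void_law_def Q1.emeasure_eq_measure Q2.emeasure_eq_measure)
  qed
  show "(\<Union>i::nat. (hyperplane_configs :: (real ^ 'n) set set set)) = hyperplane_configs" by simp
  show "emeasure Q1 hyperplane_configs \<noteq> \<infinity>" for i :: nat by simp
qed



lemma hyperplane_config_hyperplanes: "h \<in> hyperplane_configs \<Longrightarrow> h \<subseteq> hyperplanes"
  by (simp add: hyperplane_configs_def)

text \<open>The hyperplanes through \<open>x\<close> hit the ball of radius 0 around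
  \<open>x\<close>, so their intensity is zero and their void event has probability one.\<close>

lemma void_law_same_cell_self:
  fixes x :: "real ^ 'n"
  assumes Q: "void_law \<phi> lam Q" and \<phi>: "directional_distribution \<phi>"
  shows "AE h in Q. same_cell h x x"
proof -
  interpret prob_space Q using Q by (simp add: void_law_def)
  let ?A = "{hyperplane u t |u t. norm u = 1 \<and> x \<bullet> u = t}"
  have hit: "E \<inter> cball x 0 \<noteq> {}" if "E \<in> ?A" for E using that by (auto simp: hyperplane_def)
  have A: "?A \<in> sets hyperplane_space" by (rule hyperplane_family_measurable) measurable
  have "E \<inter> cball 0 (norm x) \<noteq> {}" if "E \<in> ?A" for E
    using hit[OF that] by auto
  with A have win: "window ?A" unfolding window_def by blast
  have "hyperplane_measure \<phi> ?A \<le> 2 * 0" by (rule hyperplane_measure_le[OF A \<phi> hit]) auto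
  then have "hyperplane_measure \<phi> ?A = 0" by (simp add: hyperplane_measure_def measure_le_0_iff)
  then have "prob {h \<in> hyperplane_configs. h \<inter> ?A = {}} = 1"
    using Q win by (simp add: void_law_def)
  then have "AE h in Q. h \<in> {h \<in> hyperplane_configs. h \<inter> ?A = {}}"
    using Q void_event_in_void_space[OF win] by (subst prob_eq_1[symmetric]) (auto simp: void_law_def)
  moreover have "same_cell h x x" if "h \<in> {h \<in> hyperplane_configs. h \<inter> ?A = {}}" for h
    unfolding same_cell_def
  proof (intro ballI equals0I)
    fix E y assume E: "E \<in> h" "y \<in> E \<inter> closed_segment x x"
    then have "E \<in> hyperplanes"
      using that hyperplane_config_hyperplanes[of h] by auto
    then obtain u t where "E = hyperplane u t" "norm u = 1" by (auto simp: hyperplanes_def)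
    then have "E \<in> ?A" using E by (auto simp: hyperplane_def)
    then show False using that E by auto
  qed
  ultimately show ?thesis by (auto elim: eventually_mono)
qed

subsection \<open>Reflection invariance\<close>

definition reflect_config :: "real ^ 'n \<Rightarrow> (real ^ 'n) set set \<Rightarrow> (real ^ 'n) set set" where
  "reflect_config x h = (\<lambda>E. (\<lambda>y. 2 *\<^sub>R x - y) ` E) ` h"

lemma reflect_reflect: "(\<lambda>y. 2 *\<^sub>R x - y) ` (\<lambda>y. 2 *\<^sub>R x - y) ` E = (E :: (real ^ 'n) set)"
  by (simp add: image_image)

lemma reflect_hyperplane:
  fixes x :: "real ^ 'n"
  shows "(\<lambda>y. 2 *\<^sub>R x - y) ` hyperplane u t = hyperplane u (2 * (x \<bullet> u) - t)"
proof (intro set_eqI iffI)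
  fix z assume "z \<in> hyperplane u (2 * (x \<bullet> u) - t)"
  then show "z \<in> (\<lambda>y. 2 *\<^sub>R x - y) ` hyperplane u t"
    by (intro image_eqI[of _ _ "2 *\<^sub>R x - z"]) (auto simp: hyperplane_def inner_diff_left)
qed (auto simp: hyperplane_def inner_diff_left)

lemma reflect_hyperplanes:
  assumes "E \<in> hyperplanes" shows "(\<lambda>y. 2 *\<^sub>R x - y) ` E \<in> hyperplanes"
proof -
  obtain u t where "E = hyperplane u t" "norm u = 1" using assms by (auto simp: hyperplanes_def)
  then show ?thesis unfolding hyperplanes_def
    by (intro CollectI exI[of _ u] exI[of _ "2 * (x \<bullet> u) - t"]) (auto simp: reflect_hyperplane)
qed

text \<open>The reflection is an involution, so the image family is also a preimage; membership can
  then be tested without an existential quantifier.\<close>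

lemma mem_reflect_config: "E \<in> reflect_config x A \<longleftrightarrow> (\<lambda>y. 2 *\<^sub>R x - y) ` E \<in> A"
proof
  assume "(\<lambda>y. 2 *\<^sub>R x - y) ` E \<in> A"
  then show "E \<in> reflect_config x A"
    unfolding reflect_config_def by (rule image_eqI[rotated]) (simp add: reflect_reflect)
qed (auto simp: reflect_config_def reflect_reflect)

lemma reflect_config_Int_empty: "reflect_config x h \<inter> A = {} \<longleftrightarrow> h \<inter> reflect_config x A = {}"
  by (metis (no_types) disjoint_iff mem_reflect_config reflect_reflect)

lemma reflect_config_configs:
  fixes x :: "real ^ 'n"
  assumes h: "h \<in> hyperplane_configs" shows "reflect_config x h \<in> hyperplane_configs"
  unfolding hyperplane_configs_def
proof (intro CollectI conjI allI impI)
  show "reflect_config x h \<subseteq> hyperplanes"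
    using hyperplane_config_hyperplanes[OF h] reflect_hyperplanes by (auto simp: reflect_config_def)
  fix C :: "(real ^ 'n) set" assume "compact C"
  then have "compact ((\<lambda>y. 2 *\<^sub>R x - y) ` C)"
    by (intro compact_continuous_image continuous_intros)
  then have "finite {E \<in> h. E \<inter> (\<lambda>y. 2 *\<^sub>R x - y) ` C \<noteq> {}}"
    using h by (simp add: hyperplane_configs_def)
  moreover have "{E \<in> reflect_config x h. E \<inter> C \<noteq> {}} \<subseteq>
      (\<lambda>E. (\<lambda>y. 2 *\<^sub>R x - y) ` E) ` {E \<in> h. E \<inter> (\<lambda>y. 2 *\<^sub>R x - y) ` C \<noteq> {}}"
  proof
    fix F assume "F \<in> {E \<in> reflect_config x h. E \<inter> C \<noteq> {}}"
    then obtain E z where E: "E \<in> h" "F = (\<lambda>y. 2 *\<^sub>R x - y) ` E" "z \<in> F" "z \<in> C"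
      by (auto simp: reflect_config_def)
    then have "2 *\<^sub>R x - z \<in> E \<inter> (\<lambda>y. 2 *\<^sub>R x - y) ` C" by auto
    then show "F \<in> (\<lambda>E. (\<lambda>y. 2 *\<^sub>R x - y) ` E) ` {E \<in> h. E \<inter> (\<lambda>y. 2 *\<^sub>R x - y) ` C \<noteq> {}}"
      using E by blast
  qed
  ultimately show "finite {E \<in> reflect_config x h. E \<inter> C \<noteq> {}}" by (meson finite_imageI finite_subset)
qed

text \<open>The reflection fixes \<open>x\<close>, so it maps the segment from \<open>x\<close> to
  \<open>y\<close> onto the segment from \<open>x\<close> to the mirror image of \<open>y\<close>.
  The cell of \<open>x\<close> in the reflected configuration is thus the mirror image of its
  cell.\<close>

lemma same_cell_reflect_config: "same_cell (reflect_config x h) x y \<longleftrightarrow> same_cell h x (2 *\<^sub>R x - y)"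
proof -
  have seg: "(\<lambda>y. 2 *\<^sub>R x - y) ` closed_segment x y = closed_segment x (2 *\<^sub>R x - y)"
  proof -
    have 1: "uminus ` closed_segment x y = closed_segment (- x) (- y)"
      by (intro closed_segment_linear_image[symmetric] linear_uminus)
    have 2: "(+) (2 *\<^sub>R x) ` closed_segment (- x) (- y) = closed_segment (2 *\<^sub>R x + - x) (2 *\<^sub>R x + - y)"
      by (rule closed_segment_translation[symmetric])
    have "(\<lambda>y. 2 *\<^sub>R x - y) ` closed_segment x y = (+) (2 *\<^sub>R x) ` uminus ` closed_segment x y"
      by (simp add: image_image)
    then show ?thesis unfolding 1 2 by (simp add: scaleR_2)
  qed
  have "((\<lambda>y. 2 *\<^sub>R x - y) ` E) \<inter> closed_segment x y = {} \<longleftrightarrow> E \<inter> closed_segment x (2 *\<^sub>R x - y) = {}" for E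
  proof -
    have "inj (\<lambda>y. 2 *\<^sub>R x - y)" by (auto simp: inj_def)
    from image_Int[OF this, of "(\<lambda>y. 2 *\<^sub>R x - y) ` E" "closed_segment x y"]
    have "(\<lambda>y. 2 *\<^sub>R x - y) ` (((\<lambda>y. 2 *\<^sub>R x - y) ` E) \<inter> closed_segment x y) =
        E \<inter> closed_segment x (2 *\<^sub>R x - y)" by (simp add: seg reflect_reflect)
    then show ?thesis by (metis image_is_empty)
  qed
  then show ?thesis by (simp add: same_cell_def reflect_config_def)
qed

lemma hyperplane_mem_reflect_config:
  "hyperplane u t \<in> reflect_config x A \<longleftrightarrow> hyperplane u (2 * (x \<bullet> u) - t) \<in> A"
  by (simp add: mem_reflect_config reflect_hyperplane)

text \<open>Reflection keeps the normal and replaces the offset \<open>t\<close> by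
  \<open>2 * (x \<bullet> u) - t\<close>; this measurable map pulls the preimage of \<open>A\<close>
  back to that of the reflected family.\<close>

lemma reflect_config_window:
  fixes x :: "real ^ 'n"
  assumes A: "window A" shows "window (reflect_config x A)"
proof -
  have AS: "A \<in> sets hyperplane_space" and "A \<subseteq> hyperplanes"
    using A sets.sets_into_space[of A hyperplane_space] by (auto simp: window_def)
  let ?N = "restrict_space borel (sphere 0 1) \<Otimes>\<^sub>M borel :: ((real ^ 'n) \<times> real) measure"
  have [measurable]: "(\<lambda>p. fst p) \<in> ?N \<rightarrow>\<^sub>M borel"
    by (rule measurable_compose[OF measurable_fst measurable_restrict_space1]) auto
  have [measurable]: "(\<lambda>p. fst p) \<in> ?N \<rightarrow>\<^sub>M restrict_space borel (sphere 0 1)" by (rule measurable_fst)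
  have "(\<lambda>p. (fst p, 2 * (x \<bullet> fst p) - snd p)) \<in> ?N \<rightarrow>\<^sub>M ?N" by measurable
  from measurable_compose[OF this measurable_hyperplane]
  have "(\<lambda>p. hyperplane (fst p) (2 * (x \<bullet> fst p) - snd p)) -` A \<inter> space ?N \<in> sets ?N"
    using AS by (auto intro: measurable_sets)
  moreover have "(\<lambda>p. hyperplane (fst p) (2 * (x \<bullet> fst p) - snd p)) -` A \<inter> space ?N =
      {p \<in> sphere 0 1 \<times> UNIV. hyperplane (fst p) (snd p) \<in> reflect_config x A}"
  proof -
    have "hyperplane u (2 * (x \<bullet> u) - t) \<in> A \<longleftrightarrow> hyperplane u t \<in> reflect_config x A" for u t
      unfolding reflect_hyperplane[symmetric]
      by (simp add: mem_reflect_config)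
    then show ?thesis by (auto simp: space_pair_measure space_restrict_space)
  qed
  ultimately have S: "reflect_config x A \<in> sets hyperplane_space"
    using \<open>A \<subseteq> hyperplanes\<close> by (intro sets_hyperplane_spaceI) (auto simp: reflect_config_def intro: reflect_hyperplanes)
  obtain r where r: "\<And>E. E \<in> A \<Longrightarrow> E \<inter> cball 0 r \<noteq> {}" using A unfolding window_def by meson
  have "F \<inter> cball 0 (2 * norm x + r) \<noteq> {}" if F: "F \<in> reflect_config x A" for F
  proof -
    obtain E where E: "E \<in> A" "F = (\<lambda>y. 2 *\<^sub>R x - y) ` E" using F by (auto simp: reflect_config_def)
    then obtain z where z: "z \<in> E" "norm z \<le> r" using r[OF E(1)] by auto
    have "norm (2 *\<^sub>R x - z) \<le> 2 * norm x + r"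
      using norm_triangle_ineq4[of "2 *\<^sub>R x" z] z by simp
    then show ?thesis using E z by auto
  qed
  with S show ?thesis unfolding window_def by meson
qed

lemma distr_lborel_reflect: "distr lborel borel (\<lambda>t. a - t) = (lborel :: real measure)"
proof -
  have "distr lborel borel (\<lambda>t. a - t) = distr (distr lborel borel uminus) borel ((+) a)"
    by (subst distr_distr) (simp_all add: comp_def)
  then show ?thesis by (simp add: lborel_distr_uminus lborel_distr_plus)
qed

text \<open>On the fibre over each normal \<open>u\<close> the reflection acts as \<open>t\<close>
  to \<open>2 * (x \<bullet> u) - t\<close>, which preserves Lebesgue measure.\<close>

lemma hyperplane_measure_reflect:
  fixes x :: "real ^ 'n"
  assumes A: "window A" and \<phi>: "directional_distribution \<phi>"
  shows "hyperplane_measure \<phi> (reflect_config x A) = hyperplane_measure \<phi> A"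
proof -
  let ?P = "\<lambda>A. {p \<in> sphere 0 1 \<times> UNIV. hyperplane (fst p) (snd p) \<in> A}"
  have AS: "A \<in> sets hyperplane_space" "reflect_config x A \<in> sets hyperplane_space"
    using A reflect_config_window[OF A, of x] by (simp_all add: window_def)
  note m = preimage_in_sets[OF AS(1) \<phi>] preimage_in_sets[OF AS(2) \<phi>]
  have eq: "emeasure lborel (Pair u -` ?P (reflect_config x A)) = emeasure lborel (Pair u -` ?P A)" for u
  proof -
    have ms: "Pair u -` ?P A \<in> sets borel"
      using sets_Pair1[OF m(1), of u] by (simp only: sets_lborel)
    note iff = hyperplane_mem_reflect_config[of u _ x A]
    define T T' where "T = Pair u -` ?P A" and "T' = Pair u -` ?P (reflect_config x A)"
    have mem: "t \<in> T' \<longleftrightarrow> 2 * (x \<bullet> u) - t \<in> T" for t :: real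
      unfolding T_def T'_def vimage_eq by (simp add: iff)
    then have 1: "T' = (\<lambda>t. 2 * (x \<bullet> u) - t) -` T \<inter> space lborel"
      by auto
    have "T \<in> sets borel" using ms by (simp only: T_def)
    then have "emeasure (distr lborel borel (\<lambda>t. 2 * (x \<bullet> u) - t)) T = emeasure lborel T'"
      unfolding 1 by (intro emeasure_distr) simp_all
    then have "emeasure lborel T' = emeasure lborel T" by (simp only: distr_lborel_reflect)
    then show ?thesis by (simp only: T_def T'_def)
  qed
  have "emeasure (\<phi> \<Otimes>\<^sub>M lborel) (?P (reflect_config x A)) = emeasure (\<phi> \<Otimes>\<^sub>M lborel) (?P A)"
    unfolding lborel.emeasure_pair_measure_alt[OF m(1)] lborel.emeasure_pair_measure_alt[OF m(2)]
    by (simp only: eq)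
  then show ?thesis by (simp add: hyperplane_measure_def measure_def)
qed

lemma measurable_reflect_config:
  fixes x :: "real ^ 'n"
  shows "reflect_config x \<in> void_space \<rightarrow>\<^sub>M void_space"
proof -
  have "reflect_config x \<in> void_space \<rightarrow>\<^sub>M
      sigma hyperplane_configs {{h \<in> hyperplane_configs. h \<inter> A = {}} | A. window A}"
  proof (rule measurable_measure_of)
    show "reflect_config x \<in> space void_space \<rightarrow> hyperplane_configs"
      by (auto intro: reflect_config_configs)
    fix V :: "(real ^ 'n) set set set" assume "V \<in> {{h \<in> hyperplane_configs. h \<inter> A = {}} |A. window A}"
    then obtain A where V: "V = {h \<in> hyperplane_configs. h \<inter> A = {}}" "window A" by auto
    have "reflect_config x -` V \<inter> space void_space = {h \<in> hyperplane_configs. h \<inter> reflect_config x A = {}}"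
      unfolding V by (auto simp: reflect_config_configs reflect_config_Int_empty)
    then show "reflect_config x -` V \<inter> space void_space \<in> sets void_space"
      using void_event_in_void_space[OF reflect_config_window[OF V(2)]] by simp
  qed auto
  then show ?thesis by (simp add: void_space_def)
qed

text \<open>Void events pull back to void events of the reflected window, whose intensity is the
  same, and void probabilities determine the law.\<close>

lemma void_law_reflect:
  fixes x :: "real ^ 'n"
  assumes Q: "void_law \<phi> lam Q" and \<phi>: "directional_distribution \<phi>"
  shows "distr Q void_space (reflect_config x) = Q"
proof (rule void_law_unique[OF _ Q])
  interpret prob_space Q using Q by (simp add: void_law_def)
  have sQ: "sets Q = sets void_space" using Q by (simp add: void_law_def)
  have m: "reflect_config x \<in> Q \<rightarrow>\<^sub>M void_space"
    using measurable_reflect_config by (simp cong: measurable_cong_sets add: sQ)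
  show "void_law \<phi> lam (distr Q void_space (reflect_config x))"
    unfolding void_law_def
  proof (intro conjI allI impI prob_space_distr m)
    fix A :: "(real ^ 'n) set set" assume A: "window A"
    have "reflect_config x -` {h \<in> hyperplane_configs. h \<inter> A = {}} \<inter> space Q =
        {h \<in> hyperplane_configs. h \<inter> reflect_config x A = {}}"
      using sets_eq_imp_space_eq[OF sQ] by (auto simp: reflect_config_configs reflect_config_Int_empty)
    then show "measure (distr Q void_space (reflect_config x)) {h \<in> hyperplane_configs. h \<inter> A = {}} =
        exp (- lam * hyperplane_measure \<phi> A)"
      using Q reflect_config_window[OF A] hyperplane_measure_reflect[OF A \<phi>]
      by (simp add: measure_distr[OF m void_event_in_void_space[OF A]] void_law_def)
  qed simp
qed

subsection \<open>Counts and cell radii\<close>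

text \<open>For a Poisson variable N of mean \<open>R\<close> the expectation of 2^N is exp R, and
  here \<open>R\<close> is at most \<open>2 * lam * r\<close>. The base 2 is chosen because N
  hyperplanes have 2^N sign patterns. Unlike the void law, this uses the distribution of the counts
  for all \<open>k\<close>.\<close>

lemma poisson_count_exp:
  fixes H :: "'w \<Rightarrow> (real ^ 'n) set set"
  assumes H: "poisson_hyperplane_process Pr \<phi> lam H" and \<phi>: "directional_distribution \<phi>"
    and lam: "lam > 0" and A: "window A" and r: "r \<ge> 0"
    and hit: "\<And>E. E \<in> A \<Longrightarrow> E \<inter> cball c r \<noteq> {}"
  shows "(\<lambda>w. ennreal (2 ^ card (H w \<inter> A))) \<in> borel_measurable Pr"
    and "(\<integral>\<^sup>+ w. ennreal (2 ^ card (H w \<inter> A)) \<partial>Pr) \<le> ennreal (exp (2 * lam * r))"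
proof -
  have Hm: "H \<in> Pr \<rightarrow>\<^sub>M config_space" using H by (simp add: poisson_hyperplane_process_def)
  interpret prob_space Pr using H by (simp add: poisson_hyperplane_process_def)
  have AS: "A \<in> sets hyperplane_space" using A by (simp add: window_def)
  have sp: "space config_space = (hyperplane_configs :: (real ^ 'n) set set set)"
    unfolding config_space_def by (rule space_measure_of) auto
  have Hc: "H w \<in> hyperplane_configs" if "w \<in> space Pr" for w
    using measurable_space[OF Hm that] unfolding sp .
  \<comment> \<open>Finiteness identifies \<open>hits\<close> with \<open>card\<close>, which would
    be 0 on an infinite set.\<close>
  have fin: "finite (H w \<inter> A)" if "w \<in> space Pr" for w
  proof (rule finite_subset)
    show "finite {E \<in> H w. E \<inter> cball c r \<noteq> {}}"
      using Hc[OF that] by (simp add: hyperplane_configs_def)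
    show "H w \<inter> A \<subseteq> {E \<in> H w. E \<inter> cball c r \<noteq> {}}" using hit by blast
  qed
  define R where "R = lam * hyperplane_measure \<phi> A"
  have R: "0 \<le> R" "R \<le> 2 * lam * r"
    using hyperplane_measure_le[OF AS \<phi> hit r] lam unfolding R_def
    by (auto simp: hyperplane_measure_def mult_ac)
  define N where "N k = {w \<in> space Pr. hits A (H w) = of_nat k}" for k
  have Neq: "N k = {w \<in> space Pr. card (H w \<inter> A) = k}" for k
    using fin unfolding N_def hits_def by (auto simp: emeasure_count_space)
  have Nm: "N k \<in> sets Pr" for k
  proof -
    have "{of_nat k :: ennreal} \<in> sets borel" by simp
    then have "{h \<in> hyperplane_configs. hits A h \<in> {of_nat k}} \<in>
        {{h \<in> hyperplane_configs. hits A h \<in> U} |A U. A \<in> sets hyperplane_space \<and> U \<in> sets borel}"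
      using AS by blast
    then have "{h \<in> hyperplane_configs. hits A h \<in> {of_nat k}} \<in> sets config_space"
      unfolding config_space_def by (subst sets_measure_of) auto
    from measurable_sets[OF Hm this] show ?thesis
      unfolding N_def by (rule back_subst[of "\<lambda>A. A \<in> sets Pr"]) (use Hc in auto)
  qed
  have prN: "measure Pr (N k) = R ^ k / fact k * exp (- R)" for k
  proof -
    have e: "emeasure (hyperplane_intensity \<phi> lam) A = ennreal R"
      unfolding R_def by (rule hyperplane_intensity_window[OF A \<phi> lam])
    have "\<forall>k. measure Pr {w \<in> space Pr. hits A (H w) = of_nat k} =
        (let r = measure (hyperplane_intensity \<phi> lam) A in r ^ k / fact k * exp (- r))"
      using H AS e unfolding poisson_hyperplane_process_def by (simp add: less_top[symmetric])
    then show ?thesis using R by (simp add: N_def measure_def e)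
  qed
  have ser: "ennreal (2 ^ card (H w \<inter> A)) = (\<Sum>k. ennreal (2 ^ k) * indicator (N k) w)"
    if w: "w \<in> space Pr" for w
  proof -
    have "(\<Sum>k. ennreal (2 ^ k) * indicator (N k) w) =
        (\<Sum>k\<in>{card (H w \<inter> A)}. ennreal (2 ^ k) * indicator (N k) w)"
      by (rule suminf_finite) (auto simp: Neq)
    then show ?thesis using w by (simp add: Neq)
  qed
  have "(\<lambda>w. \<Sum>k. ennreal (2 ^ k) * indicator (N k) w) \<in> borel_measurable Pr"
    using Nm by measurable
  moreover have "(\<lambda>w. ennreal (2 ^ card (H w \<inter> A))) \<in> borel_measurable Pr \<longleftrightarrow>
      (\<lambda>w. \<Sum>k. ennreal (2 ^ k) * indicator (N k) w) \<in> borel_measurable Pr"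
    by (rule measurable_cong) (rule ser)
  ultimately show "(\<lambda>w. ennreal (2 ^ card (H w \<inter> A))) \<in> borel_measurable Pr" by simp
  have "(\<integral>\<^sup>+ w. ennreal (2 ^ card (H w \<inter> A)) \<partial>Pr) = (\<integral>\<^sup>+ w. (\<Sum>k. ennreal (2 ^ k) * indicator (N k) w) \<partial>Pr)"
    by (rule nn_integral_cong[OF ser])
  also have "\<dots> = (\<Sum>k. ennreal (2 ^ k) * emeasure Pr (N k))"
    using Nm by (simp add: nn_integral_suminf nn_integral_cmult)
  also have "\<dots> = (\<Sum>k. ennreal ((2 * R) ^ k / fact k * exp (- R)))"
    by (intro suminf_cong)
      (simp add: emeasure_eq_measure prN ennreal_mult'[symmetric] power_mult_distrib mult.assoc)
  also have "\<dots> = ennreal (exp (2 * R) * exp (- R))"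
  proof -
    have "(\<lambda>k. (2 * R) ^ k / fact k * exp (- R)) sums (exp (2 * R) * exp (- R))"
      using sums_mult2[OF exp_converges[of "2 * R"], of "exp (- R)"]
      by (simp add: scaleR_conv_of_real divide_inverse mult_ac)
    then show ?thesis using R by (intro suminf_ennreal_eq) auto
  qed
  also have "\<dots> = ennreal (exp R)" by (simp add: exp_add[symmetric])
  also have "\<dots> \<le> ennreal (exp (2 * lam * r))" using R by (intro ennreal_leI) simp
  finally show "(\<integral>\<^sup>+ w. ennreal (2 ^ card (H w \<inter> A)) \<partial>Pr) \<le> ennreal (exp (2 * lam * r))" .
qed

section \<open>Exponential tails of the cell radius\<close>

text \<open>Hyperplanes with normal \<open>v\<close> close to \<open>u\<close> that cross the line
  through \<open>x\<close> in direction \<open>v\<close> at a signed distance strictly between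
  \<open>a\<close> and \<open>b\<close>.\<close>

definition slab :: "real ^ 'n \<Rightarrow> real \<Rightarrow> real ^ 'n \<Rightarrow> real \<Rightarrow> real \<Rightarrow> (real ^ 'n) set set" where
  "slab u \<eta> x a b = {hyperplane v t |v t. norm v = 1 \<and> (norm (v - u) < \<eta> \<and> x \<bullet> v + a < t \<and> t < x \<bullet> v + b)}"

lemma slab_sets: "slab u \<eta> x a b \<in> sets hyperplane_space"
  unfolding slab_def by (rule hyperplane_family_measurable) measurable

lemma window_slab:
  fixes x :: "real ^ 'n"
  shows "window (slab u \<eta> x a b)"
proof -
  have "E \<inter> cball 0 (norm x + \<bar>a\<bar> + \<bar>b\<bar>) \<noteq> {}" if E: "E \<in> slab u \<eta> x a b" for E
  proof -
    obtain v t where v: "E = hyperplane v t" "norm v = 1" "x \<bullet> v + a < t" "t < x \<bullet> v + b"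
      using E by (auto simp: slab_def)
    have "\<exists>p\<in>hyperplane v t. dist p x < \<bar>a\<bar> + \<bar>b\<bar> + 0"
      unfolding hyperplane_point_near[OF v(2)] using v by linarith
    then obtain p where p: "p \<in> E" "dist p x < \<bar>a\<bar> + \<bar>b\<bar>" using v by auto
    then have "norm p \<le> norm x + \<bar>a\<bar> + \<bar>b\<bar>"
      using norm_triangle_ineq2[of p x] by (simp add: dist_norm)
    then show ?thesis using p by auto
  qed
  then show ?thesis using slab_sets unfolding window_def by meson
qed

text \<open>Every unit normal within \<eta> of \<open>u\<close> admits an interval of offsets of
  length \<open>b - a\<close>, and Fubini multiplies.\<close>

lemma hyperplane_measure_slab_ge:
  fixes x u :: "real ^ 'n"
  assumes \<phi>: "directional_distribution \<phi>" and ab: "a \<le> b"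
  shows "measure \<phi> (ball u \<eta> \<inter> sphere 0 1) * (b - a) \<le> hyperplane_measure \<phi> (slab u \<eta> x a b)"
proof -
  interpret prob_space \<phi> using directional_distributionD[OF \<phi>] by simp
  let ?P = "{p \<in> sphere 0 1 \<times> UNIV. hyperplane (fst p) (snd p) \<in> slab u \<eta> x a b}"
  let ?U = "ball u \<eta> \<inter> sphere 0 1"
  have U: "?U \<in> sets \<phi>"
    unfolding directional_distributionD(2)[OF \<phi>] sets_restrict_space
    by (rule image_eqI[of _ _ "ball u \<eta>"]) (simp_all add: Int_commute)
  have "ennreal (measure \<phi> ?U * (b - a)) = emeasure \<phi> ?U * ennreal (b - a)"
    using ab by (simp add: emeasure_eq_measure ennreal_mult')
  also have "\<dots> = (\<integral>\<^sup>+ v. ennreal (b - a) * indicator ?U v \<partial>\<phi>)"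
    using U by (simp add: nn_integral_cmult_indicator mult.commute)
  also have "\<dots> \<le> (\<integral>\<^sup>+ v. emeasure lborel (Pair v -` ?P) \<partial>\<phi>)"
  proof (rule nn_integral_mono)
    fix v assume v: "v \<in> space \<phi>"
    show "ennreal (b - a) * indicator ?U v \<le> emeasure lborel (Pair v -` ?P)"
    proof (cases "v \<in> ?U")
      case True
      then have "{x \<bullet> v + a<..<x \<bullet> v + b} \<subseteq> Pair v -` ?P"
        unfolding slab_def by (fastforce simp: dist_norm norm_minus_commute)
      moreover have "Pair v -` ?P \<in> sets lborel"
        by (rule sets_Pair1[OF preimage_in_sets[OF slab_sets \<phi>]])
      ultimately have "emeasure lborel {x \<bullet> v + a<..<x \<bullet> v + b} \<le> emeasure lborel (Pair v -` ?P)"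
        by (rule emeasure_mono)
      then show ?thesis using ab True by simp
    qed simp
  qed
  also have "\<dots> = emeasure (\<phi> \<Otimes>\<^sub>M lborel) ?P"
    by (rule lborel.emeasure_pair_measure_alt[OF preimage_in_sets[OF slab_sets \<phi>], symmetric])
  also have "\<dots> = ennreal (hyperplane_measure \<phi> (slab u \<eta> x a b))"
    by (rule emeasure_window[OF window_slab \<phi>])
  finally show ?thesis by (simp add: hyperplane_measure_def)
qed

text \<open>The sum of \<open>\<bar>z \<bullet> u\<bar>\<close> over a spanning set vanishes only at
  0, so compactness of the sphere bounds it below by \<open>m * norm z\<close>. The error
  \<open>\<eta> * norm z\<close> is allowed because the process only offers normals near the vectors
  of \<open>B\<close>, not these vectors themselves; that there are such normals with mass at least
  \<open>p\<close> is the meaning of support.\<close>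

lemma independent_support_frame:
  assumes \<phi>: "directional_distribution (\<phi> :: (real ^ 'n) measure)"
  shows "\<exists>B \<eta> C p. finite B \<and> B \<noteq> {} \<and> \<eta> > 0 \<and> C > 0 \<and> p > 0 \<and>
    (\<forall>u\<in>B. p \<le> measure \<phi> (ball u \<eta> \<inter> sphere 0 1)) \<and>
    (\<forall>z \<delta>. (\<forall>u\<in>B. \<bar>z \<bullet> u\<bar> \<le> \<delta> + \<eta> * norm z) \<longrightarrow> norm z \<le> C * \<delta>)"
proof -
  interpret prob_space \<phi> using directional_distributionD[OF \<phi>] by simp
  obtain B where B: "B \<subseteq> measure_support \<phi>" "independent B" "card B = CARD('n)"
    using \<phi> by (auto simp: directional_distribution_def)
  have fin: "finite B" and ne: "B \<noteq> {}" using B(3) card_gt_0_iff[of B] by auto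
  have span: "span B = UNIV"
    using card_eq_dim[of B UNIV] B fin by (auto simp: dim_UNIV)
  let ?s = "\<lambda>z. \<Sum>u\<in>B. \<bar>z \<bullet> u\<bar>"
  have "\<exists>m>0. \<forall>z\<in>sphere 0 1. m \<le> ?s z"
  proof -
    have c: "compact (sphere 0 1 :: (real ^ 'n) set)" "sphere 0 1 \<noteq> ({} :: (real ^ 'n) set)"
      by (rule compact_sphere) (simp add: sphere_eq_empty)
    have "continuous_on (sphere 0 1) ?s" by (intro continuous_intros)
    from continuous_attains_inf[OF c this] obtain z0 where z0: "z0 \<in> sphere 0 1" "\<And>z. z \<in> sphere 0 1 \<Longrightarrow> ?s z0 \<le> ?s z"
      by blast
    have "?s z0 \<noteq> 0"
    proof
      assume "?s z0 = 0"
      then have "\<forall>u\<in>B. z0 \<bullet> u = 0" using fin by (simp add: sum_nonneg_eq_0_iff)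
      then have "orthogonal z0 z0"
        by (intro orthogonal_to_span[of z0 B]) (simp_all add: span orthogonal_def)
      then have "z0 = 0" by (simp add: orthogonal_self)
      then show False using z0(1) by simp
    qed
    moreover have "?s z0 \<ge> 0" by (rule sum_nonneg) simp
    ultimately have "?s z0 > 0" by linarith
    then show ?thesis using z0(2) by blast
  qed
  then obtain m where m: "m > 0" "\<And>z. norm z = 1 \<Longrightarrow> m \<le> ?s z" by auto
  have frame: "m * norm z \<le> ?s z" for z
  proof (cases "z = 0")
    case False
    have "m \<le> ?s (z /\<^sub>R norm z)" using False by (intro m(2)) simp
    also have "\<dots> = ?s z / norm z"
      by (simp add: abs_mult sum_divide_distrib divide_inverse mult.commute sum_distrib_left)
    finally show ?thesis using False by (simp add: field_simps)
  qed (simp add: sum_nonneg)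
  define D where "D = real (card B)"
  have D: "D > 0" using fin ne by (simp add: D_def card_gt_0_iff)
  \<comment> \<open>With this choice the errors over all of \<open>B\<close> add up to half of the
    lower bound \<open>m * norm z\<close> and can be absorbed by it.\<close>
  define \<eta> where "\<eta> = m / (2 * D)"
  have \<eta>: "\<eta> > 0" using m D by (simp add: \<eta>_def)
  define p where "p = Min ((\<lambda>u. measure \<phi> (ball u \<eta> \<inter> sphere 0 1)) ` B)"
  have pos: "measure \<phi> (ball u \<eta> \<inter> sphere 0 1) > 0" if "u \<in> B" for u
  proof -
    have "u \<in> measure_support \<phi>" using B that by auto
    then have "emeasure \<phi> (ball u \<eta> \<inter> sphere 0 1) > 0"
      using \<eta> directional_distributionD(3)[OF \<phi>] by (auto simp: measure_support_def)
    then show ?thesis by (simp add: emeasure_eq_measure)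
  qed
  have "p > 0" using fin ne pos by (simp add: p_def)
  moreover have pB: "\<forall>u\<in>B. p \<le> measure \<phi> (ball u \<eta> \<inter> sphere 0 1)" using fin by (simp add: p_def)
  moreover have "norm z \<le> (2 * D / m) * \<delta>" if z: "\<forall>u\<in>B. \<bar>z \<bullet> u\<bar> \<le> \<delta> + \<eta> * norm z" for z \<delta>
  proof -
    have "m * norm z \<le> ?s z" by (rule frame)
    also have "\<dots> \<le> (\<Sum>u\<in>B. \<delta> + \<eta> * norm z)" using z by (intro sum_mono) auto
    also have "\<dots> = D * \<delta> + m / 2 * norm z" using D by (simp add: D_def \<eta>_def field_simps)
    finally have "m / 2 * norm z \<le> D * \<delta>" by simp
    then show ?thesis using m by (simp add: field_simps)
  qed
  moreover have "2 * D / m > 0" using D m by simp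
  ultimately show ?thesis using fin ne \<eta>
    by (intro exI[of _ B] exI[of _ \<eta>] exI[of _ "2 * D / m"] exI[of _ p]) simp
qed

text \<open>The bad event: for some \<open>u\<close> there is a side of \<open>x\<close> on which no
  hyperplane with normal near \<open>u\<close> passes within distance \<delta>. Being a finite union
  of void events, it is an event of \<open>void_space\<close>, and it stands in for a statement
  about the radius of the cell.\<close>

definition unguarded :: "(real ^ 'n) set \<Rightarrow> real \<Rightarrow> real ^ 'n \<Rightarrow> real \<Rightarrow> (real ^ 'n) set set set" where
  "unguarded B \<eta> x \<delta> = (\<Union>u\<in>B. {h \<in> hyperplane_configs. h \<inter> slab u \<eta> x 0 \<delta> = {}} \<union>
     {h \<in> hyperplane_configs. h \<inter> slab u \<eta> x (- \<delta>) 0 = {}})"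

lemma unguarded_sets: "finite B \<Longrightarrow> unguarded B \<eta> x \<delta> \<in> sets void_space"
  unfolding unguarded_def
  by (intro sets.finite_UN sets.Un void_event_in_void_space window_slab)

text \<open>Union bound over two slabs of thickness \<delta> for each \<open>u\<close>, each slab
  being void with probability at most \<open>exp (- lam * p * \<delta>)\<close>.\<close>

lemma measure_unguarded:
  assumes Q: "void_law \<phi> lam Q" and \<phi>: "directional_distribution \<phi>" and lam: "lam > 0"
    and fin: "finite B" and \<delta>: "\<delta> \<ge> 0"
    and p: "\<And>u. u \<in> B \<Longrightarrow> p \<le> measure \<phi> (ball u \<eta> \<inter> sphere 0 1)"
  shows "measure Q (unguarded B \<eta> x \<delta>) \<le> 2 * card B * exp (- lam * p * \<delta>)"
proof -
  interpret prob_space Q using Q by (simp add: void_law_def)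
  have sQ: "sets Q = sets void_space" using Q by (simp add: void_law_def)
  have one: "measure Q {h \<in> hyperplane_configs. h \<inter> slab u \<eta> x a b = {}} \<le> exp (- lam * p * \<delta>)"
    if "u \<in> B" "b - a = \<delta>" for u a b
  proof -
    have "p * \<delta> \<le> measure \<phi> (ball u \<eta> \<inter> sphere 0 1) * (b - a)"
      using p[OF that(1)] \<delta> that(2) by (simp add: mult_right_mono)
    also have "\<dots> \<le> hyperplane_measure \<phi> (slab u \<eta> x a b)"
      using \<delta> that by (intro hyperplane_measure_slab_ge[OF \<phi>]) simp
    finally have "lam * (p * \<delta>) \<le> lam * hyperplane_measure \<phi> (slab u \<eta> x a b)"
      using lam by (intro mult_left_mono) auto
    moreover have "measure Q {h \<in> hyperplane_configs. h \<inter> slab u \<eta> x a b = {}} =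
        exp (- lam * hyperplane_measure \<phi> (slab u \<eta> x a b))"
      using Q window_slab[of u \<eta> x a b] unfolding void_law_def by blast
    ultimately show ?thesis by (simp add: mult.assoc)
  qed
  let ?V = "\<lambda>u a b. {h \<in> hyperplane_configs. h \<inter> slab u \<eta> x a b = {}}"
  have V: "?V u a b \<in> sets Q" for u a b
    unfolding sQ by (rule void_event_in_void_space[OF window_slab])
  have "measure Q (unguarded B \<eta> x \<delta>) \<le> (\<Sum>u\<in>B. measure Q (?V u 0 \<delta> \<union> ?V u (- \<delta>) 0))"
    unfolding unguarded_def
    by (rule finite_measure_subadditive_finite[OF fin]) (intro image_subsetI sets.Un V)
  also have "\<dots> \<le> (\<Sum>u\<in>B. measure Q (?V u 0 \<delta>) + measure Q (?V u (- \<delta>) 0))"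
    by (intro sum_mono measure_Un_le V)
  also have "\<dots> \<le> (\<Sum>u\<in>B. exp (- lam * p * \<delta>) + exp (- lam * p * \<delta>))"
    by (intro sum_mono add_mono one) auto
  finally show ?thesis by simp
qed

text \<open>Off the bad event there are hyperplanes on both sides of \<open>x\<close> which the
  segment to \<open>y\<close> cannot cross. They bound the increments in the directions of their
  normals, and replacing such a normal by \<open>u\<close> costs at most
  \<open>\<eta> * norm (y - x)\<close>.\<close>

lemma guarded_radius:
  assumes h: "h \<in> hyperplane_configs" "h \<notin> unguarded B \<eta> x \<delta>" and same: "same_cell h x y"
    and \<delta>: "\<delta> \<ge> 0" and u: "u \<in> B"
  shows "\<bar>(y - x) \<bullet> u\<bar> \<le> \<delta> + \<eta> * norm (y - x)"
proof -
  have off: "\<not> (x \<bullet> v \<le> t \<and> t \<le> y \<bullet> v) \<and> \<not> (y \<bullet> v \<le> t \<and> t \<le> x \<bullet> v)" if "hyperplane v t \<in> h" for v t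
  proof (rule ccontr)
    assume "\<not> ?thesis"
    then have "\<exists>z\<in>closed_segment x y. v \<bullet> z = t"
      using connected_ivt_hyperplane[of "closed_segment x y" x y v t]
        connected_ivt_hyperplane[of "closed_segment x y" y x v t] by (auto simp: inner_commute)
    then show False using same \<open>hyperplane v t \<in> h\<close> by (auto simp: same_cell_def hyperplane_def inner_commute disjoint_iff)
  qed
  have close: "\<bar>(y - x) \<bullet> u - (y - x) \<bullet> v\<bar> \<le> \<eta> * norm (y - x)" if "norm (v - u) < \<eta>" for v
  proof -
    have "\<bar>(y - x) \<bullet> u - (y - x) \<bullet> v\<bar> = \<bar>(y - x) \<bullet> (u - v)\<bar>" by (simp add: inner_diff_right)
    also have "\<dots> \<le> norm (y - x) * norm (u - v)" by (rule Cauchy_Schwarz_ineq2)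
    also have "\<dots> \<le> norm (y - x) * \<eta>" using that by (intro mult_left_mono) (auto simp: norm_minus_commute)
    finally show ?thesis by (simp add: mult.commute)
  qed
  have "h \<inter> slab u \<eta> x 0 \<delta> \<noteq> {}" "h \<inter> slab u \<eta> x (- \<delta>) 0 \<noteq> {}"
    using h u by (auto simp: unguarded_def)
  then obtain v s w t where
    v: "hyperplane v s \<in> h" "norm (v - u) < \<eta>" "x \<bullet> v < s" "s < x \<bullet> v + \<delta>" and
    w: "hyperplane w t \<in> h" "norm (w - u) < \<eta>" "x \<bullet> w - \<delta> < t" "t < x \<bullet> w"
    unfolding slab_def by (auto simp: disjoint_iff)
  have "(y - x) \<bullet> v \<le> \<delta>" using off[OF v(1)] v by (simp add: inner_diff_left)
  moreover have "(y - x) \<bullet> w \<ge> - \<delta>" using off[OF w(1)] w by (simp add: inner_diff_left)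
  ultimately show ?thesis using close[OF v(2)] close[OF w(2)] by linarith
qed

text \<open>An exponential tail bound that avoids the radius as a random variable: \<open>F\<close>
  only has to be dominated by \<open>g k\<close> whenever the radius is at most the
  \<open>k\<close>-th scale, and the scale is read off from the events \<open>unguarded\<close>. The
  constants depend on \<phi> alone.\<close>

lemma cell_radius_expectation:
  assumes \<phi>: "directional_distribution (\<phi> :: (real ^ 'n) measure)"
  shows "\<exists>C K p. C > 0 \<and> K > 0 \<and> p > 0 \<and>
    (\<forall>lam Q x F g. lam > 0 \<longrightarrow> void_law \<phi> lam Q \<longrightarrow>
      (\<forall>h\<in>hyperplane_configs. \<forall>k::nat.
         (\<forall>y. same_cell h x y \<longrightarrow> norm (y - x) \<le> C * ((real k + 1) / lam)) \<longrightarrow> F h \<le> g k) \<longrightarrow>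
      (\<integral>\<^sup>+ h. F h \<partial>Q) \<le> (\<Sum>k. g k * ennreal (K * exp (- p * real k))))"
proof -
  obtain B \<eta> C p where B: "finite B" "B \<noteq> {}" "\<eta> > 0" "C > 0" "p > 0"
    "\<And>u. u \<in> B \<Longrightarrow> p \<le> measure \<phi> (ball u \<eta> \<inter> sphere 0 1)"
    "\<And>z \<delta>. (\<forall>u\<in>B. \<bar>z \<bullet> u\<bar> \<le> \<delta> + \<eta> * norm z) \<Longrightarrow> norm z \<le> C * \<delta>"
    using independent_support_frame[OF \<phi>] by metis
  define K where "K = 2 * real (card B)"
  have K: "K > 0" using B by (simp add: K_def card_gt_0_iff)
  have main: "(\<integral>\<^sup>+ h. F h \<partial>Q) \<le> (\<Sum>k. g k * ennreal (K * exp (- p * real k)))"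
    if lam: "lam > 0" and Q: "void_law \<phi> lam Q"
      and F: "\<forall>h\<in>hyperplane_configs. \<forall>k::nat.
         (\<forall>y. same_cell h x y \<longrightarrow> norm (y - x) \<le> C * ((real k + 1) / lam)) \<longrightarrow> F h \<le> g k"
    for lam Q x and F :: "(real ^ 'n) set set \<Rightarrow> ennreal" and g :: "nat \<Rightarrow> ennreal"
  proof -
    interpret prob_space Q using Q by (simp add: void_law_def)
    have sQ: "sets Q = sets void_space" using Q by (simp add: void_law_def)
    have spQ: "space Q = hyperplane_configs" using sets_eq_imp_space_eq[OF sQ] by simp
    let ?U = "\<lambda>k::nat. unguarded B \<eta> x (real k / lam)"
    have Um: "?U k \<in> sets Q" for k unfolding sQ by (rule unguarded_sets[OF B(1)])
    have U: "measure Q (?U k) \<le> K * exp (- p * real k)" for k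
      using measure_unguarded[OF Q \<phi> lam B(1) _ B(6), of "real k / lam" x] lam by (simp add: K_def)
    have "(\<lambda>k. K * exp (- p * real k)) \<longlonglongrightarrow> K * 0"
    proof (intro tendsto_mult tendsto_const)
      have "(\<lambda>k. exp (- p) ^ k) \<longlonglongrightarrow> 0" using B(5) by (intro LIMSEQ_realpow_zero) auto
      then show "(\<lambda>k. exp (- p * real k)) \<longlonglongrightarrow> 0" by (simp add: exp_of_nat_mult[symmetric] mult.commute)
    qed
    then have lim: "(\<lambda>k. K * exp (- p * real k)) \<longlonglongrightarrow> 0" by simp
    have "measure Q (\<Inter>k. ?U k) \<le> K * exp (- p * real k)" for k
      using U[of k] finite_measure_mono[of "\<Inter>k. ?U k" "?U k"] Um by (meson INT_lower UNIV_I order_trans)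
    \<comment> \<open>Almost every configuration is therefore guarded at some scale, so that the
      least such scale exists.\<close>
    then have "measure Q (\<Inter>k. ?U k) \<le> 0" using LIMSEQ_le_const[OF lim] by blast
    then have "AE h in Q. h \<notin> (\<Inter>k. ?U k)"
    proof (intro AE_not_in null_setsI)
      show "(\<Inter>k. ?U k) \<in> sets Q" by (intro sets.countable_INT' Um) (auto intro: Um)
      show "emeasure Q (\<Inter>k. ?U k) = 0"
        using \<open>measure Q (\<Inter>k. ?U k) \<le> 0\<close> by (simp only: emeasure_eq_measure measure_le_0_iff ennreal_0)
    qed
    moreover have "AE h in Q. h \<in> hyperplane_configs" by (rule AE_I2) (simp only: spQ)
    ultimately have "AE h in Q. F h \<le> (\<Sum>k. g k * indicator (?U k) h)"
    proof eventually_elim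
      case (elim h)
      have ex: "\<exists>k. h \<notin> ?U k" using elim by auto
      define k where "k = (LEAST k. h \<notin> ?U k)"
      have k: "h \<notin> ?U k" "\<And>j. j < k \<Longrightarrow> h \<in> ?U j"
        unfolding k_def using LeastI_ex[OF ex] not_less_Least by blast+
      \<comment> \<open>Slabs of thickness 0 are empty and hence void, so the least guarded index is
        a successor. Being guarded at \<open>Suc j\<close> bounds the radius, while failing at
        \<open>j\<close> supplies the small probability.\<close>
      have "h \<in> ?U 0"
      proof -
        have "slab u \<eta> x 0 0 = {}" for u by (auto simp: slab_def)
        then show ?thesis using B(2) elim by (auto simp: unguarded_def)
      qed
      then have "k \<noteq> 0" using k(1) by metis
      then obtain j where j: "k = Suc j" using not0_implies_Suc by blast
      have "norm (y - x) \<le> C * ((real j + 1) / lam)" if y: "same_cell h x y" for y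
        using guarded_radius[OF _ k(1) y] elim lam by (intro B(7)) (auto simp: j add.commute)
      then have "F h \<le> g j" using F elim by blast
      also have "\<dots> = g j * indicator (?U j) h" using k(2)[of j] j by simp
      also have "\<dots> \<le> (\<Sum>k. g k * indicator (?U k) h)"
        using sum_le_suminf[of "\<lambda>k. g k * indicator (?U k) h" "{j}"] by (simp del: indicator_simps sum_mult_indicator)
      finally show ?case .
    qed
    then have "(\<integral>\<^sup>+ h. F h \<partial>Q) \<le> (\<integral>\<^sup>+ h. (\<Sum>k. g k * indicator (?U k) h) \<partial>Q)"
      by (rule nn_integral_mono_AE)
    also have "\<dots> = (\<Sum>k. g k * emeasure Q (?U k))"
      using Um by (simp add: nn_integral_suminf nn_integral_cmult)
    also have "\<dots> \<le> (\<Sum>k. g k * ennreal (K * exp (- p * real k)))"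
      using U by (intro suminf_le mult_left_mono) (auto simp: emeasure_eq_measure ennreal_leI)
    finally show ?thesis .
  qed
  show ?thesis using B(4,5) K main by blast
qed

subsection \<open>Conditional risk of a tree given its cells\<close>

text \<open>The number of coordinates in \<open>A\<close> is binomial. One coordinate is split off
  by Fubini, and the induction step is Pascal's rule for the binomial coefficients.\<close>

lemma (in prob_space) PiM_count_expectation:
  fixes h :: "nat \<Rightarrow> real"
  assumes A: "A \<in> events" and J: "finite J"
  shows "(\<integral>\<omega>. h (card {i \<in> J. \<omega> i \<in> A}) \<partial>(PiM J (\<lambda>_. M))) =
    (\<Sum>k\<le>card J. real (card J choose k) * prob A ^ k * (1 - prob A) ^ (card J - k) * h k)"
  using J
proof (induction J arbitrary: h rule: finite_induct)
  case empty
  interpret P: product_prob_space "\<lambda>_. M" UNIV by standard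
  show ?case by (simp add: PiM_empty lebesgue_integral_count_space_finite)
next
  case (insert j J)
  interpret P: product_prob_space "\<lambda>_. M" UNIV by standard
  interpret PJ: prob_space "PiM J (\<lambda>_. M)" by (rule prob_space_PiM) (rule prob_space_axioms)
  interpret PI: prob_space "PiM (insert j J) (\<lambda>_. M)" by (rule prob_space_PiM) (rule prob_space_axioms)
  have cnt: "card {i \<in> I. \<omega> i \<in> A} = (\<Sum>i\<in>I. if \<omega> i \<in> A then 1 else 0)" if "finite I" for \<omega> :: "'b \<Rightarrow> 'a" and I
    using that by (simp add: sum.If_cases Int_def)
  have [measurable]: "(\<lambda>\<omega>. card {i \<in> I. \<omega> i \<in> A}) \<in> PiM I (\<lambda>_. M) \<rightarrow>\<^sub>M count_space UNIV"
    if "finite I" for I :: "'b set"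
    unfolding cnt[OF that] using A by measurable
  have bdd: "\<bar>h' (card {i \<in> I. \<omega> i \<in> A})\<bar> \<le> (\<Sum>k\<le>card I. \<bar>h' k\<bar>)" if "finite I" for \<omega> :: "'b \<Rightarrow> 'a" and I and h' :: "nat \<Rightarrow> real"
    using that by (intro member_le_sum[of _ _ "\<lambda>k. \<bar>h' k\<bar>"]) (auto intro: card_mono)
  have intg: "integrable (PiM I (\<lambda>_. M)) (\<lambda>\<omega>. h' (card {i \<in> I. \<omega> i \<in> A}))"
    if "finite I" "prob_space (PiM I (\<lambda>_. M))" for I :: "'b set" and h' :: "nat \<Rightarrow> real"
  proof -
    interpret Q: prob_space "PiM I (\<lambda>_. M)" by fact
    show ?thesis
      using that(1) by (intro Q.integrable_const_bound[of _ "\<Sum>k\<le>card I. \<bar>h' k\<bar>"] AE_I2) (auto intro: bdd)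
  qed
  let ?p = "prob A" and ?q = "1 - prob A" and ?m = "card J"
  let ?N = "\<lambda>\<omega>. card {i \<in> J. \<omega> i \<in> A}"
  have split: "card {i \<in> insert j J. (x(j := y)) i \<in> A} = (if y \<in> A then Suc (?N x) else ?N x)" for x y
  proof -
    have "{i \<in> insert j J. (x(j := y)) i \<in> A} = (if y \<in> A then insert j {i \<in> J. x i \<in> A} else {i \<in> J. x i \<in> A})"
      using insert by auto
    then show ?thesis using insert by (simp add: card_insert_if)
  qed
  have "(\<integral>\<omega>. h (card {i \<in> insert j J. \<omega> i \<in> A}) \<partial>(PiM (insert j J) (\<lambda>_. M))) =
      (\<integral>x. (\<integral>y. h (card {i \<in> insert j J. (x(j := y)) i \<in> A}) \<partial>M) \<partial>(PiM J (\<lambda>_. M)))"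
    using insert by (intro P.product_integral_insert intg PI.prob_space_axioms) auto
  also have "\<dots> = (\<integral>x. ?p * h (Suc (?N x)) + ?q * h (?N x) \<partial>(PiM J (\<lambda>_. M)))"
  proof (rule Bochner_Integration.integral_cong[OF refl])
    fix x
    have "(\<integral>y. h (card {i \<in> insert j J. (x(j := y)) i \<in> A}) \<partial>M) =
        (\<integral>y. h (?N x) + indicator A y * (h (Suc (?N x)) - h (?N x)) \<partial>M)"
      unfolding split by (intro Bochner_Integration.integral_cong refl) (auto simp: indicator_def)
    also have "\<dots> = h (?N x) + ?p * (h (Suc (?N x)) - h (?N x))"
    proof -
      have "integrable M (indicator A :: 'a \<Rightarrow> real)"
        using A by (intro integrable_real_indicator) (simp_all add: less_top[symmetric])
      then show ?thesis using A by (simp add: prob_space)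
    qed
    finally show "(\<integral>y. h (card {i \<in> insert j J. (x(j := y)) i \<in> A}) \<partial>M) = ?p * h (Suc (?N x)) + ?q * h (?N x)"
      by (simp add: algebra_simps)
  qed
  also have "\<dots> = ?p * (\<integral>x. h (Suc (?N x)) \<partial>(PiM J (\<lambda>_. M))) + ?q * (\<integral>x. h (?N x) \<partial>(PiM J (\<lambda>_. M)))"
    using intg[of J "\<lambda>k. h (Suc k)"] intg[of J h] insert PJ.prob_space_axioms by simp
  also have "\<dots> = ?p * (\<Sum>k\<le>?m. real (?m choose k) * ?p ^ k * ?q ^ (?m - k) * h (Suc k)) +
      ?q * (\<Sum>k\<le>?m. real (?m choose k) * ?p ^ k * ?q ^ (?m - k) * h k)"
    using insert.IH[of "\<lambda>k. h (Suc k)"] insert.IH[of h] by simp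
  also have "?q * (\<Sum>k\<le>?m. real (?m choose k) * ?p ^ k * ?q ^ (?m - k) * h k) =
      (\<Sum>k\<le>Suc ?m. real (?m choose k) * ?p ^ k * ?q ^ (Suc ?m - k) * h k)"
    by (simp add: sum_distrib_left Suc_diff_le mult_ac)
  also have "\<dots> = ?q ^ Suc ?m * h 0 + (\<Sum>k\<le>?m. real (?m choose Suc k) * ?p ^ Suc k * ?q ^ (?m - k) * h (Suc k))"
    unfolding sum.atMost_Suc_shift by simp
  also have "?p * (\<Sum>k\<le>?m. real (?m choose k) * ?p ^ k * ?q ^ (?m - k) * h (Suc k)) + \<dots> =
      (\<Sum>k\<le>Suc ?m. real (Suc ?m choose k) * ?p ^ k * ?q ^ (Suc ?m - k) * h k)"
    unfolding sum.atMost_Suc_shift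
    by (simp add: sum_distrib_left sum.distrib[symmetric] algebra_simps)
  finally show ?case using insert by simp
qed

text \<open>At the cost of a factor 2 the square is replaced by (k + 1)(k + 2). The absorption
  identity, applied twice, turns the summands into binomial weights for \<open>m + 2\<close> trials,
  whose total is at most 1.\<close>

lemma binomial_inverse_square_moment:
  fixes p :: real
  assumes p: "0 < p" "p \<le> 1"
  shows "(\<Sum>k\<le>m. real (m choose k) * p ^ k * (1 - p) ^ (m - k) * (1 / (real k + 1)\<^sup>2)) \<le> 2 / ((real m + 1) * (real m + 2) * p\<^sup>2)"
proof -
  let ?q = "1 - p"
  have choose: "real (m choose k) / ((real k + 1) * (real k + 2)) = real (m + 2 choose (k + 2)) / ((real m + 1) * (real m + 2))" for k
  proof -
    have 1: "(real k + 1) * real (Suc m choose Suc k) = (real m + 1) * real (m choose k)"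
      using arg_cong[OF Suc_times_binomial[of k m], of real] unfolding of_nat_mult of_nat_Suc
      by (simp add: add.commute del: binomial_Suc_Suc)
    have 2: "(real k + 2) * real (Suc (Suc m) choose Suc (Suc k)) = (real m + 2) * real (Suc m choose Suc k)"
      using arg_cong[OF Suc_times_binomial[of "Suc k" "Suc m"], of real] unfolding of_nat_mult of_nat_Suc
      by (simp add: add.commute del: binomial_Suc_Suc)
    have e: "m + 2 = Suc (Suc m)" "k + 2 = Suc (Suc k)" by auto
    have "(real k + 1) * (real k + 2) * real (m + 2 choose (k + 2)) = (real m + 2) * (real m + 1) * real (m choose k)"
      unfolding e using 1 2 by algebra
    then show ?thesis by (subst frac_eq_eq) (simp_all only: mult_ac, auto)
  qed
  have "(\<Sum>k\<le>m. real (m choose k) * p ^ k * ?q ^ (m - k) * (1 / (real k + 1)\<^sup>2))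
      \<le> (\<Sum>k\<le>m. real (m choose k) * p ^ k * ?q ^ (m - k) * (2 / ((real k + 1) * (real k + 2))))"
  proof (intro sum_mono mult_left_mono)
    fix k
    show "1 / (real k + 1)\<^sup>2 \<le> 2 / ((real k + 1) * (real k + 2))"
    proof -
      have "2 / (2 * (real k + 1)\<^sup>2) \<le> 2 / ((real k + 1) * (real k + 2))"
      proof (rule divide_left_mono)
        show "(real k + 1) * (real k + 2) \<le> 2 * (real k + 1)\<^sup>2"
          by (simp add: power2_eq_square algebra_simps)
        show "0 < 2 * (real k + 1)\<^sup>2 * ((real k + 1) * (real k + 2))"
          by (intro mult_pos_pos) simp_all
      qed simp
      then show ?thesis by simp
    qed
  qed (use p in auto)
  also have "\<dots> = 2 / ((real m + 1) * (real m + 2) * p\<^sup>2) * (\<Sum>k\<le>m. real (m + 2 choose (k + 2)) * p ^ (k + 2) * ?q ^ (m - k))"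
    unfolding sum_distrib_left
  proof (intro sum.cong refl)
    fix k
    have "real (m choose k) * p ^ k * ?q ^ (m - k) * (2 / ((real k + 1) * (real k + 2))) =
       2 * p ^ k * ?q ^ (m - k) * (real (m choose k) / ((real k + 1) * (real k + 2)))" by simp
    also have "\<dots> = 2 / ((real m + 1) * (real m + 2) * p\<^sup>2) * (real (m + 2 choose (k + 2)) * p ^ (k + 2) * ?q ^ (m - k))"
    proof -
      have "2 * a * b * (x / c) = 2 / (c * p\<^sup>2) * (x * (a * p\<^sup>2) * b)" for a b c x :: real
        using p by simp
      then show ?thesis unfolding choose power_add .
    qed
    finally show "real (m choose k) * p ^ k * ?q ^ (m - k) * (2 / ((real k + 1) * (real k + 2))) =
       2 / ((real m + 1) * (real m + 2) * p\<^sup>2) * (real (m + 2 choose (k + 2)) * p ^ (k + 2) * ?q ^ (m - k))" .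
  qed
  also have "\<dots> \<le> 2 / ((real m + 1) * (real m + 2) * p\<^sup>2) * 1"
  proof (intro mult_left_mono)
    have "(\<Sum>k\<le>m. real (m + 2 choose (k + 2)) * p ^ (k + 2) * ?q ^ (m - k)) =
        (\<Sum>j\<in>(\<lambda>k. k + 2) ` {..m}. real (m + 2 choose j) * p ^ j * ?q ^ (m + 2 - j))"
      by (subst sum.reindex) (auto simp: inj_on_def)
    also have "\<dots> \<le> (\<Sum>j\<le>m + 2. real (m + 2 choose j) * p ^ j * ?q ^ (m + 2 - j))"
      using p by (intro sum_mono2) auto
    also have "\<dots> = (p + ?q) ^ (m + 2)" by (rule binomial_ring[symmetric])
    finally show "(\<Sum>k\<le>m. real (m + 2 choose (k + 2)) * p ^ (k + 2) * ?q ^ (m - k)) \<le> 1" by simp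
  qed (use p in auto)
  finally show ?thesis by simp
qed

text \<open>By Bernoulli \<open>n * p\<close> is at most \<open>(1 + p) ^ n\<close>, and
  \<open>(1 - p) ^ n * (1 + p) ^ n\<close> is at most 1. The left-hand side is the probability that
  none of \<open>n\<close> sample points falls into a cell of mass \<open>p\<close>.\<close>

lemma power_one_minus_le:
  fixes p :: real
  assumes p: "0 < p" "p \<le> 1" and n: "n \<ge> 1"
  shows "(1 - p) ^ n \<le> 1 / (n * p)"
proof -
  have "(1 - p) ^ n * (n * p) \<le> (1 - p) ^ n * (1 + n * p)"
    using p by (intro mult_left_mono) auto
  also have "\<dots> \<le> (1 - p) ^ n * (1 + p) ^ n"
    using p Bernoulli_inequality[of p n] by (intro mult_left_mono) auto
  also have "\<dots> = (1 - p\<^sup>2) ^ n" by (simp add: power_mult_distrib[symmetric] algebra_simps power2_eq_square)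
  also have "\<dots> \<le> 1" using p by (intro power_le_one) (auto simp: power_le_one)
  finally show ?thesis using p n by (simp add: field_simps)
qed

section \<open>Averages of independent observations over a fixed cell\<close>

context prob_space
begin

definition cell_weight :: "'a set \<Rightarrow> 'b set \<Rightarrow> ('b \<Rightarrow> 'a) \<Rightarrow> real" where
  "cell_weight A I \<omega> = real (card {i \<in> I. \<omega> i \<in> A})"

lemma cell_weight_eq_sum: "finite I \<Longrightarrow> cell_weight A I \<omega> = (\<Sum>i\<in>I. indicator A (\<omega> i))"
  unfolding cell_weight_def by (simp add: indicator_def sum.If_cases Int_def)

lemma cell_weight_measurable:
  assumes "A \<in> events" "finite I"
  shows "cell_weight A I \<in> borel_measurable (PiM I (\<lambda>_. M))"
proof -
  have eq: "cell_weight A I = (\<lambda>\<omega>. \<Sum>i\<in>I. indicator A (\<omega> i))"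
    using cell_weight_eq_sum[OF assms(2)] by (intro ext)
  show ?thesis unfolding eq using assms by measurable
qed

lemma integrable_PiM_component:
  fixes f :: "'a \<Rightarrow> real"
  assumes "integrable M f" "i \<in> I" "finite I"
  shows "integrable (PiM I (\<lambda>_. M)) (\<lambda>\<omega>. f (\<omega> i))"
proof -
  interpret P: product_prob_space "\<lambda>_. M" I by standard
  have "distr (PiM I (\<lambda>_. M)) M (\<lambda>\<omega>. \<omega> i) = M" using P.PiM_component assms by metis
  then have "integrable (distr (PiM I (\<lambda>_. M)) M (\<lambda>\<omega>. \<omega> i)) f" using assms(1) by simp
  then show ?thesis using assms by (subst (asm) integrable_distr_eq) auto
qed

text \<open>The off-diagonal terms vanish because, given the other sample points, the denominator is
  constant on the event that sample point \<open>i\<close> lies in the cell.\<close>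

lemma cell_average_second_moment:
  fixes g :: "'a \<Rightarrow> real"
  assumes A: "A \<in> events" and p: "prob A > 0" and g: "g \<in> borel_measurable M" "integrable M (\<lambda>z. (g z)\<^sup>2)"
    and mean: "(\<integral>z. indicator A z * g z \<partial>M) = 0"
    and var: "(\<integral>z. indicator A z * (g z)\<^sup>2 \<partial>M) \<le> B * prob A"
    and I: "finite I" "I \<noteq> {}"
  shows "integrable (PiM I (\<lambda>_. M)) (\<lambda>\<omega>. ((\<Sum>i\<in>I. indicator A (\<omega> i) * g (\<omega> i)) / cell_weight A I \<omega>)\<^sup>2)"
    and "(\<integral>\<omega>. ((\<Sum>i\<in>I. indicator A (\<omega> i) * g (\<omega> i)) / cell_weight A I \<omega>)\<^sup>2 \<partial>(PiM I (\<lambda>_. M)))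
      \<le> 2 * B / (card I * prob A)"
proof -
  interpret P: product_prob_space "\<lambda>_. M" UNIV by standard
  let ?P = "\<lambda>I. PiM I (\<lambda>_::'b. M)" and ?p = "prob A"
  let ?T = "\<lambda>i \<omega>. indicator A (\<omega> i) * g (\<omega> i)"
  let ?W = "\<lambda>I \<omega>. cell_weight A I \<omega>"
  note [measurable] = A g(1) cell_weight_measurable[OF A I(1)]
  have sq: "((\<Sum>i\<in>I. ?T i \<omega>) / ?W I \<omega>)\<^sup>2 = (\<Sum>i\<in>I. \<Sum>j\<in>I. ?T i \<omega> * ?T j \<omega> / (?W I \<omega>)\<^sup>2)" for \<omega>
    by (simp add: power2_eq_square sum_product sum_divide_distrib)
  have W1: "?W I \<omega> \<ge> 1" if "i \<in> I" "\<omega> i \<in> A" for i \<omega>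
  proof -
    have "card {i} \<le> card {i \<in> I. \<omega> i \<in> A}" using I that by (intro card_mono) auto
    then show ?thesis by (simp add: cell_weight_def)
  qed
  have int: "integrable (?P I) (\<lambda>\<omega>. ?T i \<omega> * ?T j \<omega> / (?W I \<omega>)\<^sup>2)" if ij: "i \<in> I" "j \<in> I" for i j
  proof (rule Bochner_Integration.integrable_bound)
    show "integrable (?P I) (\<lambda>\<omega>. (g (\<omega> i))\<^sup>2 + (g (\<omega> j))\<^sup>2)"
      using ij I g by (intro Bochner_Integration.integrable_add integrable_PiM_component[of "\<lambda>z. (g z)\<^sup>2"]) auto
    show "(\<lambda>\<omega>. ?T i \<omega> * ?T j \<omega> / (?W I \<omega>)\<^sup>2) \<in> borel_measurable (?P I)"
      using ij by measurable
    show "AE \<omega> in ?P I. norm (?T i \<omega> * ?T j \<omega> / (?W I \<omega>)\<^sup>2) \<le> norm ((g (\<omega> i))\<^sup>2 + (g (\<omega> j))\<^sup>2)"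
    proof (rule AE_I2)
      fix \<omega>
      have gg: "\<bar>g (\<omega> i) * g (\<omega> j)\<bar> \<le> (g (\<omega> i))\<^sup>2 + (g (\<omega> j))\<^sup>2"
      proof -
        have "0 \<le> \<bar>g (\<omega> i)\<bar> * \<bar>g (\<omega> j)\<bar>" by simp
        then show ?thesis
          using sum_squares_bound[of "\<bar>g (\<omega> i)\<bar>" "\<bar>g (\<omega> j)\<bar>"] unfolding abs_mult power2_abs by linarith
      qed
      show "norm (?T i \<omega> * ?T j \<omega> / (?W I \<omega>)\<^sup>2) \<le> norm ((g (\<omega> i))\<^sup>2 + (g (\<omega> j))\<^sup>2)"
      proof (cases "\<omega> i \<in> A \<and> \<omega> j \<in> A")
        case True
        then have "(?W I \<omega>)\<^sup>2 \<ge> 1" using W1[OF ij(1)] by simp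
        then have "\<bar>g (\<omega> i) * g (\<omega> j)\<bar> / (?W I \<omega>)\<^sup>2 \<le> \<bar>g (\<omega> i) * g (\<omega> j)\<bar> / 1"
          by (intro divide_left_mono) auto
        then show ?thesis using True gg by (simp add: abs_mult)
      qed (auto simp: indicator_def)
    qed
  qed
  show "integrable (?P I) (\<lambda>\<omega>. ((\<Sum>i\<in>I. ?T i \<omega>) / ?W I \<omega>)\<^sup>2)"
    unfolding sq by (intro Bochner_Integration.integrable_sum int)
  have ins: "(\<integral>\<omega>. f \<omega> \<partial>(?P I)) = (\<integral>x. (\<integral>y. f (x(i := y)) \<partial>M) \<partial>(?P (I - {i})))"
    if "i \<in> I" "integrable (?P I) f" for i and f :: "('b \<Rightarrow> 'a) \<Rightarrow> real"
  proof -
    have "insert i (I - {i}) = I" using that by auto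
    then show ?thesis using P.product_integral_insert[of "I - {i}" i f] that I by simp
  qed
  \<comment> \<open>Once point \<open>i\<close> lies in \<open>A\<close>, the denominator depends on
    the other points only, and the summand 1 keeps it away from zero.\<close>
  have upd: "?W I (x(i := y)) = 1 + ?W (I - {i}) x" if "i \<in> I" "y \<in> A" for i x y
  proof -
    have "{k \<in> I. (x(i := y)) k \<in> A} = insert i {k \<in> I - {i}. x k \<in> A}" using that by auto
    then show ?thesis using I by (simp add: cell_weight_def)
  qed
  have off: "(\<integral>\<omega>. ?T i \<omega> * ?T j \<omega> / (?W I \<omega>)\<^sup>2 \<partial>(?P I)) = 0" if ij: "i \<in> I" "j \<in> I" "i \<noteq> j" for i j
  proof -
    have "(\<integral>y. ?T i (x(i := y)) * ?T j (x(i := y)) / (?W I (x(i := y)))\<^sup>2 \<partial>M) = 0" for x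
    proof -
      have "(\<integral>y. ?T i (x(i := y)) * ?T j (x(i := y)) / (?W I (x(i := y)))\<^sup>2 \<partial>M) =
          (\<integral>y. indicator A y * g y * (?T j x / (1 + ?W (I - {i}) x)\<^sup>2) \<partial>M)"
        using ij upd[OF ij(1), of _ x] by (intro Bochner_Integration.integral_cong refl) (auto simp: indicator_def)
      then show ?thesis by (simp add: mean)
    qed
    then show ?thesis unfolding ins[OF ij(1) int[OF ij(1,2)]] by simp
  qed
  have diag: "(\<integral>\<omega>. ?T i \<omega> * ?T i \<omega> / (?W I \<omega>)\<^sup>2 \<partial>(?P I)) \<le> B * ?p * (2 / (real (card I) * (real (card I) + 1) * ?p\<^sup>2))"
    if i: "i \<in> I" for i
  proof -
    have inner: "(\<integral>y. ?T i (x(i := y)) * ?T i (x(i := y)) / (?W I (x(i := y)))\<^sup>2 \<partial>M) =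
        (\<integral>z. indicator A z * (g z)\<^sup>2 \<partial>M) * (1 / (1 + ?W (I - {i}) x)\<^sup>2)" for x
    proof -
      have "(\<integral>y. ?T i (x(i := y)) * ?T i (x(i := y)) / (?W I (x(i := y)))\<^sup>2 \<partial>M) =
          (\<integral>y. indicator A y * (g y)\<^sup>2 * (1 / (1 + ?W (I - {i}) x)\<^sup>2) \<partial>M)"
        using upd[OF i, of _ x]
        by (intro Bochner_Integration.integral_cong refl) (auto simp: indicator_def power2_eq_square)
      then show ?thesis by simp
    qed
    have card: "card (I - {i}) = card I - 1" "card I \<ge> 1" using I i by (auto simp: Suc_le_eq card_gt_0_iff)
    \<comment> \<open>The binomial variable counts the remaining \<open>card I - 1\<close> points,
      so the shifts by 1 and 2 in the moment bound become \<open>card I\<close> and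
      \<open>card I + 1\<close>.\<close>
    have E: "(\<integral>x. 1 / (1 + ?W (I - {i}) x)\<^sup>2 \<partial>(?P (I - {i}))) \<le> 2 / (real (card I) * (real (card I) + 1) * ?p\<^sup>2)"
    proof -
      have "(\<integral>x. 1 / (1 + ?W (I - {i}) x)\<^sup>2 \<partial>(?P (I - {i}))) =
          (\<Sum>k\<le>card (I - {i}). real (card (I - {i}) choose k) * ?p ^ k * (1 - ?p) ^ (card (I - {i}) - k) * (1 / (real k + 1)\<^sup>2))"
        using PiM_count_expectation[OF A, of "I - {i}" "\<lambda>k. 1 / (real k + 1)\<^sup>2"] I
        by (simp add: cell_weight_def add.commute)
      also have "\<dots> \<le> 2 / ((real (card (I - {i})) + 1) * (real (card (I - {i})) + 2) * ?p\<^sup>2)"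
        using p by (intro binomial_inverse_square_moment) auto
      also have "\<dots> = 2 / (real (card I) * (real (card I) + 1) * ?p\<^sup>2)" using card by (simp add: of_nat_diff)
      finally show ?thesis .
    qed
    have "(\<integral>\<omega>. ?T i \<omega> * ?T i \<omega> / (?W I \<omega>)\<^sup>2 \<partial>(?P I)) =
        (\<integral>z. indicator A z * (g z)\<^sup>2 \<partial>M) * (\<integral>x. 1 / (1 + ?W (I - {i}) x)\<^sup>2 \<partial>(?P (I - {i})))"
      unfolding ins[OF i int[OF i i]] inner by (simp only: integral_mult_right_zero)
    also have "\<dots> \<le> (B * ?p) * (2 / (real (card I) * (real (card I) + 1) * ?p\<^sup>2))"
      by (intro mult_mono var E) (auto intro: order_trans[OF _ var])
    finally show ?thesis .
  qed
  have B: "B \<ge> 0"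
  proof -
    have "0 \<le> (\<integral>z. indicator A z * (g z)\<^sup>2 \<partial>M)" by (intro Bochner_Integration.integral_nonneg) auto
    then have "0 \<le> B * ?p" using var by linarith
    then show ?thesis using p by (simp add: zero_le_mult_iff)
  qed
  have "(\<integral>\<omega>. ((\<Sum>i\<in>I. ?T i \<omega>) / ?W I \<omega>)\<^sup>2 \<partial>(?P I)) = (\<Sum>i\<in>I. \<Sum>j\<in>I. (\<integral>\<omega>. ?T i \<omega> * ?T j \<omega> / (?W I \<omega>)\<^sup>2 \<partial>(?P I)))"
    unfolding sq using int by (simp add: Bochner_Integration.integral_sum)
  also have "\<dots> = (\<Sum>i\<in>I. (\<integral>\<omega>. ?T i \<omega> * ?T i \<omega> / (?W I \<omega>)\<^sup>2 \<partial>(?P I)))"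
  proof (intro sum.cong refl)
    fix i assume i: "i \<in> I"
    show "(\<Sum>j\<in>I. (\<integral>\<omega>. ?T i \<omega> * ?T j \<omega> / (?W I \<omega>)\<^sup>2 \<partial>(?P I))) = (\<integral>\<omega>. ?T i \<omega> * ?T i \<omega> / (?W I \<omega>)\<^sup>2 \<partial>(?P I))"
    proof -
      have "(\<Sum>j\<in>I - {i}. (\<integral>\<omega>. ?T i \<omega> * ?T j \<omega> / (?W I \<omega>)\<^sup>2 \<partial>(?P I))) = 0"
        by (rule sum.neutral) (use off[OF i] in auto)
      then show ?thesis by (simp only: sum.remove[OF I(1) i] add_0_right)
    qed
  qed
  also have "\<dots> \<le> (\<Sum>i\<in>I. B * ?p * (2 / (real (card I) * (real (card I) + 1) * ?p\<^sup>2)))" by (intro sum_mono diag)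
  also have "\<dots> = 2 * B / ((real (card I) + 1) * ?p)"
  proof -
    have "N * (B * ?p * (2 / (N * N1 * ?p\<^sup>2))) = 2 * B / (N1 * ?p)" if "N \<noteq> 0" for N N1 :: real
      using that p by (simp add: power2_eq_square)
    then show ?thesis unfolding sum_constant by this (use I in \<open>simp add: card_eq_0_iff\<close>)
  qed
  also have "\<dots> \<le> 2 * B / (card I * ?p)"
    using I p B by (intro divide_left_mono mult_right_mono mult_pos_pos) (auto simp: card_gt_0_iff)
  finally show "(\<integral>\<omega>. ((\<Sum>i\<in>I. ?T i \<omega>) / ?W I \<omega>)\<^sup>2 \<partial>(?P I)) \<le> 2 * B / (card I * ?p)" .
qed

text \<open>Centring at the conditional mean \<open>c\<close> of \<open>Y\<close> on
  \<open>A\<close> reduces the error to \<open>cell_average_second_moment\<close>, except when the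
  cell is empty. In that event the quotient is 0 by convention, the squared error is at most
  \<open>L\<^sup>2\<close>, and \<open>power_one_minus_le\<close> bounds the probability.\<close>

lemma cell_average_error:
  fixes Y :: "'a \<Rightarrow> real"
  assumes A: "A \<in> events" and p: "prob A > 0" and Y: "Y \<in> borel_measurable M" "integrable M (\<lambda>z. (Y z)\<^sup>2)"
    and mean: "(\<integral>z. indicator A z * Y z \<partial>M) = c * prob A" and c: "\<bar>c\<bar> \<le> L"
    and var: "(\<integral>z. indicator A z * (Y z - c)\<^sup>2 \<partial>M) \<le> B * prob A"
    and I: "finite I" "I \<noteq> {}"
  shows "(\<integral>\<^sup>+\<omega>. ennreal (((\<Sum>i\<in>I. indicator A (\<omega> i) * Y (\<omega> i)) / cell_weight A I \<omega> - c)\<^sup>2) \<partial>(PiM I (\<lambda>_. M)))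
    \<le> ennreal ((2 * B + L\<^sup>2) / (card I * prob A))"
proof -
  let ?P = "PiM I (\<lambda>_. M)" and ?p = "prob A" and ?W = "cell_weight A I"
  interpret P: prob_space ?P by (rule prob_space_PiM) (rule prob_space_axioms)
  note [measurable] = A Y(1) cell_weight_measurable[OF A I(1)]
  have Yint: "integrable M Y"
  proof (rule Bochner_Integration.integrable_bound[of _ "\<lambda>z. 1 + (Y z)\<^sup>2"])
    show "AE z in M. norm (Y z) \<le> norm (1 + (Y z)\<^sup>2)"
    proof (rule AE_I2)
      fix z
      have "0 \<le> (\<bar>Y z\<bar> - 1)\<^sup>2" by simp
      then have "2 * \<bar>Y z\<bar> \<le> 1 + (Y z)\<^sup>2" by (simp add: power2_diff)
      then show "norm (Y z) \<le> norm (1 + (Y z)\<^sup>2)" by simp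
    qed
  qed (use Y in auto)
  let ?g = "\<lambda>z. Y z - c"
  have g: "?g \<in> borel_measurable M" "integrable M (\<lambda>z. (?g z)\<^sup>2)"
    using Y Yint by (auto simp: power2_diff)
  have iA: "integrable M (\<lambda>z. indicator A z * Y z)"
    using Yint A by (intro Bochner_Integration.integrable_bound[OF Yint]) (auto simp: indicator_def)
  have "(\<integral>z. indicator A z * ?g z \<partial>M) = (\<integral>z. indicator A z * Y z - c * indicator A z \<partial>M)"
    by (intro Bochner_Integration.integral_cong refl) (simp add: algebra_simps)
  also have "\<dots> = (\<integral>z. indicator A z * Y z \<partial>M) - (\<integral>z. c * indicator A z \<partial>M)"
    using A by (intro Bochner_Integration.integral_diff iA integrable_mult_right integrable_real_indicator)
      (simp_all add: less_top[symmetric])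
  also have "\<dots> = 0" using A mean by simp
  finally have gmean: "(\<integral>z. indicator A z * ?g z \<partial>M) = 0" .
  note m = cell_average_second_moment[OF A p g gmean var I]
  define F where "F = (\<lambda>\<omega>. ((\<Sum>i\<in>I. indicator A (\<omega> i) * ?g (\<omega> i)) / ?W \<omega>)\<^sup>2)"
  \<comment> \<open>The contribution of the empty cell, kept apart from the centred average
    \<open>F\<close>.\<close>
  define G where "G = (\<lambda>\<omega>::'b \<Rightarrow> 'a. L\<^sup>2 * (if card {i \<in> I. \<omega> i \<in> A} = 0 then 1 else 0))"
  have Fi: "integrable ?P F" unfolding F_def by (rule m(1))
  have Geq: "G = (\<lambda>\<omega>. L\<^sup>2 * (if ?W \<omega> = 0 then 1 else 0))" by (auto simp: G_def cell_weight_def)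
  have "G \<in> borel_measurable ?P" unfolding Geq by measurable
  then have Gi: "integrable ?P G"
    by (intro P.integrable_const_bound[of _ "L\<^sup>2"] AE_I2) (auto simp: G_def)
  have pt: "((\<Sum>i\<in>I. indicator A (\<omega> i) * Y (\<omega> i)) / ?W \<omega> - c)\<^sup>2 \<le> F \<omega> + G \<omega>" for \<omega>
  proof (cases "?W \<omega> = 0")
    case True
    have "c\<^sup>2 \<le> L\<^sup>2" using c by (simp add: abs_le_square_iff[symmetric])
    then show ?thesis using True by (simp add: F_def G_def cell_weight_def)
  next
    case False
    have "(\<Sum>i\<in>I. indicator A (\<omega> i) * ?g (\<omega> i)) = (\<Sum>i\<in>I. indicator A (\<omega> i) * Y (\<omega> i)) - c * ?W \<omega>"
      unfolding cell_weight_eq_sum[OF I(1)] sum_distrib_left sum_subtractf[symmetric]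
      by (intro sum.cong refl) (simp add: algebra_simps)
    then have "F \<omega> = ((\<Sum>i\<in>I. indicator A (\<omega> i) * Y (\<omega> i)) / ?W \<omega> - c)\<^sup>2"
      using False by (simp add: F_def diff_divide_distrib)
    then show ?thesis by (simp add: G_def)
  qed
  have "(\<integral>\<^sup>+\<omega>. ennreal (((\<Sum>i\<in>I. indicator A (\<omega> i) * Y (\<omega> i)) / ?W \<omega> - c)\<^sup>2) \<partial>?P)
      \<le> (\<integral>\<^sup>+\<omega>. ennreal (F \<omega> + G \<omega>) \<partial>?P)"
    by (intro nn_integral_mono ennreal_leI pt)
  also have "\<dots> = ennreal (\<integral>\<omega>. F \<omega> + G \<omega> \<partial>?P)"
    using Fi Gi by (intro nn_integral_eq_integral) (auto simp: F_def G_def)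
  also have "(\<integral>\<omega>. F \<omega> + G \<omega> \<partial>?P) = (\<integral>\<omega>. F \<omega> \<partial>?P) + (\<integral>\<omega>. G \<omega> \<partial>?P)" using Fi Gi by simp
  also have "\<dots> \<le> 2 * B / (card I * ?p) + L\<^sup>2 / (card I * ?p)"
  proof (intro add_mono)
    show "(\<integral>\<omega>. F \<omega> \<partial>?P) \<le> 2 * B / (card I * ?p)" unfolding F_def by (rule m(2))
    have "(\<integral>\<omega>. G \<omega> \<partial>?P) = L\<^sup>2 * (1 - ?p) ^ card I"
    proof -
      have "(\<integral>\<omega>. (if card {i \<in> I. \<omega> i \<in> A} = 0 then 1 else 0) \<partial>?P) =
        (\<Sum>k\<le>card I. real (card I choose k) * ?p ^ k * (1 - ?p) ^ (card I - k) * (if k = 0 then 1 else 0))"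
        by (rule PiM_count_expectation[OF A I(1), of "\<lambda>k. if k = 0 then 1 else 0"])
      also have "\<dots> = (\<Sum>k\<in>{0}. real (card I choose k) * ?p ^ k * (1 - ?p) ^ (card I - k) * (if k = 0 then 1 else 0))"
        by (intro sum.mono_neutral_right) auto
      finally show ?thesis by (simp add: G_def)
    qed
    also have "\<dots> \<le> L\<^sup>2 * (1 / (card I * ?p))"
      using p I by (intro mult_left_mono power_one_minus_le) (auto simp: Suc_le_eq card_gt_0_iff)
    finally show "(\<integral>\<omega>. G \<omega> \<partial>?P) \<le> L\<^sup>2 / (card I * ?p)" by simp
  qed
  also have "\<dots> = (2 * B + L\<^sup>2) / (card I * ?p)" by (simp add: add_divide_distrib)
  finally show ?thesis by (simp add: ennreal_leI)
qed

end

subsection \<open>The expected number of cells\<close>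

lemma same_cell_sets [measurable]:
  fixes x :: "real ^ 'n"
  assumes "h \<in> hyperplane_configs"
  shows "{y. same_cell h x y} \<in> sets borel" "{x. same_cell h x x} \<in> sets borel"
proof -
  have h: "h \<in> space void_space" using assms by simp
  have "(\<lambda>y. (x, y, h)) \<in> borel \<rightarrow>\<^sub>M borel \<Otimes>\<^sub>M borel \<Otimes>\<^sub>M void_space"
    using h by (intro measurable_Pair measurable_const measurable_ident) simp_all
  from measurable_compose[OF this measurable_same_cell]
  show "{y. same_cell h x y} \<in> sets borel" by (simp add: pred_def)
  have "(\<lambda>y. (y, y, h)) \<in> borel \<rightarrow>\<^sub>M borel \<Otimes>\<^sub>M borel \<Otimes>\<^sub>M void_space"
    using h by (intro measurable_Pair measurable_const measurable_ident) simp_all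
  from measurable_compose[OF this measurable_same_cell]
  show "{x. same_cell h x x} \<in> sets borel" by (simp add: pred_def)
qed

lemma same_cell_pair_measurable [measurable]:
  "Measurable.pred (borel \<Otimes>\<^sub>M void_space) (\<lambda>p. same_cell (snd p) (fst p :: real ^ 'n) (fst p))"
proof -
  have "(\<lambda>p :: (real ^ 'n) \<times> (real ^ 'n) set set. (fst p, fst p, snd p)) \<in> borel \<Otimes>\<^sub>M void_space \<rightarrow>\<^sub>M borel \<Otimes>\<^sub>M borel \<Otimes>\<^sub>M void_space"
    by measurable
  from measurable_compose[OF this measurable_same_cell] show ?thesis by (simp only: prod.case)
qed

text \<open>Kept in \<open>ennreal\<close> so that the inverse of a zero mass is \<open>top\<close>;
  bounds by the inverse cell mass then hold trivially on null cells.\<close>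

definition cell_mass :: "(real ^ 'n) measure \<Rightarrow> (real ^ 'n) set set \<Rightarrow> real ^ 'n \<Rightarrow> ennreal" where
  "cell_mass \<mu> h x = emeasure \<mu> {y. same_cell h x y}"

lemma same_cell_triple_measurable:
  "Measurable.pred ((borel \<Otimes>\<^sub>M void_space) \<Otimes>\<^sub>M borel) (\<lambda>p. same_cell (snd (fst p)) (fst (fst p) :: real ^ 'n) (snd p))"
proof -
  have "(\<lambda>p :: ((real ^ 'n) \<times> (real ^ 'n) set set) \<times> (real ^ 'n). (fst (fst p), snd p, snd (fst p))) \<in>
      (borel \<Otimes>\<^sub>M void_space) \<Otimes>\<^sub>M borel \<rightarrow>\<^sub>M borel \<Otimes>\<^sub>M borel \<Otimes>\<^sub>M void_space"
    by measurable
  from measurable_compose[OF this measurable_same_cell] show ?thesis by simp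
qed

lemma cell_mass_measurable:
  fixes \<mu> :: "(real ^ 'n) measure"
  assumes \<mu>: "sigma_finite_measure \<mu>" "sets \<mu> = sets borel"
  shows "(\<lambda>p. cell_mass \<mu> (snd p) (fst p)) \<in> borel_measurable (borel \<Otimes>\<^sub>M void_space)"
proof -
  interpret sigma_finite_measure \<mu> by fact
  let ?N = "borel \<Otimes>\<^sub>M void_space :: ((real ^ 'n) \<times> (real ^ 'n) set set) measure"
  have s: "sets (?N \<Otimes>\<^sub>M \<mu>) = sets (?N \<Otimes>\<^sub>M borel)" by (intro sets_pair_measure_cong \<mu> refl)
  have "Measurable.pred (?N \<Otimes>\<^sub>M \<mu>) (\<lambda>p. same_cell (snd (fst p)) (fst (fst p)) (snd p))"
    using same_cell_triple_measurable unfolding measurable_cong_sets[OF s refl] .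
  then have "{p \<in> space (?N \<Otimes>\<^sub>M \<mu>). same_cell (snd (fst p)) (fst (fst p)) (snd p)} \<in> sets (?N \<Otimes>\<^sub>M \<mu>)"
    by (simp only: pred_def)
  from measurable_emeasure_Pair[OF this]
  have "(\<lambda>x. emeasure \<mu> (Pair x -` {p \<in> space (?N \<Otimes>\<^sub>M \<mu>). same_cell (snd (fst p)) (fst (fst p)) (snd p)})) \<in> borel_measurable ?N" .
  moreover have "Pair x -` {p \<in> space (?N \<Otimes>\<^sub>M \<mu>). same_cell (snd (fst p)) (fst (fst p)) (snd p)} = {y. same_cell (snd x) (fst x) y}"
    if "x \<in> space ?N" for x
    using that sets_eq_imp_space_eq[OF \<mu>(2)] by (auto simp: space_pair_measure)
  ultimately show ?thesis unfolding cell_mass_def by (subst measurable_cong[where g="\<lambda>x. emeasure \<mu> (Pair x -` {p \<in> space (?N \<Otimes>\<^sub>M \<mu>). same_cell (snd (fst p)) (fst (fst p)) (snd p)})"]) simp_all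
qed

text \<open>A hyperplane that misses the ball misses the segment by convexity. One that hits the
  ball has both end points strictly on the same side, strictness being the content of the two
  reflexive hypotheses.\<close>

lemma same_cell_of_equal_sides:
  fixes x y c :: "real ^ 'n"
  assumes x: "x \<in> cball c r" "same_cell h x x" and y: "y \<in> cball c r" "same_cell h y y"
    and rep: "\<And>E. E \<in> h \<Longrightarrow> E = hyperplane (u E) (t E)"
    and eq: "\<And>E. E \<in> h \<Longrightarrow> E \<inter> cball c r \<noteq> {} \<Longrightarrow> x \<bullet> u E > t E \<longleftrightarrow> y \<bullet> u E > t E"
  shows "same_cell h x y"
  unfolding same_cell_def
proof (intro ballI equals0I)
  fix E p assume E: "E \<in> h" and p: "p \<in> E \<inter> closed_segment x y"
  have "closed_segment x y \<subseteq> cball c r" using x y by (intro closed_segment_subset) auto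
  then have hit: "E \<inter> cball c r \<noteq> {}" using p by auto
  obtain s where s: "0 \<le> s" "s \<le> 1" "p = (1 - s) *\<^sub>R x + s *\<^sub>R y"
    using p by (auto simp: in_segment)
  have "p \<bullet> u E = t E" using p rep[OF E] by (auto simp: hyperplane_def)
  then have t: "(1 - s) * (x \<bullet> u E) + s * (y \<bullet> u E) = t E" using s by (simp add: inner_add_left)
  have "x \<notin> E" "y \<notin> E" using E x y by (auto simp: same_cell_def)
  then have ne: "x \<bullet> u E \<noteq> t E" "y \<bullet> u E \<noteq> t E" using rep[OF E] by (auto simp: hyperplane_def)
  show False
  proof (cases "x \<bullet> u E > t E")
    case True
    then have "y \<bullet> u E > t E" using eq[OF E hit] by simp
    then have "(1 - s) * (- (x \<bullet> u E)) + s * (- (y \<bullet> u E)) < - t E"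
      using True s by (intro convex_bound_lt) auto
    then show False using t by simp
  next
    case False
    then have "x \<bullet> u E < t E" "y \<bullet> u E < t E" using eq[OF E hit] ne by auto
    then have "(1 - s) * (x \<bullet> u E) + s * (y \<bullet> u E) < t E" using s by (intro convex_bound_lt) auto
    then show False using t by simp
  qed
qed

lemma inverse_ennreal_antimono: "a \<le> b \<Longrightarrow> inverse b \<le> inverse (a :: ennreal)"
proof (cases "a = 0 \<or> b = top")
  case False
  assume ab: "a \<le> b"
  with False have "a \<noteq> top" by (auto simp: top_unique)
  then obtain x y where xy: "a = ennreal x" "0 \<le> x" "b = ennreal y" "0 \<le> y"
    using False by (cases a; cases b) auto
  then have "0 < x" "x \<le> y" using False ab by (auto simp: less_le ennreal_le_iff)
  then show ?thesis unfolding xy by (simp add: inverse_ennreal ennreal_leI le_imp_inverse_le)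
qed auto

text \<open>Sign patterns with respect to the hyperplanes that hit the ball cut it into at most 2^k
  pieces. The cell of a generic point contains almost all of the piece of that point, so the inverse
  cell mass is at most the inverse mass of the piece, and this integrates to at most 1 over the
  piece.\<close>

lemma integral_inverse_cell_mass_ball:
  fixes c :: "real ^ 'n"
  assumes h: "h \<in> hyperplane_configs" and \<mu>: "finite_measure \<mu>" "sets \<mu> = sets borel"
    and good: "AE x in \<mu>. same_cell h x x"
  shows "(\<integral>\<^sup>+ x. indicator (cball c r) x * inverse (cell_mass \<mu> h x) \<partial>\<mu>)
    \<le> ennreal (2 ^ card {E \<in> h. E \<inter> cball c r \<noteq> {}})"
proof -
  interpret finite_measure \<mu> by fact
  let ?F = "{E \<in> h. E \<inter> cball c r \<noteq> {}}"
  have fin: "finite ?F" using h by (simp add: hyperplane_configs_def)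
  have "\<forall>E\<in>h. \<exists>u t. E = hyperplane u t"
    using hyperplane_config_hyperplanes[OF h] unfolding hyperplanes_def by blast
  then obtain u t where rep: "\<And>E. E \<in> h \<Longrightarrow> E = hyperplane (u E) (t E)" by metis
  \<comment> \<open>The piece with sign pattern \<open>s\<close>, the set of hyperplanes having the
    point on their positive side.\<close>
  define Q where "Q s = {x \<in> cball c r. \<forall>E\<in>?F. x \<bullet> u E > t E \<longleftrightarrow> E \<in> s}" for s
  have Qm [measurable]: "Q s \<in> sets borel" for s
  proof -
    have eq: "Q s = cball c r \<inter> (\<Inter>E\<in>?F. if E \<in> s then {x. x \<bullet> u E > t E} else {x. \<not> x \<bullet> u E > t E}) "
      unfolding Q_def by auto
    have "(if E \<in> s then {x. x \<bullet> u E > t E} else {x. \<not> x \<bullet> u E > t E}) \<in> sets borel" for E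
    proof -
      have "{x. x \<bullet> u E > t E} \<in> sets borel" "{x. \<not> x \<bullet> u E > t E} \<in> sets borel" by measurable
      then show ?thesis by simp
    qed
    note m = this
    show ?thesis
    proof (cases "?F = {}")
      case True
      then have "Q s = cball c r" unfolding Q_def by blast
      then show ?thesis by simp
    next
      case False
      show ?thesis unfolding eq by (intro sets.Int sets.finite_INT fin False m) simp
    qed
  qed
  have Qm': "Q s \<in> sets \<mu>" for s using Qm \<mu>(2) by simp
  have mass: "emeasure \<mu> (Q s) \<le> cell_mass \<mu> h x" if x: "x \<in> Q s" "same_cell h x x" for x s
  proof -
    have "emeasure \<mu> (Q s) \<le> emeasure \<mu> {y. same_cell h x y}"
    proof (rule emeasure_mono_AE)
      show "{y. same_cell h x y} \<in> sets \<mu>" using same_cell_sets[OF h] \<mu>(2) by simp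
      show "AE y in \<mu>. y \<in> Q s \<longrightarrow> y \<in> {y. same_cell h x y}"
        using good
      proof eventually_elim
        case (elim y)
        show ?case
        proof
          assume y: "y \<in> Q s"
          have "same_cell h x y"
            by (rule same_cell_of_equal_sides[where u=u and t=t and c=c and r=r])
              (use x y elim rep in \<open>auto simp: Q_def\<close>)
          then show "y \<in> {y. same_cell h x y}" by simp
        qed
      qed
    qed
    then show ?thesis by (simp add: cell_mass_def)
  qed
  have "(\<integral>\<^sup>+ x. indicator (cball c r) x * inverse (cell_mass \<mu> h x) \<partial>\<mu>)
      \<le> (\<integral>\<^sup>+ x. (\<Sum>s\<in>Pow ?F. indicator (Q s) x * inverse (emeasure \<mu> (Q s))) \<partial>\<mu>)"
  proof (rule nn_integral_mono_AE)
    show "AE x in \<mu>. indicator (cball c r) x * inverse (cell_mass \<mu> h x) \<le>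
        (\<Sum>s\<in>Pow ?F. indicator (Q s) x * inverse (emeasure \<mu> (Q s)))"
      using good
    proof eventually_elim
      case (elim x)
      show ?case
      proof (cases "x \<in> cball c r")
        case True
        define s where "s = {E \<in> ?F. x \<bullet> u E > t E}"
        have xs: "x \<in> Q s" "s \<in> Pow ?F" using True by (auto simp: Q_def s_def)
        have "inverse (cell_mass \<mu> h x) \<le> inverse (emeasure \<mu> (Q s))"
          using mass[OF xs(1) elim] by (rule inverse_ennreal_antimono)
        also have "\<dots> = indicator (Q s) x * inverse (emeasure \<mu> (Q s))" using xs by simp
        also have "\<dots> \<le> (\<Sum>s\<in>Pow ?F. indicator (Q s) x * inverse (emeasure \<mu> (Q s)))"
          using fin xs(2) by (intro member_le_sum) auto
        finally show ?thesis using True by simp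
      qed simp
    qed
  qed
  also have "\<dots> = (\<Sum>s\<in>Pow ?F. emeasure \<mu> (Q s) * inverse (emeasure \<mu> (Q s)))"
    using Qm' by (simp add: nn_integral_sum nn_integral_multc)
  also have "\<dots> \<le> (\<Sum>s\<in>Pow ?F. 1)"
  proof (intro sum_mono)
    fix s
    \<comment> \<open>On a piece of mass zero the product is zero times \<open>top\<close>, which is
      0 in \<open>ennreal\<close>.\<close>
    define m where "m = measure \<mu> (Q s)"
    have "ennreal m * inverse (ennreal m) \<le> 1"
    proof (cases "m = 0")
      case False
      then have "m > 0" using measure_nonneg[of \<mu> "Q s"] unfolding m_def by linarith
      then show ?thesis by (simp add: inverse_ennreal ennreal_mult'[symmetric])
    qed simp
    then show "emeasure \<mu> (Q s) * inverse (emeasure \<mu> (Q s)) \<le> 1"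
      unfolding emeasure_eq_measure m_def .
  qed
  also have "\<dots> = of_nat (2 ^ card ?F)" using fin by (simp add: card_Pow)
  also have "\<dots> = ennreal (2 ^ card ?F)" by (simp add: ennreal_power[symmetric])
  finally show ?thesis .
qed

section \<open>Covering a ball of the subspace, and the count of cells\<close>

lemma orthonormal_expansion:
  fixes B :: "(real ^ 'n) set"
  assumes B: "pairwise orthogonal B" "\<And>b. b \<in> B \<Longrightarrow> norm b = 1" and x: "x \<in> span B"
  shows "(\<Sum>b\<in>B. (x \<bullet> b) *\<^sub>R b) = x"
proof -
  let ?y = "\<Sum>b\<in>B. (x \<bullet> b) *\<^sub>R b"
  have "(\<Sum>b\<in>B. (b \<bullet> x / (b \<bullet> b)) *\<^sub>R b) = ?y"
    using B(2) by (intro sum.cong refl) (simp add: dot_square_norm inner_commute)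
  then have orth: "orthogonal z (x - ?y)" if "z \<in> span B" for z
    using Gram_Schmidt_step[OF B(1) that, of x] by simp
  have "?y \<in> span B" by (intro span_sum span_scale span_base)
  then have "x - ?y \<in> span B" using x by (rule span_diff[rotated])
  then have "x - ?y = 0" using orth orthogonal_self by blast
  then show ?thesis by simp
qed

text \<open>The centres form a grid of mesh \<open>e\<close> in orthonormal coordinates of
  \<open>S\<close>: rounding down changes each of the \<open>d\<close> coordinates by at most
  \<open>e\<close>, and the point by at most \<open>d * e\<close>.\<close>

lemma subspace_ball_covering:
  fixes S :: "(real ^ 'n) set"
  assumes S: "subspace S" "dim S = d" and R: "R \<ge> 0"
  shows "\<exists>C>0. \<forall>r. 0 < r \<and> r \<le> 1 \<longrightarrow>
    (\<exists>P. finite P \<and> real (card P) \<le> C * (1 / r) ^ d \<and> S \<inter> cball 0 R \<subseteq> (\<Union>c\<in>P. cball c r))"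
proof -
  obtain B where B: "B \<subseteq> S" "pairwise orthogonal B" "\<And>b. b \<in> B \<Longrightarrow> norm b = 1"
    "independent B" "card B = dim S" "span B = S"
    using orthonormal_basis_subspace[OF S(1)] by metis
  have finB: "finite B" using B(4) by (rule independent_imp_finite)
  \<comment> \<open>The 5 comes from \<open>2 * m + 1\<close> with \<open>m\<close> at most
    \<open>R / e + 2\<close>; it is absorbed because \<open>1 / r\<close> is at least 1.\<close>
  define C where "C = (2 * R * (real d + 1) + 5) ^ d"
  have C: "C > 0" using R unfolding C_def by (intro zero_less_power) (simp add: add_nonneg_pos)
  show ?thesis
  proof (intro exI[of _ C] conjI C allI impI)
    fix r :: real assume r: "0 < r \<and> r \<le> 1"
    \<comment> \<open>Dividing by \<open>d + 1\<close> rather than by \<open>d\<close> covers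
      dimension zero as well.\<close>
    define e where "e = r / (real d + 1)"
    have e: "e > 0" "real d * e \<le> r" using r by (auto simp: e_def field_simps)
    define m where "m = \<lceil>R / e\<rceil> + 1"
    define pt where "pt k = (\<Sum>b\<in>B. (e * real_of_int (k b)) *\<^sub>R b)" for k
    define P where "P = pt ` (B \<rightarrow>\<^sub>E {-m..m})"
    have finP: "finite P" unfolding P_def using finB by (intro finite_imageI finite_PiE) auto
    have m0: "0 \<le> m" using R e by (simp add: m_def) (smt (verit) ceiling_mono ceiling_zero divide_nonneg_nonneg)
    have "real (card P) \<le> real (card (B \<rightarrow>\<^sub>E {-m..m}))"
      unfolding P_def using finB by (intro of_nat_mono card_image_le finite_PiE) auto
    also have "\<dots> = real_of_int (2 * m + 1) ^ d"
      using finB B(5) S(2) m0 by (simp add: card_PiE)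
    also have "\<dots> \<le> ((2 * R * (real d + 1) + 5) * (1 / r)) ^ d"
    proof (intro power_mono)
      have "real_of_int m \<le> R / e + 2" unfolding m_def by linarith
      then have "real_of_int (2 * m + 1) \<le> 2 * (R / e) + 5" by simp
      also have "\<dots> \<le> 2 * (R / e) + 5 * (1 / r)" using r by (simp add: field_simps)
      also have "\<dots> = (2 * R * (real d + 1) + 5) * (1 / r)" using r by (simp add: e_def add_divide_distrib distrib_right)
      finally show "real_of_int (2 * m + 1) \<le> (2 * R * (real d + 1) + 5) * (1 / r)" .
    qed (use m0 in auto)
    also have "\<dots> = C * (1 / r) ^ d" by (simp only: C_def power_mult_distrib)
    finally have card: "real (card P) \<le> C * (1 / r) ^ d" .
    have "S \<inter> cball 0 R \<subseteq> (\<Union>c\<in>P. cball c r)"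
    proof
      fix x assume x: "x \<in> S \<inter> cball 0 R"
      define k where "k = (\<lambda>b\<in>B. \<lfloor>(x \<bullet> b) / e\<rfloor>)"
      have "\<bar>x \<bullet> b\<bar> \<le> R" if "b \<in> B" for b
        using Cauchy_Schwarz_ineq2[of x b] B(3)[OF that] x by simp
      then have "\<bar>(x \<bullet> b) / e\<bar> \<le> R / e" if "b \<in> B" for b
        using that e by (simp add: divide_right_mono)
      then have "k b \<in> {-m..m}" if "b \<in> B" for b
      proof -
        have "\<bar>(x \<bullet> b) / e\<bar> \<le> R / e" using \<open>b \<in> B\<close> \<open>\<And>b. b \<in> B \<Longrightarrow> \<bar>(x \<bullet> b) / e\<bar> \<le> R / e\<close> by blast
        then have "- (R / e) \<le> (x \<bullet> b) / e" "(x \<bullet> b) / e \<le> R / e" by linarith+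
        then show ?thesis using that unfolding k_def m_def by simp linarith
      qed
      then have "k \<in> B \<rightarrow>\<^sub>E {-m..m}" by (auto simp: k_def)
      then have kP: "pt k \<in> P" by (simp add: P_def)
      have xB: "x = (\<Sum>b\<in>B. (x \<bullet> b) *\<^sub>R b)"
        using orthonormal_expansion[OF B(2,3), of x] x B(6) by simp
      have "norm (x - pt k) = norm (\<Sum>b\<in>B. (x \<bullet> b - e * real_of_int (k b)) *\<^sub>R b)"
        by (subst xB) (simp add: pt_def sum_subtractf scaleR_diff_left)
      also have "\<dots> \<le> (\<Sum>b\<in>B. e)"
      proof (rule sum_norm_le)
        fix b assume b: "b \<in> B"
        define q where "q = (x \<bullet> b) / e"
        have "x \<bullet> b = e * q" using e by (simp add: q_def)
        moreover have "\<bar>q - of_int \<lfloor>q\<rfloor>\<bar> \<le> 1" by linarith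
        ultimately have "\<bar>x \<bullet> b - e * of_int \<lfloor>q\<rfloor>\<bar> \<le> e"
          using e by (simp add: right_diff_distrib[symmetric] abs_mult)
        then show "norm ((x \<bullet> b - e * real_of_int (k b)) *\<^sub>R b) \<le> e"
          using b B(3)[OF b] by (simp add: k_def q_def)
      qed
      also have "\<dots> \<le> r" using e B(5) S(2) by simp
      finally have "x \<in> cball (pt k) r" by (simp add: dist_norm norm_minus_commute)
      with kP show "x \<in> (\<Union>c\<in>P. cball c r)" by blast
    qed
    with finP card show "\<exists>P. finite P \<and> real (card P) \<le> C * (1 / r) ^ d \<and> S \<inter> cball 0 R \<subseteq> (\<Union>c\<in>P. cball c r)"
      by blast
  qed
qed


definition hitting :: "real ^ 'n \<Rightarrow> real \<Rightarrow> (real ^ 'n) set set" where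
  "hitting c r = {E \<in> hyperplanes. E \<inter> cball c r \<noteq> {}}"

lemma window_hitting:
  fixes c :: "real ^ 'n"
  shows "window (hitting c r)"
proof -
  have iff: "hyperplane u t \<inter> cball c r \<noteq> {} \<longleftrightarrow> \<bar>c \<bullet> u - t\<bar> \<le> r" if u: "norm u = 1" for u t
  proof
    assume "hyperplane u t \<inter> cball c r \<noteq> {}"
    then obtain p where "p \<in> hyperplane u t" and p: "dist c p \<le> r" by auto
    then have pt: "p \<bullet> u = t" by (simp add: hyperplane_def)
    have "\<bar>c \<bullet> u - t\<bar> = \<bar>(c - p) \<bullet> u\<bar>" using pt by (simp add: inner_diff_left)
    also have "\<dots> \<le> norm (c - p) * norm u" by (rule Cauchy_Schwarz_ineq2)
    finally show "\<bar>c \<bullet> u - t\<bar> \<le> r" using p u by (simp add: dist_norm)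
  next
    assume *: "\<bar>c \<bullet> u - t\<bar> \<le> r"
    let ?p = "c + (t - c \<bullet> u) *\<^sub>R u"
    have "?p \<in> hyperplane u t"
      using u by (simp add: hyperplane_def inner_add_left dot_square_norm)
    moreover have "?p \<in> cball c r" using * u by (simp add: dist_norm abs_minus_commute)
    ultimately show "hyperplane u t \<inter> cball c r \<noteq> {}" by blast
  qed
  have eq: "hitting c r = {hyperplane u t |u t. norm u = 1 \<and> \<bar>c \<bullet> u - t\<bar> \<le> r}"
  proof (intro set_eqI iffI)
    fix E assume "E \<in> hitting c r"
    then obtain u t where "E = hyperplane u t" "norm u = 1" "E \<inter> cball c r \<noteq> {}"
      by (auto simp: hitting_def hyperplanes_def)
    with iff[of u t] show "E \<in> {hyperplane u t |u t. norm u = 1 \<and> \<bar>c \<bullet> u - t\<bar> \<le> r}" by blast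
  next
    fix E assume "E \<in> {hyperplane u t |u t. norm u = 1 \<and> \<bar>c \<bullet> u - t\<bar> \<le> r}"
    then obtain u t where "E = hyperplane u t" "norm u = 1" "\<bar>c \<bullet> u - t\<bar> \<le> r" by blast
    with iff[of u t] show "E \<in> hitting c r" by (auto simp: hitting_def hyperplanes_def)
  qed
  have "hitting c r \<in> sets hyperplane_space"
    unfolding eq by (rule hyperplane_family_measurable) measurable
  moreover have "E \<inter> cball 0 (norm c + r) \<noteq> {}" if E: "E \<in> hitting c r" for E
  proof -
    obtain p where p: "p \<in> E" "dist c p \<le> r" using E by (auto simp: hitting_def)
    have "norm p \<le> norm c + r" using norm_triangle_ineq2[of p c] p by (simp add: dist_norm norm_minus_commute)
    then show ?thesis using p by auto
  qed
  ultimately show ?thesis unfolding window_def by meson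
qed

text \<open>Fubini moves the statement from each deterministic point to almost all points of one
  configuration, the form in which a fixed configuration is analysed.\<close>

lemma void_law_AE_same_cell:
  fixes \<mu> :: "(real ^ 'n) measure"
  assumes Q: "void_law \<phi> lam Q" and \<phi>: "directional_distribution \<phi>"
    and \<mu>: "sigma_finite_measure \<mu>" "sets \<mu> = sets borel"
  shows "AE h in Q. AE x in \<mu>. same_cell h x x"
proof -
  interpret Q: prob_space Q using Q by (simp add: void_law_def)
  interpret \<mu>: sigma_finite_measure \<mu> by fact
  interpret P: pair_sigma_finite \<mu> Q ..
  have sQ: "sets Q = sets void_space" using Q by (simp add: void_law_def)
  have s: "sets (\<mu> \<Otimes>\<^sub>M Q) = sets (borel \<Otimes>\<^sub>M void_space)" by (intro sets_pair_measure_cong \<mu> sQ)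
  have "Measurable.pred (\<mu> \<Otimes>\<^sub>M Q) (\<lambda>p. same_cell (snd p) (fst p) (fst p))"
    using same_cell_pair_measurable unfolding measurable_cong_sets[OF s refl] .
  then have m: "{p \<in> space (\<mu> \<Otimes>\<^sub>M Q). same_cell (snd p) (fst p) (fst p)} \<in> sets (\<mu> \<Otimes>\<^sub>M Q)"
    by (simp only: pred_def)
  have "AE x in \<mu>. AE h in Q. same_cell h x x"
    by (intro AE_I2 void_law_same_cell_self[OF Q \<phi>])
  then show ?thesis using P.AE_commute[OF m] by simp
qed

text \<open>Balls of radius \<open>1 / lam\<close> make the exponential moment per ball at most
  \<open>exp 2\<close>, independently of \<open>lam\<close>, so only their number grows. The
  condition \<open>lam \<ge> 1\<close> keeps the radius at most 1, as the covering demands.\<close>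

lemma expected_inverse_cell_mass:
  fixes \<mu> \<phi> :: "(real ^ 'n) measure" and H :: "'w \<Rightarrow> (real ^ 'n) set set"
  assumes S: "subspace S" "dim S = d" and R: "R \<ge> 0" and \<phi>: "directional_distribution \<phi>"
    and \<mu>: "finite_measure \<mu>" "sets \<mu> = sets borel" "AE x in \<mu>. x \<in> S \<inter> cball 0 R"
  shows "\<exists>C>0. \<forall>(Pr :: 'w measure) lam H. lam \<ge> 1 \<longrightarrow> poisson_hyperplane_process Pr \<phi> lam H \<longrightarrow>
    (\<integral>\<^sup>+ h. (\<integral>\<^sup>+ x. inverse (cell_mass \<mu> h x) \<partial>\<mu>) \<partial>(distr Pr void_space H)) \<le> ennreal (C * lam ^ d)"
proof -
  interpret \<mu>: finite_measure \<mu> by fact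
  obtain C where C: "C > 0" "\<And>r. 0 < r \<Longrightarrow> r \<le> 1 \<Longrightarrow>
    \<exists>P. finite P \<and> real (card P) \<le> C * (1 / r) ^ d \<and> S \<inter> cball 0 R \<subseteq> (\<Union>c\<in>P. cball c r)"
    using subspace_ball_covering[OF S R] by blast
  have main: "(\<integral>\<^sup>+ h. (\<integral>\<^sup>+ x. inverse (cell_mass \<mu> h x) \<partial>\<mu>) \<partial>(distr Pr void_space H)) \<le> ennreal (C * exp 2 * lam ^ d)"
    if lam: "lam \<ge> 1" and H: "poisson_hyperplane_process Pr \<phi> lam H"
    for Pr :: "'w measure" and lam H
  proof -
    have lam0: "lam > 0" using lam by simp
    define r where "r = 1 / lam"
    have r: "0 < r" "r \<le> 1" "1 / r = lam" using lam by (auto simp: r_def)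
    obtain P where P: "finite P" "real (card P) \<le> C * lam ^ d" "S \<inter> cball 0 R \<subseteq> (\<Union>c\<in>P. cball c r)"
      using C(2)[OF r(1,2)] r(3) by auto
    note HV = poisson_void_law[OF H \<phi> lam0]
    let ?Q = "distr Pr void_space H"
    let ?G = "\<lambda>h. \<integral>\<^sup>+ x. inverse (cell_mass \<mu> h x) \<partial>\<mu>"
    have s: "sets (borel \<Otimes>\<^sub>M void_space) = sets (\<mu> \<Otimes>\<^sub>M (void_space :: (real ^ 'n) set set measure))"
      by (intro sets_pair_measure_cong \<mu>(2)[symmetric] refl)
    have im: "(\<lambda>p. inverse (cell_mass \<mu> (snd p) (fst p))) \<in> borel_measurable (borel \<Otimes>\<^sub>M void_space)"
      using cell_mass_measurable[OF \<mu>.sigma_finite_measure_axioms \<mu>(2)]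
      by (rule borel_measurable_inverse_ennreal)
    have m: "(\<lambda>p. inverse (cell_mass \<mu> (fst p) (snd p))) \<in> borel_measurable (void_space \<Otimes>\<^sub>M \<mu>)"
    proof -
      have "(\<lambda>p. (snd p, fst p)) \<in> void_space \<Otimes>\<^sub>M \<mu> \<rightarrow>\<^sub>M \<mu> \<Otimes>\<^sub>M (void_space :: (real ^ 'n) set set measure)"
        by (intro measurable_Pair measurable_snd measurable_fst)
      then have "(\<lambda>p. (snd p, fst p)) \<in> void_space \<Otimes>\<^sub>M \<mu> \<rightarrow>\<^sub>M borel \<Otimes>\<^sub>M (void_space :: (real ^ 'n) set set measure)"
        unfolding measurable_cong_sets[OF refl s] .
      from measurable_compose[OF this im] show ?thesis by simp
    qed
    have Gm: "?G \<in> borel_measurable void_space"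
      using \<mu>.borel_measurable_nn_integral_fst[OF m] by simp
    have "(\<integral>\<^sup>+ h. ?G h \<partial>?Q) = (\<integral>\<^sup>+ w. ?G (H w) \<partial>Pr)"
      by (rule nn_integral_distr[OF HV(1)]) (use Gm in simp)
    also have "\<dots> \<le> (\<integral>\<^sup>+ w. (\<Sum>c\<in>P. ennreal (2 ^ card (H w \<inter> hitting c r))) \<partial>Pr)"
    proof (rule nn_integral_mono_AE)
      have "AE h in ?Q. AE x in \<mu>. same_cell h x x"
        by (rule void_law_AE_same_cell[OF HV(2) \<phi> \<mu>.sigma_finite_measure_axioms \<mu>(2)])
      then have "AE w in Pr. AE x in \<mu>. same_cell (H w) x x" by (rule AE_distrD[OF HV(1)])
      then show "AE w in Pr. ?G (H w) \<le> (\<Sum>c\<in>P. ennreal (2 ^ card (H w \<inter> hitting c r)))"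
        using AE_space
      proof eventually_elim
        case (elim w)
        have h: "H w \<in> hyperplane_configs" using measurable_space[OF HV(1) elim(2)] by simp
        have cm: "cell_mass \<mu> (H w) \<in> borel_measurable \<mu>"
        proof -
          have "(\<lambda>x. (x, H w)) \<in> borel \<rightarrow>\<^sub>M borel \<Otimes>\<^sub>M void_space"
            using h by (intro measurable_Pair measurable_const measurable_ident) simp_all
          from measurable_compose[OF this cell_mass_measurable[OF \<mu>.sigma_finite_measure_axioms \<mu>(2)]]
          show ?thesis unfolding measurable_cong_sets[OF \<mu>(2) refl] by simp
        qed
        have cb: "cball c r \<in> sets \<mu>" for c using \<mu>(2) by simp
        have "?G (H w) \<le> (\<integral>\<^sup>+ x. (\<Sum>c\<in>P. indicator (cball c r) x * inverse (cell_mass \<mu> (H w) x)) \<partial>\<mu>)"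
        proof (rule nn_integral_mono_AE)
          show "AE x in \<mu>. inverse (cell_mass \<mu> (H w) x) \<le>
              (\<Sum>c\<in>P. indicator (cball c r) x * inverse (cell_mass \<mu> (H w) x))"
            using \<mu>(3)
          proof eventually_elim
            case (elim x)
            then obtain c where c: "c \<in> P" "x \<in> cball c r" using P(3) by blast
            have "inverse (cell_mass \<mu> (H w) x) = indicator (cball c r) x * inverse (cell_mass \<mu> (H w) x)"
              using c by simp
            also have "\<dots> \<le> (\<Sum>c\<in>P. indicator (cball c r) x * inverse (cell_mass \<mu> (H w) x))"
              using c P(1) by (intro member_le_sum) auto
            finally show ?case .
          qed
        qed
        also have "\<dots> = (\<Sum>c\<in>P. (\<integral>\<^sup>+ x. indicator (cball c r) x * inverse (cell_mass \<mu> (H w) x) \<partial>\<mu>))"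
          by (intro nn_integral_sum borel_measurable_times_ennreal borel_measurable_indicator cb
              borel_measurable_inverse_ennreal cm)
        also have "\<dots> \<le> (\<Sum>c\<in>P. ennreal (2 ^ card {E \<in> H w. E \<inter> cball c r \<noteq> {}}))"
          by (intro sum_mono integral_inverse_cell_mass_ball[OF h \<mu>(1,2) elim(1)])
        also have "(\<lambda>c. {E \<in> H w. E \<inter> cball c r \<noteq> {}}) = (\<lambda>c. H w \<inter> hitting c r)"
          using hyperplane_config_hyperplanes[OF h] by (auto simp: hitting_def fun_eq_iff)
        finally show ?case .
      qed
    qed
    also have "\<dots> = (\<Sum>c\<in>P. \<integral>\<^sup>+ w. ennreal (2 ^ card (H w \<inter> hitting c r)) \<partial>Pr)"
      by (intro nn_integral_sum poisson_count_exp(1)[OF H \<phi> lam0 window_hitting, where r=r])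
        (use r in \<open>auto simp: hitting_def\<close>)
    also have "\<dots> \<le> (\<Sum>c\<in>P. ennreal (exp 2))"
    proof (intro sum_mono)
      fix c
      have "(\<integral>\<^sup>+ w. ennreal (2 ^ card (H w \<inter> hitting c r)) \<partial>Pr) \<le> ennreal (exp (2 * lam * r))"
        by (intro poisson_count_exp(2)[OF H \<phi> lam0 window_hitting, where c=c])
          (use r in \<open>auto simp: hitting_def\<close>)
      then show "(\<integral>\<^sup>+ w. ennreal (2 ^ card (H w \<inter> hitting c r)) \<partial>Pr) \<le> ennreal (exp 2)"
        using lam by (simp add: r_def)
    qed
    also have "\<dots> = ennreal (real (card P) * exp 2)" by (simp add: ennreal_mult'' ennreal_of_nat_eq_real_of_nat)
    also have "\<dots> \<le> ennreal (C * exp 2 * lam ^ d)"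
      using P(2) by (intro ennreal_leI) (simp add: mult.commute mult.left_commute mult_left_mono)
    finally show ?thesis .
  qed
  have "C * exp 2 > 0" using C(1) by simp
  then show ?thesis using main by (intro exI[of _ "C * exp 2"]) auto
qed

subsection \<open>The regression model\<close>

lemma regression_modelD:
  assumes "regression_model W \<rho> f \<sigma>"
  shows "prob_space \<rho>" "sets \<rho> = sets (restrict_space borel W \<Otimes>\<^sub>M borel)" "space \<rho> = W \<times> UNIV"
    "fst \<in> \<rho> \<rightarrow>\<^sub>M borel" "snd \<in> \<rho> \<rightarrow>\<^sub>M borel" "integrable \<rho> (\<lambda>z. (snd z)\<^sup>2)"
    "fst \<in> \<rho> \<rightarrow>\<^sub>M restrict_space borel W"
proof -
  show "prob_space \<rho>" and s: "sets \<rho> = sets (restrict_space borel W \<Otimes>\<^sub>M borel)"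
    and "integrable \<rho> (\<lambda>z. (snd z)\<^sup>2)"
    using assms by (auto simp: regression_model_def)
  show "space \<rho> = W \<times> UNIV"
    using sets_eq_imp_space_eq[OF s] by (simp add: space_pair_measure space_restrict_space)
  show f: "fst \<in> \<rho> \<rightarrow>\<^sub>M restrict_space borel W" unfolding measurable_cong_sets[OF s refl] by (rule measurable_fst)
  then show "fst \<in> \<rho> \<rightarrow>\<^sub>M borel" by (simp add: measurable_restrict_space2_iff)
  show "snd \<in> \<rho> \<rightarrow>\<^sub>M borel" unfolding measurable_cong_sets[OF s refl] by (rule measurable_snd)
qed

lemma (in prob_space) square_integrable_imp_integrable:
  fixes Y :: "'a \<Rightarrow> real"
  assumes "Y \<in> borel_measurable M" "integrable M (\<lambda>z. (Y z)\<^sup>2)"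
  shows "integrable M Y"
proof (rule Bochner_Integration.integrable_bound[of _ "\<lambda>z. 1 + (Y z)\<^sup>2"])
  show "AE z in M. norm (Y z) \<le> norm (1 + (Y z)\<^sup>2)"
  proof (rule AE_I2)
    fix z
    have "0 \<le> (\<bar>Y z\<bar> - 1)\<^sup>2" by simp
    then have "2 * \<bar>Y z\<bar> \<le> 1 + (Y z)\<^sup>2" by (simp add: power2_diff)
    then show "norm (Y z) \<le> norm (1 + (Y z)\<^sup>2)" by simp
  qed
qed (use assms in auto)

text \<open>\<open>F\<close> is a bounded Borel function on the whole space agreeing with
  \<open>f\<close> on \<open>W\<close>. Events about the first coordinate belong to the conditioning
  sigma-algebra, so over them the response and the squared noise may be replaced by their
  conditional expectations.\<close>

lemma regression_model_moments:
  fixes F :: "real ^ 'n \<Rightarrow> real"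
  assumes model: "regression_model W \<rho> f \<sigma>"
    and F: "F \<in> borel_measurable borel" "\<And>x. x \<in> W \<Longrightarrow> F x = f x" "\<And>x. \<bar>F x\<bar> \<le> L"
    and A: "A \<in> sets borel"
  shows "integrable \<rho> (\<lambda>z. (snd z - F (fst z))\<^sup>2)"
    and "(\<integral>z. indicator A (fst z) * snd z \<partial>\<rho>) = (\<integral>z. indicator A (fst z) * F (fst z) \<partial>\<rho>)"
    and "(\<integral>z. indicator A (fst z) * (snd z - F (fst z))\<^sup>2 \<partial>\<rho>) =
      \<sigma>\<^sup>2 * measure \<rho> {z \<in> space \<rho>. fst z \<in> A}"
proof -
  note D = regression_modelD[OF model]
  interpret prob_space \<rho> by (rule D(1))
  define \<F> where "\<F> = vimage_algebra (space \<rho>) fst (borel :: (real ^ 'n) measure)"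
  let ?N = "\<lambda>z. snd z - f (fst z)"
  have ae: "AE z in \<rho>. real_cond_exp \<rho> \<F> snd z = f (fst z)"
    "AE z in \<rho>. real_cond_exp \<rho> \<F> ?N z = 0"
    "AE z in \<rho>. real_cond_exp \<rho> \<F> (\<lambda>x. (?N x - real_cond_exp \<rho> \<F> ?N x)\<^sup>2) z = \<sigma>\<^sup>2"
    using model by (auto simp: regression_model_def Let_def \<F>_def cond_var_def)
  have sub: "subalgebra \<rho> \<F>"
    unfolding subalgebra_def
  proof
    show "space \<F> = space \<rho>" by (simp add: \<F>_def)
    show "sets \<F> \<subseteq> sets \<rho>" unfolding \<F>_def
      by (subst sets_vimage_algebra2) (use D(4) in \<open>auto intro: measurable_sets\<close>)
  qed
  then have "finite_measure_subalgebra \<rho> \<F>"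
    by (simp add: finite_measure_subalgebra_def finite_measure_axioms finite_measure_subalgebra_axioms_def)
  then interpret S: finite_measure_subalgebra \<rho> \<F> .
  note [measurable] = D(4,5) F(1)
  define A' where "A' = fst -` A \<inter> space \<rho>"
  have A'F: "A' \<in> sets \<F>" unfolding A'_def \<F>_def using A by (rule in_vimage_algebra)
  have A'm: "A' \<in> sets \<rho>" using A'F sub by (auto simp: subalgebra_def)
  have FW: "F (fst z) = f (fst z)" if "z \<in> space \<rho>" for z using that D(3) F(2) by auto
  have sndi: "integrable \<rho> snd" by (rule square_integrable_imp_integrable[OF D(5,6)])
  have Fi: "integrable \<rho> (\<lambda>z. F (fst z))" "integrable \<rho> (\<lambda>z. (F (fst z))\<^sup>2)"
  proof -
    show "integrable \<rho> (\<lambda>z. F (fst z))" using F(3) by (intro integrable_const_bound[of _ L]) auto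
    have "(F x)\<^sup>2 \<le> L\<^sup>2" for x using F(3)[of x] by (metis abs_ge_zero power2_abs power_mono)
    then show "integrable \<rho> (\<lambda>z. (F (fst z))\<^sup>2)" by (intro integrable_const_bound[of _ "L\<^sup>2"]) auto
  qed
  have "integrable \<rho> (\<lambda>z. 2 * (snd z)\<^sup>2 + 2 * (F (fst z))\<^sup>2)" using D(6) Fi(2) by simp
  then show Ni: "integrable \<rho> (\<lambda>z. (snd z - F (fst z))\<^sup>2)"
  proof (rule Bochner_Integration.integrable_bound)
    show "AE z in \<rho>. norm ((snd z - F (fst z))\<^sup>2) \<le> norm (2 * (snd z)\<^sup>2 + 2 * (F (fst z))\<^sup>2)"
    proof (rule AE_I2)
      fix z :: "(real ^ 'n) \<times> real"
      have "0 \<le> (snd z + F (fst z))\<^sup>2" by simp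
      then have "(snd z - F (fst z))\<^sup>2 \<le> 2 * (snd z)\<^sup>2 + 2 * (F (fst z))\<^sup>2"
        by (simp add: power2_diff power2_sum)
      then show "norm ((snd z - F (fst z))\<^sup>2) \<le> norm (2 * (snd z)\<^sup>2 + 2 * (F (fst z))\<^sup>2)"
        by simp
    qed
  qed measurable
  have A'ind: "indicator A (fst z) = (indicator A' z :: real)" if "z \<in> space \<rho>" for z
    using that by (simp add: A'_def indicator_def)
  show "(\<integral>z. indicator A (fst z) * snd z \<partial>\<rho>) = (\<integral>z. indicator A (fst z) * F (fst z) \<partial>\<rho>)"
  proof -
    have "(\<integral>z. indicator A (fst z) * snd z \<partial>\<rho>) = (\<integral>z\<in>A'. snd z \<partial>\<rho>)"
      unfolding set_lebesgue_integral_def by (intro Bochner_Integration.integral_cong refl) (simp add: A'ind)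
    also have "\<dots> = (\<integral>z\<in>A'. real_cond_exp \<rho> \<F> snd z \<partial>\<rho>)"
      by (rule S.real_cond_exp_intA[OF sndi A'F])
    also have "\<dots> = (\<integral>z\<in>A'. F (fst z) \<partial>\<rho>)"
      unfolding set_lebesgue_integral_def
    proof (rule integral_cong_AE)
      show "AE z in \<rho>. indicator A' z *\<^sub>R real_cond_exp \<rho> \<F> snd z = indicator A' z *\<^sub>R F (fst z)"
        using ae(1) AE_space by eventually_elim (simp add: FW)
      show "(\<lambda>z. indicator A' z *\<^sub>R real_cond_exp \<rho> \<F> snd z) \<in> borel_measurable \<rho>"
        using A'm by measurable
      show "(\<lambda>z. indicator A' z *\<^sub>R F (fst z)) \<in> borel_measurable \<rho>" using A'm by measurable
    qed
    also have "\<dots> = (\<integral>z. indicator A (fst z) * F (fst z) \<partial>\<rho>)"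
      unfolding set_lebesgue_integral_def by (intro Bochner_Integration.integral_cong refl) (simp add: A'ind)
    finally show ?thesis .
  qed
  show "(\<integral>z. indicator A (fst z) * (snd z - F (fst z))\<^sup>2 \<partial>\<rho>) = \<sigma>\<^sup>2 * measure \<rho> {z \<in> space \<rho>. fst z \<in> A}"
  proof -
    let ?g = "\<lambda>x. (?N x - real_cond_exp \<rho> \<F> ?N x)\<^sup>2"
    have "(\<lambda>z. snd z - F (fst z)) \<in> borel_measurable \<rho>" by measurable
    moreover have "?N \<in> borel_measurable \<rho> \<longleftrightarrow> (\<lambda>z. snd z - F (fst z)) \<in> borel_measurable \<rho>"
      by (rule measurable_cong) (simp add: FW)
    ultimately have Nm [measurable]: "?N \<in> borel_measurable \<rho>" by simp
    have gm [measurable]: "?g \<in> borel_measurable \<rho>" by measurable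
    have geq: "AE z in \<rho>. ?g z = (snd z - F (fst z))\<^sup>2"
      using ae(2) AE_space by eventually_elim (simp add: FW)
    have gi: "integrable \<rho> ?g" 
      by (rule integrable_cong_AE_imp[OF Ni gm]) (use geq in \<open>auto elim: eventually_mono\<close>)
    have "(\<integral>z. indicator A (fst z) * (snd z - F (fst z))\<^sup>2 \<partial>\<rho>) = (\<integral>z. indicator A' z *\<^sub>R ?g z \<partial>\<rho>)"
    proof (rule integral_cong_AE)
      show "AE z in \<rho>. indicator A (fst z) * (snd z - F (fst z))\<^sup>2 = indicator A' z *\<^sub>R ?g z"
        using geq AE_space by eventually_elim (simp add: A'ind)
      show "(\<lambda>z. indicator A (fst z) * (snd z - F (fst z))\<^sup>2) \<in> borel_measurable \<rho>" using A by measurable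
      show "(\<lambda>z. indicator A' z *\<^sub>R ?g z) \<in> borel_measurable \<rho>" using A'm by measurable
    qed
    also have "\<dots> = (\<integral>z\<in>A'. real_cond_exp \<rho> \<F> ?g z \<partial>\<rho>)"
      using S.real_cond_exp_intA[OF gi A'F] by (simp add: set_lebesgue_integral_def)
    also have "\<dots> = (\<integral>z. indicator A' z *\<^sub>R \<sigma>\<^sup>2 \<partial>\<rho>)"
      unfolding set_lebesgue_integral_def
    proof (rule integral_cong_AE)
      show "AE z in \<rho>. indicator A' z *\<^sub>R real_cond_exp \<rho> \<F> ?g z = indicator A' z *\<^sub>R \<sigma>\<^sup>2"
        using ae(3) by eventually_elim simp
      show "(\<lambda>z. indicator A' z *\<^sub>R real_cond_exp \<rho> \<F> ?g z) \<in> borel_measurable \<rho>"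
        using A'm by measurable
      show "(\<lambda>z. indicator A' z *\<^sub>R \<sigma>\<^sup>2) \<in> borel_measurable \<rho>" using A'm by measurable
    qed
    also have "\<dots> = \<sigma>\<^sup>2 * measure \<rho> A'" using A'm by simp
    also have "A' = {z \<in> space \<rho>. fst z \<in> A}" by (auto simp: A'_def)
    finally show ?thesis .
  qed
qed

text \<open>The deterministic target with which a tree is compared once the configuration is fixed.
  On a cell of mass zero division by zero gives 0, which respects the bound of
  \<open>cell_average_bound\<close>.\<close>

definition cell_average :: "(real ^ 'n) measure \<Rightarrow> (real ^ 'n \<Rightarrow> real) \<Rightarrow> (real ^ 'n) set set \<Rightarrow> real ^ 'n \<Rightarrow> real" where
  "cell_average \<mu> F h x =
     (\<integral>y. indicator {y. same_cell h x y} y * F y \<partial>\<mu>) / measure \<mu> {y. same_cell h x y}"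

text \<open>An empty cell yields 0 / 0 = 0, the same default as in \<open>tree_estimator\<close>, so
  no case distinction is made.\<close>

definition cell_tree :: "nat \<Rightarrow> (nat \<Rightarrow> (real ^ 'n) \<times> real) \<Rightarrow> (real ^ 'n) set set \<Rightarrow> real ^ 'n \<Rightarrow> real" where
  "cell_tree n Z h x = (\<Sum>i<n. indicator {y. same_cell h x y} (fst (Z i)) * snd (Z i)) /
     (\<Sum>i<n. indicator {y. same_cell h x y} (fst (Z i)))"

lemma covariate_lawD:
  assumes model: "regression_model W \<rho> f \<sigma>"
  shows "prob_space (covariate_law \<rho>)" "sets (covariate_law \<rho>) = sets borel"
    "A \<in> sets borel \<Longrightarrow> measure (covariate_law \<rho>) A = measure \<rho> {z \<in> space \<rho>. fst z \<in> A}"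
    "A \<in> sets borel \<Longrightarrow> emeasure (covariate_law \<rho>) A = emeasure \<rho> {z \<in> space \<rho>. fst z \<in> A}"
proof -
  note D = regression_modelD[OF model]
  show "prob_space (covariate_law \<rho>)" unfolding covariate_law_def by (rule prob_space.prob_space_distr[OF D(1,4)])
  show "sets (covariate_law \<rho>) = sets borel" by (simp add: covariate_law_def)
  have e: "fst -` A \<inter> space \<rho> = {z \<in> space \<rho>. fst z \<in> A}" by auto
  show "A \<in> sets borel \<Longrightarrow> measure (covariate_law \<rho>) A = measure \<rho> {z \<in> space \<rho>. fst z \<in> A}"
    unfolding covariate_law_def using measure_distr[OF D(4)] e by simp
  show "A \<in> sets borel \<Longrightarrow> emeasure (covariate_law \<rho>) A = emeasure \<rho> {z \<in> space \<rho>. fst z \<in> A}"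
    unfolding covariate_law_def using emeasure_distr[OF D(4)] e by simp
qed

lemma cell_average_bound:
  fixes F :: "real ^ 'n \<Rightarrow> real"
  assumes \<mu>: "prob_space \<mu>" "sets \<mu> = sets borel" and F: "F \<in> borel_measurable borel" "\<And>x. \<bar>F x\<bar> \<le> L"
    and h: "h \<in> hyperplane_configs"
  shows "\<bar>cell_average \<mu> F h x\<bar> \<le> L"
proof -
  interpret prob_space \<mu> by fact
  let ?A = "{y. same_cell h x y}"
  have A: "?A \<in> sets \<mu>" using same_cell_sets[OF h] \<mu>(2) by simp
  have Fm: "F \<in> borel_measurable \<mu>" using F(1) unfolding measurable_cong_sets[OF \<mu>(2) refl] .
  have iA: "integrable \<mu> (indicator ?A :: _ \<Rightarrow> real)"
    using A by (intro integrable_real_indicator) (simp_all add: less_top[symmetric])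
  have L: "0 \<le> L" using F(2)[of undefined] by linarith
  have "\<bar>\<integral>y. indicator ?A y * F y \<partial>\<mu>\<bar> \<le> (\<integral>y. L * indicator ?A y \<partial>\<mu>)"
    unfolding real_norm_def[symmetric]
  proof (rule order_trans[OF integral_norm_bound integral_mono_AE'])
    show "integrable \<mu> (\<lambda>y. L * indicator ?A y)" using iA by simp
    show "AE y in \<mu>. norm (indicator ?A y * F y) \<le> L * indicator ?A y"
      using F(2) by (intro AE_I2) (simp add: indicator_def)
  qed (use L in simp)
  also have "\<dots> = L * prob ?A" using A by simp
  finally have *: "\<bar>\<integral>y. indicator ?A y * F y \<partial>\<mu>\<bar> \<le> L * prob ?A" .
  show ?thesis
  proof (cases "prob ?A = 0")
    case True
    then show ?thesis using L by (simp add: cell_average_def)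
  next
    case False
    then have "prob ?A > 0" using measure_nonneg[of \<mu> ?A] by linarith
    then show ?thesis using * by (simp add: cell_average_def abs_divide field_simps)
  qed
qed

lemma tree_variance:
  fixes F :: "real ^ 'n \<Rightarrow> real"
  assumes model: "regression_model W \<rho> f \<sigma>"
    and F: "F \<in> borel_measurable borel" "\<And>x. x \<in> W \<Longrightarrow> F x = f x" "\<And>x. \<bar>F x\<bar> \<le> L" and L: "L > 0"
    and h: "h \<in> hyperplane_configs" and n: "n \<ge> 1"
  shows "(\<integral>\<^sup>+\<omega>. ennreal ((cell_tree n \<omega> h x - cell_average (covariate_law \<rho>) F h x)\<^sup>2) \<partial>(PiM {..<n} (\<lambda>_. \<rho>)))
    \<le> ennreal ((4 * \<sigma>\<^sup>2 + 17 * L\<^sup>2) / n) * inverse (cell_mass (covariate_law \<rho>) h x)"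
proof -
  note D = regression_modelD[OF model]
  interpret prob_space \<rho> by (rule D(1))
  note \<mu> = covariate_lawD[OF model]
  let ?\<mu> = "covariate_law \<rho>" and ?C = "{y. same_cell h x y}"
  note [measurable] = D(4,5) F(1)
  have C [measurable]: "?C \<in> sets borel" by (rule same_cell_sets[OF h])
  define A where "A = {z \<in> space \<rho>. fst z \<in> ?C}"
  have A: "A \<in> events" unfolding A_def by measurable
  have pA: "measure ?\<mu> ?C = prob A" unfolding A_def by (rule \<mu>(3)[OF C])
  define c where "c = cell_average ?\<mu> F h x"
  have c: "\<bar>c\<bar> \<le> L" unfolding c_def by (rule cell_average_bound[OF \<mu>(1,2) F(1,3) h])
  have K: "(4 * \<sigma>\<^sup>2 + 17 * L\<^sup>2) / n > 0" using L n by (intro divide_pos_pos add_nonneg_pos) auto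
  show ?thesis
  proof (cases "prob A = 0")
    \<comment> \<open>On a null cell the right-hand side is \<open>top\<close>, because the leading
      factor is positive.\<close>
    case True
    then have "cell_mass ?\<mu> h x = 0"
      unfolding cell_mass_def \<mu>(4)[OF C] A_def[symmetric] by (simp add: emeasure_eq_measure)
    then have "ennreal ((4 * \<sigma>\<^sup>2 + 17 * L\<^sup>2) / n) * inverse (cell_mass ?\<mu> h x) = top"
    proof -
      have "ennreal ((4 * \<sigma>\<^sup>2 + 17 * L\<^sup>2) / n) \<noteq> 0" using K by (metis ennreal_eq_0_iff not_le)
      then show ?thesis using \<open>cell_mass ?\<mu> h x = 0\<close> by (simp add: ennreal_mult_eq_top_iff del: ennreal_eq_0_iff)
    qed
    then show ?thesis by simp
  next
    case False
    then have p: "prob A > 0" using measure_nonneg[of \<rho> A] by linarith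
    have indA: "indicator ?C (fst z) = (indicator A z :: real)" if "z \<in> space \<rho>" for z
      using that by (simp add: A_def indicator_def)
    have iA: "integrable \<rho> (indicator A :: _ \<Rightarrow> real)"
      using A by (intro integrable_real_indicator) (simp_all add: less_top[symmetric])
    have "(\<integral>z. indicator A z * snd z \<partial>\<rho>) = (\<integral>z. indicator ?C (fst z) * snd z \<partial>\<rho>)"
      by (intro Bochner_Integration.integral_cong refl) (simp add: indA)
    also have "\<dots> = (\<integral>z. indicator ?C (fst z) * F (fst z) \<partial>\<rho>)"
      by (rule regression_model_moments(2)[OF model F C])
    also have "\<dots> = (\<integral>y. indicator ?C y * F y \<partial>?\<mu>)"
      unfolding covariate_law_def by (rule integral_distr[OF D(4), symmetric]) measurable
    also have "\<dots> = c * prob A" using p unfolding c_def cell_average_def pA by simp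
    finally have mean: "(\<integral>z. indicator A z * snd z \<partial>\<rho>) = c * prob A" .
    have Ni: "integrable \<rho> (\<lambda>z. (snd z - F (fst z))\<^sup>2)" by (rule regression_model_moments(1)[OF model F C])
    have iN: "integrable \<rho> (\<lambda>z. indicator A z * (snd z - F (fst z))\<^sup>2)"
      using integrable_real_mult_indicator[OF A Ni] by (simp add: mult.commute)
    have "(\<integral>z. indicator A z * (snd z - c)\<^sup>2 \<partial>\<rho>) \<le>
        (\<integral>z. 2 * (indicator A z * (snd z - F (fst z))\<^sup>2) + 8 * L\<^sup>2 * indicator A z \<partial>\<rho>)"
    proof (rule integral_mono_AE')
      show "integrable \<rho> (\<lambda>z. 2 * (indicator A z * (snd z - F (fst z))\<^sup>2) + 8 * L\<^sup>2 * indicator A z)"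
        using iN iA by simp
      show "AE z in \<rho>. indicator A z * (snd z - c)\<^sup>2 \<le> 2 * (indicator A z * (snd z - F (fst z))\<^sup>2) + 8 * L\<^sup>2 * indicator A z"
      proof (rule AE_I2)
        fix z :: "(real ^ 'n) \<times> real"
        \<comment> \<open>The variance on the cell is split into noise and the deviation of
          \<open>F\<close> from its cell mean; the latter is at most \<open>2 * L\<close> whatever
          the size of the cell.\<close>
        have "\<bar>F (fst z) - c\<bar> \<le> 2 * L" using F(3)[of "fst z"] c by linarith
        then have "(F (fst z) - c)\<^sup>2 \<le> (2 * L)\<^sup>2" by (metis abs_ge_zero power2_abs power_mono)
        moreover have "(snd z - c)\<^sup>2 \<le> 2 * (snd z - F (fst z))\<^sup>2 + 2 * (F (fst z) - c)\<^sup>2"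
        proof -
          have "0 \<le> ((snd z - F (fst z)) - (F (fst z) - c))\<^sup>2" by simp
          then show ?thesis by (simp add: power2_eq_square algebra_simps)
        qed
        ultimately have "(snd z - c)\<^sup>2 \<le> 2 * (snd z - F (fst z))\<^sup>2 + 8 * L\<^sup>2" by (simp add: power_mult_distrib)
        then show "indicator A z * (snd z - c)\<^sup>2 \<le> 2 * (indicator A z * (snd z - F (fst z))\<^sup>2) + 8 * L\<^sup>2 * indicator A z"
          by (simp add: indicator_def)
      qed
      show "AE z in \<rho>. 0 \<le> 2 * (indicator A z * (snd z - F (fst z))\<^sup>2) + 8 * L\<^sup>2 * indicator A z"
        by (rule AE_I2) simp
    qed
    also have "\<dots> = 2 * (\<integral>z. indicator A z * (snd z - F (fst z))\<^sup>2 \<partial>\<rho>) + 8 * L\<^sup>2 * prob A"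
      using iN iA A by simp
    also have "(\<integral>z. indicator A z * (snd z - F (fst z))\<^sup>2 \<partial>\<rho>) = (\<integral>z. indicator ?C (fst z) * (snd z - F (fst z))\<^sup>2 \<partial>\<rho>)"
      by (intro Bochner_Integration.integral_cong refl) (simp add: indA)
    also have "\<dots> = \<sigma>\<^sup>2 * prob A"
      unfolding A_def by (rule regression_model_moments(3)[OF model F C])
    finally have var: "(\<integral>z. indicator A z * (snd z - c)\<^sup>2 \<partial>\<rho>) \<le> (2 * \<sigma>\<^sup>2 + 8 * L\<^sup>2) * prob A"
      by (simp add: algebra_simps)
    have ne: "{..<n} \<noteq> {}" using n by (auto simp: lessThan_empty_iff)
    have "(\<integral>\<^sup>+\<omega>. ennreal ((cell_tree n \<omega> h x - c)\<^sup>2) \<partial>(PiM {..<n} (\<lambda>_. \<rho>))) =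
        (\<integral>\<^sup>+\<omega>. ennreal (((\<Sum>i\<in>{..<n}. indicator A (\<omega> i) * snd (\<omega> i)) / cell_weight A {..<n} \<omega> - c)\<^sup>2) \<partial>(PiM {..<n} (\<lambda>_. \<rho>)))"
    proof (rule nn_integral_cong)
      fix \<omega> assume "\<omega> \<in> space (PiM {..<n} (\<lambda>_. \<rho>))"
      then have "\<omega> i \<in> space \<rho>" if "i < n" for i using that by (auto simp: space_PiM PiE_iff)
      then have "indicator ?C (fst (\<omega> i)) = (indicator A (\<omega> i) :: real)" if "i < n" for i using that indA by blast
      then have "cell_tree n \<omega> h x = (\<Sum>i\<in>{..<n}. indicator A (\<omega> i) * snd (\<omega> i)) / cell_weight A {..<n} \<omega>"
        unfolding cell_tree_def cell_weight_eq_sum[OF finite_lessThan] by simp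
      then show "ennreal ((cell_tree n \<omega> h x - c)\<^sup>2) =
        ennreal (((\<Sum>i\<in>{..<n}. indicator A (\<omega> i) * snd (\<omega> i)) / cell_weight A {..<n} \<omega> - c)\<^sup>2)" by simp
    qed
    also have "\<dots> \<le> ennreal ((2 * (2 * \<sigma>\<^sup>2 + 8 * L\<^sup>2) + L\<^sup>2) / (card {..<n} * prob A))"
      by (rule cell_average_error[OF A p D(5,6) mean c var finite_lessThan ne])
    also have "(2 * (2 * \<sigma>\<^sup>2 + 8 * L\<^sup>2) + L\<^sup>2) / (card {..<n} * prob A) = (4 * \<sigma>\<^sup>2 + 17 * L\<^sup>2) / n * inverse (prob A)"
      by (simp add: divide_inverse mult.commute)
    also have "ennreal \<dots> = ennreal ((4 * \<sigma>\<^sup>2 + 17 * L\<^sup>2) / n) * inverse (cell_mass ?\<mu> h x)"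
      unfolding cell_mass_def \<mu>(4)[OF C] A_def[symmetric] emeasure_eq_measure
      by (simp only: inverse_ennreal[OF p] ennreal_mult'[OF less_imp_le[OF K]])
    finally show ?thesis unfolding c_def .
  qed
qed

subsection \<open>Lebesgue measure on the subspace\<close>

lemma orthonormal_basis_ofD:
  fixes S :: "(real ^ 'n) set"
  assumes "subspace S"
  shows "orthonormal_basis_of S \<subseteq> S" "pairwise orthogonal (orthonormal_basis_of S)"
    "\<And>b. b \<in> orthonormal_basis_of S \<Longrightarrow> norm b = 1" "span (orthonormal_basis_of S) = S"
    "finite (orthonormal_basis_of S)" "card (orthonormal_basis_of S) = dim S"
proof -
  obtain B where "B \<subseteq> S" "pairwise orthogonal B" "\<And>b. b \<in> B \<Longrightarrow> norm b = 1" "span B = S"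
    using orthonormal_basis_subspace[OF assms] by metis
  then have "\<exists>B. B \<subseteq> S \<and> pairwise orthogonal B \<and> (\<forall>b\<in>B. norm b = 1) \<and> span B = S" by blast
  from someI_ex[OF this] show 1: "orthonormal_basis_of S \<subseteq> S" and 2: "pairwise orthogonal (orthonormal_basis_of S)"
    and 3: "\<And>b. b \<in> orthonormal_basis_of S \<Longrightarrow> norm b = 1" and 4: "span (orthonormal_basis_of S) = S"
    unfolding orthonormal_basis_of_def by auto
  have "0 \<notin> orthonormal_basis_of S" using 3 by force
  then have i: "independent (orthonormal_basis_of S)" using 2 by (rule pairwise_orthogonal_independent[rotated])
  show "finite (orthonormal_basis_of S)" using i by (rule independent_imp_finite)
  show "card (orthonormal_basis_of S) = dim S"
    using dim_eq_card_independent[OF i] 4 by (metis dim_span)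
qed

context
  fixes S B :: "(real ^ 'n) set"
  assumes S: "subspace S"
  defines "B \<equiv> orthonormal_basis_of S"
begin

private definition T :: "(real ^ 'n \<Rightarrow> real) \<Rightarrow> real ^ 'n" where "T c = (\<Sum>b\<in>B. c b *\<^sub>R b)"

private lemmas B = orthonormal_basis_ofD[OF S, folded B_def]

private lemma subspace_lborel_eq: "subspace_lborel S = distr (PiM B (\<lambda>_. lborel)) borel T"
  unfolding subspace_lborel_def Let_def B_def[symmetric] T_def[abs_def] ..

private lemma T_measurable [measurable]: "T \<in> PiM B (\<lambda>_. lborel) \<rightarrow>\<^sub>M borel"
  unfolding T_def[abs_def] by measurable

lemma sets_subspace_lborel [simp]: "sets (subspace_lborel S) = sets borel"
  unfolding subspace_lborel_eq by simp

lemma space_subspace_lborel [simp]: "space (subspace_lborel S) = UNIV"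
  unfolding subspace_lborel_eq by simp

lemma AE_subspace_lborel: "AE y in subspace_lborel S. y \<in> S"
proof -
  have "closed S" using S by (rule closed_subspace)
  have "T c \<in> S" for c
    unfolding T_def using B(1) S by (intro subspace_sum subspace_scale) auto
  then show ?thesis
    unfolding subspace_lborel_eq using \<open>closed S\<close> by (subst AE_distr_iff) auto
qed

text \<open>The product measure is determined by its values on boxes, where every coordinate
  contributes one factor \<open>\<bar>a\<bar>\<close>.\<close>

private lemma PiM_affine:
  fixes a :: real
  assumes a: "a \<noteq> 0"
  shows "scale_measure (ennreal (\<bar>a\<bar> ^ card B))
      (distr (PiM B (\<lambda>_. lborel)) (PiM B (\<lambda>_. lborel)) (\<lambda>c. \<lambda>b\<in>B. t b + a * c b)) = PiM B (\<lambda>_. lborel)"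
    (is "scale_measure _ (distr ?P ?P ?g) = _")
proof -
  interpret product_sigma_finite "\<lambda>_ :: real ^ 'n. lborel :: real measure" by standard
  have g: "?g \<in> ?P \<rightarrow>\<^sub>M ?P" by (rule measurable_restrict) measurable
  show ?thesis
  proof (rule PiM_eqI[OF B(5)])
    fix A :: "real ^ 'n \<Rightarrow> real set" assume A: "\<And>i. i \<in> B \<Longrightarrow> A i \<in> sets lborel"
    have one: "ennreal \<bar>a\<bar> * emeasure lborel ((\<lambda>s. t b + a * s) -` A b) = emeasure lborel (A b)" if "b \<in> B" for b
    proof -
      have Ab: "A b \<in> sets borel" using A[OF that] by simp
      have "emeasure lborel (A b) = emeasure (density (distr lborel borel (\<lambda>s. t b + a * s)) (\<lambda>_. ennreal \<bar>a\<bar>)) (A b)"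
        by (rule arg_cong[of _ _ "\<lambda>M. emeasure M _", OF lborel_real_affine[OF a]])
      also have "\<dots> = ennreal \<bar>a\<bar> * emeasure (distr lborel borel (\<lambda>s. t b + a * s)) (A b)"
        using Ab by (intro emeasure_density_const) simp
      also have "emeasure (distr lborel borel (\<lambda>s. t b + a * s)) (A b) = emeasure lborel ((\<lambda>s. t b + a * s) -` A b)"
        using Ab by (subst emeasure_distr) simp_all
      finally show ?thesis by simp
    qed
    have m: "(\<lambda>s. t b + a * s) -` A b \<in> sets lborel" if "b \<in> B" for b
    proof -
      have "(\<lambda>s. t b + a * s) \<in> borel \<rightarrow>\<^sub>M borel" by measurable
      from measurable_sets[OF this, of "A b"] A[OF that] show ?thesis by simp
    qed
    have pre: "?g -` (Pi\<^sub>E B A) \<inter> space ?P = Pi\<^sub>E B (\<lambda>b. (\<lambda>s. t b + a * s) -` A b)"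
      by (auto simp: space_PiM PiE_iff extensional_def)
    have "Pi\<^sub>E B A \<in> sets ?P" using A B(5) by (intro sets_PiM_I_finite) auto
    then have "emeasure (scale_measure (ennreal (\<bar>a\<bar> ^ card B)) (distr ?P ?P ?g)) (Pi\<^sub>E B A) =
        ennreal (\<bar>a\<bar> ^ card B) * emeasure ?P (Pi\<^sub>E B (\<lambda>b. (\<lambda>s. t b + a * s) -` A b))"
      by (simp only: emeasure_scale_measure emeasure_distr[OF g] pre)
    also have "emeasure ?P (Pi\<^sub>E B (\<lambda>b. (\<lambda>s. t b + a * s) -` A b)) = (\<Prod>b\<in>B. emeasure lborel ((\<lambda>s. t b + a * s) -` A b))"
      using m B(5) by (intro emeasure_PiM) auto
    also have "ennreal (\<bar>a\<bar> ^ card B) * (\<Prod>b\<in>B. emeasure lborel ((\<lambda>s. t b + a * s) -` A b)) =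
        (\<Prod>b\<in>B. ennreal \<bar>a\<bar>) * (\<Prod>b\<in>B. emeasure lborel ((\<lambda>s. t b + a * s) -` A b))"
      by (simp only: prod_constant ennreal_power abs_ge_zero)
    also have "(\<Prod>b\<in>B. ennreal \<bar>a\<bar>) * (\<Prod>b\<in>B. emeasure lborel ((\<lambda>s. t b + a * s) -` A b)) =
        (\<Prod>b\<in>B. emeasure lborel (A b))"
      unfolding prod.distrib[symmetric] by (intro prod.cong refl one)
    finally show "emeasure (scale_measure (ennreal (\<bar>a\<bar> ^ card B)) (distr ?P ?P ?g)) (Pi\<^sub>E B A) = (\<Prod>b\<in>B. emeasure lborel (A b))" .
  qed simp
qed

text \<open>Translation along \<open>S\<close> and scaling act separately on each coordinate of the
  basis. The case \<open>a = -1\<close> is the reflection at a point of \<open>S\<close>, and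
  factors between 0 and 1 give the shrunken bodies behind \<open>boundary_layer\<close>.\<close>

lemma emeasure_subspace_lborel_affine:
  assumes a: "a \<noteq> 0" and x: "x \<in> S" and E: "E \<in> sets borel"
  shows "emeasure (subspace_lborel S) E =
    ennreal (\<bar>a\<bar> ^ dim S) * emeasure (subspace_lborel S) ((\<lambda>y. x + a *\<^sub>R y) -` E)"
proof -
  let ?P = "PiM B (\<lambda>_. lborel :: real measure)" and ?g = "\<lambda>c. \<lambda>b\<in>B. x \<bullet> b + a * c b"
  have g: "?g \<in> ?P \<rightarrow>\<^sub>M ?P" by (rule measurable_restrict) measurable
  have Tg: "T (?g c) = x + a *\<^sub>R T c" for c
  proof -
    have "T (?g c) = (\<Sum>b\<in>B. (x \<bullet> b) *\<^sub>R b) + (\<Sum>b\<in>B. (a * c b) *\<^sub>R b)"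
      unfolding T_def sum.distrib[symmetric] by (intro sum.cong refl) (simp add: scaleR_add_left)
    also have "(\<Sum>b\<in>B. (x \<bullet> b) *\<^sub>R b) = x" using orthonormal_expansion[OF B(2,3)] x B(4) by simp
    finally show ?thesis by (simp add: T_def scaleR_sum_right)
  qed
  have TE: "T -` E \<inter> space ?P \<in> sets ?P" using E by (rule measurable_sets[OF T_measurable])
  have E': "(\<lambda>y. x + a *\<^sub>R y) -` E \<in> sets borel"
  proof -
    have "(\<lambda>y. x + a *\<^sub>R y) \<in> borel \<rightarrow>\<^sub>M borel" by measurable
    from measurable_sets[OF this E] show ?thesis by simp
  qed
  have "emeasure (subspace_lborel S) E = emeasure ?P (T -` E \<inter> space ?P)"
    unfolding subspace_lborel_eq using E by (rule emeasure_distr[OF T_measurable])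
  also have "\<dots> = emeasure (scale_measure (ennreal (\<bar>a\<bar> ^ card B)) (distr ?P ?P ?g)) (T -` E \<inter> space ?P)"
    by (simp only: PiM_affine[OF a])
  also have "\<dots> = ennreal (\<bar>a\<bar> ^ card B) * emeasure ?P (?g -` (T -` E \<inter> space ?P) \<inter> space ?P)"
    by (simp add: emeasure_distr[OF g TE])
  also have "?g -` (T -` E \<inter> space ?P) \<inter> space ?P = T -` ((\<lambda>y. x + a *\<^sub>R y) -` E) \<inter> space ?P"
    using measurable_space[OF g] by (auto simp: Tg)
  also have "emeasure ?P \<dots> = emeasure (subspace_lborel S) ((\<lambda>y. x + a *\<^sub>R y) -` E)"
    unfolding subspace_lborel_eq using E' by (rule emeasure_distr[OF T_measurable, symmetric])
  finally show ?thesis by (simp only: B(6))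
qed

lemma distr_subspace_lborel_reflect:
  assumes x: "x \<in> S"
  shows "distr (subspace_lborel S) borel (\<lambda>y. 2 *\<^sub>R x - y) = subspace_lborel S"
proof (rule measure_eqI)
  fix E assume "E \<in> sets (distr (subspace_lborel S) borel (\<lambda>y. 2 *\<^sub>R x - y))"
  then have E: "E \<in> sets borel" by simp
  have x2: "2 *\<^sub>R x \<in> S" using S x by (rule subspace_scale)
  have f: "(\<lambda>y. 2 *\<^sub>R x - y) \<in> subspace_lborel S \<rightarrow>\<^sub>M borel"
    unfolding measurable_cong_sets[OF sets_subspace_lborel refl] by measurable
  have "emeasure (distr (subspace_lborel S) borel (\<lambda>y. 2 *\<^sub>R x - y)) E =
      emeasure (subspace_lborel S) ((\<lambda>y. 2 *\<^sub>R x - y) -` E)"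
    using emeasure_distr[OF f E] by simp
  also have "\<dots> = emeasure (subspace_lborel S) E"
    using emeasure_subspace_lborel_affine[of "-1", OF _ x2 E] by simp
  finally show "emeasure (distr (subspace_lborel S) borel (\<lambda>y. 2 *\<^sub>R x - y)) E = emeasure (subspace_lborel S) E" .
qed simp

text \<open>Orthonormal coordinates of a point of the ball are bounded by \<open>R\<close>, so in
  coordinates the ball lies in a cube of finite volume.\<close>

lemma emeasure_subspace_lborel_cball: "emeasure (subspace_lborel S) (cball 0 R) < \<infinity>"
proof -
  let ?P = "PiM B (\<lambda>_. lborel :: real measure)"
  interpret product_sigma_finite "\<lambda>_ :: real ^ 'n. lborel :: real measure" by standard
  have coord: "T c \<bullet> b = c b" if b: "b \<in> B" for c b
  proof -
    have "T c \<bullet> b = (\<Sum>b'\<in>B. c b' * (b' \<bullet> b))" by (simp add: T_def inner_sum_left)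
    also have "\<dots> = (\<Sum>b'\<in>{b}. c b' * (b' \<bullet> b))"
    proof (rule sum.mono_neutral_right)
      show "\<forall>i\<in>B - {b}. c i * (i \<bullet> b) = 0"
      proof
        fix i assume i: "i \<in> B - {b}"
        then have "orthogonal i b" using pairwiseD[OF B(2), of i b] b by blast
        then show "c i * (i \<bullet> b) = 0" by (simp add: orthogonal_def)
      qed
    qed (use B(5) b in auto)
    also have "\<dots> = c b" using B(3)[OF b] by (simp add: dot_square_norm)
    finally show ?thesis .
  qed
  have "emeasure (subspace_lborel S) (cball 0 R) = emeasure ?P (T -` cball 0 R \<inter> space ?P)"
    unfolding subspace_lborel_eq by (rule emeasure_distr[OF T_measurable]) simp
  also have "\<dots> \<le> emeasure ?P (Pi\<^sub>E B (\<lambda>_. {- R..R}))"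
  proof (rule emeasure_mono)
    show "T -` cball 0 R \<inter> space ?P \<subseteq> Pi\<^sub>E B (\<lambda>_. {- R..R})"
    proof
      fix c assume c: "c \<in> T -` cball 0 R \<inter> space ?P"
      have "c b \<in> {- R..R}" if b: "b \<in> B" for b
      proof -
        have "\<bar>T c \<bullet> b\<bar> \<le> R" using Cauchy_Schwarz_ineq2[of "T c" b] B(3)[OF b] c by simp
        then show ?thesis using coord[OF b, of c] by auto
      qed
      then show "c \<in> Pi\<^sub>E B (\<lambda>_. {- R..R})" using c by (auto simp: space_PiM PiE_iff)
    qed
    show "Pi\<^sub>E B (\<lambda>_. {- R..R}) \<in> sets ?P" using B(5) by (intro sets_PiM_I_finite) auto
  qed
  also have "\<dots> = (\<Prod>b\<in>B. emeasure lborel {- R..R})"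
    using B(5) by (intro emeasure_PiM) auto
  also have "\<dots> < \<infinity>" 
    by (cases "R \<ge> 0") (auto simp: ennreal_power[symmetric] power_less_top_ennreal)
  finally show ?thesis .
qed

end

subsection \<open>Supports and boundary layers\<close>

lemma closed_measure_support:
  fixes \<mu> :: "'a::topological_space measure"
  assumes "space \<mu> = UNIV" shows "closed (measure_support \<mu>)"
proof -
  have "- measure_support \<mu> = \<Union>{U. open U \<and> emeasure \<mu> U = 0}"
    using assms by (auto simp: measure_support_def not_gr_zero)
  then have "open (- measure_support \<mu>)" by (auto intro: open_Union)
  then show ?thesis by (simp add: closed_def)
qed

text \<open>Every point outside the support has a basic open null neighbourhood, and a countable
  basis contains only countably many of these.\<close>

lemma AE_measure_support:
  fixes \<mu> :: "'a::second_countable_topology measure"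
  assumes \<mu>: "sets \<mu> = sets borel" shows "AE x in \<mu>. x \<in> measure_support \<mu>"
proof -
  have sp: "space \<mu> = UNIV" using sets_eq_imp_space_eq[OF \<mu>] by simp
  obtain \<B> :: "'a set set" where \<B>: "countable \<B>" "topological_basis \<B>"
    using ex_countable_basis by blast
  define N where "N = {U \<in> \<B>. emeasure \<mu> U = 0}"
  have "AE x in \<mu>. \<forall>U\<in>N. x \<notin> U"
  proof (subst AE_ball_countable)
    show "countable N" using \<B>(1) by (simp add: N_def)
    show "\<forall>U\<in>N. AE x in \<mu>. x \<notin> U"
    proof
      fix U assume U: "U \<in> N"
      then have "open U" using \<B>(2) by (auto simp: N_def topological_basis_open)
      then show "AE x in \<mu>. x \<notin> U" using U \<mu> by (intro AE_not_in null_setsI) (auto simp: N_def)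
    qed
  qed
  then show ?thesis
  proof eventually_elim
    case (elim x)
    show ?case
      unfolding measure_support_def
    proof (intro CollectI conjI allI impI)
      fix U assume U: "open U \<and> x \<in> U"
      obtain V where V: "V \<in> \<B>" "x \<in> V" "V \<subseteq> U"
        by (rule topological_basisE[OF \<B>(2) conjunct1[OF U] conjunct2[OF U]])
      then have "emeasure \<mu> V \<noteq> 0" using elim by (auto simp: N_def)
      then have "0 < emeasure \<mu> V" by (simp add: zero_less_iff_neq_zero)
      also have "emeasure \<mu> V \<le> emeasure \<mu> U" using V U \<mu> by (intro emeasure_mono) auto
      finally have "0 < emeasure \<mu> U" .
      then show "emeasure \<mu> (U \<inter> space \<mu>) > 0" unfolding sp by simp
    qed (simp add: sp)
  qed
qed

lemma measure_support_subset:
  fixes \<mu> :: "'a::topological_space measure"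
  assumes "sets \<mu> = sets borel" "closed W" "AE x in \<mu>. x \<in> W" shows "measure_support \<mu> \<subseteq> W"
proof
  fix x assume x: "x \<in> measure_support \<mu>"
  have sp: "space \<mu> = UNIV" using sets_eq_imp_space_eq[OF assms(1)] by simp
  show "x \<in> W"
  proof (rule ccontr)
    assume "x \<notin> W"
    then have "emeasure \<mu> (- W) > 0" using x assms(2) by (auto simp: measure_support_def sp)
    moreover have "- W \<in> sets \<mu>" using assms by auto
    moreover have "- W = {x \<in> space \<mu>. \<not> x \<in> W}" by (auto simp: sp)
    ultimately show False using AE_E2[OF assms(3)] by simp
  qed
qed

text \<open>A convex set of the dimension of \<open>S\<close> has \<open>S\<close> as its affine
  hull, so its relative interior, which is nonempty, is an interior within \<open>S\<close>.\<close>

lemma relative_inball: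
  fixes S K :: "(real ^ 'n) set"
  assumes S: "subspace S" "dim S = d" and K: "K \<subseteq> S" "convex K" "aff_dim K = int d"
  shows "\<exists>c\<in>K. \<exists>\<rho>>0. cball c \<rho> \<inter> S \<subseteq> K"
proof -
  have ne: "K \<noteq> {}" using K(3) by auto
  have "affine hull K = S"
  proof (rule affine_dim_equal)
    show "affine S" using S(1) by (rule subspace_imp_affine)
    show "affine hull K \<subseteq> S" using K(1) \<open>affine S\<close> by (rule hull_minimal)
    show "aff_dim (affine hull K) = aff_dim S" using S K by (simp add: aff_dim_subspace)
  qed (use ne in auto)
  moreover obtain c where "c \<in> rel_interior K" using rel_interior_eq_empty[OF K(2)] ne by auto
  ultimately show ?thesis by (auto simp: mem_rel_interior_cball)
qed

text \<open>The layer is \<open>K\<close> minus a copy of \<open>K\<close> shrunk about the centre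
  \<open>c\<close> of an inball. A point of the copy has weight \<open>s\<close> at
  \<open>c\<close>, so by convexity a ball of radius \<open>s * \<rho>\<close> around it stays in
  \<open>K\<close> within \<open>S\<close>. Bernoulli's inequality makes the lost volume linear in
  \<open>s\<close>.\<close>

lemma boundary_layer:
  fixes S K :: "(real ^ 'n) set"
  assumes S: "subspace S" "dim S = d" and K: "K \<subseteq> S" "convex K" "aff_dim K = int d" "compact K"
  shows "\<exists>C\<ge>0. \<forall>r\<ge>0. \<exists>D\<in>sets borel. emeasure (subspace_lborel S) D \<le> ennreal (C * r) \<and> D \<subseteq> K \<and>
    (\<forall>x\<in>K - D. \<forall>y\<in>S. norm (y - x) \<le> r \<longrightarrow> y \<in> K)"
proof -
  let ?\<nu> = "subspace_lborel S"
  obtain c \<rho> where c: "c \<in> K" "\<rho> > 0" "cball c \<rho> \<inter> S \<subseteq> K" using relative_inball[OF S K(1-3)] by blast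
  obtain R where "\<forall>x\<in>K. norm x \<le> R" using compact_imp_bounded[OF K(4)] by (auto simp: bounded_iff)
  then have R: "K \<subseteq> cball 0 R" by auto
  have Kb: "K \<in> sets borel" using K(4) by (simp add: compact_imp_closed borel_closed)
  have "emeasure ?\<nu> K \<le> emeasure ?\<nu> (cball 0 R)" using R by (intro emeasure_mono) (simp_all add: S)
  also have "\<dots> < \<infinity>" by (rule emeasure_subspace_lborel_cball[OF S(1)])
  finally have fin: "emeasure ?\<nu> K = ennreal (measure ?\<nu> K)" by (intro emeasure_eq_ennreal_measure) auto
  define V where "V = measure ?\<nu> K"
  have V: "V \<ge> 0" by (simp add: V_def)
  \<comment> \<open>The summand 1 beside \<open>d\<close> also covers large \<open>r\<close> in
    dimension zero, where all of \<open>K\<close> is taken as the layer.\<close>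
  define C where "C = V * (real d + 1) / \<rho>"
  have "C \<ge> 0" using V c by (simp add: C_def)
  moreover have "\<exists>D\<in>sets borel. emeasure ?\<nu> D \<le> ennreal (C * r) \<and> D \<subseteq> K \<and>
    (\<forall>x\<in>K - D. \<forall>y\<in>S. norm (y - x) \<le> r \<longrightarrow> y \<in> K)" if r: "r \<ge> 0" for r
  proof -
    \<comment> \<open>The amount of shrinking for which \<open>s * \<rho>\<close> equals
      \<open>r\<close>.\<close>
    define s where "s = r / \<rho>"
    have s0: "s \<ge> 0" using r c by (simp add: s_def)
    have Cr: "C * r = V * (real d + 1) * s" by (simp add: C_def s_def)
    show ?thesis
    proof (cases "s < 1")
      case False
      have "V * 1 \<le> V * ((real d + 1) * s)"
        using False V by (intro mult_left_mono mult_ge1_I) auto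
      then have "V \<le> C * r" by (simp add: Cr)
      then have "emeasure ?\<nu> K \<le> ennreal (C * r)" unfolding fin V_def by (rule ennreal_leI)
      then show ?thesis by (intro bexI[of _ K] conjI Kb) simp_all
    next
      case True
      let ?f = "\<lambda>z. s *\<^sub>R c + (1 - s) *\<^sub>R z"
      define K' where "K' = ?f ` K"
      have K'K: "K' \<subseteq> K"
      proof
        fix x assume "x \<in> K'"
        then obtain z where "z \<in> K" "x = s *\<^sub>R c + (1 - s) *\<^sub>R z" by (auto simp: K'_def)
        then show "x \<in> K" using convexD[OF K(2) c(1) \<open>z \<in> K\<close>, of s "1 - s"] s0 True by simp
      qed
      have "compact K'" unfolding K'_def by (intro compact_continuous_image continuous_intros K(4))
      then have K'b: "K' \<in> sets borel" by (simp add: compact_imp_closed borel_closed)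
      have pre: "?f -` K' = K"
      proof -
        have "inj ?f" using True by (auto simp: inj_def)
        then show ?thesis unfolding K'_def by (rule inj_vimage_image_eq)
      qed
      have "s *\<^sub>R c \<in> S" using c(1) K(1) S(1) by (auto intro: subspace_scale)
      from emeasure_subspace_lborel_affine[OF S(1) _ this K'b, of "1 - s"]
      have "emeasure ?\<nu> K' = ennreal ((1 - s) ^ d) * emeasure ?\<nu> K" using True s0 S(2) pre by simp
      also have "\<dots> = ennreal ((1 - s) ^ d * V)" using True unfolding fin V_def[symmetric] by (simp add: ennreal_mult')
      finally have eK': "emeasure ?\<nu> K' = ennreal ((1 - s) ^ d * V)" .
      have "emeasure ?\<nu> (K - K') = emeasure ?\<nu> K - emeasure ?\<nu> K'"
        using K'K Kb K'b eK' by (intro emeasure_Diff) (simp_all add: S)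
      also have "\<dots> = ennreal (V - (1 - s) ^ d * V)"
        unfolding fin V_def[symmetric] eK' using V True by (intro ennreal_minus) simp
      also have "\<dots> \<le> ennreal (C * r)"
      proof (rule ennreal_leI)
        have "1 + real d * (- s) \<le> (1 + (- s)) ^ d" using True by (intro Bernoulli_inequality) simp
        then have "V * (1 - (1 - s) ^ d) \<le> V * (real d * s)" using V by (intro mult_left_mono) auto
        also have "\<dots> \<le> V * ((real d + 1) * s)" using V s0 by (intro mult_left_mono mult_right_mono) auto
        finally show "V - (1 - s) ^ d * V \<le> C * r" by (simp add: Cr algebra_simps)
      qed
      finally have "emeasure ?\<nu> (K - K') \<le> ennreal (C * r)" .
      moreover have *: "y \<in> K" if x: "x \<in> K - (K - K')" and y: "y \<in> S" "norm (y - x) \<le> r" for x y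
      proof (cases "s = 0")
        case True
        then have "r = 0" using c by (simp add: s_def)
        then show ?thesis using x y by simp
      next
        case False
        then have sp: "s > 0" using s0 by simp
        obtain z where z: "z \<in> K" "x = s *\<^sub>R c + (1 - s) *\<^sub>R z" using x by (auto simp: K'_def)
        \<comment> \<open>Obtained by solving \<open>y = s *\<^sub>R w + (1 - s) *\<^sub>R z\<close>
          for \<open>w\<close>: the displacement is magnified by \<open>1 / s\<close>, from
          \<open>r\<close> to the radius of the inball.\<close>
        let ?w = "c + (1 / s) *\<^sub>R (y - x)"
        have "x \<in> S" using x K(1) by auto
        then have "?w \<in> S" using S(1) y c(1) K(1) by (intro subspace_add subspace_scale subspace_diff) auto
        moreover have "norm (?w - c) \<le> \<rho>"
        proof -
          have "norm (?w - c) = norm (y - x) / s" using sp by simp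
          also have "\<dots> \<le> r / s" using y sp by (intro divide_right_mono) auto
          also have "\<dots> = \<rho>"
          proof -
            have "r \<noteq> 0" using sp by (auto simp: s_def)
            then show ?thesis using c(2) by (simp add: s_def)
          qed
          finally show ?thesis .
        qed
        ultimately have "?w \<in> K" using c(3) by (auto simp: dist_norm norm_minus_commute)
        then have "s *\<^sub>R ?w + (1 - s) *\<^sub>R z \<in> K" using K(2) z sp \<open>s < 1\<close> by (intro convexD) auto
        moreover have "s *\<^sub>R ?w + (1 - s) *\<^sub>R z = y" using sp by (simp add: z(2) scaleR_add_right)
        ultimately show ?thesis by simp
      qed
      ultimately show ?thesis
        by (intro bexI[of _ "K - K'"] conjI sets.Diff Kb K'b ballI impI) (assumption, blast, blast)
    qed
  qed
  ultimately show ?thesis by blast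
qed

text \<open>A segment in \<open>S\<close> from \<open>x\<close> to a point outside \<open>K\<close>
  would meet the relative frontier, at distance less than \<epsilon> from \<open>x\<close>.\<close>

lemma inner_part_ball:
  fixes S K :: "(real ^ 'n) set"
  assumes S: "subspace S" and K: "K \<subseteq> S" and x: "x \<in> inner_part_in S K \<epsilon>"
    and y: "y \<in> S" "norm (y - x) < \<epsilon>"
  shows "y \<in> K"
proof (rule ccontr)
  assume yK: "y \<notin> K"
  have xK: "x \<in> K" and inf: "infdist x (top_of_set S frontier_of K) \<ge> \<epsilon>"
    using x by (auto simp: inner_part_in_def)
  have "connectedin (top_of_set S) (closed_segment x y)"
  proof -
    have "closed_segment x y \<subseteq> S"
      using K xK y by (intro closed_segment_subset subspace_imp_convex[OF S]) auto
    then show ?thesis by (simp add: connectedin_subtopology)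
  qed
  moreover have "closed_segment x y \<inter> K \<noteq> {}" "closed_segment x y - K \<noteq> {}" using xK yK by auto
  ultimately have "closed_segment x y \<inter> (top_of_set S frontier_of K) \<noteq> {}"
    by (rule connectedin_Int_frontier_of)
  then obtain z where z: "z \<in> closed_segment x y" "z \<in> top_of_set S frontier_of K" by blast
  have "infdist x (top_of_set S frontier_of K) \<le> dist x z" using z(2) by (rule infdist_le)
  also have "\<dots> \<le> dist x y" using z(1) by (metis dist_in_closed_segment dist_commute)
  finally show False using inf y(2) by (simp add: dist_norm norm_minus_commute)
qed

subsection \<open>Bias of a single tree\<close>

text \<open>By the joint measurability of \<open>same_cell\<close>, numerator and denominator are
  parameter integrals of jointly measurable functions.\<close>

lemma cell_average_measurable:
  fixes F :: "real ^ 'n \<Rightarrow> real"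
  assumes \<mu>: "prob_space \<mu>" "sets \<mu> = sets borel" and F: "F \<in> borel_measurable borel"
  shows "(\<lambda>p. cell_average \<mu> F (snd p) (fst p)) \<in> borel_measurable (borel \<Otimes>\<^sub>M void_space)"
proof -
  interpret prob_space \<mu> by fact
  let ?N = "borel \<Otimes>\<^sub>M void_space :: ((real ^ 'n) \<times> (real ^ 'n) set set) measure"
  have s: "sets (?N \<Otimes>\<^sub>M \<mu>) = sets (?N \<Otimes>\<^sub>M borel)" by (intro sets_pair_measure_cong \<mu> refl)
  have "Measurable.pred (?N \<Otimes>\<^sub>M \<mu>) (\<lambda>p. same_cell (snd (fst p)) (fst (fst p)) (snd p))"
    using same_cell_triple_measurable unfolding measurable_cong_sets[OF s refl] .
  note [measurable] = this
  have [measurable]: "F \<in> borel_measurable \<mu>" using F unfolding measurable_cong_sets[OF \<mu>(2) refl] .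
  have "(\<lambda>p. indicator {y. same_cell (snd (fst p)) (fst (fst p)) y} (snd p) * F (snd p)) =
      (\<lambda>p. if same_cell (snd (fst p)) (fst (fst p)) (snd p) then F (snd p) else 0)"
    by (auto simp: indicator_def)
  also have "\<dots> \<in> borel_measurable (?N \<Otimes>\<^sub>M \<mu>)" by measurable
  finally have "(\<lambda>(p, y). indicator {y. same_cell (snd p) (fst p) y} y * F y) \<in> borel_measurable (?N \<Otimes>\<^sub>M \<mu>)"
    by (simp only: case_prod_unfold)
  then have 1: "(\<lambda>p. \<integral>y. indicator {y. same_cell (snd p) (fst p) y} y * F y \<partial>\<mu>) \<in> borel_measurable ?N"
    by (rule borel_measurable_lebesgue_integral)
  have 2: "(\<lambda>p. measure \<mu> {y. same_cell (snd p) (fst p) y}) \<in> borel_measurable ?N"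
  proof -
    have "(\<lambda>p. enn2real (cell_mass \<mu> (snd p) (fst p))) \<in> borel_measurable ?N"
      using cell_mass_measurable[OF sigma_finite_measure_axioms \<mu>(2)] by measurable
    then show ?thesis by (simp only: cell_mass_def measure_def)
  qed
  show ?thesis unfolding cell_average_def using 1 2 by (rule borel_measurable_divide)
qed

lemma cell_average_config_measurable:
  fixes F :: "real ^ 'n \<Rightarrow> real"
  assumes \<mu>: "prob_space \<mu>" "sets \<mu> = sets borel" and F: "F \<in> borel_measurable borel"
  shows "(\<lambda>h. cell_average \<mu> F h x) \<in> borel_measurable void_space"
proof -
  have "(\<lambda>h. (x, h)) \<in> void_space \<rightarrow>\<^sub>M borel \<Otimes>\<^sub>M void_space"
    by (intro measurable_Pair measurable_const measurable_ident) simp_all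
  from measurable_compose[OF this cell_average_measurable[OF \<mu> F]] show ?thesis by simp
qed

text \<open>Off the hyperplanes a whole ball around \<open>x\<close> belongs to its cell, and balls
  around points of the support have positive mass. At such points the cell average is a genuine
  mean.\<close>

lemma support_cell_mass_pos:
  assumes \<mu>: "finite_measure \<mu>" "sets \<mu> = sets borel" and h: "h \<in> hyperplane_configs"
    and x: "x \<in> measure_support \<mu>" "same_cell h x x"
  shows "measure \<mu> {y. same_cell h x y} > 0"
proof -
  interpret finite_measure \<mu> by fact
  have sp: "space \<mu> = UNIV" using sets_eq_imp_space_eq[OF \<mu>(2)] by simp
  have "x \<in> - \<Union>h" using x(2) by (auto simp: same_cell_def)
  from openE[OF open_complement_config[OF h] this]
  obtain r where r: "r > 0" "ball x r \<subseteq> - \<Union>h" by blast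
  have "ball x r \<subseteq> {y. same_cell h x y}"
  proof
    fix y assume y: "y \<in> ball x r"
    then have "closed_segment x y \<subseteq> ball x r" using r by (intro closed_segment_subset) auto
    then show "y \<in> {y. same_cell h x y}" using r(2) by (auto simp: same_cell_def)
  qed
  moreover have "{y. same_cell h x y} \<in> sets \<mu>" using same_cell_sets(1)[OF h, of x] by (simp only: \<mu>(2))
  ultimately have "emeasure \<mu> (ball x r) \<le> emeasure \<mu> {y. same_cell h x y}" by (rule emeasure_mono)
  moreover have "emeasure \<mu> (ball x r) > 0" using x(1) r(1) by (auto simp: measure_support_def sp)
  ultimately have "emeasure \<mu> {y. same_cell h x y} > 0" by (rule less_le_trans[rotated])
  then show ?thesis by (simp add: emeasure_eq_measure)
qed

lemma abs_integral_le_weighted: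
  fixes g w :: "'a \<Rightarrow> real"
  assumes "integrable M w" "g \<in> borel_measurable M" "AE y in M. \<bar>g y\<bar> \<le> c * w y"
  shows "integrable M g" "\<bar>\<integral>y. g y \<partial>M\<bar> \<le> c * (\<integral>y. w y \<partial>M)"
proof -
  have cw: "integrable M (\<lambda>y. c * w y)" using assms(1) by simp
  show g: "integrable M g"
    by (rule Bochner_Integration.integrable_bound[OF cw assms(2)]) (use assms(3) in \<open>auto elim: eventually_mono\<close>)
  have "\<bar>\<integral>y. g y \<partial>M\<bar> \<le> (\<integral>y. \<bar>g y\<bar> \<partial>M)" by (rule integral_abs_bound)
  also have "\<dots> \<le> (\<integral>y. c * w y \<partial>M)" using g cw assms(3) by (intro integral_mono_AE) auto
  finally show "\<bar>\<integral>y. g y \<partial>M\<bar> \<le> c * (\<integral>y. w y \<partial>M)" by simp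
qed

text \<open>As the cell has positive mass, the bias at \<open>x\<close> is the mean of
  \<open>F y - F x\<close> over the cell, to which only points of \<open>W\<close>
  contribute.\<close>

lemma cell_average_local:
  fixes F :: "real ^ 'n \<Rightarrow> real"
  assumes \<mu>: "prob_space \<mu>" "sets \<mu> = sets borel" "AE y in \<mu>. y \<in> W"
    and F: "F \<in> borel_measurable borel" "\<And>y. \<bar>F y\<bar> \<le> L"
    and h: "h \<in> hyperplane_configs" and x: "x \<in> measure_support \<mu>" "same_cell h x x"
    and e: "\<And>y. y \<in> W \<Longrightarrow> same_cell h x y \<Longrightarrow> \<bar>F y - F x\<bar> \<le> e"
  shows "\<bar>cell_average \<mu> F h x - F x\<bar> \<le> e"
proof -
  interpret prob_space \<mu> by fact
  let ?Z = "{y. same_cell h x y}"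
  have Z: "?Z \<in> sets \<mu>" using same_cell_sets(1)[OF h, of x] by (simp only: \<mu>(2))
  have Fm: "F \<in> borel_measurable \<mu>" using F(1) unfolding measurable_cong_sets[OF \<mu>(2) refl] .
  have p: "prob ?Z > 0" by (rule support_cell_mass_pos[OF finite_measure_axioms \<mu>(2) h x])
  have iZ: "integrable \<mu> (indicator ?Z :: _ \<Rightarrow> real)"
    using Z by (intro integrable_real_indicator) (simp_all add: less_top[symmetric])
  have iF: "integrable \<mu> (\<lambda>y. indicator ?Z y * F y)"
  proof (rule abs_integral_le_weighted(1)[OF iZ])
    show "(\<lambda>y. indicator ?Z y * F y) \<in> borel_measurable \<mu>"
      by (rule borel_measurable_times[OF borel_measurable_indicator[OF Z] Fm])
    show "AE y in \<mu>. \<bar>indicator ?Z y * F y\<bar> \<le> L * indicator ?Z y"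
      using F(2) by (intro AE_I2) (simp add: indicator_def)
  qed
  have "(\<integral>y. indicator ?Z y * F y \<partial>\<mu>) - F x * prob ?Z = (\<integral>y. indicator ?Z y * F y \<partial>\<mu>) - (\<integral>y. F x * indicator ?Z y \<partial>\<mu>)"
    using Z by simp
  also have "\<dots> = (\<integral>y. indicator ?Z y * F y - F x * indicator ?Z y \<partial>\<mu>)"
    using iF iZ by (intro Bochner_Integration.integral_diff[symmetric]) simp_all
  also have "\<bar>\<dots>\<bar> \<le> e * (\<integral>y. indicator ?Z y \<partial>\<mu>)"
  proof (rule abs_integral_le_weighted(2)[OF iZ])
    show "(\<lambda>y. indicator ?Z y * F y - F x * indicator ?Z y) \<in> borel_measurable \<mu>"
      by (intro borel_measurable_diff borel_measurable_times borel_measurable_indicator Z Fm borel_measurable_const)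
    show "AE y in \<mu>. \<bar>indicator ?Z y * F y - F x * indicator ?Z y\<bar> \<le> e * indicator ?Z y"
      using \<mu>(3) by eventually_elim (use e in \<open>auto simp: indicator_def\<close>)
  qed
  also have "(\<integral>y. indicator ?Z y \<partial>\<mu>) = prob ?Z" using Z by simp
  finally have "\<bar>(\<integral>y. indicator ?Z y * F y \<partial>\<mu>) - F x * prob ?Z\<bar> \<le> e * prob ?Z" .
  moreover have "cell_average \<mu> F h x - F x = ((\<integral>y. indicator ?Z y * F y \<partial>\<mu>) - F x * prob ?Z) / prob ?Z"
    using p by (simp add: cell_average_def diff_divide_distrib)
  ultimately show ?thesis using p by (simp add: abs_divide divide_le_eq)
qed

lemma summable_square_exp:
  fixes p :: real
  assumes p: "p > 0" shows "summable (\<lambda>k. (real k + 1)\<^sup>2 * exp (- p * real k))"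
proof (rule summable_comparison_test')
  \<comment> \<open>Each factor \<open>real k + 1\<close> is paid for with a quarter of the decay
    rate, so half of it is left for the geometric series.\<close>
  show "summable (\<lambda>k. (1 + 4 / p)\<^sup>2 * exp (- p / 2) ^ k)"
    using p by (intro summable_mult summable_geometric) simp
  fix k :: nat
  have "real k + 1 \<le> (1 + 4 / p) * exp (p * k / 4)"
  proof -
    have 1: "1 + p * k / 4 \<le> exp (p * k / 4)" by (rule exp_ge_add_one_self)
    then have "p * k / 4 \<le> exp (p * k / 4)" by linarith
    then have "(4 / p) * (p * k / 4) \<le> (4 / p) * exp (p * k / 4)" using p by (intro mult_left_mono) auto
    moreover have "(4 / p) * (p * k / 4) = real k" using p by simp
    moreover have "1 \<le> exp (p * k / 4)" using p by simp
    ultimately show ?thesis unfolding distrib_right by linarith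
  qed
  then have "(real k + 1)\<^sup>2 \<le> ((1 + 4 / p) * exp (p * k / 4))\<^sup>2" by (intro power_mono) auto
  also have "\<dots> = (1 + 4 / p)\<^sup>2 * exp (p * k / 2)"
    by (simp add: power_mult_distrib power2_eq_square[of "exp _"] exp_add[symmetric])
  finally have "(real k + 1)\<^sup>2 * exp (- p * real k) \<le> (1 + 4 / p)\<^sup>2 * exp (p * k / 2) * exp (- p * real k)"
    by (intro mult_right_mono) auto
  also have "\<dots> = (1 + 4 / p)\<^sup>2 * exp (- p / 2) ^ k"
    by (simp add: exp_of_nat_mult[symmetric] mult.assoc exp_add[symmetric] algebra_simps)
  finally show "norm ((real k + 1)\<^sup>2 * exp (- p * real k)) \<le> (1 + 4 / p)\<^sup>2 * exp (- p / 2) ^ k" by simp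
qed

text \<open>The Hoelder bound at each radius scale is summed against the exponential weights. The
  exponent \<gamma> is left free because it is \<beta> for the class of order 0 and 1 for the class
  of order 1, whose members are Lipschitz on a convex \<open>W\<close>.\<close>

lemma bias_second_moment:
  fixes F :: "real ^ 'n \<Rightarrow> real"
  assumes \<phi>: "directional_distribution \<phi>"
    and \<mu>: "prob_space \<mu>" "sets \<mu> = sets borel" "AE y in \<mu>. y \<in> W"
    and F: "F \<in> borel_measurable borel" "\<And>y. \<bar>F y\<bar> \<le> L"
    and \<gamma>: "0 < \<gamma>" "\<gamma> \<le> 1" and G: "G \<ge> 0"
    and hold: "\<And>x y. x \<in> W \<Longrightarrow> y \<in> W \<Longrightarrow> \<bar>F y - F x\<bar> \<le> G * norm (y - x) powr \<gamma>"
  shows "\<exists>C\<ge>0. \<forall>lam Q x. lam > 0 \<longrightarrow> void_law \<phi> lam Q \<longrightarrow> x \<in> W \<inter> measure_support \<mu> \<longrightarrow>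
    (\<integral>\<^sup>+h. ennreal ((cell_average \<mu> F h x - F x)\<^sup>2) \<partial>Q) \<le> ennreal (C * lam powr (- 2 * \<gamma>))"
proof -
  obtain c K p where c: "c > 0" "K > 0" "p > 0" and "\<forall>lam Q x F g. lam > 0 \<longrightarrow> void_law \<phi> lam Q \<longrightarrow>
      (\<forall>h\<in>hyperplane_configs. \<forall>k::nat.
         (\<forall>y. same_cell h x y \<longrightarrow> norm (y - x) \<le> c * ((real k + 1) / lam)) \<longrightarrow> F h \<le> g k) \<longrightarrow>
      (\<integral>\<^sup>+ h. F h \<partial>Q) \<le> (\<Sum>k. g k * ennreal (K * exp (- p * real k)))"
    using cell_radius_expectation[OF \<phi>] by (elim exE conjE) (rule that, assumption+)
  note tail = this(4)[rule_format]
  define s where "s = (\<Sum>k. (real k + 1)\<^sup>2 * exp (- p * real k))"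
  have sm: "summable (\<lambda>k. (real k + 1)\<^sup>2 * exp (- p * real k))" by (rule summable_square_exp[OF c(3)])
  define C where "C = G\<^sup>2 * c powr (2 * \<gamma>) * K * s"
  have "s \<ge> 0" unfolding s_def by (intro suminf_nonneg sm) simp
  then have C: "C \<ge> 0" using c by (simp add: C_def)
  show ?thesis
  proof (intro exI[of _ C] conjI C allI impI)
    fix lam :: real and Q x assume lam: "lam > 0" and Q: "void_law \<phi> lam Q" and x: "x \<in> W \<inter> measure_support \<mu>"
    define A where "A = G\<^sup>2 * (c / lam) powr (2 * \<gamma>)"
    have "(\<integral>\<^sup>+h. ennreal ((cell_average \<mu> F h x - F x)\<^sup>2) \<partial>Q) \<le>
        (\<integral>\<^sup>+h. (if same_cell h x x then ennreal ((cell_average \<mu> F h x - F x)\<^sup>2) else 0) \<partial>Q)"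
      using void_law_same_cell_self[OF Q \<phi>, of x]
      by (intro nn_integral_mono_AE) (auto elim: eventually_mono)
    also have "\<dots> \<le> (\<Sum>k. ennreal (A * (real k + 1)\<^sup>2) * ennreal (K * exp (- p * real k)))"
    proof (rule tail[OF lam Q])
      fix h and k :: nat
      assume h: "h \<in> hyperplane_configs" and R: "\<And>y. same_cell h x y \<Longrightarrow> norm (y - x) \<le> c * ((real k + 1) / lam)"
      let ?R = "c * ((real k + 1) / lam)"
      show "(if same_cell h x x then ennreal ((cell_average \<mu> F h x - F x)\<^sup>2) else 0) \<le> ennreal (A * (real k + 1)\<^sup>2)"
      proof (cases "same_cell h x x")
        case True
        have R0: "?R > 0" using c lam by simp
        have "\<bar>cell_average \<mu> F h x - F x\<bar> \<le> G * ?R powr \<gamma>"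
        proof (rule cell_average_local[OF \<mu> F h _ True])
          fix y assume y: "y \<in> W" "same_cell h x y"
          have "\<bar>F y - F x\<bar> \<le> G * norm (y - x) powr \<gamma>" using hold x y by blast
          also have "\<dots> \<le> G * ?R powr \<gamma>" using R y G \<gamma> by (intro mult_left_mono powr_mono2) auto
          finally show "\<bar>F y - F x\<bar> \<le> G * ?R powr \<gamma>" .
        qed (use x in auto)
        then have "(cell_average \<mu> F h x - F x)\<^sup>2 \<le> (G * ?R powr \<gamma>)\<^sup>2"
          by (metis abs_ge_zero power2_abs power_mono)
        also have "\<dots> = G\<^sup>2 * ((c / lam) * (real k + 1)) powr (2 * \<gamma>)"
        proof -
          have "?R = (c / lam) * (real k + 1)" by simp
          then show ?thesis
            by (simp only: power_mult_distrib power2_eq_square[of "_ powr _"] powr_add[symmetric] mult_2)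
        qed
        also have "\<dots> = A * (real k + 1) powr (2 * \<gamma>)"
        proof -
          have "((c / lam) * (real k + 1)) powr (2 * \<gamma>) = (c / lam) powr (2 * \<gamma>) * (real k + 1) powr (2 * \<gamma>)"
            by (rule powr_mult)
          then show ?thesis by (simp only: A_def mult.assoc)
        qed
        also have "\<dots> \<le> A * (real k + 1) powr 2"
          using \<gamma> by (intro mult_left_mono powr_mono) (auto simp: A_def)
        also have "\<dots> = A * (real k + 1)\<^sup>2" by simp
        finally show ?thesis using True by (simp add: ennreal_leI)
      qed simp
    qed
    also have "\<dots> = (\<Sum>k. ennreal (A * K * ((real k + 1)\<^sup>2 * exp (- p * real k))))"
      using c by (intro suminf_cong) (simp add: A_def ennreal_mult'[symmetric] mult_ac)
    also have "\<dots> = ennreal (\<Sum>k. A * K * ((real k + 1)\<^sup>2 * exp (- p * real k)))"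
      using c sm by (intro suminf_ennreal2 summable_mult) (auto simp: A_def)
    also have "(\<Sum>k. A * K * ((real k + 1)\<^sup>2 * exp (- p * real k))) = A * K * s"
      unfolding s_def by (rule suminf_mult[OF sm])
    also have "A * K * s = C * lam powr (- 2 * \<gamma>)"
    proof -
      have 1: "(c / lam) powr (2 * \<gamma>) = c powr (2 * \<gamma>) / lam powr (2 * \<gamma>)"
        using c lam by (simp add: powr_divide)
      have 2: "lam powr (- 2 * \<gamma>) = 1 / lam powr (2 * \<gamma>)" using powr_minus_divide[of lam "2 * \<gamma>"] by simp
      show ?thesis unfolding A_def C_def 1 2 by simp
    qed
    finally show "(\<integral>\<^sup>+h. ennreal ((cell_average \<mu> F h x - F x)\<^sup>2) \<partial>Q) \<le> ennreal (C * lam powr (- 2 * \<gamma>))" .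
  qed
qed

subsection \<open>Cancellation of the linear term by reflection\<close>

text \<open>With \<open>a\<close>, \<open>a'\<close> the density on the cell and its reflection, the linear part of the regression
  function has opposite signs on the two cells, and the two normalized densities differ by a relative
  error of the order of the radius.\<close>

lemma reflected_bias_sum:
  fixes F p :: "real ^ 'n \<Rightarrow> real" and K S :: "(real ^ 'n) set"
  assumes S: "subspace S" and \<mu>: "prob_space \<mu>" "\<mu> = density (subspace_lborel S) (\<lambda>y. ennreal (indicator K y * p y))"
    and q: "(\<lambda>y. indicator K y * p y) \<in> borel_measurable borel"
    and p: "pmin > 0" "\<And>y. y \<in> K \<Longrightarrow> pmin \<le> p y" "\<And>y z. y \<in> K \<Longrightarrow> z \<in> K \<Longrightarrow> \<bar>p y - p z\<bar> \<le> Cp * norm (y - z)"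
    and F: "F \<in> borel_measurable borel" "\<And>y. \<bar>F y\<bar> \<le> L"
    and G: "G \<ge> 0" "\<And>y. y \<in> K \<Longrightarrow> \<bar>F y - F x\<bar> \<le> G * norm (y - x)"
    and sd: "\<And>y. y \<in> K \<Longrightarrow> 2 *\<^sub>R x - y \<in> K \<Longrightarrow> \<bar>F y + F (2 *\<^sub>R x - y) - 2 * F x\<bar> \<le> C1 * norm (y - x) powr (1 + \<beta>)"
    and h: "h \<in> hyperplane_configs" and x: "x \<in> S" "x \<in> measure_support \<mu>" "same_cell h x x"
    and R: "R \<ge> 0" "\<And>y. y \<in> S \<Longrightarrow> same_cell h x y \<Longrightarrow> norm (y - x) \<le> R \<and> y \<in> K \<and> 2 *\<^sub>R x - y \<in> K"
    and C: "Cp \<ge> 0" "C1 \<ge> 0" "\<beta> > 0"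
  shows "\<bar>(cell_average \<mu> F h x - F x) + (cell_average \<mu> F (reflect_config x h) x - F x)\<bar>
    \<le> C1 * R powr (1 + \<beta>) + 4 * G * Cp / pmin * R\<^sup>2"
proof -
  interpret prob_space \<mu> by fact
  let ?\<nu> = "subspace_lborel S" and ?r = "\<lambda>y. 2 *\<^sub>R x - y" and ?h' = "reflect_config x h"
  define q' where "q' = (\<lambda>y. indicator K y * p y)"
  note s\<nu> = sets_subspace_lborel[OF S]
  have s\<mu>: "sets \<mu> = sets borel" unfolding \<mu>(2) by (simp add: s\<nu>)
  have sp\<mu>: "space \<mu> = UNIV" using sets_eq_imp_space_eq[OF s\<mu>] by simp
  have h': "?h' \<in> hyperplane_configs" by (rule reflect_config_configs[OF h])
  have x': "same_cell ?h' x x" using x(3) by (simp add: same_cell_reflect_config scaleR_2)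
  let ?Z = "{y. same_cell h x y}" and ?Z' = "{y. same_cell ?h' x y}"
  have Z [measurable]: "?Z \<in> sets borel" "?Z' \<in> sets borel" by (rule same_cell_sets[OF h], rule same_cell_sets[OF h'])
  have Zr: "indicator ?Z' y = (indicator ?Z (?r y) :: real)" for y
    by (simp add: indicator_def same_cell_reflect_config)
  have rr: "?r (?r y) = y" for y by simp
  have q'm [measurable]: "q' \<in> borel_measurable borel" using q by (simp only: q'_def)
  note [measurable] = F(1)
  have q0: "q' y \<ge> 0" for y using p(1) p(2)[of y] by (cases "y \<in> K") (auto simp: q'_def)
  have r\<nu>: "?r \<in> ?\<nu> \<rightarrow>\<^sub>M borel" unfolding measurable_cong_sets[OF s\<nu> refl] by measurable
  have m\<nu>: "g \<in> borel_measurable ?\<nu>" if "g \<in> borel_measurable borel" for g :: "real ^ 'n \<Rightarrow> real"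
    using that unfolding measurable_cong_sets[OF s\<nu> refl] .
  have int_\<mu>: "(\<integral>y. g y \<partial>\<mu>) = (\<integral>y. q' y * g y \<partial>?\<nu>)" if "g \<in> borel_measurable borel" for g :: "real ^ 'n \<Rightarrow> real"
    unfolding \<mu>(2) using q0 by (subst integral_density) (use m\<nu>[OF that] m\<nu>[OF q'm] in \<open>simp_all add: q'_def\<close>)
  have int_r: "(\<integral>y. g y \<partial>?\<nu>) = (\<integral>y. g (?r y) \<partial>?\<nu>)" if "g \<in> borel_measurable borel" for g :: "real ^ 'n \<Rightarrow> real"
    using integral_distr[OF r\<nu> that] by (simp only: distr_subspace_lborel_reflect[OF S x(1)])
  have qi: "integrable ?\<nu> q'"
  proof (rule integrableI_nonneg)
    have "(\<integral>\<^sup>+y. ennreal (q' y) \<partial>?\<nu>) = emeasure \<mu> UNIV"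
      unfolding \<mu>(2) q'_def using m\<nu>[OF q] by (subst emeasure_density) (simp_all add: s\<nu>)
    then show "(\<integral>\<^sup>+y. ennreal (q' y) \<partial>?\<nu>) < \<infinity>" using emeasure_space_1 by (simp add: sp\<mu>)
  qed (use q0 m\<nu>[OF q'm] in auto)
  have qri: "integrable ?\<nu> (\<lambda>y. q' (?r y))"
  proof -
    have "integrable (distr ?\<nu> borel ?r) q'" by (simp only: distr_subspace_lborel_reflect[OF S x(1)] qi)
    then show ?thesis by (subst (asm) integrable_distr_eq[OF r\<nu> q'm])
  qed
  define a where "a = (\<lambda>y. indicator ?Z y * q' y)"
  define a' where "a' = (\<lambda>y. indicator ?Z y * q' (?r y))"
  have am [measurable]: "a \<in> borel_measurable borel" "a' \<in> borel_measurable borel"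
    unfolding a_def a'_def by measurable
  have a0: "a y \<ge> 0" "a' y \<ge> 0" for y using q0 by (auto simp: a_def a'_def)
  have ai: "integrable ?\<nu> a"
    by (rule abs_integral_le_weighted(1)[OF qi m\<nu>[OF am(1)], where c=1]) (auto simp: a_def indicator_def q0 intro!: AE_I2)
  have ai': "integrable ?\<nu> a'"
    by (rule abs_integral_le_weighted(1)[OF qri m\<nu>[OF am(2)], where c=1]) (auto simp: a'_def indicator_def q0 intro!: AE_I2)
  define P where "P = (\<integral>y. a y \<partial>?\<nu>)"
  define P' where "P' = (\<integral>y. a' y \<partial>?\<nu>)"
  have mZ: "measure \<mu> ?Z = P"
  proof -
    have "measure \<mu> ?Z = (\<integral>y. indicator ?Z y \<partial>\<mu>)" using Z s\<mu> by simp
    also have "\<dots> = (\<integral>y. q' y * indicator ?Z y \<partial>?\<nu>)" by (rule int_\<mu>) measurable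
    finally show ?thesis by (simp add: P_def a_def mult.commute)
  qed
  have mZ': "measure \<mu> ?Z' = P'"
  proof -
    have "measure \<mu> ?Z' = (\<integral>y. indicator ?Z' y \<partial>\<mu>)" using Z s\<mu> by simp
    also have "\<dots> = (\<integral>y. q' y * indicator ?Z' y \<partial>?\<nu>)" by (rule int_\<mu>) measurable
    also have "\<dots> = (\<integral>y. q' (?r y) * indicator ?Z' (?r y) \<partial>?\<nu>)" by (rule int_r) measurable
    finally show ?thesis unfolding Zr rr by (simp only: P'_def a'_def mult.commute)
  qed
  have P: "P > 0" "P' > 0"
    using support_cell_mass_pos[OF finite_measure_axioms s\<mu> h x(2,3)]
      support_cell_mass_pos[OF finite_measure_axioms s\<mu> h' x(2) x'] mZ mZ' by auto
  have nZ: "(\<integral>y. indicator ?Z y * F y \<partial>\<mu>) = (\<integral>y. a y * F y \<partial>?\<nu>)"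
  proof -
    have "(\<integral>y. indicator ?Z y * F y \<partial>\<mu>) = (\<integral>y. q' y * (indicator ?Z y * F y) \<partial>?\<nu>)" by (rule int_\<mu>) measurable
    then show ?thesis by (simp only: a_def mult_ac)
  qed
  have nZ': "(\<integral>y. indicator ?Z' y * F y \<partial>\<mu>) = (\<integral>y. a' y * F (?r y) \<partial>?\<nu>)"
  proof -
    have "(\<integral>y. indicator ?Z' y * F y \<partial>\<mu>) = (\<integral>y. q' y * (indicator ?Z' y * F y) \<partial>?\<nu>)" by (rule int_\<mu>) measurable
    also have "\<dots> = (\<integral>y. q' (?r y) * (indicator ?Z' (?r y) * F (?r y)) \<partial>?\<nu>)" by (rule int_r) measurable
    finally show ?thesis unfolding Zr rr by (simp only: a'_def mult_ac)
  qed
  have L: "L \<ge> 0" using F(2)[of 0] by linarith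
  have bi: "integrable ?\<nu> (\<lambda>y. w y * g y)" if "integrable ?\<nu> w" "w \<in> borel_measurable borel" "\<And>y. w y \<ge> 0"
    "g \<in> borel_measurable borel" "\<And>y. \<bar>g y\<bar> \<le> B" for w g :: "real ^ 'n \<Rightarrow> real" and B
  proof (rule abs_integral_le_weighted(1)[OF that(1) m\<nu>])
    show "(\<lambda>y. w y * g y) \<in> borel_measurable borel" using that(2,4) by (rule borel_measurable_times)
    show "AE y in ?\<nu>. \<bar>w y * g y\<bar> \<le> B * w y"
    proof (rule AE_I2)
      fix y
      have "w y * \<bar>g y\<bar> \<le> w y * B" by (rule mult_left_mono[OF that(5) that(3)])
      then show "\<bar>w y * g y\<bar> \<le> B * w y" using that(3)[of y] by (simp add: abs_mult mult.commute)
    qed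
  qed
  define u where "u = (\<lambda>y. F (?r y) - F x)"
  have um [measurable]: "u \<in> borel_measurable borel" unfolding u_def by measurable
  have ub: "\<bar>u y\<bar> \<le> 2 * L" for y using F(2)[of "?r y"] F(2)[of x] unfolding u_def by linarith
  have iaF: "integrable ?\<nu> (\<lambda>y. a y * F y)" by (rule bi[OF ai am(1) a0(1) F])
  have iau: "integrable ?\<nu> (\<lambda>y. a y * u y)" by (rule bi[OF ai am(1) a0(1) um ub])
  have iau': "integrable ?\<nu> (\<lambda>y. a' y * u y)" by (rule bi[OF ai' am(2) a0(2) um ub])
  \<comment> \<open>\<open>X\<close> and \<open>X'\<close> integrate the same increment of
    \<open>F\<close>, taken at the mirror point, against the two densities; \<open>T\<close>
    collects the symmetric second difference. Together they replace an explicit linear part of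
    \<open>F\<close>.\<close>
  define X where "X = (\<integral>y. a y * u y \<partial>?\<nu>)"
  define X' where "X' = (\<integral>y. a' y * u y \<partial>?\<nu>)"
  define T where "T = (\<integral>y. a y * (F y + F (?r y) - 2 * F x) \<partial>?\<nu>)"
  have nF: "(\<integral>y. a y * F y \<partial>?\<nu>) = T - X + F x * P"
  proof -
    have "(\<integral>y. a y * F y \<partial>?\<nu>) + X - F x * P = (\<integral>y. a y * F y + a y * u y - F x * a y \<partial>?\<nu>)"
      unfolding X_def P_def using iaF iau ai by simp
    also have "\<dots> = T" unfolding T_def u_def by (intro Bochner_Integration.integral_cong refl) (simp add: algebra_simps)
    finally show ?thesis by simp
  qed
  have nF': "(\<integral>y. a' y * F (?r y) \<partial>?\<nu>) = X' + F x * P'"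
  proof -
    have "X' + F x * P' = (\<integral>y. a' y * u y + F x * a' y \<partial>?\<nu>)"
      unfolding X'_def P'_def using iau' ai' by simp
    also have "\<dots> = (\<integral>y. a' y * F (?r y) \<partial>?\<nu>)"
      unfolding u_def by (intro Bochner_Integration.integral_cong refl) (simp add: algebra_simps)
    finally show ?thesis by simp
  qed
  \<comment> \<open>Besides the second difference only \<open>X' - X\<close> and
    \<open>P - P'\<close> remain, and both are differences between the density and its mirror image,
    which gains a further factor of order \<open>R\<close>.\<close>
  have sum: "(cell_average \<mu> F h x - F x) + (cell_average \<mu> F ?h' x - F x) = T / P + ((X' - X) / P' + X / P * ((P - P') / P'))"
  proof -
    have "cell_average \<mu> F h x = (T - X + F x * P) / P" "cell_average \<mu> F ?h' x = (X' + F x * P') / P'"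
      unfolding cell_average_def mZ mZ' nZ nZ' nF nF' by auto
    then have "(cell_average \<mu> F h x - F x) + (cell_average \<mu> F ?h' x - F x) = (T - X) / P + X' / P'"
      using P by (simp add: add_divide_distrib)
    also have "\<dots> = T / P + ((X' - X) / P' + X / P * ((P - P') / P'))"
      using P by (simp add: field_simps)
    finally show ?thesis .
  qed
  have AES: "AE y in ?\<nu>. y \<in> S" by (rule AE_subspace_lborel[OF S])
  have near: "norm (y - x) \<le> R" "y \<in> K" "?r y \<in> K" if "y \<in> S" "y \<in> ?Z" for y using R(2) that by auto
  have T: "\<bar>T\<bar> \<le> (C1 * R powr (1 + \<beta>)) * P"
    unfolding T_def P_def
  proof (rule abs_integral_le_weighted(2)[OF ai m\<nu>])
    show "AE y in ?\<nu>. \<bar>a y * (F y + F (?r y) - 2 * F x)\<bar> \<le> (C1 * R powr (1 + \<beta>)) * a y"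
      using AES
    proof eventually_elim
      case (elim y)
      show ?case
      proof (cases "y \<in> ?Z")
        case True
        have "\<bar>F y + F (?r y) - 2 * F x\<bar> \<le> C1 * norm (y - x) powr (1 + \<beta>)" using near[OF elim True] sd by blast
        also have "\<dots> \<le> C1 * R powr (1 + \<beta>)" using near[OF elim True] C by (intro mult_left_mono powr_mono2) auto
        finally have "a y * \<bar>F y + F (?r y) - 2 * F x\<bar> \<le> a y * (C1 * R powr (1 + \<beta>))" using a0(1) by (rule mult_left_mono)
        then show ?thesis using a0(1)[of y] by (simp add: abs_mult mult.commute)
      qed (simp add: a_def)
    qed
  qed measurable
  have uR: "\<bar>u y\<bar> \<le> G * R" if "y \<in> S" "y \<in> ?Z" for y
  proof -
    have "\<bar>u y\<bar> \<le> G * norm (?r y - x)" unfolding u_def using near[OF that] G(2) by blast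
    also have "norm (?r y - x) = norm (y - x)"
    proof -
      have "?r y - x = - (y - x)" by (simp add: scaleR_2)
      then show ?thesis by (simp only: norm_minus_cancel)
    qed
    also have "G * norm (y - x) \<le> G * R" using near[OF that] G by (intro mult_left_mono) auto
    finally show ?thesis .
  qed
  \<comment> \<open>The relative variation of the density between mirror points, whose distance is
    at most \<open>2 * R\<close>; dividing by \<open>pmin\<close> makes the Lipschitz bound
    relative.\<close>
  define \<eta> where "\<eta> = 2 * Cp * R / pmin"
  have \<eta>: "\<eta> \<ge> 0" using C R p by (simp add: \<eta>_def)
  have rel: "\<bar>a' y - a y\<bar> \<le> \<eta> * a' y" if "y \<in> S" for y
  proof (cases "y \<in> ?Z")
    case True
    note n = near[OF that True]
    have "\<bar>a' y - a y\<bar> = \<bar>p (?r y) - p y\<bar>" using True n by (simp add: a_def a'_def q'_def)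
    also have "\<dots> \<le> Cp * norm (?r y - y)" using n p(3) by blast
    also have "norm (?r y - y) = 2 * norm (y - x)"
    proof -
      have "?r y - y = - (2 *\<^sub>R (y - x))" by (simp add: scaleR_2 algebra_simps)
      then show ?thesis by (simp only: norm_minus_cancel norm_scaleR)
    qed
    also have "Cp * (2 * norm (y - x)) \<le> Cp * (2 * R)" using n C by (intro mult_left_mono) auto
    also have "\<dots> = \<eta> * pmin" using p(1) by (simp add: \<eta>_def)
    also have "\<dots> \<le> \<eta> * p (?r y)" using \<eta> n p(2) by (intro mult_left_mono) auto
    also have "p (?r y) = a' y" using True n by (simp add: a'_def q'_def)
    finally show ?thesis .
  qed (simp add: a_def a'_def)
  have XX: "\<bar>X' - X\<bar> \<le> (G * R * \<eta>) * P'"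
  proof -
    have "X' - X = (\<integral>y. a' y * u y - a y * u y \<partial>?\<nu>)" unfolding X_def X'_def using iau iau' by simp
    also have "\<bar>\<dots>\<bar> \<le> (G * R * \<eta>) * P'"
      unfolding P'_def
    proof (rule abs_integral_le_weighted(2)[OF ai' m\<nu>])
      show "AE y in ?\<nu>. \<bar>a' y * u y - a y * u y\<bar> \<le> (G * R * \<eta>) * a' y"
        using AES
      proof eventually_elim
        case (elim y)
        show ?case
        proof (cases "y \<in> ?Z")
          case True
          have "\<bar>a' y * u y - a y * u y\<bar> = \<bar>u y\<bar> * \<bar>a' y - a y\<bar>"
            by (simp add: abs_mult[symmetric] algebra_simps)
          also have "\<dots> \<le> (G * R) * (\<eta> * a' y)" using uR[OF elim True] rel[OF elim] G R by (intro mult_mono) auto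
          finally show ?thesis by (simp add: mult_ac)
        qed (simp add: a_def a'_def)
      qed
    qed measurable
    finally show ?thesis .
  qed
  have X: "\<bar>X\<bar> \<le> (G * R) * P"
    unfolding X_def P_def
  proof (rule abs_integral_le_weighted(2)[OF ai m\<nu>])
    show "AE y in ?\<nu>. \<bar>a y * u y\<bar> \<le> (G * R) * a y"
      using AES
    proof eventually_elim
      case (elim y)
      show ?case
      proof (cases "y \<in> ?Z")
        case True
        then show ?thesis using uR[OF elim True] a0(1)[of y] by (simp add: abs_mult mult.commute mult_left_mono)
      qed (simp add: a_def)
    qed
  qed measurable
  have PP: "\<bar>P - P'\<bar> \<le> \<eta> * P'"
  proof -
    have "P - P' = (\<integral>y. a y - a' y \<partial>?\<nu>)" unfolding P_def P'_def using ai ai' by simp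
    also have "\<bar>\<dots>\<bar> \<le> \<eta> * P'"
      unfolding P'_def
    proof (rule abs_integral_le_weighted(2)[OF ai' m\<nu>])
      show "AE y in ?\<nu>. \<bar>a y - a' y\<bar> \<le> \<eta> * a' y"
        using AES by eventually_elim (use rel in \<open>simp add: abs_minus_commute\<close>)
    qed measurable
    finally show ?thesis .
  qed
  have "\<bar>T / P\<bar> \<le> C1 * R powr (1 + \<beta>)" using T P by (simp add: abs_divide divide_le_eq)
  moreover have "\<bar>(X' - X) / P'\<bar> \<le> G * R * \<eta>" using XX P by (simp add: abs_divide divide_le_eq)
  moreover have "\<bar>X / P * ((P - P') / P')\<bar> \<le> (G * R) * \<eta>"
  proof -
    have "\<bar>X / P\<bar> \<le> G * R" using X P by (simp add: abs_divide divide_le_eq)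
    moreover have "\<bar>(P - P') / P'\<bar> \<le> \<eta>" using PP P by (simp add: abs_divide divide_le_eq)
    ultimately show ?thesis unfolding abs_mult using G R by (intro mult_mono) auto
  qed
  ultimately have "\<bar>T / P + ((X' - X) / P' + X / P * ((P - P') / P'))\<bar> \<le> C1 * R powr (1 + \<beta>) + 2 * (G * R * \<eta>)"
    by linarith
  also have "2 * (G * R * \<eta>) = 4 * G * Cp / pmin * R\<^sup>2" by (simp add: \<eta>_def power2_eq_square)
  finally show ?thesis unfolding sum .
qed

text \<open>\<open>J\<close> collects the radius scales at which a neighbourhood of \<open>x\<close>
  in \<open>S\<close> may leave \<open>K\<close>. Off \<open>J\<close> the cell and its mirror image
  stay in \<open>K\<close> and \<open>reflected_bias_sum\<close> applies; on \<open>J\<close> there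
  is only the Lipschitz bound of order \<open>1 / lam\<close>, damped by the exponential weight.
  \<open>J\<close> is left open because interior points and boundary layers choose it
  differently.\<close>

lemma mean_bias_bound:
  fixes F p :: "real ^ 'n \<Rightarrow> real" and K S :: "(real ^ 'n) set"
  assumes \<phi>: "directional_distribution \<phi>" and S: "subspace S"
    and \<mu>: "prob_space \<mu>" "\<mu> = density (subspace_lborel S) (\<lambda>y. ennreal (indicator K y * p y))" "AE y in \<mu>. y \<in> K"
    and K: "bounded K" "K \<subseteq> S" "K = measure_support \<mu>"
    and q: "(\<lambda>y. indicator K y * p y) \<in> borel_measurable borel"
    and p: "pmin > 0" "\<And>y. y \<in> K \<Longrightarrow> pmin \<le> p y" "\<And>y z. y \<in> K \<Longrightarrow> z \<in> K \<Longrightarrow> \<bar>p y - p z\<bar> \<le> Cp * norm (y - z)"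
    and F: "F \<in> borel_measurable borel" "\<And>y. \<bar>F y\<bar> \<le> L"
    and G: "G \<ge> 0" "\<And>x y. x \<in> K \<Longrightarrow> y \<in> K \<Longrightarrow> \<bar>F y - F x\<bar> \<le> G * norm (y - x)"
    and sd: "\<And>x y. x \<in> K \<Longrightarrow> y \<in> K \<Longrightarrow> 2 *\<^sub>R x - y \<in> K \<Longrightarrow>
      \<bar>F y + F (2 *\<^sub>R x - y) - 2 * F x\<bar> \<le> C1 * norm (y - x) powr (1 + \<beta>)"
    and C: "Cp \<ge> 0" "C1 \<ge> 0" and \<beta>: "0 < \<beta>" "\<beta> \<le> 1"
  shows "\<exists>C c r. C \<ge> 0 \<and> c > 0 \<and> r > 0 \<and> (\<forall>lam Q x J. lam > 0 \<longrightarrow> void_law \<phi> lam Q \<longrightarrow> x \<in> K \<longrightarrow>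
      (\<forall>k. k \<notin> J \<longrightarrow> (\<forall>y\<in>S. norm (y - x) \<le> c * ((real k + 1) / lam) \<longrightarrow> y \<in> K)) \<longrightarrow>
      \<bar>\<integral>h. cell_average \<mu> F h x - F x \<partial>Q\<bar> \<le>
        C * lam powr (- (1 + \<beta>)) + C / lam * (\<Sum>k. indicator J k * ((real k + 1) * exp (- r * real k))))"
proof -
  obtain c K0 r where c: "c > 0" "K0 > 0" "r > 0" and "\<forall>lam Q x F g. lam > 0 \<longrightarrow> void_law \<phi> lam Q \<longrightarrow>
      (\<forall>h\<in>hyperplane_configs. \<forall>k::nat.
         (\<forall>y. same_cell h x y \<longrightarrow> norm (y - x) \<le> c * ((real k + 1) / lam)) \<longrightarrow> F h \<le> g k) \<longrightarrow>
      (\<integral>\<^sup>+ h. F h \<partial>Q) \<le> (\<Sum>k. g k * ennreal (K0 * exp (- r * real k)))"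
    using cell_radius_expectation[OF \<phi>] by (elim exE conjE) (rule that, assumption+)
  note tail = this(4)[rule_format]
  have s\<mu>: "sets \<mu> = sets borel" unfolding \<mu>(2) by (simp add: sets_subspace_lborel[OF S])
  obtain D0 where D0: "\<forall>x\<in>K. norm x \<le> D0" using K(1) by (auto simp: bounded_iff)
  define Dm where "Dm = 2 * \<bar>D0\<bar> + 1"
  have Dm: "Dm > 0" "\<And>x y. x \<in> K \<Longrightarrow> y \<in> K \<Longrightarrow> norm (y - x) \<le> Dm"
  proof -
    show "Dm > 0" by (simp add: Dm_def)
    fix x y assume "x \<in> K" "y \<in> K"
    then have "norm x \<le> \<bar>D0\<bar>" "norm y \<le> \<bar>D0\<bar>" using D0 by fastforce+
    then show "norm (y - x) \<le> Dm" using norm_triangle_ineq4[of y x] by (simp add: Dm_def)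
  qed
  \<comment> \<open>The density error is of order R^2, which within the diameter bound
    \<open>Dm\<close> is at most R^(1+\<beta>) times \<open>Dm powr (1 - \<beta>)\<close>.\<close>
  define C3 where "C3 = C1 + 4 * G * Cp / pmin * Dm powr (1 - \<beta>)"
  have C3: "C3 \<ge> 0" using C G p by (simp add: C3_def)
  define s where "s = (\<Sum>k. (real k + 1)\<^sup>2 * exp (- r * real k))"
  have sm: "summable (\<lambda>k. (real k + 1)\<^sup>2 * exp (- r * real k))" by (rule summable_square_exp[OF c(3)])
  have s0: "s \<ge> 0" unfolding s_def by (intro suminf_nonneg sm) simp
  define CC where "CC = C3 * c powr (1 + \<beta>) * K0 * s + 2 * G * c * K0"
  have nn: "C3 * c powr (1 + \<beta>) * K0 * s \<ge> 0" "2 * G * c * K0 \<ge> 0" using C3 c s0 G by auto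
  have main: "\<bar>\<integral>h. cell_average \<mu> F h x - F x \<partial>Q\<bar> \<le>
        CC * lam powr (- (1 + \<beta>)) + CC / lam * (\<Sum>k. indicator J k * ((real k + 1) * exp (- r * real k)))"
    if lam: "lam > 0" and Q: "void_law \<phi> lam Q" and x: "x \<in> K"
      and J: "\<forall>k. k \<notin> J \<longrightarrow> (\<forall>y\<in>S. norm (y - x) \<le> c * ((real k + 1) / lam) \<longrightarrow> y \<in> K)"
    for lam Q x J
  proof -
    interpret Q: prob_space Q using Q by (simp add: void_law_def)
    have sQ: "sets Q = sets void_space" using Q by (simp add: void_law_def)
    have xS: "x \<in> S" "x \<in> measure_support \<mu>" using x K by auto
    let ?b = "\<lambda>h. cell_average \<mu> F h x - F x"
    have bm: "?b \<in> borel_measurable void_space"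
      using cell_average_config_measurable[OF \<mu>(1) s\<mu> F(1)] by (rule borel_measurable_diff) simp
    have rm: "reflect_config x \<in> Q \<rightarrow>\<^sub>M void_space"
      unfolding measurable_cong_sets[OF sQ refl] by (rule measurable_reflect_config)
    have bmQ: "?b \<in> borel_measurable Q" unfolding measurable_cong_sets[OF sQ refl] by (rule bm)
    have bb: "\<bar>?b h\<bar> \<le> 2 * L" if "h \<in> hyperplane_configs" for h
      using cell_average_bound[OF \<mu>(1) s\<mu> F that, of x] F(2)[of x] by linarith
    have spQ: "space Q = hyperplane_configs" using sets_eq_imp_space_eq[OF sQ] by simp
    have bi: "integrable Q ?b"
      by (rule Q.integrable_const_bound[OF _ bmQ, of "2 * L"]) (use bb spQ in \<open>auto intro!: AE_I2\<close>)
    have eqd: "distr Q void_space (reflect_config x) = Q" by (rule void_law_reflect[OF Q \<phi>])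
    have bi': "integrable Q (\<lambda>h. ?b (reflect_config x h))"
      using bi integrable_distr_eq[OF rm bm] unfolding eqd by blast
    have same: "(\<integral>h. ?b (reflect_config x h) \<partial>Q) = (\<integral>h. ?b h \<partial>Q)"
      using integral_distr[OF rm bm] unfolding eqd by simp
    let ?B = "\<lambda>h. ?b h + ?b (reflect_config x h)"
    let ?rho = "\<lambda>k. c * ((real k + 1) / lam)"
    define g where "g = (\<lambda>k. C3 * ?rho k powr (1 + \<beta>) + indicator J k * (2 * G * ?rho k))"
    have rho0: "?rho k > 0" for k using c lam by simp
    have g0: "g k \<ge> 0" for k unfolding g_def using C3 G(1) c lam by (intro add_nonneg_nonneg mult_nonneg_nonneg) auto
    have "(\<integral>\<^sup>+h. ennreal \<bar>?B h\<bar> \<partial>Q) \<le> (\<integral>\<^sup>+h. (if same_cell h x x then ennreal \<bar>?B h\<bar> else 0) \<partial>Q)"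
      using void_law_same_cell_self[OF Q \<phi>, of x]
      by (intro nn_integral_mono_AE) (auto elim: eventually_mono)
    also have "\<dots> \<le> (\<Sum>k. ennreal (g k) * ennreal (K0 * exp (- r * real k)))"
    proof (rule tail[OF lam Q])
      fix h and k :: nat
      assume h: "h \<in> hyperplane_configs" and R: "\<And>y. same_cell h x y \<Longrightarrow> norm (y - x) \<le> ?rho k"
      show "(if same_cell h x x then ennreal \<bar>?B h\<bar> else 0) \<le> ennreal (g k)"
      proof (cases "same_cell h x x")
        case True
        have h': "reflect_config x h \<in> hyperplane_configs" by (rule reflect_config_configs[OF h])
        have True': "same_cell (reflect_config x h) x x" using True by (simp add: same_cell_reflect_config scaleR_2)
        have "\<bar>?B h\<bar> \<le> g k"
        proof (cases "k \<in> J")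
          case kJ: True
          have "\<bar>?b h\<bar> \<le> G * ?rho k"
          proof (rule cell_average_local[OF \<mu>(1) s\<mu> \<mu>(3) F h xS(2) True])
            fix y assume y: "y \<in> K" "same_cell h x y"
            have "\<bar>F y - F x\<bar> \<le> G * norm (y - x)" by (rule G(2)[OF x y(1)])
            also have "\<dots> \<le> G * ?rho k" by (rule mult_left_mono[OF R[OF y(2)] G(1)])
            finally show "\<bar>F y - F x\<bar> \<le> G * ?rho k" .
          qed
          moreover have "\<bar>?b (reflect_config x h)\<bar> \<le> G * ?rho k"
          proof (rule cell_average_local[OF \<mu>(1) s\<mu> \<mu>(3) F h' xS(2) True'])
            fix y assume y: "y \<in> K" "same_cell (reflect_config x h) x y"
            then have "norm (2 *\<^sub>R x - y - x) \<le> ?rho k" by (intro R) (simp add: same_cell_reflect_config)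
            moreover have "2 *\<^sub>R x - y - x = - (y - x)" by (simp add: scaleR_2)
            ultimately have n: "norm (y - x) \<le> ?rho k" by (simp only: norm_minus_cancel)
            have "\<bar>F y - F x\<bar> \<le> G * norm (y - x)" by (rule G(2)[OF x y(1)])
            also have "\<dots> \<le> G * ?rho k" by (rule mult_left_mono[OF n G(1)])
            finally show "\<bar>F y - F x\<bar> \<le> G * ?rho k" .
          qed
          moreover have "2 * G * ?rho k \<le> g k" unfolding g_def using kJ C3 by simp
          ultimately show ?thesis by linarith
        next
          case False
          \<comment> \<open>Scales beyond the diameter of \<open>K\<close> are truncated, so that
            R^2 can be traded for the power \<open>1 + \<beta>\<close> at every scale.\<close>
          define R' where "R' = min (?rho k) Dm"
          have R'0: "R' > 0" using rho0[of k] Dm(1) by (simp add: R'_def)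
          have near: "norm (y - x) \<le> R' \<and> y \<in> K \<and> 2 *\<^sub>R x - y \<in> K" if y: "y \<in> S" "same_cell h x y" for y
          proof -
            have n: "norm (y - x) \<le> ?rho k" by (rule R[OF y(2)])
            then have yK: "y \<in> K" using J False y(1) by blast
            have "2 *\<^sub>R x - y \<in> S" using S xS y by (intro subspace_diff subspace_scale) auto
            moreover have "2 *\<^sub>R x - y - x = - (y - x)" by (simp add: scaleR_2)
            then have "norm (2 *\<^sub>R x - y - x) \<le> ?rho k" using n by (simp only: norm_minus_cancel)
            ultimately have "2 *\<^sub>R x - y \<in> K" using J False by blast
            with n yK Dm(2)[OF x yK] show ?thesis by (simp add: R'_def)
          qed
          have "\<bar>?B h\<bar> \<le> C1 * R' powr (1 + \<beta>) + 4 * G * Cp / pmin * R'\<^sup>2"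
            by (rule reflected_bias_sum[OF S \<mu>(1,2) q p F G(1) G(2)[OF x] sd[OF x] h xS True less_imp_le[OF R'0] near C \<beta>(1)])
          also have "R'\<^sup>2 \<le> R' powr (1 + \<beta>) * Dm powr (1 - \<beta>)"
          proof -
            have "R'\<^sup>2 = R' powr (1 + \<beta>) * R' powr (1 - \<beta>)" using R'0 by (simp add: powr_add[symmetric])
            also have "\<dots> \<le> R' powr (1 + \<beta>) * Dm powr (1 - \<beta>)"
              using R'0 \<beta> by (intro mult_left_mono powr_mono2) (auto simp: R'_def)
            finally show ?thesis .
          qed
          then have "C1 * R' powr (1 + \<beta>) + 4 * G * Cp / pmin * R'\<^sup>2 \<le>
              C1 * R' powr (1 + \<beta>) + 4 * G * Cp / pmin * (R' powr (1 + \<beta>) * Dm powr (1 - \<beta>))"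
            using G C p by (intro add_left_mono mult_left_mono) auto
          also have "\<dots> = C3 * R' powr (1 + \<beta>)" by (simp add: C3_def algebra_simps)
          also have "\<dots> \<le> C3 * ?rho k powr (1 + \<beta>)"
            using R'0 \<beta> C3 by (intro mult_left_mono powr_mono2) (auto simp: R'_def)
          also have "\<dots> = g k" using False by (simp add: g_def)
          finally show ?thesis .
        qed
        then show ?thesis using True by (simp add: ennreal_leI)
      qed simp
    qed
    also have "\<dots> = (\<Sum>k. ennreal (g k * (K0 * exp (- r * real k))))"
      using g0 by (intro suminf_cong) (simp only: ennreal_mult')
    finally have B: "(\<integral>\<^sup>+h. ennreal \<bar>?B h\<bar> \<partial>Q) \<le> (\<Sum>k. ennreal (g k * (K0 * exp (- r * real k))))" .
    let ?t = "\<lambda>k. indicator J k * ((real k + 1) * exp (- r * real k))"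
    have t_le: "?t k \<le> (real k + 1)\<^sup>2 * exp (- r * real k)" for k
    proof -
      have "(real k + 1) * 1 \<le> (real k + 1) * (real k + 1)" by (intro mult_left_mono) auto
      then have "(real k + 1) * exp (- r * real k) \<le> (real k + 1)\<^sup>2 * exp (- r * real k)"
        by (intro mult_right_mono) (auto simp: power2_eq_square)
      then show ?thesis by (simp add: indicator_def)
    qed
    have tsum: "summable ?t"
      by (rule summable_comparison_test'[OF sm]) (use t_le in \<open>simp add: abs_of_nonneg\<close>)
    let ?u = "\<lambda>k. (C3 * (c / lam) powr (1 + \<beta>) * K0) * ((real k + 1)\<^sup>2 * exp (- r * real k)) + (2 * G * (c / lam) * K0) * ?t k"
    have usum: "summable ?u" by (intro summable_add summable_mult sm tsum)
    \<comment> \<open>Bounding the power \<open>1 + \<beta>\<close> of \<open>real k + 1\<close> by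
      its square lets the single series \<open>s\<close> serve for all \<beta>.\<close>
    have gu: "g k * (K0 * exp (- r * real k)) \<le> ?u k" for k
    proof -
      have "?rho k powr (1 + \<beta>) = (c / lam) powr (1 + \<beta>) * (real k + 1) powr (1 + \<beta>)"
        using powr_mult[of "c / lam" "real k + 1" "1 + \<beta>"] by simp
      also have "\<dots> \<le> (c / lam) powr (1 + \<beta>) * (real k + 1) powr 2"
        using \<beta> by (intro mult_left_mono powr_mono) auto
      finally have "?rho k powr (1 + \<beta>) \<le> (c / lam) powr (1 + \<beta>) * (real k + 1)\<^sup>2" by simp
      then have "C3 * ?rho k powr (1 + \<beta>) \<le> C3 * ((c / lam) powr (1 + \<beta>) * (real k + 1)\<^sup>2)"
        using C3 by (rule mult_left_mono)
      then have "C3 * ?rho k powr (1 + \<beta>) * (K0 * exp (- r * real k)) \<le>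
          C3 * ((c / lam) powr (1 + \<beta>) * (real k + 1)\<^sup>2) * (K0 * exp (- r * real k))"
        using c by (intro mult_right_mono) auto
      also have "\<dots> = (C3 * (c / lam) powr (1 + \<beta>) * K0) * ((real k + 1)\<^sup>2 * exp (- r * real k))"
        by (simp only: mult_ac)
      finally have e1: "C3 * ?rho k powr (1 + \<beta>) * (K0 * exp (- r * real k)) \<le>
          (C3 * (c / lam) powr (1 + \<beta>) * K0) * ((real k + 1)\<^sup>2 * exp (- r * real k))" .
      have e2: "indicator J k * (2 * G * ?rho k) * (K0 * exp (- r * real k)) = (2 * G * (c / lam) * K0) * ?t k"
        by simp
      show ?thesis unfolding g_def distrib_right e2 by (rule add_right_mono[OF e1])
    qed
    have "(\<Sum>k. ennreal (g k * (K0 * exp (- r * real k)))) \<le> (\<Sum>k. ennreal (?u k))"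
      by (intro suminf_le ennreal_leI gu) auto
    also have "\<dots> = ennreal (\<Sum>k. ?u k)"
    proof (rule suminf_ennreal2[OF _ usum])
      fix k show "0 \<le> ?u k" using C3 c lam G by (intro add_nonneg_nonneg mult_nonneg_nonneg) auto
    qed
    also have "(\<Sum>k. ?u k) = (C3 * (c / lam) powr (1 + \<beta>) * K0) * s + (2 * G * (c / lam) * K0) * (\<Sum>k. ?t k)"
      unfolding s_def by (subst suminf_add[symmetric]) (intro summable_mult sm tsum | simp only: suminf_mult[OF sm] suminf_mult[OF tsum])+
    finally have B2: "(\<Sum>k. ennreal (g k * (K0 * exp (- r * real k)))) \<le>
        ennreal ((C3 * (c / lam) powr (1 + \<beta>) * K0) * s + (2 * G * (c / lam) * K0) * (\<Sum>k. ?t k))" .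
    have t0: "(\<Sum>k. ?t k) \<ge> 0" by (intro suminf_nonneg tsum) simp
    have rhs0: "(C3 * (c / lam) powr (1 + \<beta>) * K0) * s + (2 * G * (c / lam) * K0) * (\<Sum>k. ?t k) \<ge> 0"
      using C3 c lam G s0 t0 by (intro add_nonneg_nonneg mult_nonneg_nonneg) auto
    have iB: "integrable Q (\<lambda>h. \<bar>?B h\<bar>)" by (intro integrable_abs Bochner_Integration.integrable_add bi bi')
    \<comment> \<open>A configuration and its mirror image have the same law, so the mean of the
      summed biases is twice the mean bias. The absolute value is taken inside only after this
      pairing, which is where the cancellation is won.\<close>
    have "2 * \<bar>\<integral>h. ?b h \<partial>Q\<bar> = \<bar>\<integral>h. ?B h \<partial>Q\<bar>"
    proof -
      have "(\<integral>h. ?B h \<partial>Q) = 2 * (\<integral>h. ?b h \<partial>Q)"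
        using Bochner_Integration.integral_add[OF bi bi'] same by linarith
      then show ?thesis by (simp only: abs_mult abs_numeral)
    qed
    also have "\<dots> \<le> (\<integral>h. \<bar>?B h\<bar> \<partial>Q)" by (rule integral_abs_bound)
    also have "\<dots> \<le> (C3 * (c / lam) powr (1 + \<beta>) * K0) * s + (2 * G * (c / lam) * K0) * (\<Sum>k. ?t k)"
    proof -
      have "ennreal (\<integral>h. \<bar>?B h\<bar> \<partial>Q) = (\<integral>\<^sup>+h. ennreal \<bar>?B h\<bar> \<partial>Q)"
        by (rule nn_integral_eq_integral[OF iB, symmetric]) simp
      also note B
      also note B2
      finally show ?thesis using rhs0 by (simp only: ennreal_le_iff)
    qed
    also have "(C3 * (c / lam) powr (1 + \<beta>) * K0) * s = (C3 * c powr (1 + \<beta>) * K0 * s) * lam powr (- (1 + \<beta>))"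
      using c lam powr_minus_divide[of lam "1 + \<beta>"] by (simp add: powr_divide)
    also have "\<dots> \<le> CC * lam powr (- (1 + \<beta>))" using nn by (intro mult_right_mono) (auto simp: CC_def)
    also have "(2 * G * (c / lam) * K0) * (\<Sum>k. ?t k) = (2 * G * c * K0) * (1 / lam * (\<Sum>k. ?t k))" by simp
    also have "\<dots> \<le> CC * (1 / lam * (\<Sum>k. ?t k))"
      using nn t0 lam by (intro mult_right_mono mult_nonneg_nonneg) (auto simp: CC_def)
    finally have "2 * \<bar>\<integral>h. ?b h \<partial>Q\<bar> \<le> CC * lam powr (- (1 + \<beta>)) + CC / lam * (\<Sum>k. ?t k)" by simp
    then show ?thesis by linarith
  qed
  have "CC \<ge> 0" using nn by (simp add: CC_def)
  then show ?thesis
    by (intro exI[of _ CC] exI[of _ c] exI[of _ r] conjI c(1,3) allI impI) (assumption, rule main)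
qed


section \<open>Squared mean bias in the interior and across the boundary layers\<close>

text \<open>At depth \<epsilon> only scales of radius at least \<epsilon> are bad. For them
  \<open>c / (\<epsilon> * lam) * (real k + 1)\<close> is at least 1, which buys a factor
  \<open>1 / lam\<close> for one more power of \<open>real k + 1\<close>. The boundary then
  contributes lam^(-2), at most lam^(-1-\<beta>) for \<open>lam \<ge> 1\<close>.\<close>

lemma mean_bias_inner:
  fixes m :: "'q \<Rightarrow> 'x::real_normed_vector \<Rightarrow> real"
  assumes mb: "\<And>lam Q x J. lam > 0 \<Longrightarrow> V lam Q \<Longrightarrow> x \<in> K \<Longrightarrow>
      (\<forall>k. k \<notin> J \<longrightarrow> (\<forall>y\<in>S. norm (y - x) \<le> c * ((real k + 1) / lam) \<longrightarrow> y \<in> K)) \<Longrightarrow>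
      \<bar>m Q x\<bar> \<le> C * lam powr (- (1 + \<beta>)) + C / lam * (\<Sum>k. indicator J k * ((real k + 1) * exp (- r * real k)))"
    and C: "C \<ge> 0" "c > 0" "r > 0" and \<beta>: "0 < \<beta>" "\<beta> \<le> 1" and \<epsilon>: "\<epsilon> > 0"
    and A: "A \<subseteq> K" "\<And>x y. x \<in> A \<Longrightarrow> y \<in> S \<Longrightarrow> norm (y - x) < \<epsilon> \<Longrightarrow> y \<in> K"
  shows "\<exists>C'\<ge>0. \<forall>lam Q x. lam \<ge> 1 \<longrightarrow> V lam Q \<longrightarrow> x \<in> A \<longrightarrow> (m Q x)\<^sup>2 \<le> C' * lam powr (- 2 - 2 * \<beta>)"
proof -
  define s where "s = (\<Sum>k. (real k + 1)\<^sup>2 * exp (- r * real k))"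
  have sm: "summable (\<lambda>k. (real k + 1)\<^sup>2 * exp (- r * real k))" by (rule summable_square_exp[OF C(3)])
  have s0: "s \<ge> 0" unfolding s_def by (intro suminf_nonneg sm) simp
  define C' where "C' = (C + C * (c / \<epsilon>) * s)\<^sup>2"
  show ?thesis
  proof (intro exI[of _ C'] conjI allI impI)
    fix lam :: real and Q x assume lam: "lam \<ge> 1" and V: "V lam Q" and x: "x \<in> A"
    define J where "J = {k::nat. \<epsilon> \<le> c * ((real k + 1) / lam)}"
    let ?t = "\<lambda>k. indicator J k * ((real k + 1) * exp (- r * real k))"
    have t_le: "?t k \<le> (c / (\<epsilon> * lam)) * ((real k + 1)\<^sup>2 * exp (- r * real k))" for k
    proof (cases "k \<in> J")
      case True
      then have "1 \<le> c / (\<epsilon> * lam) * (real k + 1)" using \<epsilon> lam by (simp add: J_def field_simps)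
      then have "1 * ((real k + 1) * exp (- r * real k)) \<le> c / (\<epsilon> * lam) * (real k + 1) * ((real k + 1) * exp (- r * real k))"
        by (intro mult_right_mono) auto
      then show ?thesis using True by (simp add: power2_eq_square mult.assoc)
    qed (use \<epsilon> lam C in simp)
    have cs: "summable (\<lambda>k. (c / (\<epsilon> * lam)) * ((real k + 1)\<^sup>2 * exp (- r * real k)))" by (intro summable_mult sm)
    have tsum: "summable ?t"
      by (rule summable_comparison_test'[OF cs]) (use t_le in \<open>simp add: abs_of_nonneg\<close>)
    have "(\<Sum>k. ?t k) \<le> (\<Sum>k. (c / (\<epsilon> * lam)) * ((real k + 1)\<^sup>2 * exp (- r * real k)))"
      by (rule suminf_le[OF t_le tsum cs])
    also have "\<dots> = (c / (\<epsilon> * lam)) * s" unfolding s_def by (rule suminf_mult[OF sm])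
    finally have T: "(\<Sum>k. ?t k) \<le> (c / (\<epsilon> * lam)) * s" .
    have "\<bar>m Q x\<bar> \<le> C * lam powr (- (1 + \<beta>)) + C / lam * (\<Sum>k. ?t k)"
    proof (rule mb[OF _ V])
      show "\<forall>k. k \<notin> J \<longrightarrow> (\<forall>y\<in>S. norm (y - x) \<le> c * ((real k + 1) / lam) \<longrightarrow> y \<in> K)"
        using A(2)[OF x] by (auto simp: J_def)
    qed (use x A lam in auto)
    also have "\<dots> \<le> C * lam powr (- (1 + \<beta>)) + C / lam * ((c / (\<epsilon> * lam)) * s)"
      using C lam T by (intro add_left_mono mult_left_mono) auto
    also have "C / lam * ((c / (\<epsilon> * lam)) * s) = C * (c / \<epsilon>) * s * lam powr (- 2)"
      using lam powr_minus_divide[of lam 2] by (simp add: power2_eq_square mult_ac)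
    also have "C * lam powr (- (1 + \<beta>)) + \<dots> \<le> C * lam powr (- (1 + \<beta>)) + C * (c / \<epsilon>) * s * lam powr (- (1 + \<beta>))"
      using \<beta> lam C \<epsilon> s0 by (intro add_left_mono mult_left_mono powr_mono) auto
    also have "\<dots> = (C + C * (c / \<epsilon>) * s) * lam powr (- (1 + \<beta>))" by (simp only: distrib_right)
    finally have "\<bar>m Q x\<bar> \<le> (C + C * (c / \<epsilon>) * s) * lam powr (- (1 + \<beta>))" .
    then have "\<bar>m Q x\<bar>\<^sup>2 \<le> ((C + C * (c / \<epsilon>) * s) * lam powr (- (1 + \<beta>)))\<^sup>2" by (intro power_mono) auto
    also have "\<dots> = C' * lam powr (- 2 - 2 * \<beta>)"
      by (simp add: C'_def power_mult_distrib power2_eq_square[of "_ powr _"] powr_add[symmetric])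
    finally show "(m Q x)\<^sup>2 \<le> C' * lam powr (- 2 - 2 * \<beta>)" by simp
  qed (simp add: C'_def)
qed

text \<open>Scale \<open>k\<close> counts as bad at \<open>x\<close> when \<open>x\<close> lies in
  the layer belonging to the \<open>k\<close>-th radius, whose mass is of order (k + 1) / lam. The
  squared bound, of order lam^(-2), integrates over the layers to lam^(-3), and lam^(-3) is at most
  lam^(-2-2 \<beta>) because \<beta> is at most 1/2.\<close>

lemma mean_bias_global:
  fixes m :: "'q \<Rightarrow> 'x::real_normed_vector \<Rightarrow> real"
  assumes mb: "\<And>lam Q x J. lam > 0 \<Longrightarrow> V lam Q \<Longrightarrow> x \<in> K \<Longrightarrow>
      (\<forall>k. k \<notin> J \<longrightarrow> (\<forall>y\<in>S. norm (y - x) \<le> c * ((real k + 1) / lam) \<longrightarrow> y \<in> K)) \<Longrightarrow>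
      \<bar>m Q x\<bar> \<le> C * lam powr (- (1 + \<beta>)) + C / lam * (\<Sum>k. indicator J k * ((real k + 1) * exp (- r * real k)))"
    and C: "C \<ge> 0" "c > 0" "r > 0" and \<beta>: "0 < \<beta>" "\<beta> \<le> 1/2"
    and \<mu>: "prob_space \<mu>" "AE x in \<mu>. x \<in> K"
    and layer: "B \<ge> 0" "\<And>\<rho>. \<rho> \<ge> 0 \<Longrightarrow> \<exists>D\<in>sets \<mu>. emeasure \<mu> D \<le> ennreal (B * \<rho>) \<and>
      (\<forall>x\<in>K - D. \<forall>y\<in>S. norm (y - x) \<le> \<rho> \<longrightarrow> y \<in> K)"
  shows "\<exists>C'\<ge>0. \<forall>lam Q. lam \<ge> 1 \<longrightarrow> V lam Q \<longrightarrow>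
    (\<integral>\<^sup>+x. ennreal ((m Q x)\<^sup>2) \<partial>\<mu>) \<le> ennreal (C' * lam powr (- 2 - 2 * \<beta>))"
proof -
  interpret prob_space \<mu> by fact
  define s where "s = (\<Sum>k. (real k + 1)\<^sup>2 * exp (- r * real k))"
  have sm: "summable (\<lambda>k. (real k + 1)\<^sup>2 * exp (- r * real k))" by (rule summable_square_exp[OF C(3)])
  have s0: "s \<ge> 0" unfolding s_def by (intro suminf_nonneg sm) simp
  define w where "w = (\<lambda>k. (real k + 1) * exp (- r * real k))"
  have w0: "w k \<ge> 0" for k by (simp add: w_def)
  have w_le: "w k \<le> (real k + 1)\<^sup>2 * exp (- r * real k)" for k
  proof -
    have "(real k + 1) * 1 \<le> (real k + 1) * (real k + 1)" by (intro mult_left_mono) auto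
    then show ?thesis unfolding w_def by (intro mult_right_mono) (auto simp: power2_eq_square)
  qed
  define C' where "C' = 2 * C\<^sup>2 + 2 * C\<^sup>2 * s * (B * c * s)"
  have nn: "2 * C\<^sup>2 * s * (B * c * s) \<ge> 0" using C s0 layer(1) by auto
  show ?thesis
  proof (intro exI[of _ C'] conjI allI impI)
    show "C' \<ge> 0" using nn by (simp add: C'_def)
    fix lam :: real and Q assume lam: "lam \<ge> 1" and V: "V lam Q"
    have lam0: "lam > 0" using lam by simp
    let ?rho = "\<lambda>k. c * ((real k + 1) / lam)"
    have "\<forall>k. \<exists>D. D \<in> sets \<mu> \<and> emeasure \<mu> D \<le> ennreal (B * ?rho k) \<and>
        (\<forall>x\<in>K - D. \<forall>y\<in>S. norm (y - x) \<le> ?rho k \<longrightarrow> y \<in> K)"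
    proof
      fix k
      have "?rho k \<ge> 0" using C lam by simp
      from layer(2)[OF this] show "\<exists>D. D \<in> sets \<mu> \<and> emeasure \<mu> D \<le> ennreal (B * ?rho k) \<and>
        (\<forall>x\<in>K - D. \<forall>y\<in>S. norm (y - x) \<le> ?rho k \<longrightarrow> y \<in> K)" by blast
    qed
    from choice[OF this] obtain D where D: "\<And>k. D k \<in> sets \<mu>" "\<And>k. emeasure \<mu> (D k) \<le> ennreal (B * ?rho k)"
      "\<And>k x y. x \<in> K - D k \<Longrightarrow> y \<in> S \<Longrightarrow> norm (y - x) \<le> ?rho k \<Longrightarrow> y \<in> K" by blast
    define t where "t = (\<lambda>x k. indicator {k. x \<in> D k} k * w k)"
    have t0: "t x k \<ge> 0" for x k by (simp add: t_def w0)
    have t_le: "t x k \<le> (real k + 1)\<^sup>2 * exp (- r * real k)" for x k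
      using w_le[of k] w0[of k] by (simp add: t_def indicator_def)
    have tsum: "summable (t x)" for x
      by (rule summable_comparison_test'[OF sm]) (use t_le t0 in \<open>simp add: abs_of_nonneg\<close>)
    have T0: "(\<Sum>k. t x k) \<ge> 0" for x by (intro suminf_nonneg tsum t0)
    \<comment> \<open>This uniform bound turns the square of the series into a multiple of the
      series itself, which is linear in the layer indicators and can be integrated term by
      term.\<close>
    have Ts: "(\<Sum>k. t x k) \<le> s" for x unfolding s_def by (rule suminf_le[OF t_le tsum sm])
    have pt: "(m Q x)\<^sup>2 \<le> 2 * C\<^sup>2 * lam powr (- 2 - 2 * \<beta>) + 2 * C\<^sup>2 * s / lam\<^sup>2 * (\<Sum>k. t x k)" if x: "x \<in> K" for x
    proof -
      let ?a = "C * lam powr (- (1 + \<beta>))" and ?b = "C / lam * (\<Sum>k. t x k)"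
      have "\<bar>m Q x\<bar> \<le> ?a + ?b"
        unfolding t_def w_def by (rule mb[OF lam0 V x]) (use D(3) x in auto)
      then have "\<bar>m Q x\<bar>\<^sup>2 \<le> (?a + ?b)\<^sup>2" by (intro power_mono) auto
      also have "\<dots> \<le> 2 * ?a\<^sup>2 + 2 * ?b\<^sup>2"
      proof -
        have "(a + b)\<^sup>2 \<le> 2 * a\<^sup>2 + 2 * b\<^sup>2" for a b :: real
        proof -
          have "0 \<le> (a - b)\<^sup>2" by simp
          then show ?thesis by (simp add: power2_sum power2_diff)
        qed
        then show ?thesis .
      qed
      also have "?a\<^sup>2 = C\<^sup>2 * lam powr (- 2 - 2 * \<beta>)"
        by (simp add: power_mult_distrib power2_eq_square[of "_ powr _"] powr_add[symmetric])
      also have "?b\<^sup>2 = C\<^sup>2 / lam\<^sup>2 * ((\<Sum>k. t x k) * (\<Sum>k. t x k))"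
        by (simp add: power_mult_distrib power_divide power2_eq_square[of "suminf _"])
      also have "C\<^sup>2 / lam\<^sup>2 * ((\<Sum>k. t x k) * (\<Sum>k. t x k)) \<le> C\<^sup>2 / lam\<^sup>2 * (s * (\<Sum>k. t x k))"
        by (intro mult_left_mono mult_right_mono Ts T0) simp
      finally show ?thesis by (simp add: mult_ac)
    qed
    have "(\<Sum>k. ennreal (w k) * emeasure \<mu> (D k)) \<le> (\<Sum>k. ennreal (B * c / lam * ((real k + 1)\<^sup>2 * exp (- r * real k))))"
    proof (intro suminf_le allI)
      fix k
      have "ennreal (w k) * emeasure \<mu> (D k) \<le> ennreal (w k) * ennreal (B * ?rho k)"
        by (intro mult_left_mono D(2)) simp
      also have "\<dots> = ennreal (w k * (B * ?rho k))" by (rule ennreal_mult'[symmetric, OF w0])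
      also have "w k * (B * ?rho k) = B * c / lam * ((real k + 1)\<^sup>2 * exp (- r * real k))"
        by (simp add: w_def power2_eq_square)
      finally show "ennreal (w k) * emeasure \<mu> (D k) \<le> ennreal (B * c / lam * ((real k + 1)\<^sup>2 * exp (- r * real k)))" .
    qed auto
    also have "\<dots> = ennreal (\<Sum>k. B * c / lam * ((real k + 1)\<^sup>2 * exp (- r * real k)))"
      using layer(1) C lam by (intro suminf_ennreal2 summable_mult sm) auto
    also have "(\<Sum>k. B * c / lam * ((real k + 1)\<^sup>2 * exp (- r * real k))) = B * c / lam * s"
      unfolding s_def by (rule suminf_mult[OF sm])
    finally have layers: "(\<Sum>k. ennreal (w k) * emeasure \<mu> (D k)) \<le> ennreal (B * c / lam * s)" .
    have "(\<integral>\<^sup>+x. ennreal ((m Q x)\<^sup>2) \<partial>\<mu>) \<le>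
        (\<integral>\<^sup>+x. ennreal (2 * C\<^sup>2 * lam powr (- 2 - 2 * \<beta>)) + ennreal (2 * C\<^sup>2 * s / lam\<^sup>2) * (\<Sum>k. ennreal (w k) * indicator (D k) x) \<partial>\<mu>)"
    proof (rule nn_integral_mono_AE)
      show "AE x in \<mu>. ennreal ((m Q x)\<^sup>2) \<le>
          ennreal (2 * C\<^sup>2 * lam powr (- 2 - 2 * \<beta>)) + ennreal (2 * C\<^sup>2 * s / lam\<^sup>2) * (\<Sum>k. ennreal (w k) * indicator (D k) x)"
        using \<mu>(2)
      proof eventually_elim
        case (elim x)
        have "ennreal (\<Sum>k. t x k) = (\<Sum>k. ennreal (t x k))" by (rule suminf_ennreal2[OF t0 tsum, symmetric])
        also have "\<dots> = (\<Sum>k. ennreal (w k) * indicator (D k) x)"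
          by (intro suminf_cong) (simp add: t_def indicator_def)
        finally have e: "ennreal (\<Sum>k. t x k) = (\<Sum>k. ennreal (w k) * indicator (D k) x)" .
        have "ennreal ((m Q x)\<^sup>2) \<le> ennreal (2 * C\<^sup>2 * lam powr (- 2 - 2 * \<beta>) + 2 * C\<^sup>2 * s / lam\<^sup>2 * (\<Sum>k. t x k))"
          by (rule ennreal_leI[OF pt[OF elim]])
        also have "\<dots> = ennreal (2 * C\<^sup>2 * lam powr (- 2 - 2 * \<beta>)) + ennreal (2 * C\<^sup>2 * s / lam\<^sup>2) * ennreal (\<Sum>k. t x k)"
        proof -
          have a: "0 \<le> 2 * C\<^sup>2 * lam powr (- 2 - 2 * \<beta>)" by simp
          have c: "0 \<le> 2 * C\<^sup>2 * s / lam\<^sup>2" using s0 by simp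
          have b: "0 \<le> 2 * C\<^sup>2 * s / lam\<^sup>2 * (\<Sum>k. t x k)" using c T0 by (rule mult_nonneg_nonneg)
          show ?thesis by (simp only: ennreal_plus[OF a b] ennreal_mult'[OF c])
        qed
        finally show ?case unfolding e .
      qed
    qed
    also have "\<dots> = ennreal (2 * C\<^sup>2 * lam powr (- 2 - 2 * \<beta>)) + ennreal (2 * C\<^sup>2 * s / lam\<^sup>2) * (\<Sum>k. ennreal (w k) * emeasure \<mu> (D k))"
      using D(1) by (simp add: nn_integral_add nn_integral_cmult nn_integral_suminf emeasure_space_1)
    also have "\<dots> \<le> ennreal (2 * C\<^sup>2 * lam powr (- 2 - 2 * \<beta>)) + ennreal (2 * C\<^sup>2 * s / lam\<^sup>2) * ennreal (B * c / lam * s)"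
      by (intro add_left_mono mult_left_mono layers) simp
    also have "ennreal (2 * C\<^sup>2 * s / lam\<^sup>2) * ennreal (B * c / lam * s) = ennreal (2 * C\<^sup>2 * s / lam\<^sup>2 * (B * c / lam * s))"
      using s0 by (intro ennreal_mult'[symmetric]) simp
    also have "ennreal (2 * C\<^sup>2 * lam powr (- 2 - 2 * \<beta>)) + \<dots> =
        ennreal (2 * C\<^sup>2 * lam powr (- 2 - 2 * \<beta>) + 2 * C\<^sup>2 * s / lam\<^sup>2 * (B * c / lam * s))"
      using s0 layer(1) C lam by (intro ennreal_plus[symmetric]) auto
    also have "\<dots> \<le> ennreal (C' * lam powr (- 2 - 2 * \<beta>))"
    proof (rule ennreal_leI)
      have "2 * C\<^sup>2 * s / lam\<^sup>2 * (B * c / lam * s) = 2 * C\<^sup>2 * s * (B * c * s) * lam powr (- 3)"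
        using lam powr_minus_divide[of lam 3] by (simp add: power2_eq_square power3_eq_cube)
      also have "\<dots> \<le> 2 * C\<^sup>2 * s * (B * c * s) * lam powr (- 2 - 2 * \<beta>)"
        using nn \<beta> lam by (intro mult_left_mono powr_mono) auto
      finally show "2 * C\<^sup>2 * lam powr (- 2 - 2 * \<beta>) + 2 * C\<^sup>2 * s / lam\<^sup>2 * (B * c / lam * s) \<le> C' * lam powr (- 2 - 2 * \<beta>)"
        unfolding C'_def distrib_right by simp
    qed
    finally show "(\<integral>\<^sup>+x. ennreal ((m Q x)\<^sup>2) \<partial>\<mu>) \<le> ennreal (C' * lam powr (- 2 - 2 * \<beta>))" .
  qed
qed

subsection \<open>Hoelder classes\<close>

text \<open>The Hoelder class controls partial derivatives one at a time; the factor
  \<open>CARD('n)\<close> is the price of passing to all directions.\<close>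

lemma linear_functional_bound:
  fixes g :: "real ^ 'n \<Rightarrow> real" and B :: real
  assumes g: "linear g" and B: "\<And>i. \<bar>g (axis i 1)\<bar> \<le> B"
  shows "\<bar>g v\<bar> \<le> CARD('n) * B * norm v"
proof -
  have "g v = g (\<Sum>i\<in>UNIV. v $ i *\<^sub>R axis i 1)"
    using basis_expansion[of v] by (simp add: scalar_mult_eq_scaleR)
  also have "\<dots> = (\<Sum>i\<in>UNIV. v $ i * g (axis i 1))"
    using g by (simp add: linear_sum linear_scale)
  also have "\<bar>\<dots>\<bar> \<le> (\<Sum>i\<in>(UNIV :: 'n set). norm v * B)"
  proof (rule order_trans[OF sum_abs sum_mono])
    fix i :: 'n
    show "\<bar>v $ i * g (axis i 1)\<bar> \<le> norm v * B"
      unfolding abs_mult using B[of i] component_le_norm_cart[of v i] by (intro mult_mono) auto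
  qed
  finally show ?thesis by (simp add: mult_ac)
qed

lemma holder_bounded_continuous_on:
  assumes f: "holder_bounded W \<beta> L f" and \<beta>: "\<beta> > 0"
  shows "continuous_on W f"
  unfolding continuous_on
proof
  fix x assume x: "x \<in> W"
  have "((\<lambda>y. L * norm (y - x) powr \<beta>) \<longlongrightarrow> L * norm (x - x) powr \<beta>) (at x within W)"
    using \<beta> by (intro tendsto_intros tendsto_powr') auto
  then have lim: "((\<lambda>y. L * norm (y - x) powr \<beta>) \<longlongrightarrow> 0) (at x within W)" by simp
  have "((\<lambda>y. f y - f x) \<longlongrightarrow> 0) (at x within W)"
  proof (rule Lim_null_comparison[OF _ lim])
    show "\<forall>\<^sub>F y in at x within W. norm (f y - f x) \<le> L * norm (y - x) powr \<beta>"
      using f x by (auto simp: eventually_at_filter holder_bounded_def intro!: always_eventually)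
  qed
  then show "(f \<longlongrightarrow> f x) (at x within W)" by (rule LIM_zero_cancel)
qed

text \<open>The expansions of \<open>f\<close> at \<open>x\<close> towards \<open>y\<close> and
  towards its mirror image have opposite linear terms, so the symmetric second difference consists
  of two Hoelder remainders. Convexity of \<open>W\<close> keeps the segments inside the domain
  where the derivative is controlled.\<close>

lemma holder_class_1_taylor:
  fixes f :: "real ^ 'n \<Rightarrow> real" and \<beta> L :: real
  assumes f: "f \<in> holder_class_1 W \<beta> L" and W: "convex W" and \<beta>: "\<beta> > 0" and L: "L \<ge> 0"
  shows "\<And>x y. x \<in> W \<Longrightarrow> y \<in> W \<Longrightarrow> \<bar>f y - f x\<bar> \<le> CARD('n) * L * norm (y - x)"
    and "\<And>x y. x \<in> W \<Longrightarrow> y \<in> W \<Longrightarrow> 2 *\<^sub>R x - y \<in> W \<Longrightarrow>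
      \<bar>f y + f (2 *\<^sub>R x - y) - 2 * f x\<bar> \<le> 2 * CARD('n) * L * norm (y - x) powr (1 + \<beta>)"
proof -
  obtain f' where f': "\<And>x. x \<in> W \<Longrightarrow> (f has_derivative f' x) (at x within W)"
    "\<And>i. holder_bounded W \<beta> L (\<lambda>x. f' x (axis i 1))"
    using f unfolding holder_class_1_def by blast
  have lin: "linear (f' x)" if "x \<in> W" for x using has_derivative_linear[OF f'(1)[OF that]] .
  show "\<bar>f y - f x\<bar> \<le> CARD('n) * L * norm (y - x)" if x: "x \<in> W" and y: "y \<in> W" for x y
  proof -
    have "norm (f y - f x) \<le> CARD('n) * L * norm (y - x)"
    proof (rule differentiable_bound[OF W f'(1) _ y x])
      fix z assume z: "z \<in> W"
      show "onorm (f' z) \<le> CARD('n) * L"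
      proof (rule onorm_le)
        fix v
        have "\<bar>f' z v\<bar> \<le> CARD('n) * L * norm v"
          by (rule linear_functional_bound[OF lin[OF z]]) (use f'(2) z in \<open>auto simp: holder_bounded_def\<close>)
        then show "norm (f' z v) \<le> CARD('n) * L * norm v" by simp
      qed
    qed
    then show ?thesis by simp
  qed
  have taylor: "\<bar>f y - f x - f' x (y - x)\<bar> \<le> CARD('n) * L * norm (y - x) powr (1 + \<beta>)" if x: "x \<in> W" and y: "y \<in> W" for x y
  proof -
    have seg: "closed_segment x y \<subseteq> W" using x y W by (intro closed_segment_subset)
    have "norm (f y - f x - f' x (y - x)) \<le> norm (y - x) * (CARD('n) * (L * norm (y - x) powr \<beta>))"
    proof (rule differentiable_bound_linearization[where S="closed_segment x y"])
      show "x + t *\<^sub>R (y - x) \<in> closed_segment x y" if "t \<in> {0..1}" for t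
        using that by (auto simp: in_segment algebra_simps intro!: exI[of _ t])
      show "(f has_derivative f' z) (at z within closed_segment x y)" if "z \<in> closed_segment x y" for z
        using f'(1)[of z] seg that by (auto intro: has_derivative_subset)
      show "onorm (f' z - f' x) \<le> CARD('n) * (L * norm (y - x) powr \<beta>)" if z: "z \<in> closed_segment x y" for z
      proof (rule onorm_le)
        fix v
        have zW: "z \<in> W" using z seg by blast
        have "linear (f' z - f' x)" unfolding fun_diff_def by (intro linear_compose_sub lin zW x)
        then have "\<bar>(f' z - f' x) v\<bar> \<le> CARD('n) * (L * norm (y - x) powr \<beta>) * norm v"
        proof (rule linear_functional_bound)
          fix i
          have "\<bar>(f' z - f' x) (axis i 1)\<bar> \<le> L * norm (z - x) powr \<beta>"
            using f'(2)[of i] zW x by (simp add: holder_bounded_def)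
          also have "\<dots> \<le> L * norm (y - x) powr \<beta>"
            using segment_bound(1)[OF z] L \<beta> by (intro mult_left_mono powr_mono2) auto
          finally show "\<bar>(f' z - f' x) (axis i 1)\<bar> \<le> L * norm (y - x) powr \<beta>" .
        qed
        then show "norm ((f' z - f' x) v) \<le> CARD('n) * (L * norm (y - x) powr \<beta>) * norm v" by simp
      qed
      show "x \<in> closed_segment x y" by simp
    qed
    also have "norm (y - x) * (CARD('n) * (L * norm (y - x) powr \<beta>)) = CARD('n) * L * norm (y - x) powr (1 + \<beta>)"
    proof (cases "norm (y - x) = 0")
      case False
      then show ?thesis by (simp add: powr_add)
    qed simp
    finally show ?thesis by simp
  qed
  show "\<bar>f y + f (2 *\<^sub>R x - y) - 2 * f x\<bar> \<le> 2 * CARD('n) * L * norm (y - x) powr (1 + \<beta>)"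
    if x: "x \<in> W" and y: "y \<in> W" and r: "2 *\<^sub>R x - y \<in> W" for x y
  proof -
    have d: "2 *\<^sub>R x - y - x = - (y - x)" by (simp add: scaleR_2)
    have "f' x (2 *\<^sub>R x - y - x) = - f' x (y - x)" unfolding d using lin[OF x] by (rule linear_neg)
    then have "f y + f (2 *\<^sub>R x - y) - 2 * f x = (f y - f x - f' x (y - x)) +
        (f (2 *\<^sub>R x - y) - f x - f' x (2 *\<^sub>R x - y - x))" by simp
    moreover have "norm (2 *\<^sub>R x - y - x) = norm (y - x)" unfolding d by (rule norm_minus_cancel)
    ultimately show ?thesis using taylor[OF x y] taylor[OF x r] by simp
  qed
qed

subsection \<open>Joint laws in the forest experiment\<close>

text \<open>Disjoint blocks of independent sources generate independent sigma-algebras. As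
  \<open>U\<close> and \<open>V\<close> each depend on one block, their joint law is a product, and
  expectations can be computed by Fubini. \<open>U\<close> may itself be a tuple, which yields the
  triple laws below.\<close>

lemma (in prob_space) indep_pair_law:
  assumes indep: "indep_sets F I" and sub: "I1 \<subseteq> I" "I2 \<subseteq> I" "I1 \<inter> I2 = {}"
    and stable: "\<And>i. i \<in> I \<Longrightarrow> Int_stable (F i)"
    and U: "U \<in> sigma (space M) (\<Union>i\<in>I1. F i) \<rightarrow>\<^sub>M MU" and V: "V \<in> sigma (space M) (\<Union>i\<in>I2. F i) \<rightarrow>\<^sub>M MV"
  shows "U \<in> M \<rightarrow>\<^sub>M MU" "V \<in> M \<rightarrow>\<^sub>M MV"
    "distr M (MU \<Otimes>\<^sub>M MV) (\<lambda>w. (U w, V w)) = distr M MU U \<Otimes>\<^sub>M distr M MV V"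
proof -
  have ev: "F i \<subseteq> events" if "i \<in> I" for i using indep that by (auto simp: indep_sets_def)
  have pow: "(\<Union>i\<in>J. F i) \<subseteq> Pow (space M)" if "J \<subseteq> I" for J
    using ev that sets.sets_into_space by blast
  have "indep_sets (\<lambda>j. sigma_sets (space M) (\<Union>i\<in>(case_bool I1 I2 j). F i)) UNIV"
  proof (rule indep_sets_collect_sigma)
    show "indep_sets F (\<Union>j\<in>UNIV. case_bool I1 I2 j)"
      by (rule indep_sets_mono_index[OF _ indep]) (use sub in \<open>auto simp: UNIV_bool\<close>)
    show "Int_stable (F i)" if "i \<in> case_bool I1 I2 j" for i j
      using that sub stable by (cases j) auto
    show "disjoint_family_on (case_bool I1 I2) UNIV"
      using sub(3) by (auto simp: disjoint_family_on_def split: bool.splits)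
  qed
  then have ind: "indep_set (sigma_sets (space M) (\<Union>i\<in>I1. F i)) (sigma_sets (space M) (\<Union>i\<in>I2. F i))"
    unfolding indep_set_def
    by (rule indep_sets_mono_sets) (auto split: bool.splits)
  have s: "sets (sigma (space M) (\<Union>i\<in>J. F i)) = sigma_sets (space M) (\<Union>i\<in>J. F i)"
    "space (sigma (space M) (\<Union>i\<in>J. F i)) = space M" if "J \<subseteq> I" for J
    using pow[OF that] by (simp_all add: sets_measure_of space_measure_of)
  have sub_ev: "sigma_sets (space M) (\<Union>i\<in>J. F i) \<subseteq> events" if "J \<subseteq> I" for J
    using ev that by (intro sets.sigma_sets_subset) auto
  have Upre: "U -` A \<inter> space M \<in> sigma_sets (space M) (\<Union>i\<in>I1. F i)" if "A \<in> sets MU" for A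
    using measurable_sets[OF U that] s[OF sub(1)] by simp
  have Vpre: "V -` B \<inter> space M \<in> sigma_sets (space M) (\<Union>i\<in>I2. F i)" if "B \<in> sets MV" for B
    using measurable_sets[OF V that] s[OF sub(2)] by simp
  show Um: "U \<in> M \<rightarrow>\<^sub>M MU"
  proof (rule measurableI)
    show "U w \<in> space MU" if "w \<in> space M" for w using measurable_space[OF U] s[OF sub(1)] that by simp
    show "U -` A \<inter> space M \<in> events" if "A \<in> sets MU" for A using Upre[OF that] sub_ev[OF sub(1)] by blast
  qed
  show Vm: "V \<in> M \<rightarrow>\<^sub>M MV"
  proof (rule measurableI)
    show "V w \<in> space MV" if "w \<in> space M" for w using measurable_space[OF V] s[OF sub(2)] that by simp
    show "V -` A \<inter> space M \<in> events" if "A \<in> sets MV" for A using Vpre[OF that] sub_ev[OF sub(2)] by blast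
  qed
  interpret U: prob_space "distr M MU U" by (rule prob_space_distr[OF Um])
  interpret V: prob_space "distr M MV V" by (rule prob_space_distr[OF Vm])
  have UV: "(\<lambda>w. (U w, V w)) \<in> M \<rightarrow>\<^sub>M MU \<Otimes>\<^sub>M MV" by (rule measurable_Pair[OF Um Vm])
  have "distr M MU U \<Otimes>\<^sub>M distr M MV V = distr M (MU \<Otimes>\<^sub>M MV) (\<lambda>w. (U w, V w))"
  proof (rule pair_measure_eqI[OF U.sigma_finite_measure_axioms V.sigma_finite_measure_axioms])
    show "sets (distr M MU U \<Otimes>\<^sub>M distr M MV V) = sets (distr M (MU \<Otimes>\<^sub>M MV) (\<lambda>w. (U w, V w)))"
      unfolding sets_distr by (intro sets_pair_measure_cong sets_distr)
    fix A B assume "A \<in> sets (distr M MU U)" "B \<in> sets (distr M MV V)"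
    then have A: "A \<in> sets MU" and B: "B \<in> sets MV" by simp_all
    have "(\<lambda>w. (U w, V w)) -` (A \<times> B) \<inter> space M = (U -` A \<inter> space M) \<inter> (V -` B \<inter> space M)" by auto
    moreover have "prob ((U -` A \<inter> space M) \<inter> (V -` B \<inter> space M)) = prob (U -` A \<inter> space M) * prob (V -` B \<inter> space M)"
      by (rule indep_setD[OF ind Upre[OF A] Vpre[OF B]])
    ultimately show "emeasure (distr M MU U) A * emeasure (distr M MV V) B =
        emeasure (distr M (MU \<Otimes>\<^sub>M MV) (\<lambda>w. (U w, V w))) (A \<times> B)"
      using A B by (simp add: emeasure_distr[OF Um] emeasure_distr[OF Vm] emeasure_distr[OF UV] emeasure_eq_measure ennreal_mult')
  qed
  then show "distr M (MU \<Otimes>\<^sub>M MV) (\<lambda>w. (U w, V w)) = distr M MU U \<Otimes>\<^sub>M distr M MV V" by (rule sym)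
qed

text \<open>The family of sigma-algebras from \<open>forest_experiment\<close>, named so that blocks
  of sources can be addressed.\<close>

definition source_algebra ::
  "((real ^ 'n) \<times> real) measure \<Rightarrow> 'w measure \<Rightarrow> ('w \<Rightarrow> real ^ 'n) \<Rightarrow> (nat \<Rightarrow> 'w \<Rightarrow> (real ^ 'n) \<times> real) \<Rightarrow>
   (nat \<Rightarrow> 'w \<Rightarrow> (real ^ 'n) set set) \<Rightarrow> source \<Rightarrow> 'w set set" where
  "source_algebra \<rho> Pr X Z H s = (case s of
     Test \<Rightarrow> sets (vimage_algebra (space Pr) X borel)
   | Sample i \<Rightarrow> sets (vimage_algebra (space Pr) (Z i) \<rho>)
   | Hyperplanes m \<Rightarrow> sets (vimage_algebra (space Pr) (H m) config_space))"

lemma Int_stable_source_algebra: "Int_stable (source_algebra \<rho> Pr X Z H s)"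
  unfolding source_algebra_def by (cases s) (auto simp: sets.Int_stable)

lemma measurable_generated:
  assumes U: "U \<in> space M \<rightarrow> space MU" and s: "s \<in> I" "sets (vimage_algebra (space M) U MU) = F s"
    and pow: "\<And>s. s \<in> I \<Longrightarrow> F s \<subseteq> Pow (space M)"
  shows "U \<in> sigma (space M) (\<Union>s\<in>I. F s) \<rightarrow>\<^sub>M MU"
proof (rule measurableI)
  have p: "(\<Union>s\<in>I. F s) \<subseteq> Pow (space M)" using pow by blast
  have sp: "space (sigma (space M) (\<Union>s\<in>I. F s)) = space M" using p by (rule space_measure_of)
  show "U w \<in> space MU" if "w \<in> space (sigma (space M) (\<Union>s\<in>I. F s))" for w using that U unfolding sp by auto
  fix A assume "A \<in> sets MU"
  then have "U -` A \<inter> space M \<in> F s" unfolding s(2)[symmetric] by (rule in_vimage_algebra)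
  then show "U -` A \<inter> space (sigma (space M) (\<Union>s\<in>I. F s)) \<in> sets (sigma (space M) (\<Union>s\<in>I. F s))"
    unfolding sp sets_measure_of[OF p] using s(1) by (intro sigma_sets.Basic) blast
qed

lemma AE_covariate_law:
  assumes "regression_model W \<rho> f \<sigma>" "closed W"
  shows "AE x in covariate_law \<rho>. x \<in> W"
proof -
  note D = regression_modelD[OF assms(1)]
  have "AE z in \<rho>. fst z \<in> W" using D(3) by (intro AE_I2) auto
  then show ?thesis
    unfolding covariate_law_def using assms(2) by (subst AE_distr_iff[OF D(4)]) auto
qed

section \<open>Product laws within one experiment\<close>

locale forest =
  fixes W :: "(real ^ 'n) set" and \<rho> :: "((real ^ 'n) \<times> real) measure" and \<phi> :: "(real ^ 'n) measure"
    and lam :: real and n M :: nat and Pr :: "'w measure" and X Z H f \<sigma>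
  assumes exp: "forest_experiment W \<rho> \<phi> lam n M Pr X Z H"
    and \<phi>: "directional_distribution \<phi>"
    and model: "regression_model W \<rho> f \<sigma>"
begin

sublocale prob_space Pr using exp by (simp add: forest_experiment_def)

abbreviation "F \<equiv> source_algebra \<rho> Pr X Z H"
abbreviation "I \<equiv> {Test} \<union> Sample ` {..<n} \<union> Hyperplanes ` {..<M}"
abbreviation "\<mu> \<equiv> covariate_law \<rho>"

lemma lam_pos: "lam > 0" and M_pos: "M \<ge> 1"
  using exp by (auto simp: forest_experiment_def)

lemma indep: "indep_sets F I"
  using exp unfolding forest_experiment_def source_algebra_def[abs_def] by blast

lemma X: "X \<in> Pr \<rightarrow>\<^sub>M borel" "distr Pr borel X = \<mu>" "\<And>w. w \<in> space Pr \<Longrightarrow> X w \<in> W"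
proof -
  have X: "X \<in> Pr \<rightarrow>\<^sub>M restrict_space borel W" using exp by (simp add: forest_experiment_def)
  then show "X \<in> Pr \<rightarrow>\<^sub>M borel" by (simp add: measurable_restrict_space2_iff)
  show "X w \<in> W" if "w \<in> space Pr" for w using measurable_space[OF X that] by (simp add: space_restrict_space)
  show "distr Pr borel X = \<mu>" using exp by (simp add: forest_experiment_def)
qed

lemma Z: "i < n \<Longrightarrow> Z i \<in> Pr \<rightarrow>\<^sub>M \<rho>" "i < n \<Longrightarrow> distr Pr \<rho> (Z i) = \<rho>"
  using exp by (auto simp: forest_experiment_def)

lemma H: "m < M \<Longrightarrow> poisson_hyperplane_process Pr \<phi> lam (H m)"
  using exp by (auto simp: forest_experiment_def)

lemma H_config: "m < M \<Longrightarrow> H m \<in> Pr \<rightarrow>\<^sub>M config_space"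
  using H by (auto simp: poisson_hyperplane_process_def)

lemmas H_void = poisson_void_law[OF H \<phi> lam_pos]

lemma F_Pow: "s \<in> I \<Longrightarrow> F s \<subseteq> Pow (space Pr)"
  using indep sets.sets_into_space unfolding indep_sets_def by blast

lemma X_generated: "Test \<in> J \<Longrightarrow> J \<subseteq> I \<Longrightarrow> X \<in> sigma (space Pr) (\<Union>s\<in>J. F s) \<rightarrow>\<^sub>M borel"
  by (rule measurable_generated[where s=Test]) (use F_Pow in \<open>auto simp: source_algebra_def\<close>)

lemma Z_generated: "Sample i \<in> J \<Longrightarrow> J \<subseteq> I \<Longrightarrow> Z i \<in> sigma (space Pr) (\<Union>s\<in>J. F s) \<rightarrow>\<^sub>M \<rho>"
  by (rule measurable_generated[where s="Sample i"])
    (use F_Pow measurable_space[OF Z(1)] in \<open>auto simp: source_algebra_def\<close>)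

lemma H_generated: "Hyperplanes m \<in> J \<Longrightarrow> J \<subseteq> I \<Longrightarrow> H m \<in> sigma (space Pr) (\<Union>s\<in>J. F s) \<rightarrow>\<^sub>M void_space"
  by (rule measurable_config_void, rule measurable_generated[where s="Hyperplanes m"])
    (use F_Pow measurable_space[OF H_config] in \<open>auto simp: source_algebra_def\<close>)

lemmas pair_law = indep_pair_law[OF indep _ _ _ Int_stable_source_algebra]

lemma law_X_H:
  assumes m: "m < M"
  shows "distr Pr (borel \<Otimes>\<^sub>M void_space) (\<lambda>w. (X w, H m w)) = \<mu> \<Otimes>\<^sub>M distr Pr void_space (H m)"
  using pair_law(3)[of "{Test}" "{Hyperplanes m}" X borel "H m" void_space] m
    X_generated[of "{Test}"] H_generated[of m "{Hyperplanes m}"] X(2) by simp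

text \<open>Two different trees share the test point but have independent configurations; the
  off-diagonal bias terms factorise through this law.\<close>

lemma law_X_H_H:
  assumes m: "m < M" "m' < M" "m \<noteq> m'"
  shows "distr Pr ((borel \<Otimes>\<^sub>M void_space) \<Otimes>\<^sub>M void_space) (\<lambda>w. ((X w, H m w), H m' w)) =
    (\<mu> \<Otimes>\<^sub>M distr Pr void_space (H m)) \<Otimes>\<^sub>M distr Pr void_space (H m')"
proof -
  have s: "{Test, Hyperplanes m} \<subseteq> I" "{Hyperplanes m'} \<subseteq> I" using m by auto
  have U: "(\<lambda>w. (X w, H m w)) \<in> sigma (space Pr) (\<Union>s\<in>{Test, Hyperplanes m}. F s) \<rightarrow>\<^sub>M borel \<Otimes>\<^sub>M void_space"
    by (rule measurable_Pair[OF X_generated[OF _ s(1)] H_generated[OF _ s(1)]]) simp_all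
  show ?thesis
    using pair_law(3)[OF s _ U H_generated[OF _ s(2)]] m law_X_H[OF m(1)] by simp
qed

text \<open>Independence of the sample is read off from the sources \<open>Sample i\<close> alone.
  The condition \<open>n \<ge> 1\<close> provides the nonempty index set required by the
  characterisation of independence through product laws.\<close>

lemma law_Z:
  assumes n: "n \<ge> 1"
  shows "distr Pr (PiM {..<n} (\<lambda>_. \<rho>)) (\<lambda>w. \<lambda>i\<in>{..<n}. Z i w) = PiM {..<n} (\<lambda>_. \<rho>)"
proof -
  have "indep_vars (\<lambda>_. \<rho>) Z {..<n}"
    unfolding indep_vars_def2
  proof (intro conjI ballI)
    show "Z i \<in> Pr \<rightarrow>\<^sub>M \<rho>" if "i \<in> {..<n}" for i using Z(1) that by simp
    show "indep_sets (\<lambda>i. {Z i -` A \<inter> space Pr |A. A \<in> sets \<rho>}) {..<n}"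
    proof (rule indep_setsI)
      show "{Z i -` A \<inter> space Pr |A. A \<in> sets \<rho>} \<subseteq> events" if "i \<in> {..<n}" for i
        using measurable_sets[OF Z(1)] that by auto
      fix A J assume J: "J \<noteq> {}" "J \<subseteq> {..<n}" "finite J" and A: "\<forall>j\<in>J. A j \<in> {Z j -` B \<inter> space Pr |B. B \<in> sets \<rho>}"
      let ?A = "\<lambda>s. case s of Sample i \<Rightarrow> A i | _ \<Rightarrow> {}"
      have "prob (\<Inter>s\<in>Sample ` J. ?A s) = (\<Prod>s\<in>Sample ` J. prob (?A s))"
      proof (rule indep_setsD[OF indep])
        show "\<forall>s\<in>Sample ` J. ?A s \<in> F s"
        proof
          fix s assume "s \<in> Sample ` J"
          then obtain j where j: "s = Sample j" "j \<in> J" by auto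
          then obtain B where "A j = Z j -` B \<inter> space Pr" "B \<in> sets \<rho>" using A by blast
          then show "?A s \<in> F s" unfolding j source_algebra_def by (simp add: in_vimage_algebra)
        qed
      qed (use J in auto)
      moreover have "(\<Prod>s\<in>Sample ` J. prob (?A s)) = (\<Prod>j\<in>J. prob (A j))"
        by (subst prod.reindex) (auto simp: inj_on_def)
      ultimately show "prob (\<Inter>j\<in>J. A j) = (\<Prod>j\<in>J. prob (A j))" by simp
    qed
  qed
  moreover have ne: "{..<n} \<noteq> {}" using n by (auto simp: lessThan_empty_iff)
  ultimately have "distr Pr (PiM {..<n} (\<lambda>_. \<rho>)) (\<lambda>w. \<lambda>i\<in>{..<n}. Z i w) = PiM {..<n} (\<lambda>i. distr Pr \<rho> (Z i))"
    using indep_vars_iff_distr_eq_PiM'[OF ne, of Z "\<lambda>_. \<rho>"] Z(1) by auto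
  also have "\<dots> = PiM {..<n} (\<lambda>_. \<rho>)" by (intro PiM_cong refl Z(2)) simp
  finally show ?thesis .
qed

lemma law_X_H_Z:
  assumes m: "m < M" and n: "n \<ge> 1"
  shows "distr Pr ((borel \<Otimes>\<^sub>M void_space) \<Otimes>\<^sub>M PiM {..<n} (\<lambda>_. \<rho>)) (\<lambda>w. ((X w, H m w), \<lambda>i\<in>{..<n}. Z i w)) =
    (\<mu> \<Otimes>\<^sub>M distr Pr void_space (H m)) \<Otimes>\<^sub>M PiM {..<n} (\<lambda>_. \<rho>)"
proof -
  have s: "{Test, Hyperplanes m} \<subseteq> I" "Sample ` {..<n} \<subseteq> I" using m by auto
  have U: "(\<lambda>w. (X w, H m w)) \<in> sigma (space Pr) (\<Union>s\<in>{Test, Hyperplanes m}. F s) \<rightarrow>\<^sub>M borel \<Otimes>\<^sub>M void_space"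
    by (rule measurable_Pair[OF X_generated[OF _ s(1)] H_generated[OF _ s(1)]]) simp_all
  have V: "(\<lambda>w. \<lambda>i\<in>{..<n}. Z i w) \<in> sigma (space Pr) (\<Union>s\<in>Sample ` {..<n}. F s) \<rightarrow>\<^sub>M PiM {..<n} (\<lambda>_. \<rho>)"
    by (rule measurable_restrict) (rule Z_generated[OF _ s(2)], simp)
  show ?thesis
    using pair_law(3)[OF s _ U V] m law_X_H[OF m] law_Z[OF n] by auto
qed

text \<open>\<open>U\<close> is independent of the configuration, so the statement for a
  deterministic point lifts by Fubini. It is applied to the test point and to each sample
  point.\<close>

lemma AE_same_cell:
  assumes m: "m < M" and s: "s \<in> I" "s \<noteq> Hyperplanes m"
    and U: "U \<in> sigma (space Pr) (\<Union>s\<in>{s}. F s) \<rightarrow>\<^sub>M borel"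
  shows "AE w in Pr. same_cell (H m w) (U w) (U w)"
proof -
  have sub: "{s} \<subseteq> I" "{Hyperplanes m} \<subseteq> I" using m s by auto
  note L = pair_law[OF sub _ U H_generated[OF _ sub(2)]]
  have Um: "U \<in> Pr \<rightarrow>\<^sub>M borel" using L(1) s by auto
  let ?Q = "distr Pr void_space (H m)" and ?U = "distr Pr borel U"
  interpret U: prob_space ?U by (rule prob_space_distr[OF Um])
  interpret Q: prob_space ?Q by (rule prob_space_distr[OF H_void(1)[OF m]])
  interpret UQ: pair_sigma_finite ?U ?Q ..
  have law: "distr Pr (borel \<Otimes>\<^sub>M void_space) (\<lambda>w. (U w, H m w)) = ?U \<Otimes>\<^sub>M ?Q" using L(3) s by auto
  have sets: "sets (?U \<Otimes>\<^sub>M ?Q) = sets (borel \<Otimes>\<^sub>M void_space)" by (intro sets_pair_measure_cong sets_distr)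
  have pm: "{p \<in> space (?U \<Otimes>\<^sub>M ?Q). same_cell (snd p) (fst p) (fst p)} \<in> sets (?U \<Otimes>\<^sub>M ?Q)"
    using same_cell_pair_measurable unfolding sets sets_eq_imp_space_eq[OF sets] pred_def .
  have "AE p in ?U \<Otimes>\<^sub>M ?Q. same_cell (snd p) (fst p) (fst p)"
    by (rule UQ.AE_pair_measure[OF pm]) (auto intro!: AE_I2 void_law_same_cell_self[OF H_void(2)[OF m] \<phi>])
  then have "AE p in distr Pr (borel \<Otimes>\<^sub>M void_space) (\<lambda>w. (U w, H m w)). same_cell (snd p) (fst p) (fst p)"
    by (simp only: law)
  from AE_distrD[OF measurable_Pair[OF Um H_void(1)[OF m]] this] show ?thesis by simp
qed

text \<open>Almost surely neither the test point nor any sample point lies on a hyperplane. On that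
  event \<open>mem_cell_of_iff\<close> identifies the indicators, and the defaults for empty cells
  coincide.\<close>

lemma AE_tree_eq:
  assumes m: "m < M"
  shows "AE w in Pr. tree_estimator n (\<lambda>i. Z i w) (induced_tessellation W (H m w)) (X w) =
    cell_tree n (\<lambda>i. Z i w) (H m w) (X w)"
proof -
  have 1: "AE w in Pr. same_cell (H m w) (X w) (X w)"
    by (rule AE_same_cell[OF m, where s=Test]) (use X_generated[of "{Test}"] in simp_all)
  have 2: "AE w in Pr. \<forall>i\<in>{..<n}. same_cell (H m w) (fst (Z i w)) (fst (Z i w))"
  proof (rule AE_finite_allI)
    fix i assume i: "i \<in> {..<n}"
    then have "Z i \<in> sigma (space Pr) (\<Union>s\<in>{Sample i}. F s) \<rightarrow>\<^sub>M \<rho>" by (intro Z_generated) auto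
    from measurable_compose[OF this regression_modelD(4)[OF model]]
    show "AE w in Pr. same_cell (H m w) (fst (Z i w)) (fst (Z i w))"
      by (rule AE_same_cell[OF m, where s="Sample i", rotated 2]) (use i in auto)
  qed simp
  show ?thesis
    using 1 2 AE_space
  proof eventually_elim
    case (elim w)
    have h: "H m w \<in> hyperplane_configs" using measurable_space[OF H_void(1)[OF m] elim(3)] by simp
    have ind: "indicator (cell_of (induced_tessellation W (H m w)) (X w)) (fst (Z i w)) =
        (indicator {y. same_cell (H m w) (X w) y} (fst (Z i w)) :: real)" if i: "i < n" for i
    proof -
      have "fst (Z i w) \<in> W"
        using measurable_space[OF Z(1)[OF i] elim(3)] regression_modelD(3)[OF model] by auto
      then have "fst (Z i w) \<in> cell_of (induced_tessellation W (H m w)) (X w) \<longleftrightarrow> same_cell (H m w) (X w) (fst (Z i w))"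
        using elim i by (intro mem_cell_of_iff[OF h X(3)[OF elim(3)]]) auto
      then show ?thesis by (simp add: indicator_def)
    qed
    show ?case
      unfolding tree_estimator_def cell_count_def cell_tree_def using ind by simp
  qed
qed


subsection \<open>Risk decomposition\<close>

context
  fixes ff :: "real ^ 'n \<Rightarrow> real" and L :: real
  assumes ff: "ff \<in> borel_measurable borel" "\<And>x. x \<in> W \<Longrightarrow> ff x = f x" "\<And>x. \<bar>ff x\<bar> \<le> L"
    and L: "L > 0" and n: "n \<ge> 1"
begin

abbreviation "Q m \<equiv> distr Pr void_space (H m)"
abbreviation "bias x h \<equiv> cell_average \<mu> ff h x - ff x"

lemma bias_measurable: "(\<lambda>p. bias (fst p) (snd p)) \<in> borel_measurable (borel \<Otimes>\<^sub>M void_space)"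
  using cell_average_measurable[OF covariate_lawD(1,2)[OF model] ff(1)] measurable_compose[OF measurable_fst ff(1)]
  by (rule borel_measurable_diff)

lemma bias_bound: "h \<in> hyperplane_configs \<Longrightarrow> \<bar>bias x h\<bar> \<le> 2 * L"
  using cell_average_bound[OF covariate_lawD(1,2)[OF model] ff(1,3), of h x] ff(3)[of x] by linarith

text \<open>By the product law the sample can be integrated out at a fixed test point and
  configuration, where \<open>tree_variance\<close> applies. Exchanging the two remaining integrals
  leaves the quantity bounded by \<open>B\<close>.\<close>

lemma tree_variance_risk:
  assumes m: "m < M"
    and B: "(\<integral>\<^sup>+ h. (\<integral>\<^sup>+ x. inverse (cell_mass \<mu> h x) \<partial>\<mu>) \<partial>Q m) \<le> ennreal B"
  shows "(\<lambda>w. cell_tree n (\<lambda>i. Z i w) (H m w) (X w)) \<in> borel_measurable Pr"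
    "(\<integral>\<^sup>+ w. ennreal ((cell_tree n (\<lambda>i. Z i w) (H m w) (X w) - cell_average \<mu> ff (H m w) (X w))\<^sup>2) \<partial>Pr)
      \<le> ennreal ((4 * \<sigma>\<^sup>2 + 17 * L\<^sup>2) / n) * ennreal B"
proof -
  note \<mu> = covariate_lawD[OF model]
  interpret \<mu>: prob_space \<mu> by (rule \<mu>(1))
  interpret Q: prob_space "Q m" by (rule prob_space_distr[OF H_void(1)[OF m]])
  interpret \<rho>: prob_space \<rho> by (rule regression_modelD(1)[OF model])
  let ?P = "PiM {..<n} (\<lambda>_. \<rho>)"
  interpret P: prob_space ?P by (rule prob_space_PiM) (rule \<rho>.prob_space_axioms)
  interpret \<mu>Q: pair_sigma_finite \<mu> "Q m" ..
  let ?N = "(borel \<Otimes>\<^sub>M void_space) \<Otimes>\<^sub>M ?P :: (((real ^ 'n) \<times> (real ^ 'n) set set) \<times> (nat \<Rightarrow> (real ^ 'n) \<times> real)) measure"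
  have s1: "sets (\<mu> \<Otimes>\<^sub>M Q m) = sets (borel \<Otimes>\<^sub>M void_space)" by (intro sets_pair_measure_cong \<mu>(2) sets_distr)
  have s2: "sets ((\<mu> \<Otimes>\<^sub>M Q m) \<Otimes>\<^sub>M ?P) = sets ?N" by (intro sets_pair_measure_cong s1 refl)
  have comp: "(\<lambda>p. snd p i) \<in> ?N \<rightarrow>\<^sub>M \<rho>" if "i < n" for i
    using that by (intro measurable_compose[OF measurable_snd measurable_component_singleton]) simp
  have pred: "Measurable.pred ?N (\<lambda>p. same_cell (snd (fst p)) (fst (fst p)) (fst (snd p i)))" if i: "i < n" for i
  proof -
    have "(\<lambda>p. (fst p, fst (snd p i))) \<in> ?N \<rightarrow>\<^sub>M (borel \<Otimes>\<^sub>M void_space) \<Otimes>\<^sub>M borel"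
      by (intro measurable_Pair measurable_fst measurable_compose[OF comp[OF i] regression_modelD(4)[OF model]])
    from measurable_compose[OF this same_cell_triple_measurable] show ?thesis by simp
  qed
  have ind: "(\<lambda>p. indicator {y. same_cell (snd (fst p)) (fst (fst p)) y} (fst (snd p i)) :: real) \<in> borel_measurable ?N" if i: "i < n" for i
  proof -
    have "(\<lambda>p. indicator {y. same_cell (snd (fst p)) (fst (fst p)) y} (fst (snd p i)) :: real) =
        (\<lambda>p. if same_cell (snd (fst p)) (fst (fst p)) (fst (snd p i)) then 1 else 0)" by (auto simp: indicator_def)
    also have "\<dots> \<in> borel_measurable ?N" using pred[OF i] by (intro measurable_If) (simp_all add: pred_def)
    finally show ?thesis .
  qed
  have tree: "(\<lambda>p. cell_tree n (snd p) (snd (fst p)) (fst (fst p))) \<in> borel_measurable ?N"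
    unfolding cell_tree_def
    by (intro borel_measurable_divide borel_measurable_sum borel_measurable_times ind
        measurable_compose[OF comp regression_modelD(5)[OF model]]) simp_all
  have avg: "(\<lambda>p. cell_average \<mu> ff (snd (fst p)) (fst (fst p))) \<in> borel_measurable ?N"
    by (rule measurable_compose[OF measurable_fst cell_average_measurable[OF \<mu>(1,2) ff(1)]])
  define g where "g = (\<lambda>p. ennreal ((cell_tree n (snd p) (snd (fst p)) (fst (fst p)) - cell_average \<mu> ff (snd (fst p)) (fst (fst p)))\<^sup>2))"
  have gm: "g \<in> borel_measurable ?N" unfolding g_def using tree avg by measurable
  have gm': "g \<in> borel_measurable ((\<mu> \<Otimes>\<^sub>M Q m) \<Otimes>\<^sub>M ?P)" using gm unfolding measurable_cong_sets[OF s2 refl] .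
  let ?T = "\<lambda>w. ((X w, H m w), \<lambda>i\<in>{..<n}. Z i w)"
  have Tm: "?T \<in> Pr \<rightarrow>\<^sub>M ?N"
    by (intro measurable_Pair X(1) H_void(1)[OF m] measurable_restrict Z(1)) simp
  have restr: "cell_tree n (\<lambda>i\<in>{..<n}. Z i w) h x = cell_tree n (\<lambda>i. Z i w) h x" for w h x
    by (simp add: cell_tree_def)
  show "(\<lambda>w. cell_tree n (\<lambda>i. Z i w) (H m w) (X w)) \<in> borel_measurable Pr"
    using measurable_compose[OF Tm tree] by (simp add: restr)
  have "(\<lambda>p. inverse (cell_mass \<mu> (snd p) (fst p))) \<in> borel_measurable (borel \<Otimes>\<^sub>M void_space)"
    using cell_mass_measurable[OF \<mu>.sigma_finite_measure_axioms \<mu>(2)] by (rule borel_measurable_inverse_ennreal)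
  then have im: "(\<lambda>p. inverse (cell_mass \<mu> (snd p) (fst p))) \<in> borel_measurable (\<mu> \<Otimes>\<^sub>M Q m)"
    unfolding measurable_cong_sets[OF s1 refl] .
  have "(\<integral>\<^sup>+ w. ennreal ((cell_tree n (\<lambda>i. Z i w) (H m w) (X w) - cell_average \<mu> ff (H m w) (X w))\<^sup>2) \<partial>Pr) =
      (\<integral>\<^sup>+ w. g (?T w) \<partial>Pr)" by (simp add: g_def restr)
  also have "\<dots> = (\<integral>\<^sup>+ p. g p \<partial>distr Pr ?N ?T)" by (rule nn_integral_distr[OF Tm, symmetric]) (use gm in simp)
  also have "\<dots> = (\<integral>\<^sup>+ p. g p \<partial>((\<mu> \<Otimes>\<^sub>M Q m) \<Otimes>\<^sub>M ?P))" by (simp only: law_X_H_Z[OF m n])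
  also have "\<dots> = (\<integral>\<^sup>+ q. (\<integral>\<^sup>+ \<omega>. g (q, \<omega>) \<partial>?P) \<partial>(\<mu> \<Otimes>\<^sub>M Q m))" by (rule P.nn_integral_fst[OF gm', symmetric])
  also have "\<dots> \<le> (\<integral>\<^sup>+ q. ennreal ((4 * \<sigma>\<^sup>2 + 17 * L\<^sup>2) / n) * inverse (cell_mass \<mu> (snd q) (fst q)) \<partial>(\<mu> \<Otimes>\<^sub>M Q m))"
  proof (rule nn_integral_mono)
    fix q assume "q \<in> space (\<mu> \<Otimes>\<^sub>M Q m)"
    then have h: "snd q \<in> hyperplane_configs" by (auto simp: space_pair_measure)
    show "(\<integral>\<^sup>+ \<omega>. g (q, \<omega>) \<partial>?P) \<le> ennreal ((4 * \<sigma>\<^sup>2 + 17 * L\<^sup>2) / n) * inverse (cell_mass \<mu> (snd q) (fst q))"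
      unfolding g_def using tree_variance[OF model ff L h n, of "fst q"] by simp
  qed
  also have "\<dots> = ennreal ((4 * \<sigma>\<^sup>2 + 17 * L\<^sup>2) / n) * (\<integral>\<^sup>+ q. inverse (cell_mass \<mu> (snd q) (fst q)) \<partial>(\<mu> \<Otimes>\<^sub>M Q m))"
    by (rule nn_integral_cmult[OF im])
  also have "(\<integral>\<^sup>+ q. inverse (cell_mass \<mu> (snd q) (fst q)) \<partial>(\<mu> \<Otimes>\<^sub>M Q m)) = (\<integral>\<^sup>+ h. (\<integral>\<^sup>+ x. inverse (cell_mass \<mu> h x) \<partial>\<mu>) \<partial>Q m)"
    using \<mu>Q.nn_integral_snd[OF im] by simp
  also have "ennreal ((4 * \<sigma>\<^sup>2 + 17 * L\<^sup>2) / n) * \<dots> \<le> ennreal ((4 * \<sigma>\<^sup>2 + 17 * L\<^sup>2) / n) * ennreal B"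
    by (rule mult_left_mono[OF B]) simp
  finally show "(\<integral>\<^sup>+ w. ennreal ((cell_tree n (\<lambda>i. Z i w) (H m w) (X w) - cell_average \<mu> ff (H m w) (X w))\<^sup>2) \<partial>Pr)
      \<le> ennreal ((4 * \<sigma>\<^sup>2 + 17 * L\<^sup>2) / n) * ennreal B" .
qed


text \<open>Given the test point, the biases of two trees are independent, so their product
  contributes mean biases instead of second moments. This is the source of the gain of a forest over
  a tree.\<close>

lemma bias_product:
  assumes m: "m < M" "m' < M" "m \<noteq> m'" and A: "A \<in> sets borel"
  shows "(\<integral>w. indicator A (X w) * (bias (X w) (H m w) * bias (X w) (H m' w)) \<partial>Pr) =
    (\<integral>x. indicator A x * ((\<integral>h. bias x h \<partial>Q m) * (\<integral>h. bias x h \<partial>Q m')) \<partial>\<mu>)"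
proof -
  note \<mu> = covariate_lawD[OF model]
  interpret \<mu>: prob_space \<mu> by (rule \<mu>(1))
  interpret Q: prob_space "Q m" by (rule prob_space_distr[OF H_void(1)[OF m(1)]])
  interpret Q': prob_space "Q m'" by (rule prob_space_distr[OF H_void(1)[OF m(2)]])
  interpret \<mu>Q: pair_prob_space \<mu> "Q m" ..
  interpret \<mu>QQ: pair_prob_space "\<mu> \<Otimes>\<^sub>M Q m" "Q m'" ..
  let ?N = "(borel \<Otimes>\<^sub>M void_space) \<Otimes>\<^sub>M void_space :: (((real ^ 'n) \<times> (real ^ 'n) set set) \<times> (real ^ 'n) set set) measure"
  have s1: "sets (\<mu> \<Otimes>\<^sub>M Q m) = sets (borel \<Otimes>\<^sub>M void_space)" by (intro sets_pair_measure_cong \<mu>(2) sets_distr)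
  have s2: "sets ((\<mu> \<Otimes>\<^sub>M Q m) \<Otimes>\<^sub>M Q m') = sets ?N" by (intro sets_pair_measure_cong s1 sets_distr)
  let ?T = "\<lambda>w. ((X w, H m w), H m' w)"
  have Tm: "?T \<in> Pr \<rightarrow>\<^sub>M ?N" by (intro measurable_Pair X(1) H_void(1) m)
  define g where "g = (\<lambda>p. indicator A (fst (fst p)) * (bias (fst (fst p)) (snd (fst p)) * bias (fst (fst p)) (snd p)))"
  have b1: "(\<lambda>p. bias (fst (fst p)) (snd (fst p))) \<in> borel_measurable ?N"
    by (rule measurable_compose[OF measurable_fst bias_measurable])
  have b2: "(\<lambda>p. bias (fst (fst p)) (snd p)) \<in> borel_measurable ?N"
  proof -
    have "(\<lambda>p. (fst (fst p), snd p)) \<in> ?N \<rightarrow>\<^sub>M borel \<Otimes>\<^sub>M void_space"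
      by (intro measurable_Pair measurable_snd measurable_compose[OF measurable_fst measurable_fst])
    from measurable_compose[OF this bias_measurable] show ?thesis by simp
  qed
  have i1: "(\<lambda>p. indicator A (fst (fst p)) :: real) \<in> borel_measurable ?N"
    by (rule measurable_compose[OF measurable_compose[OF measurable_fst measurable_fst] borel_measurable_indicator[OF A]])
  have gm: "g \<in> borel_measurable ?N" unfolding g_def by (intro borel_measurable_times i1 b1 b2)
  then have gm': "g \<in> borel_measurable ((\<mu> \<Otimes>\<^sub>M Q m) \<Otimes>\<^sub>M Q m')" unfolding measurable_cong_sets[OF s2 refl] .
  have gb: "\<bar>g p\<bar> \<le> (2 * L) * (2 * L)" if "p \<in> space ?N" for p
  proof -
    have c: "snd (fst p) \<in> hyperplane_configs" "snd p \<in> hyperplane_configs" using that by (auto simp: space_pair_measure)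
    have "\<bar>bias (fst (fst p)) (snd (fst p)) * bias (fst (fst p)) (snd p)\<bar> \<le> (2 * L) * (2 * L)"
      unfolding abs_mult using bias_bound[OF c(1)] bias_bound[OF c(2)] L by (intro mult_mono) auto
    then show ?thesis using L by (cases "fst (fst p) \<in> A") (simp_all add: g_def)
  qed
  have gi: "integrable ((\<mu> \<Otimes>\<^sub>M Q m) \<Otimes>\<^sub>M Q m') g"
  proof (rule \<mu>QQ.integrable_const_bound[OF AE_I2 gm'])
    fix p assume "p \<in> space ((\<mu> \<Otimes>\<^sub>M Q m) \<Otimes>\<^sub>M Q m')"
    then show "norm (g p) \<le> (2 * L) * (2 * L)" using gb[of p] sets_eq_imp_space_eq[OF s2] by simp
  qed
  have "(\<integral>w. indicator A (X w) * (bias (X w) (H m w) * bias (X w) (H m' w)) \<partial>Pr) = (\<integral>w. g (?T w) \<partial>Pr)"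
    by (simp add: g_def)
  also have "\<dots> = (\<integral>p. g p \<partial>distr Pr ?N ?T)" by (rule integral_distr[OF Tm gm, symmetric])
  also have "\<dots> = (\<integral>p. g p \<partial>((\<mu> \<Otimes>\<^sub>M Q m) \<Otimes>\<^sub>M Q m'))" by (simp only: law_X_H_H[OF m])
  also have "\<dots> = (\<integral>q. (\<integral>h'. g (q, h') \<partial>Q m') \<partial>(\<mu> \<Otimes>\<^sub>M Q m))" by (rule \<mu>QQ.integral_fst'[OF gi, symmetric])
  also have "\<dots> = (\<integral>x. (\<integral>h. (\<integral>h'. g ((x, h), h') \<partial>Q m') \<partial>Q m) \<partial>\<mu>)"
    by (rule \<mu>Q.integral_fst'[OF \<mu>QQ.integrable_fst'[OF gi], symmetric])
  also have "\<dots> = (\<integral>x. indicator A x * ((\<integral>h. bias x h \<partial>Q m) * (\<integral>h. bias x h \<partial>Q m')) \<partial>\<mu>)"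
    unfolding g_def fst_conv snd_conv integral_mult_right_zero integral_mult_left_zero ..
  finally show ?thesis .
qed

text \<open>By Fubini the pointwise bound is averaged over the test point; points of
  \<open>W\<close> in the support carry the full mass of its law.\<close>

lemma bias_square:
  assumes W: "closed W" and m: "m < M" and e2: "\<And>x. x \<in> W \<inter> measure_support \<mu> \<Longrightarrow> (\<integral>\<^sup>+h. ennreal ((bias x h)\<^sup>2) \<partial>Q m) \<le> ennreal e2"
  shows "(\<integral>\<^sup>+w. ennreal ((bias (X w) (H m w))\<^sup>2) \<partial>Pr) \<le> ennreal e2"
proof -
  note \<mu> = covariate_lawD[OF model]
  interpret \<mu>: prob_space \<mu> by (rule \<mu>(1))
  interpret Q: prob_space "Q m" by (rule prob_space_distr[OF H_void(1)[OF m]])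
  let ?N = "borel \<Otimes>\<^sub>M void_space :: ((real ^ 'n) \<times> (real ^ 'n) set set) measure"
  have s1: "sets (\<mu> \<Otimes>\<^sub>M Q m) = sets ?N" by (intro sets_pair_measure_cong \<mu>(2) sets_distr)
  have gm: "(\<lambda>p. ennreal ((bias (fst p) (snd p))\<^sup>2)) \<in> borel_measurable ?N"
    by (intro measurable_compose[OF _ measurable_ennreal] borel_measurable_power bias_measurable)
  then have gm': "(\<lambda>p. ennreal ((bias (fst p) (snd p))\<^sup>2)) \<in> borel_measurable (\<mu> \<Otimes>\<^sub>M Q m)"
    unfolding measurable_cong_sets[OF s1 refl] .
  let ?T = "\<lambda>w. (X w, H m w)"
  have Tm: "?T \<in> Pr \<rightarrow>\<^sub>M ?N" by (intro measurable_Pair X(1) H_void(1) m)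
  have "(\<integral>\<^sup>+w. ennreal ((bias (X w) (H m w))\<^sup>2) \<partial>Pr) = (\<integral>\<^sup>+p. ennreal ((bias (fst p) (snd p))\<^sup>2) \<partial>distr Pr ?N ?T)"
    using nn_integral_distr[OF Tm, of "\<lambda>p. ennreal ((bias (fst p) (snd p))\<^sup>2)"] gm by simp
  also have "\<dots> = (\<integral>\<^sup>+p. ennreal ((bias (fst p) (snd p))\<^sup>2) \<partial>(\<mu> \<Otimes>\<^sub>M Q m))" by (simp only: law_X_H[OF m])
  also have "\<dots> = (\<integral>\<^sup>+x. (\<integral>\<^sup>+h. ennreal ((bias x h)\<^sup>2) \<partial>Q m) \<partial>\<mu>)"
    using Q.nn_integral_fst[OF gm'] by simp
  also have "\<dots> \<le> (\<integral>\<^sup>+x. ennreal e2 \<partial>\<mu>)"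
  proof (rule nn_integral_mono_AE)
    have "AE x in \<mu>. x \<in> W" by (rule AE_covariate_law[OF model W])
    then show "AE x in \<mu>. (\<integral>\<^sup>+h. ennreal ((bias x h)\<^sup>2) \<partial>Q m) \<le> ennreal e2"
      using AE_measure_support[OF \<mu>(2)] by eventually_elim (auto intro: e2)
  qed
  also have "\<dots> = ennreal e2" by (simp add: \<mu>.emeasure_space_1)
  finally show ?thesis .
qed

text \<open>\<open>e1\<close> bounds the squared mean bias, \<open>e2\<close> the mean squared bias
  of one tree. Of the M^2 products only the M diagonal ones cost \<open>e2\<close>, so averaging
  leaves \<open>e1 + e2 / M\<close>. The indicator of \<open>A\<close> restricts the bias part and
  is bounded by 1 in the variance part.\<close>

lemma forest_risk:
  assumes W: "closed W" and A: "A \<in> sets borel"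
    and B: "\<And>m. m < M \<Longrightarrow> (\<integral>\<^sup>+ h. (\<integral>\<^sup>+ x. inverse (cell_mass \<mu> h x) \<partial>\<mu>) \<partial>Q m) \<le> ennreal B" "B \<ge> 0"
    and e1: "\<And>Q'. void_law \<phi> lam Q' \<Longrightarrow> (\<integral>\<^sup>+x. ennreal (indicator A x * (\<integral>h. bias x h \<partial>Q')\<^sup>2) \<partial>\<mu>) \<le> ennreal e1" "e1 \<ge> 0"
    and e2: "\<And>Q' x. void_law \<phi> lam Q' \<Longrightarrow> x \<in> W \<inter> measure_support \<mu> \<Longrightarrow> (\<integral>\<^sup>+h. ennreal ((bias x h)\<^sup>2) \<partial>Q') \<le> ennreal e2" "e2 \<ge> 0"
  shows "(\<integral>\<^sup>+w. ennreal (indicator A (X w) * squared_error W f n M X Z H w) \<partial>Pr) \<le>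
    ennreal (2 * ((4 * \<sigma>\<^sup>2 + 17 * L\<^sup>2) / n * B) + 2 * (e1 + e2 / M))"
proof -
  note \<mu> = covariate_lawD[OF model]
  interpret \<mu>: prob_space \<mu> by (rule \<mu>(1))
  define K where "K = (4 * \<sigma>\<^sup>2 + 17 * L\<^sup>2) / n"
  have K0: "K \<ge> 0" by (simp add: K_def)
  have Mp: "real M > 0" using M_pos by simp
  define t where "t m w = cell_tree n (\<lambda>i. Z i w) (H m w) (X w) - cell_average \<mu> ff (H m w) (X w)" for m w
  define b where "b m w = bias (X w) (H m w)" for m w
  define i where "i w = (indicator A (X w) :: real)" for w
  have im [measurable]: "i \<in> borel_measurable Pr"
    unfolding i_def[abs_def] by (rule measurable_compose[OF X(1) borel_measurable_indicator[OF A]])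
  have i01: "0 \<le> i w" "i w \<le> 1" for w by (auto simp: i_def indicator_def)
  have XH: "(\<lambda>w. (X w, H m w)) \<in> Pr \<rightarrow>\<^sub>M borel \<Otimes>\<^sub>M void_space" if "m < M" for m
    by (intro measurable_Pair X(1) H_void(1) that)
  have bm: "b m \<in> borel_measurable Pr" if "m < M" for m
    using measurable_compose[OF XH[OF that] bias_measurable] unfolding b_def[abs_def] by simp
  have avgm: "(\<lambda>w. cell_average \<mu> ff (H m w) (X w)) \<in> borel_measurable Pr" if "m < M" for m
    using measurable_compose[OF XH[OF that] cell_average_measurable[OF \<mu>(1,2) ff(1)]] by simp
  have tm: "t m \<in> borel_measurable Pr" if "m < M" for m
    unfolding t_def[abs_def] by (intro borel_measurable_diff avgm[OF that] tree_variance_risk(1)[OF that B(1)[OF that]])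
  have tv: "(\<integral>\<^sup>+w. ennreal ((t m w)\<^sup>2) \<partial>Pr) \<le> ennreal (K * B)" if "m < M" for m
    using tree_variance_risk(2)[OF that B(1)[OF that]] unfolding t_def K_def[symmetric] ennreal_mult'[OF K0, symmetric] .
  have bb: "\<bar>b m w\<bar> \<le> 2 * L" if "m < M" "w \<in> space Pr" for m w
    unfolding b_def using measurable_space[OF H_void(1)[OF that(1)] that(2)] by (intro bias_bound) simp
  define D where "D w = (\<Sum>m<M. b m w) / M" for w
  have Dm: "D \<in> borel_measurable Pr" unfolding D_def[abs_def] by (intro borel_measurable_divide borel_measurable_sum bm) simp_all
  have prod_int: "integrable Pr (\<lambda>w. i w * (b m w * b m' w))" if "m < M" "m' < M" for m m'
  proof (rule integrable_const_bound[OF AE_I2, of _ "(2 * L) * (2 * L)"])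
    fix w assume w: "w \<in> space Pr"
    have "\<bar>b m w * b m' w\<bar> \<le> (2 * L) * (2 * L)"
      unfolding abs_mult using bb[OF that(1) w] bb[OF that(2) w] L by (intro mult_mono) auto
    moreover have "\<bar>i w * (b m w * b m' w)\<bar> \<le> 1 * \<bar>b m w * b m' w\<bar>"
      unfolding abs_mult[of "i w"] using i01[of w] by (intro mult_right_mono) auto
    ultimately show "norm (i w * (b m w * b m' w)) \<le> (2 * L) * (2 * L)" by simp
  qed (intro borel_measurable_times im bm that)
  \<comment> \<open>Adding \<open>e1\<close> on the diagonal as well is harmless and lets the double
    sum be evaluated at once.\<close>
  have cross: "(\<integral>w. i w * (b m w * b m' w) \<partial>Pr) \<le> e1 + (if m = m' then e2 else 0)" if mm: "m < M" "m' < M" for m m'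
  proof (cases "m = m'")
    case True
    have "(\<integral>w. i w * (b m w * b m' w) \<partial>Pr) \<le> e2"
    proof (rule integral_real_bounded[OF e2(2)])
      have "(\<integral>\<^sup>+w. ennreal (i w * (b m w * b m' w)) \<partial>Pr) \<le> (\<integral>\<^sup>+w. ennreal ((b m w)\<^sup>2) \<partial>Pr)"
      proof (intro nn_integral_mono ennreal_leI)
        fix w
        have "i w * (b m w)\<^sup>2 \<le> 1 * (b m w)\<^sup>2" using i01 by (intro mult_right_mono) auto
        then show "i w * (b m w * b m' w) \<le> (b m w)\<^sup>2" using True by (simp add: power2_eq_square)
      qed
      also have "\<dots> \<le> ennreal e2"
        unfolding b_def by (rule bias_square[OF W mm(1) e2(1)[OF H_void(2)[OF mm(1)]]])
      finally show "(\<integral>\<^sup>+w. ennreal (i w * (b m w * b m' w)) \<partial>Pr) \<le> ennreal e2" .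
    qed
    then show ?thesis using True e1(2) by simp
  next
    case False
    \<comment> \<open>Void probabilities determine the law, so all trees have the same law and the
      product of the two mean biases is a square.\<close>
    have QQ: "Q m' = Q m" by (rule void_law_unique[OF H_void(2)[OF mm(2)] H_void(2)[OF mm(1)]])
    have "(\<integral>w. i w * (b m w * b m' w) \<partial>Pr) = (\<integral>x. indicator A x * (\<integral>h. bias x h \<partial>Q m)\<^sup>2 \<partial>\<mu>)"
      unfolding i_def b_def bias_product[OF mm False A] QQ power2_eq_square ..
    also have "\<dots> \<le> e1" by (rule integral_real_bounded[OF e1(2) e1(1)[OF H_void(2)[OF mm(1)]]])
    finally show ?thesis using False by simp
  qed
  have D2: "i w * (D w)\<^sup>2 = (\<Sum>m<M. \<Sum>m'<M. i w * (b m w * b m' w)) / (real M)\<^sup>2" for w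
    unfolding D_def power_divide power2_eq_square[of "sum _ _"] sum_product by (simp add: sum_distrib_left)
  have Di: "integrable Pr (\<lambda>w. i w * (D w)\<^sup>2)"
    unfolding D2 by (intro integrable_divide Bochner_Integration.integrable_sum prod_int) auto
  have "(\<integral>w. i w * (D w)\<^sup>2 \<partial>Pr) = (\<Sum>m<M. \<Sum>m'<M. (\<integral>w. i w * (b m w * b m' w) \<partial>Pr)) / (real M)\<^sup>2"
  proof -
    have "(\<integral>w. (\<Sum>m<M. \<Sum>m'<M. i w * (b m w * b m' w)) \<partial>Pr) = (\<Sum>m<M. (\<integral>w. (\<Sum>m'<M. i w * (b m w * b m' w)) \<partial>Pr))"
      by (intro Bochner_Integration.integral_sum Bochner_Integration.integrable_sum prod_int) auto
    also have "\<dots> = (\<Sum>m<M. \<Sum>m'<M. (\<integral>w. i w * (b m w * b m' w) \<partial>Pr))"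
      by (intro sum.cong refl Bochner_Integration.integral_sum prod_int) auto
    finally show ?thesis unfolding D2 by simp
  qed
  also have "\<dots> \<le> (\<Sum>m<M. \<Sum>m'<M. e1 + (if m = m' then e2 else 0)) / (real M)\<^sup>2"
    by (intro divide_right_mono sum_mono cross) auto
  also have "\<dots> = (real M * (real M * e1 + e2)) / (real M)\<^sup>2"
    by (simp add: sum.distrib)
  also have "\<dots> = e1 + e2 / M" using Mp by (simp add: power2_eq_square add_divide_distrib)
  finally have Dbound: "(\<integral>w. i w * (D w)\<^sup>2 \<partial>Pr) \<le> e1 + e2 / M" .
  have bias_part: "(\<integral>\<^sup>+w. ennreal (i w * (D w)\<^sup>2) \<partial>Pr) \<le> ennreal (e1 + e2 / M)"
    using nn_integral_eq_integral[OF Di] i01 Dbound by (simp add: ennreal_leI)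
  have var_part: "(\<integral>\<^sup>+w. ennreal ((\<Sum>m<M. (t m w)\<^sup>2) / M) \<partial>Pr) \<le> ennreal (K * B)"
  proof -
    have "(\<integral>\<^sup>+w. ennreal ((\<Sum>m<M. (t m w)\<^sup>2) / M) \<partial>Pr) = (\<integral>\<^sup>+w. (\<Sum>m<M. ennreal ((t m w)\<^sup>2)) * ennreal (1 / M) \<partial>Pr)"
      by (intro nn_integral_cong) (simp add: sum_ennreal ennreal_mult'[symmetric] sum_nonneg)
    also have "\<dots> = (\<Sum>m<M. (\<integral>\<^sup>+w. ennreal ((t m w)\<^sup>2) \<partial>Pr)) * ennreal (1 / M)"
    proof -
      have em: "(\<lambda>w. ennreal ((t m w)\<^sup>2)) \<in> borel_measurable Pr" if "m \<in> {..<M}" for m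
        by (intro measurable_compose[OF _ measurable_ennreal] borel_measurable_power tm) (use that in simp)
      have sm: "(\<lambda>w. \<Sum>m<M. ennreal ((t m w)\<^sup>2)) \<in> borel_measurable Pr"
        by (intro borel_measurable_sum em)
      show ?thesis by (simp only: nn_integral_multc[OF sm] nn_integral_sum[OF em])
    qed
    also have "\<dots> \<le> (\<Sum>m<M. ennreal (K * B)) * ennreal (1 / M)"
      by (intro mult_right_mono sum_mono tv) auto
    also have "\<dots> = ennreal (K * B)"
    proof -
      have "(\<Sum>m<M. ennreal (K * B)) = ennreal (\<Sum>m<M. K * B)" using K0 B(2) by (intro sum_ennreal) simp
      then show ?thesis using K0 B(2) Mp by (simp add: ennreal_mult''[symmetric])
    qed
    finally show ?thesis .
  qed
  have pt: "AE w in Pr. ennreal (i w * squared_error W f n M X Z H w) \<le>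
      2 * ennreal ((\<Sum>m<M. (t m w)\<^sup>2) / M) + 2 * ennreal (i w * (D w)\<^sup>2)"
  proof -
    have "AE w in Pr. \<forall>m\<in>{..<M}. tree_estimator n (\<lambda>i. Z i w) (induced_tessellation W (H m w)) (X w) =
        cell_tree n (\<lambda>i. Z i w) (H m w) (X w)"
      by (rule AE_finite_allI) (auto intro: AE_tree_eq)
    then show ?thesis
      using AE_space
    proof eventually_elim
      case (elim w)
      let ?T = "(\<Sum>m<M. t m w) / M"
      have fX: "f (X w) = ff (X w)" using ff(2) X(3)[OF elim(2)] by simp
      have "forest_estimator n M (\<lambda>i. Z i w) (\<lambda>m. induced_tessellation W (H m w)) (X w) - f (X w) =
          (\<Sum>m<M. cell_tree n (\<lambda>i. Z i w) (H m w) (X w)) / M - (\<Sum>m<M. ff (X w)) / M"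
        using elim(1) Mp by (simp add: forest_estimator_def fX)
      also have "\<dots> = (\<Sum>m<M. t m w + b m w) / M"
        unfolding diff_divide_distrib[symmetric] sum_subtractf[symmetric] t_def b_def by simp
      also have "\<dots> = ?T + D w" by (simp add: D_def sum.distrib add_divide_distrib)
      finally have se: "squared_error W f n M X Z H w = (?T + D w)\<^sup>2" by (simp add: squared_error_def)
      have "0 \<le> (?T - D w)\<^sup>2" by simp
      then have "(?T + D w)\<^sup>2 \<le> 2 * ?T\<^sup>2 + 2 * (D w)\<^sup>2" unfolding power2_sum power2_diff by linarith
      \<comment> \<open>The trees share one sample, so their errors are combined by the
        Cauchy-Schwarz inequality.\<close>
      moreover have "?T\<^sup>2 \<le> (\<Sum>m<M. (t m w)\<^sup>2) / M"
      proof -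
        have "(\<Sum>m<M. t m w)\<^sup>2 \<le> (\<Sum>m<M. (t m w)\<^sup>2) * real M"
          using sum_squared_le_sum_of_squares[of "\<lambda>m. t m w" "{..<M}"] by simp
        then have "?T\<^sup>2 \<le> (\<Sum>m<M. (t m w)\<^sup>2) * real M / (real M)\<^sup>2"
          unfolding power_divide by (intro divide_right_mono) auto
        then show ?thesis using Mp by (simp add: power2_eq_square)
      qed
      ultimately have "(?T + D w)\<^sup>2 \<le> 2 * ((\<Sum>m<M. (t m w)\<^sup>2) / M) + 2 * (D w)\<^sup>2" by linarith
      then have "i w * (?T + D w)\<^sup>2 \<le> i w * (2 * ((\<Sum>m<M. (t m w)\<^sup>2) / M) + 2 * (D w)\<^sup>2)"
        using i01 by (intro mult_left_mono) auto
      also have "\<dots> \<le> 2 * ((\<Sum>m<M. (t m w)\<^sup>2) / M) + 2 * (i w * (D w)\<^sup>2)"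
      proof -
        have "i w * (2 * ((\<Sum>m<M. (t m w)\<^sup>2) / M)) \<le> 1 * (2 * ((\<Sum>m<M. (t m w)\<^sup>2) / M))"
          using i01 by (intro mult_right_mono) (auto simp: sum_nonneg)
        then show ?thesis by (simp add: distrib_left)
      qed
      finally have "ennreal (i w * squared_error W f n M X Z H w) \<le> ennreal (2 * ((\<Sum>m<M. (t m w)\<^sup>2) / M) + 2 * (i w * (D w)\<^sup>2))"
        unfolding se by (rule ennreal_leI)
      also have "\<dots> = 2 * ennreal ((\<Sum>m<M. (t m w)\<^sup>2) / M) + 2 * ennreal (i w * (D w)\<^sup>2)"
      proof -
        have two: "ennreal (2 * x) = 2 * ennreal x" for x :: real
          using ennreal_mult'[of 2 x] by simp
        have a: "0 \<le> 2 * ((\<Sum>m<M. (t m w)\<^sup>2) / M)" by (intro mult_nonneg_nonneg divide_nonneg_nonneg sum_nonneg) simp_all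
        have b: "0 \<le> 2 * (i w * (D w)\<^sup>2)" using i01[of w] by (intro mult_nonneg_nonneg) simp_all
        show ?thesis by (simp only: ennreal_plus[OF a b] two)
      qed
      finally show ?case .
    qed
  qed
  have "(\<integral>\<^sup>+w. ennreal (i w * squared_error W f n M X Z H w) \<partial>Pr) \<le>
      (\<integral>\<^sup>+w. 2 * ennreal ((\<Sum>m<M. (t m w)\<^sup>2) / M) + 2 * ennreal (i w * (D w)\<^sup>2) \<partial>Pr)"
    by (rule nn_integral_mono_AE[OF pt])
  also have "\<dots> = 2 * (\<integral>\<^sup>+w. ennreal ((\<Sum>m<M. (t m w)\<^sup>2) / M) \<partial>Pr) + 2 * (\<integral>\<^sup>+w. ennreal (i w * (D w)\<^sup>2) \<partial>Pr)"
  proof -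
    have 1: "(\<lambda>w. ennreal ((\<Sum>m<M. (t m w)\<^sup>2) / M)) \<in> borel_measurable Pr"
      by (intro measurable_compose[OF _ measurable_ennreal] borel_measurable_divide borel_measurable_sum borel_measurable_power tm) simp_all
    have 2: "(\<lambda>w. ennreal (i w * (D w)\<^sup>2)) \<in> borel_measurable Pr"
      by (intro measurable_compose[OF _ measurable_ennreal] borel_measurable_times borel_measurable_power im Dm)
    show ?thesis using 1 2 by (simp add: nn_integral_add nn_integral_cmult)
  qed
  also have "\<dots> \<le> 2 * ennreal (K * B) + 2 * ennreal (e1 + e2 / M)"
    by (intro add_mono mult_left_mono var_part bias_part) auto
  also have "\<dots> = ennreal (2 * (K * B) + 2 * (e1 + e2 / M))"
  proof -
    have two: "ennreal (2 * x) = 2 * ennreal x" for x :: real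
      using ennreal_mult'[of 2 x] by simp
    have a: "0 \<le> 2 * (K * B)" using K0 B(2) by simp
    have b: "0 \<le> 2 * (e1 + e2 / M)" using e1(2) e2(2) by simp
    show ?thesis by (simp only: ennreal_plus[OF a b] two)
  qed
  finally show ?thesis unfolding i_def K_def .
qed

end

end

subsection \<open>Rates\<close>

text \<open>\<open>f\<close> is constrained only on \<open>W\<close>. Being continuous on this
  closed set, it becomes a bounded Borel function when extended by zero, as the integrals over the
  whole space require.\<close>

lemma truncated_regression_function:
  fixes f :: "real ^ 'n \<Rightarrow> real"
  assumes W: "closed W" and f: "holder_bounded W \<beta> L f" and \<beta>: "\<beta> > 0" and L: "L > 0"
    and ff: "ff = (\<lambda>x. indicator W x *\<^sub>R f x)"
  shows "ff \<in> borel_measurable borel" "\<And>x. x \<in> W \<Longrightarrow> ff x = f x" "\<And>x. \<bar>ff x\<bar> \<le> L"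
proof -
  show "ff \<in> borel_measurable borel"
    unfolding ff by (rule borel_measurable_continuous_on_indicator[OF _ holder_bounded_continuous_on[OF f \<beta>]]) (use W in simp)
  show "ff x = f x" if "x \<in> W" for x using that by (simp add: ff)
  show "\<bar>ff x\<bar> \<le> L" for x using f L by (cases "x \<in> W") (auto simp: ff holder_bounded_def)
qed

context
  fixes W S :: "(real ^ 'n) set" and \<phi> :: "(real ^ 'n) measure" and \<rho> :: "((real ^ 'n) \<times> real) measure"
    and f :: "real ^ 'n \<Rightarrow> real" and \<sigma> \<beta> L :: real and d :: nat
  assumes W: "compact W" "convex W"
    and \<phi>: "directional_distribution \<phi>"
    and model: "regression_model W \<rho> f \<sigma>"
    and S: "subspace S" "dim S = d" "measure_support (covariate_law \<rho>) \<subseteq> S"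
    and \<beta>: "0 < \<beta>" "\<beta> \<le> 1" and L: "0 < L"
begin

private abbreviation "\<nu> \<equiv> covariate_law \<rho>"

private lemmas \<nu> = covariate_lawD[OF model]

private lemma closed_W: "closed W" using W(1) by (rule compact_imp_closed)

private lemma AE_W: "AE x in \<nu>. x \<in> W" by (rule AE_covariate_law[OF model closed_W])

private lemma inverse_cell_mass_bound:
  "\<exists>C>0. \<forall>(Pr :: 'w measure) lam H. lam \<ge> 1 \<longrightarrow> poisson_hyperplane_process Pr \<phi> lam H \<longrightarrow>
    (\<integral>\<^sup>+ h. (\<integral>\<^sup>+ x. inverse (cell_mass \<nu> h x) \<partial>\<nu>) \<partial>(distr Pr void_space H)) \<le> ennreal (C * lam ^ d)"
proof -
  interpret \<nu>: prob_space \<nu> by (rule \<nu>(1))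
  obtain R where R: "\<forall>x\<in>W. norm x \<le> R" using compact_imp_bounded[OF W(1)] by (auto simp: bounded_iff)
  have AE: "AE x in \<nu>. x \<in> S \<inter> cball 0 \<bar>R\<bar>"
    using AE_W AE_measure_support[OF \<nu>(2)]
  proof eventually_elim
    case (elim x)
    then show ?case using R S(3) by force
  qed
  show ?thesis
    by (rule expected_inverse_cell_mass[OF S(1,2) abs_ge_zero \<phi> \<nu>.finite_measure_axioms \<nu>(2) AE])
qed

text \<open>Here \<open>e1\<close> and \<open>e2\<close> are the same quantity, so
  \<open>1 + 1 / M\<close> is simply bounded by 2 and the estimate is uniform in
  \<open>M\<close>.\<close>

lemma risk_bound_0:
  assumes f: "f \<in> holder_class_0 W \<beta> L"
  shows "\<exists>C\<ge>0. \<forall>lam n M (Pr :: 'w measure) X Z H. n \<ge> 1 \<longrightarrow> lam \<ge> 1 \<longrightarrow> forest_experiment W \<rho> \<phi> lam n M Pr X Z H \<longrightarrow>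
    (LINT w|Pr. squared_error W f n M X Z H w) \<le> C * (lam ^ d / n + lam powr (- 2 * \<beta>))"
proof -
  have hb: "holder_bounded W \<beta> L f" using f by (simp add: holder_class_0_def)
  define ff where "ff = (\<lambda>x. indicator W x *\<^sub>R f x)"
  note ff = truncated_regression_function[OF closed_W hb \<beta>(1) L ff_def]
  interpret \<nu>: prob_space \<nu> by (rule \<nu>(1))
  obtain C1 where C1: "C1 > 0" "\<And>(Pr :: 'w measure) lam H. lam \<ge> 1 \<Longrightarrow> poisson_hyperplane_process Pr \<phi> lam H \<Longrightarrow>
    (\<integral>\<^sup>+ h. (\<integral>\<^sup>+ x. inverse (cell_mass \<nu> h x) \<partial>\<nu>) \<partial>(distr Pr void_space H)) \<le> ennreal (C1 * lam ^ d)"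
    using inverse_cell_mass_bound by blast
  have "\<exists>C\<ge>0. \<forall>lam Q x. lam > 0 \<longrightarrow> void_law \<phi> lam Q \<longrightarrow> x \<in> W \<inter> measure_support \<nu> \<longrightarrow>
      (\<integral>\<^sup>+h. ennreal ((cell_average \<nu> ff h x - ff x)\<^sup>2) \<partial>Q) \<le> ennreal (C * lam powr (- 2 * \<beta>))"
  proof (rule bias_second_moment[OF \<phi> \<nu>(1,2) AE_W ff(1,3) \<beta> less_imp_le[OF L]])
    fix x y assume "x \<in> W" "y \<in> W"
    then show "\<bar>ff y - ff x\<bar> \<le> L * norm (y - x) powr \<beta>"
      using hb by (simp add: ff(2) holder_bounded_def)
  qed
  then obtain C2 where C2: "C2 \<ge> 0" "\<And>lam Q x. lam > 0 \<Longrightarrow> void_law \<phi> lam Q \<Longrightarrow> x \<in> W \<inter> measure_support \<nu> \<Longrightarrow>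
      (\<integral>\<^sup>+h. ennreal ((cell_average \<nu> ff h x - ff x)\<^sup>2) \<partial>Q) \<le> ennreal (C2 * lam powr (- 2 * \<beta>))" by blast
  define C where "C = 2 * (4 * \<sigma>\<^sup>2 + 17 * L\<^sup>2) * C1 + 4 * C2"
  have "C \<ge> 0" using C1(1) C2(1) by (simp add: C_def)
  moreover have "(LINT w|Pr. squared_error W f n M X Z H w) \<le> C * (lam ^ d / n + lam powr (- 2 * \<beta>))"
    if n: "n \<ge> 1" and lam: "lam \<ge> 1" and e: "forest_experiment W \<rho> \<phi> lam n M Pr X Z H"
    for lam n M and Pr :: "'w measure" and X Z H
  proof -
    interpret forest W \<rho> \<phi> lam n M Pr X Z H f \<sigma> by standard (rule e, rule \<phi>, rule model)
    let ?e = "C2 * lam powr (- 2 * \<beta>)"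
    have e0: "?e \<ge> 0" using C2(1) by simp
    have B0: "C1 * lam ^ d \<ge> 0" using C1(1) lam by simp
    \<comment> \<open>The square of a mean is at most the mean of the square, by nonnegativity of
      the variance.\<close>
    have sq: "(\<integral>h. cell_average \<nu> ff h x - ff x \<partial>Q')\<^sup>2 \<le> ?e" if Q': "void_law \<phi> lam Q'" and x: "x \<in> W \<inter> measure_support \<nu>" for Q' x
    proof -
      interpret Q': prob_space Q' using Q' by (simp add: void_law_def)
      have sQ: "sets Q' = sets void_space" using Q' by (simp add: void_law_def)
      let ?b = "\<lambda>h. cell_average \<nu> ff h x - ff x"
      have bm: "?b \<in> borel_measurable Q'"
        unfolding measurable_cong_sets[OF sQ refl]
        using cell_average_config_measurable[OF \<nu>(1,2) ff(1)] by (rule borel_measurable_diff) simp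
      have bb: "\<bar>?b h\<bar> \<le> 2 * L" if "h \<in> space Q'" for h
      proof -
        have "h \<in> hyperplane_configs" using that sets_eq_imp_space_eq[OF sQ] by simp
        from cell_average_bound[OF \<nu>(1,2) ff(1,3) this, of x] show ?thesis using ff(3)[of x] by linarith
      qed
      have bi: "integrable Q' ?b" by (rule Q'.integrable_const_bound[OF AE_I2 bm]) (use bb in auto)
      have b2i: "integrable Q' (\<lambda>h. (?b h)\<^sup>2)"
      proof (rule Q'.integrable_const_bound[OF AE_I2])
        show "norm ((?b h)\<^sup>2) \<le> (2 * L)\<^sup>2" if "h \<in> space Q'" for h
          using power_mono[OF bb[OF that] abs_ge_zero, of 2] by simp
      qed (use bm in measurable)
      have "(\<integral>h. ?b h \<partial>Q')\<^sup>2 \<le> (\<integral>h. (?b h)\<^sup>2 \<partial>Q')"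
        using Q'.variance_positive[of ?b] Q'.variance_eq[OF bi b2i] by linarith
      also have "\<dots> \<le> ?e" by (rule integral_real_bounded[OF e0 C2(2)[OF lam_pos Q' x]])
      finally show ?thesis .
    qed
    have "(\<integral>\<^sup>+w. ennreal (indicator UNIV (X w) * squared_error W f n M X Z H w) \<partial>Pr) \<le>
        ennreal (2 * ((4 * \<sigma>\<^sup>2 + 17 * L\<^sup>2) / n * (C1 * lam ^ d)) + 2 * (?e + ?e / M))"
    proof (rule forest_risk[OF ff L n closed_W])
      show "(\<integral>\<^sup>+ h. (\<integral>\<^sup>+ x. inverse (cell_mass \<nu> h x) \<partial>\<nu>) \<partial>distr Pr void_space (H m)) \<le> ennreal (C1 * lam ^ d)" if "m < M" for m
        by (rule C1(2)[OF lam H[OF that]])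
      show "(\<integral>\<^sup>+x. ennreal (indicator UNIV x * (\<integral>h. cell_average \<nu> ff h x - ff x \<partial>Q')\<^sup>2) \<partial>\<nu>) \<le> ennreal ?e"
        if Q': "void_law \<phi> lam Q'" for Q'
      proof -
        have "(\<integral>\<^sup>+x. ennreal (indicator UNIV x * (\<integral>h. cell_average \<nu> ff h x - ff x \<partial>Q')\<^sup>2) \<partial>\<nu>) \<le> (\<integral>\<^sup>+x. ennreal ?e \<partial>\<nu>)"
        proof (rule nn_integral_mono_AE)
          show "AE x in \<nu>. ennreal (indicator UNIV x * (\<integral>h. cell_average \<nu> ff h x - ff x \<partial>Q')\<^sup>2) \<le> ennreal ?e"
            using AE_W AE_measure_support[OF \<nu>(2)]
          proof eventually_elim
            case (elim x)
            then show ?case using sq[OF Q', of x] by (simp add: ennreal_leI)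
          qed
        qed
        then show ?thesis by (simp add: \<nu>.emeasure_space_1)
      qed
      show "(\<integral>\<^sup>+h. ennreal ((cell_average \<nu> ff h x - ff x)\<^sup>2) \<partial>Q') \<le> ennreal ?e"
        if "void_law \<phi> lam Q'" "x \<in> W \<inter> measure_support \<nu>" for Q' x by (rule C2(2)[OF lam_pos that])
    qed (use e0 B0 in simp_all)
    then have "(LINT w|Pr. squared_error W f n M X Z H w) \<le>
        2 * ((4 * \<sigma>\<^sup>2 + 17 * L\<^sup>2) / n * (C1 * lam ^ d)) + 2 * (?e + ?e / M)"
      using B0 e0 by (intro integral_real_bounded) simp_all
    also have "\<dots> \<le> C * (lam ^ d / n + lam powr (- 2 * \<beta>))"
    proof -
      have "?e / M \<le> ?e / 1" using M_pos e0 by (intro divide_left_mono) auto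
      then have "2 * (?e + ?e / M) \<le> 4 * C2 * lam powr (- 2 * \<beta>)" by simp
      moreover have "4 * C2 * lam powr (- 2 * \<beta>) \<le> C * lam powr (- 2 * \<beta>)"
        using C1(1) by (intro mult_right_mono) (auto simp: C_def)
      moreover have "2 * ((4 * \<sigma>\<^sup>2 + 17 * L\<^sup>2) / n * (C1 * lam ^ d)) = (2 * (4 * \<sigma>\<^sup>2 + 17 * L\<^sup>2) * C1) * (lam ^ d / n)" by simp
      moreover have "\<dots> \<le> C * (lam ^ d / n)" using C2(1) lam by (intro mult_right_mono) (auto simp: C_def)
      ultimately show ?thesis unfolding distrib_left by linarith
    qed
    finally show ?thesis .
  qed
  ultimately show ?thesis by (intro exI[of _ C]) simp
qed

text \<open>The set \<open>A\<close> lets one argument serve both claims: the inner part uses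
  \<open>mean_bias_inner\<close>, the whole space \<open>mean_bias_global\<close>. The term
  \<open>lam powr (- 2) / M\<close> is the diagonal of the bias double sum, the one that a large
  number of trees has to suppress.\<close>

lemma risk_bound_1:
  assumes f: "f \<in> holder_class_1 W \<beta> L" and K: "K = measure_support \<nu>" "convex K" "aff_dim K = int d"
    and dens: "positive_lipschitz_density_on S K \<nu>"
    and A: "A \<in> sets borel" and cases: "A = UNIV \<and> \<beta> \<le> 1/2 \<or> (\<exists>\<epsilon>>0. A = inner_part_in S K \<epsilon>)"
  shows "\<exists>C\<ge>0. \<forall>lam n M (Pr :: 'w measure) X Z H. n \<ge> 1 \<longrightarrow> lam \<ge> 1 \<longrightarrow> forest_experiment W \<rho> \<phi> lam n M Pr X Z H \<longrightarrow>
    (LINT w|Pr. indicator A (X w) * squared_error W f n M X Z H w) \<le>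
      C * (lam ^ d / n + lam powr (- 2 - 2 * \<beta>) + lam powr (- 2) / M)"
proof -
  have hb: "holder_bounded W \<beta> L f" using f by (simp add: holder_class_1_def)
  define ff where "ff = (\<lambda>x. indicator W x *\<^sub>R f x)"
  note ff = truncated_regression_function[OF closed_W hb \<beta>(1) L ff_def]
  interpret \<nu>: prob_space \<nu> by (rule \<nu>(1))
  note taylor = holder_class_1_taylor[OF f W(2) \<beta>(1) less_imp_le[OF L]]
  have KW: "K \<subseteq> W" unfolding K(1) by (rule measure_support_subset[OF \<nu>(2) closed_W AE_W])
  have sp: "space \<nu> = UNIV" using sets_eq_imp_space_eq[OF \<nu>(2)] by simp
  have clK: "closed K" unfolding K(1) by (rule closed_measure_support[OF sp])
  have cK: "compact K" using W(1) clK KW by (metis compact_Int_closed inf.absorb_iff2)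
  have KS: "K \<subseteq> S" using S(3) K(1) by simp
  have AEK: "AE x in \<nu>. x \<in> K" unfolding K(1) by (rule AE_measure_support[OF \<nu>(2)])
  obtain p Cp where p: "\<And>x. x \<in> K \<Longrightarrow> p x > 0" "Cp-lipschitz_on K p"
    "\<nu> = density (subspace_lborel S) (\<lambda>x. ennreal (indicator K x * p x))"
    using dens unfolding positive_lipschitz_density_on_def by blast
  have pc: "continuous_on K p" using p(2) by (rule lipschitz_on_continuous_on)
  have Kne: "K \<noteq> {}" using K(3) by auto
  \<comment> \<open>Continuity on the compact \<open>K\<close> makes the positive density bounded
    away from zero, which the relative density error needs. The maximum, in turn, converts volumes
    of boundary layers into masses.\<close>
  obtain xm where xm: "xm \<in> K" "\<And>y. y \<in> K \<Longrightarrow> p xm \<le> p y" using continuous_attains_inf[OF cK Kne pc] by blast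
  obtain xM where xM: "xM \<in> K" "\<And>y. y \<in> K \<Longrightarrow> p y \<le> p xM" using continuous_attains_sup[OF cK Kne pc] by blast
  have Cp: "Cp \<ge> 0" using p(2) by (rule lipschitz_on_nonneg)
  have plip: "\<bar>p y - p z\<bar> \<le> Cp * norm (y - z)" if "y \<in> K" "z \<in> K" for y z
    using lipschitz_onD[OF p(2) that] by (simp add: dist_norm)
  have qm: "(\<lambda>y. indicator K y * p y) \<in> borel_measurable borel"
    using borel_measurable_continuous_on_indicator[OF _ pc] clK by simp
  let ?G = "CARD('n) * L"
  have G0: "?G \<ge> 0" using L by simp
  have lip: "\<bar>ff y - ff x\<bar> \<le> ?G * norm (y - x)" if "x \<in> W" "y \<in> W" for x y
    using taylor(1)[OF that] by (simp add: ff(2) that)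
  have sd: "\<bar>ff y + ff (2 *\<^sub>R x - y) - 2 * ff x\<bar> \<le> 2 * CARD('n) * L * norm (y - x) powr (1 + \<beta>)"
    if "x \<in> K" "y \<in> K" "2 *\<^sub>R x - y \<in> K" for x y
  proof -
    have w: "x \<in> W" "y \<in> W" "2 *\<^sub>R x - y \<in> W" using that KW by auto
    from taylor(2)[OF w] show ?thesis by (simp add: ff(2) w)
  qed
  have "\<exists>C c r. C \<ge> 0 \<and> c > 0 \<and> r > 0 \<and> (\<forall>lam Q x J. lam > 0 \<longrightarrow> void_law \<phi> lam Q \<longrightarrow> x \<in> K \<longrightarrow>
      (\<forall>k. k \<notin> J \<longrightarrow> (\<forall>y\<in>S. norm (y - x) \<le> c * ((real k + 1) / lam) \<longrightarrow> y \<in> K)) \<longrightarrow>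
      \<bar>\<integral>h. cell_average \<nu> ff h x - ff x \<partial>Q\<bar> \<le>
        C * lam powr (- (1 + \<beta>)) + C / lam * (\<Sum>k. indicator J k * ((real k + 1) * exp (- r * real k))))"
  proof (rule mean_bias_bound[OF \<phi> S(1) \<nu>(1) p(3) AEK compact_imp_bounded[OF cK] KS K(1) qm p(1)[OF xm(1)] xm(2) plip ff(1,3) G0 _ sd Cp _ \<beta>])
    show "\<bar>ff y - ff x\<bar> \<le> ?G * norm (y - x)" if "x \<in> K" "y \<in> K" for x y using lip[of x y] that KW by blast
    show "0 \<le> 2 * CARD('n) * L" using L by simp
  qed
  then obtain Cm c r where Cm: "Cm \<ge> 0" "c > 0" "r > 0" and "\<forall>lam Q x J. lam > 0 \<longrightarrow> void_law \<phi> lam Q \<longrightarrow> x \<in> K \<longrightarrow>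
      (\<forall>k. k \<notin> J \<longrightarrow> (\<forall>y\<in>S. norm (y - x) \<le> c * ((real k + 1) / lam) \<longrightarrow> y \<in> K)) \<longrightarrow>
      \<bar>\<integral>h. cell_average \<nu> ff h x - ff x \<partial>Q\<bar> \<le>
        Cm * lam powr (- (1 + \<beta>)) + Cm / lam * (\<Sum>k. indicator J k * ((real k + 1) * exp (- r * real k)))"
    by (elim exE conjE) (rule that, assumption+)
  then have mb: "\<bar>\<integral>h. cell_average \<nu> ff h x - ff x \<partial>Q\<bar> \<le>
        Cm * lam powr (- (1 + \<beta>)) + Cm / lam * (\<Sum>k. indicator J k * ((real k + 1) * exp (- r * real k)))"
    if "lam > 0" "void_law \<phi> lam Q" "x \<in> K"
      "\<forall>k. k \<notin> J \<longrightarrow> (\<forall>y\<in>S. norm (y - x) \<le> c * ((real k + 1) / lam) \<longrightarrow> y \<in> K)" for lam Q x J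
    using that by simp
  have "\<exists>C\<ge>0. \<forall>lam Q. lam \<ge> 1 \<longrightarrow> void_law \<phi> lam Q \<longrightarrow>
    (\<integral>\<^sup>+x. ennreal (indicator A x * (\<integral>h. cell_average \<nu> ff h x - ff x \<partial>Q)\<^sup>2) \<partial>\<nu>) \<le> ennreal (C * lam powr (- 2 - 2 * \<beta>))"
    using cases
  proof (elim disjE conjE exE)
    assume A: "A = UNIV" and b: "\<beta> \<le> 1/2"
    obtain B0 where B0: "B0 \<ge> 0" "\<And>\<rho>. \<rho> \<ge> 0 \<Longrightarrow> \<exists>D\<in>sets borel. emeasure (subspace_lborel S) D \<le> ennreal (B0 * \<rho>) \<and> D \<subseteq> K \<and>
        (\<forall>x\<in>K - D. \<forall>y\<in>S. norm (y - x) \<le> \<rho> \<longrightarrow> y \<in> K)"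
      using boundary_layer[OF S(1,2) KS K(2,3) cK] by blast
    have pM: "p xM \<ge> 0" using p(1)[OF xM(1)] by simp
    have layer: "\<exists>D\<in>sets \<nu>. emeasure \<nu> D \<le> ennreal ((p xM * B0) * \<rho>) \<and>
        (\<forall>x\<in>K - D. \<forall>y\<in>S. norm (y - x) \<le> \<rho> \<longrightarrow> y \<in> K)" if \<rho>: "\<rho> \<ge> 0" for \<rho>
    proof -
      obtain D where D: "D \<in> sets borel" "emeasure (subspace_lborel S) D \<le> ennreal (B0 * \<rho>)"
        "\<forall>x\<in>K - D. \<forall>y\<in>S. norm (y - x) \<le> \<rho> \<longrightarrow> y \<in> K" using B0(2)[OF \<rho>] by blast
      have D': "D \<in> sets (subspace_lborel S)" using D(1) by (simp only: sets_subspace_lborel[OF S(1)])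
      have qm': "(\<lambda>y. ennreal (indicator K y * p y)) \<in> borel_measurable (subspace_lborel S)"
        unfolding measurable_cong_sets[OF sets_subspace_lborel[OF S(1)] refl]
        by (rule measurable_compose[OF qm measurable_ennreal])
      have "emeasure \<nu> D = (\<integral>\<^sup>+y. ennreal (indicator K y * p y) * indicator D y \<partial>subspace_lborel S)"
        by (subst p(3)) (rule emeasure_density[OF qm' D'])
      also have "\<dots> \<le> (\<integral>\<^sup>+y. ennreal (p xM) * indicator D y \<partial>subspace_lborel S)"
      proof (intro nn_integral_mono mult_right_mono ennreal_leI)
        show "indicator K y * p y \<le> p xM" for y using xM(2)[of y] pM by (simp add: indicator_def)
      qed simp
      also have "\<dots> = ennreal (p xM) * emeasure (subspace_lborel S) D" using D' by (rule nn_integral_cmult_indicator)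
      also have "\<dots> \<le> ennreal (p xM) * ennreal (B0 * \<rho>)" by (rule mult_left_mono[OF D(2)]) simp
      also have "\<dots> = ennreal ((p xM * B0) * \<rho>)" using pM by (simp add: ennreal_mult' mult.assoc)
      finally have "emeasure \<nu> D \<le> ennreal ((p xM * B0) * \<rho>)" .
      moreover have "D \<in> sets \<nu>" using D(1) by (simp only: \<nu>(2))
      ultimately show ?thesis using D(3) by blast
    qed
    have BB: "p xM * B0 \<ge> 0" using pM B0(1) by simp
    have U: "indicator UNIV x * t = t" for x :: "real ^ 'n" and t :: real by simp
    show ?thesis unfolding A U
      by (rule mean_bias_global[of "void_law \<phi>" K S c "\<lambda>Q x. \<integral>h. cell_average \<nu> ff h x - ff x \<partial>Q" Cm \<beta> r \<nu>,
        OF mb Cm \<beta>(1) b \<nu>(1) AEK BB layer])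
  next
    fix \<epsilon> :: real assume \<epsilon>: "\<epsilon> > 0" and A: "A = inner_part_in S K \<epsilon>"
    have "\<exists>C'\<ge>0. \<forall>lam Q x. lam \<ge> 1 \<longrightarrow> void_law \<phi> lam Q \<longrightarrow> x \<in> A \<longrightarrow>
        (\<integral>h. cell_average \<nu> ff h x - ff x \<partial>Q)\<^sup>2 \<le> C' * lam powr (- 2 - 2 * \<beta>)"
    proof (rule mean_bias_inner[of "void_law \<phi>" K S c "\<lambda>Q x. \<integral>h. cell_average \<nu> ff h x - ff x \<partial>Q" Cm \<beta> r \<epsilon> A,
          OF mb Cm \<beta> \<epsilon>])
      show "A \<subseteq> K" by (auto simp: A inner_part_in_def)
      show "y \<in> K" if "x \<in> A" "y \<in> S" "norm (y - x) < \<epsilon>" for x y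
        using inner_part_ball[OF S(1) KS _ that(2,3)] that(1) A by simp
    qed
    then obtain C' where C': "C' \<ge> 0" "\<And>lam Q x. lam \<ge> 1 \<Longrightarrow> void_law \<phi> lam Q \<Longrightarrow> x \<in> A \<Longrightarrow>
        (\<integral>h. cell_average \<nu> ff h x - ff x \<partial>Q)\<^sup>2 \<le> C' * lam powr (- 2 - 2 * \<beta>)" by blast
    have "(\<integral>\<^sup>+x. ennreal (indicator A x * (\<integral>h. cell_average \<nu> ff h x - ff x \<partial>Q)\<^sup>2) \<partial>\<nu>) \<le> ennreal (C' * lam powr (- 2 - 2 * \<beta>))"
      if "lam \<ge> 1" "void_law \<phi> lam Q" for lam Q
    proof -
      have "(\<integral>\<^sup>+x. ennreal (indicator A x * (\<integral>h. cell_average \<nu> ff h x - ff x \<partial>Q)\<^sup>2) \<partial>\<nu>) \<le>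
          (\<integral>\<^sup>+x. ennreal (C' * lam powr (- 2 - 2 * \<beta>)) \<partial>\<nu>)"
      proof (intro nn_integral_mono ennreal_leI)
        show "indicator A x * (\<integral>h. cell_average \<nu> ff h x - ff x \<partial>Q)\<^sup>2 \<le> C' * lam powr (- 2 - 2 * \<beta>)" for x
          using C'(2)[OF that, of x] C'(1) by (simp add: indicator_def)
      qed
      then show ?thesis by (simp add: \<nu>.emeasure_space_1)
    qed
    with C'(1) show ?thesis by blast
  qed
  then obtain C3 where C3: "C3 \<ge> 0" "\<And>lam Q. lam \<ge> 1 \<Longrightarrow> void_law \<phi> lam Q \<Longrightarrow>
    (\<integral>\<^sup>+x. ennreal (indicator A x * (\<integral>h. cell_average \<nu> ff h x - ff x \<partial>Q)\<^sup>2) \<partial>\<nu>) \<le> ennreal (C3 * lam powr (- 2 - 2 * \<beta>))"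
    by blast
  obtain C1 where C1: "C1 > 0" "\<And>(Pr :: 'w measure) lam H. lam \<ge> 1 \<Longrightarrow> poisson_hyperplane_process Pr \<phi> lam H \<Longrightarrow>
    (\<integral>\<^sup>+ h. (\<integral>\<^sup>+ x. inverse (cell_mass \<nu> h x) \<partial>\<nu>) \<partial>(distr Pr void_space H)) \<le> ennreal (C1 * lam ^ d)"
    using inverse_cell_mass_bound by blast
  have "\<exists>C\<ge>0. \<forall>lam Q x. lam > 0 \<longrightarrow> void_law \<phi> lam Q \<longrightarrow> x \<in> W \<inter> measure_support \<nu> \<longrightarrow>
      (\<integral>\<^sup>+h. ennreal ((cell_average \<nu> ff h x - ff x)\<^sup>2) \<partial>Q) \<le> ennreal (C * lam powr (- 2 * 1))"
  proof (rule bias_second_moment[OF \<phi> \<nu>(1,2) AE_W ff(1,3) _ _ G0])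
    show "\<bar>ff y - ff x\<bar> \<le> ?G * norm (y - x) powr 1" if "x \<in> W" "y \<in> W" for x y using lip[OF that] by simp
  qed simp_all
  then obtain C2 where C2: "C2 \<ge> 0" "\<And>lam Q x. lam > 0 \<Longrightarrow> void_law \<phi> lam Q \<Longrightarrow> x \<in> W \<inter> measure_support \<nu> \<Longrightarrow>
      (\<integral>\<^sup>+h. ennreal ((cell_average \<nu> ff h x - ff x)\<^sup>2) \<partial>Q) \<le> ennreal (C2 * lam powr (- 2))" by auto
  define C where "C = 2 * (4 * \<sigma>\<^sup>2 + 17 * L\<^sup>2) * C1 + 2 * C3 + 2 * C2"
  have nn: "2 * (4 * \<sigma>\<^sup>2 + 17 * L\<^sup>2) * C1 \<ge> 0" using C1(1) by simp
  have "C \<ge> 0" using nn C2(1) C3(1) by (simp add: C_def)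
  moreover have "(LINT w|Pr. indicator A (X w) * squared_error W f n M X Z H w) \<le>
      C * (lam ^ d / n + lam powr (- 2 - 2 * \<beta>) + lam powr (- 2) / M)"
    if n: "n \<ge> 1" and lam: "lam \<ge> 1" and e: "forest_experiment W \<rho> \<phi> lam n M Pr X Z H"
    for lam n M and Pr :: "'w measure" and X Z H
  proof -
    interpret forest W \<rho> \<phi> lam n M Pr X Z H f \<sigma> by standard (rule e, rule \<phi>, rule model)
    let ?e1 = "C3 * lam powr (- 2 - 2 * \<beta>)" and ?e2 = "C2 * lam powr (- 2)"
    have e0: "?e1 \<ge> 0" "?e2 \<ge> 0" using C2(1) C3(1) by simp_all
    have B0: "C1 * lam ^ d \<ge> 0" using C1(1) lam by simp
    have "(\<integral>\<^sup>+w. ennreal (indicator A (X w) * squared_error W f n M X Z H w) \<partial>Pr) \<le>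
        ennreal (2 * ((4 * \<sigma>\<^sup>2 + 17 * L\<^sup>2) / n * (C1 * lam ^ d)) + 2 * (?e1 + ?e2 / M))"
    proof (rule forest_risk[OF ff L n closed_W A _ B0 C3(2)[OF lam] e0(1) C2(2)[OF lam_pos] e0(2)])
      show "(\<integral>\<^sup>+ h. (\<integral>\<^sup>+ x. inverse (cell_mass \<nu> h x) \<partial>\<nu>) \<partial>distr Pr void_space (H m)) \<le> ennreal (C1 * lam ^ d)" if "m < M" for m
        by (rule C1(2)[OF lam H[OF that]])
    qed
    then have "(LINT w|Pr. indicator A (X w) * squared_error W f n M X Z H w) \<le>
        2 * ((4 * \<sigma>\<^sup>2 + 17 * L\<^sup>2) / n * (C1 * lam ^ d)) + 2 * (?e1 + ?e2 / M)"
      using B0 e0 by (intro integral_real_bounded) simp_all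
    also have "\<dots> = (2 * (4 * \<sigma>\<^sup>2 + 17 * L\<^sup>2) * C1) * (lam ^ d / n) + (2 * C3) * lam powr (- 2 - 2 * \<beta>) + (2 * C2) * (lam powr (- 2) / M)"
      by (simp add: distrib_left distrib_right mult.assoc)
    also have "\<dots> \<le> C * (lam ^ d / n) + C * lam powr (- 2 - 2 * \<beta>) + C * (lam powr (- 2) / M)"
      using nn C2(1) C3(1) lam by (intro add_mono mult_right_mono) (auto simp: C_def)
    finally show ?thesis by (simp only: distrib_left)
  qed
  ultimately show ?thesis by (intro exI[of _ C]) simp
qed

end

section \<open>Rates in the sample size\<close>

lemma filterlim_powr_sequentially:
  assumes a: "(a::real) > 0"
  shows "filterlim (\<lambda>n. real n powr a) at_top at_top"
proof -
  have "((\<lambda>n. real n powr (- a)) \<longlongrightarrow> 0) at_top"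
    by (rule tendsto_neg_powr[OF _ filterlim_real_sequentially]) (use a in simp)
  then have "filterlim (\<lambda>n. inverse (real n powr (- a))) at_top at_top"
    by (rule filterlim_inverse_at_top) (use eventually_gt_at_top[of "0::nat"] in \<open>auto elim!: eventually_mono\<close>)
  then show ?thesis by (simp add: powr_minus)
qed

text \<open>The choice \<open>a = 1 / (d + 2 * \<kappa>)\<close> equates the exponents of
  \<open>lam n ^ d / n\<close> and \<open>lam n powr (- 2 * \<kappa>)\<close>. The two claims are
  the instances \<kappa> = \<beta> and \<kappa> = \<beta> + 1, with \<open>g\<close> the power of
  \<open>L\<close>, a positive constant. The bound on \<open>r\<close> is required only where
  \<open>lam n \<ge> 1\<close>, which holds eventually because \<open>lam\<close> diverges.\<close>

lemma risk_rate:
  fixes lam r E :: "nat \<Rightarrow> real" and c a \<kappa> e C g :: real and d :: nat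
  assumes lam: "lam \<sim>[at_top] (\<lambda>n. c * real n powr a)" "\<And>n. lam n > 0" and c: "c > 0"
    and \<kappa>: "\<kappa> > 0" and a: "a = 1 / (d + 2 * \<kappa>)" and e: "e = - 2 * \<kappa> / (d + 2 * \<kappa>)"
    and r: "\<And>n. n \<ge> 1 \<Longrightarrow> lam n \<ge> 1 \<Longrightarrow> \<bar>r n\<bar> \<le> C * (lam n ^ d / n + lam n powr (- 2 * \<kappa>) + E n)"
    and E: "E \<in> O(\<lambda>n. real n powr e)" and g: "g > 0"
  shows "r \<in> O(\<lambda>n. g * real n powr e)"
proof -
  have den: "d + 2 * \<kappa> > 0" using \<kappa> by simp
  then have a0: "a > 0" by (simp add: a)
  have ea: "e = a * (- 2 * \<kappa>)" by (simp add: e a)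
  have ea': "a * d - 1 = e" using den by (simp add: e a field_simps)
  have theta: "lam \<in> \<Theta>(\<lambda>n. real n powr a)"
    using asymp_equiv_imp_bigtheta[OF lam(1)] c by simp
  have top: "filterlim lam at_top at_top"
  proof (rule asymp_equiv_at_top_transfer[OF asymp_equiv_symI[OF lam(1)]])
    show "filterlim (\<lambda>n. c * real n powr a) at_top at_top"
      using filterlim_tendsto_pos_mult_at_top[OF tendsto_const c filterlim_powr_sequentially[OF a0]] .
  qed
  have "(\<lambda>n. lam n ^ d / n) \<in> O(\<lambda>n. (real n powr a) ^ d / n)"
    using landau_o.big_power[OF bigthetaD1[OF theta], of d]
    by (intro landau_o.big.divide_right) (use eventually_gt_at_top[of "0::nat"] in \<open>auto elim!: eventually_mono\<close>)
  also have "(\<lambda>n. (real n powr a) ^ d / n) \<in> \<Theta>(\<lambda>n. real n powr e)"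
  proof (rule bigthetaI_cong)
    show "\<forall>\<^sub>F n in at_top. (real n powr a) ^ d / n = real n powr e"
      using eventually_gt_at_top[of "0::nat"]
    proof eventually_elim
      case (elim n)
      have "(real n powr a) ^ d / n = real n powr (a * d) / real n powr 1"
        using elim by (simp add: powr_powr powr_realpow[symmetric])
      then show ?case by (simp only: powr_diff[symmetric] ea')
    qed
  qed
  finally have 1: "(\<lambda>n. lam n ^ d / n) \<in> O(\<lambda>n. real n powr e)" .
  have 2: "(\<lambda>n. lam n powr (- 2 * \<kappa>)) \<in> O(\<lambda>n. real n powr e)"
    using bigthetaD1[OF bigtheta_powr[OF theta, of "- 2 * \<kappa>"]] lam(2)
    by (simp add: powr_powr ea abs_of_pos)
  have "r \<in> O(\<lambda>n. lam n ^ d / n + lam n powr (- 2 * \<kappa>) + E n)"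
  proof (rule bigoI[of _ "\<bar>C\<bar>"])
    show "\<forall>\<^sub>F n in at_top. norm (r n) \<le> \<bar>C\<bar> * norm (lam n ^ d / n + lam n powr (- 2 * \<kappa>) + E n)"
      using eventually_ge_at_top[of "1::nat"] filterlim_at_top[THEN iffD1, OF top, rule_format, of 1]
    proof eventually_elim
      case (elim n)
      have "\<bar>r n\<bar> \<le> \<bar>C * (lam n ^ d / n + lam n powr (- 2 * \<kappa>) + E n)\<bar>" using r[OF elim] by linarith
      then show ?case by (simp only: abs_mult real_norm_def)
    qed
  qed
  also have "(\<lambda>n. lam n ^ d / n + lam n powr (- 2 * \<kappa>) + E n) \<in> O(\<lambda>n. real n powr e)"
    by (intro sum_in_bigo(1) 1 2 E)
  finally show ?thesis using g by simp
qed

lemma squared_error_nonneg: "0 \<le> squared_error W f n M X Z H w"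
  by (simp add: squared_error_def)

lemma inner_part_borel:
  fixes S K :: "(real ^ 'n) set"
  assumes "closed K"
  shows "inner_part_in S K \<epsilon> \<in> sets borel"
proof -
  have "inner_part_in S K \<epsilon> = K \<inter> {x. \<epsilon> \<le> infdist x (top_of_set S frontier_of K)}"
    by (auto simp: inner_part_in_def)
  moreover have "closed {x. \<epsilon> \<le> infdist x (top_of_set S frontier_of K)}"
    by (intro closed_Collect_le continuous_intros)
  ultimately show ?thesis using assms by (simp add: closed_Int)
qed

theorem theorem16:
  fixes W S zonoid :: "(real ^ 'n) set"
    and \<phi> :: "(real ^ 'n) measure"
    and \<rho> :: "((real ^ 'n) \<times> real) measure"
    and f :: "real ^ 'n \<Rightarrow> real"
    and \<sigma> \<beta> L :: real
    and d :: nat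
  assumes W: "compact W" "convex W" "W \<noteq> {}" "aff_dim W = int CARD('n)"
    and \<phi>: "directional_distribution \<phi>" "normalized_associated_zonoid \<phi> zonoid"
    and model: "regression_model W \<rho> f \<sigma>"
    and S: "subspace S" "dim S = d" "measure_support (covariate_law \<rho>) \<subseteq> S"
    and \<beta>: "0 < \<beta>" "\<beta> \<le> 1" and L: "0 < L"
  shows
    "(f \<in> holder_class_0 W \<beta> L \<longrightarrow>
       (\<forall>(lam :: nat \<Rightarrow> real) (M :: nat) (Pr :: nat \<Rightarrow> 'w measure) X Z H.
          lam \<sim>[at_top] (\<lambda>n. L powr (2 / (d + 2*\<beta>)) * real n powr (1 / (d + 2*\<beta>))) \<and>
          M \<ge> 1 \<and>
          (\<forall>n. forest_experiment W \<rho> \<phi> (lam n) n M (Pr n) (X n) (Z n) (H n)) \<longrightarrow>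
          (\<lambda>n. LINT w|Pr n. squared_error W f n M (X n) (Z n) (H n) w)
            \<in> O(\<lambda>n. L powr (2*d / (d + 2*\<beta>)) * real n powr (- 2*\<beta> / (d + 2*\<beta>)))))
     \<and>
     (\<forall>K. f \<in> holder_class_1 W \<beta> L \<and>
       K = measure_support (covariate_law \<rho>) \<and> convex K \<and> aff_dim K = int d \<and>
       positive_lipschitz_density_on S K (covariate_law \<rho>) \<longrightarrow>
       (\<forall>(lam :: nat \<Rightarrow> real) (M :: nat \<Rightarrow> nat) (Pr :: nat \<Rightarrow> 'w measure) X Z H.
          lam \<sim>[at_top] (\<lambda>n. L powr (2 / (d + 2*\<beta> + 2)) * real n powr (1 / (d + 2*\<beta> + 2))) \<and>
          (\<lambda>n. real (M n)) \<in>
            \<Omega>(\<lambda>n. L powr (4*\<beta> / (d + 2*\<beta> + 2)) * real n powr (2*\<beta> / (d + 2*\<beta> + 2))) \<and>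
          (\<forall>n. forest_experiment W \<rho> \<phi> (lam n) n (M n) (Pr n) (X n) (Z n) (H n)) \<longrightarrow>
          (\<forall>\<epsilon>. 0 < \<epsilon> \<and> \<epsilon> < inradius_in S K \<longrightarrow>
             (\<lambda>n. expectation_given (Pr n) {w \<in> space (Pr n). X n w \<in> inner_part_in S K \<epsilon>}
                     (squared_error W f n (M n) (X n) (Z n) (H n)))
               \<in> O(\<lambda>n. L powr (2*d / (d + 2*\<beta> + 2)) *
                        real n powr (- (2*\<beta> + 2) / (d + 2*\<beta> + 2)))) \<and>
          (\<beta> \<le> 1/2 \<longrightarrow>
             (\<lambda>n. LINT w|Pr n. squared_error W f n (M n) (X n) (Z n) (H n) w)
               \<in> O(\<lambda>n. L powr (2*d / (d + 2*\<beta> + 2)) *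
                        real n powr (- (2*\<beta> + 2) / (d + 2*\<beta> + 2))))))"
proof (rule conjI)
  show "f \<in> holder_class_0 W \<beta> L \<longrightarrow>
       (\<forall>(lam :: nat \<Rightarrow> real) (M :: nat) (Pr :: nat \<Rightarrow> 'w measure) X Z H.
          lam \<sim>[at_top] (\<lambda>n. L powr (2 / (d + 2*\<beta>)) * real n powr (1 / (d + 2*\<beta>))) \<and>
          M \<ge> 1 \<and>
          (\<forall>n. forest_experiment W \<rho> \<phi> (lam n) n M (Pr n) (X n) (Z n) (H n)) \<longrightarrow>
          (\<lambda>n. LINT w|Pr n. squared_error W f n M (X n) (Z n) (H n) w)
            \<in> O(\<lambda>n. L powr (2*d / (d + 2*\<beta>)) * real n powr (- 2*\<beta> / (d + 2*\<beta>))))"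
  proof (intro impI allI, elim conjE)
    fix lam :: "nat \<Rightarrow> real" and M :: nat and Pr :: "nat \<Rightarrow> 'w measure" and X Z H
    assume f: "f \<in> holder_class_0 W \<beta> L"
      and lam: "lam \<sim>[at_top] (\<lambda>n. L powr (2 / (d + 2*\<beta>)) * real n powr (1 / (d + 2*\<beta>)))"
      and e: "\<forall>n. forest_experiment W \<rho> \<phi> (lam n) n M (Pr n) (X n) (Z n) (H n)"
    obtain C where C: "C \<ge> 0" "\<And>lam n M (Pr :: 'w measure) X Z H. n \<ge> 1 \<Longrightarrow> lam \<ge> 1 \<Longrightarrow>
        forest_experiment W \<rho> \<phi> lam n M Pr X Z H \<Longrightarrow>
        (LINT w|Pr. squared_error W f n M X Z H w) \<le> C * (lam ^ d / n + lam powr (- 2 * \<beta>))"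
      using risk_bound_0[OF W(1,2) \<phi>(1) model S \<beta> L f, where 'w = 'w] by blast
    show "(\<lambda>n. LINT w|Pr n. squared_error W f n M (X n) (Z n) (H n) w)
            \<in> O(\<lambda>n. L powr (2*d / (d + 2*\<beta>)) * real n powr (- 2*\<beta> / (d + 2*\<beta>)))"
    proof (rule risk_rate[OF lam _ _ \<beta>(1) refl refl])
      show "lam n > 0" for n using e by (simp add: forest_experiment_def)
      show "\<bar>LINT w|Pr n. squared_error W f n M (X n) (Z n) (H n) w\<bar> \<le> C * (lam n ^ d / n + lam n powr (- 2 * \<beta>) + 0)"
        if "n \<ge> 1" "lam n \<ge> 1" for n
        using C(2)[OF that e[rule_format]] by (simp add: abs_of_nonneg squared_error_nonneg)
    qed (use L in simp_all)
  qed
  show "\<forall>K. f \<in> holder_class_1 W \<beta> L \<and>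
       K = measure_support (covariate_law \<rho>) \<and> convex K \<and> aff_dim K = int d \<and>
       positive_lipschitz_density_on S K (covariate_law \<rho>) \<longrightarrow>
       (\<forall>(lam :: nat \<Rightarrow> real) (M :: nat \<Rightarrow> nat) (Pr :: nat \<Rightarrow> 'w measure) X Z H.
          lam \<sim>[at_top] (\<lambda>n. L powr (2 / (d + 2*\<beta> + 2)) * real n powr (1 / (d + 2*\<beta> + 2))) \<and>
          (\<lambda>n. real (M n)) \<in>
            \<Omega>(\<lambda>n. L powr (4*\<beta> / (d + 2*\<beta> + 2)) * real n powr (2*\<beta> / (d + 2*\<beta> + 2))) \<and>
          (\<forall>n. forest_experiment W \<rho> \<phi> (lam n) n (M n) (Pr n) (X n) (Z n) (H n)) \<longrightarrow>
          (\<forall>\<epsilon>. 0 < \<epsilon> \<and> \<epsilon> < inradius_in S K \<longrightarrow>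
             (\<lambda>n. expectation_given (Pr n) {w \<in> space (Pr n). X n w \<in> inner_part_in S K \<epsilon>}
                     (squared_error W f n (M n) (X n) (Z n) (H n)))
               \<in> O(\<lambda>n. L powr (2*d / (d + 2*\<beta> + 2)) *
                        real n powr (- (2*\<beta> + 2) / (d + 2*\<beta> + 2)))) \<and>
          (\<beta> \<le> 1/2 \<longrightarrow>
             (\<lambda>n. LINT w|Pr n. squared_error W f n (M n) (X n) (Z n) (H n) w)
               \<in> O(\<lambda>n. L powr (2*d / (d + 2*\<beta> + 2)) *
                        real n powr (- (2*\<beta> + 2) / (d + 2*\<beta> + 2)))))"
  proof (intro impI allI, elim conjE)
    fix K and lam :: "nat \<Rightarrow> real" and M :: "nat \<Rightarrow> nat" and Pr :: "nat \<Rightarrow> 'w measure" and X Z H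
    assume f: "f \<in> holder_class_1 W \<beta> L"
      and K: "K = measure_support (covariate_law \<rho>)" "convex K" "aff_dim K = int d"
        "positive_lipschitz_density_on S K (covariate_law \<rho>)"
      and lam: "lam \<sim>[at_top] (\<lambda>n. L powr (2 / (d + 2*\<beta> + 2)) * real n powr (1 / (d + 2*\<beta> + 2)))"
      and M: "(\<lambda>n. real (M n)) \<in> \<Omega>(\<lambda>n. L powr (4*\<beta> / (d + 2*\<beta> + 2)) * real n powr (2*\<beta> / (d + 2*\<beta> + 2)))"
      and e: "\<forall>n. forest_experiment W \<rho> \<phi> (lam n) n (M n) (Pr n) (X n) (Z n) (H n)"
    define a where "a = 1 / (d + 2 * \<beta> + 2)"
    define rate where "rate = - (2 * \<beta> + 2) / (d + 2 * \<beta> + 2)"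
    have rate: "rate = a * (- 2) + - (2 * \<beta> / (d + 2 * \<beta> + 2))" by (simp add: rate_def a_def diff_divide_distrib)
    have lam_pos: "lam n > 0" and M_pos: "M n \<ge> 1" for n using e by (simp_all add: forest_experiment_def)
    \<comment> \<open>The growth of \<open>M n\<close> adds the exponent
      \<open>- (2 * \<beta> / (d + 2 * \<beta> + 2))\<close> to that of
      \<open>lam n powr (- 2)\<close>, and the sum is exactly \<open>rate\<close>.\<close>
    have E: "(\<lambda>n. lam n powr (- 2) / M n) \<in> O(\<lambda>n. real n powr rate)"
    proof -
      have "lam \<in> \<Theta>(\<lambda>n. real n powr a)"
        using asymp_equiv_imp_bigtheta[OF lam] L by (simp add: a_def)
      from bigthetaD1[OF bigtheta_powr[OF this, of "- 2"]]
      have 1: "(\<lambda>n. lam n powr (- 2)) \<in> O(\<lambda>n. real n powr (a * (- 2)))"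
        using lam_pos by (simp add: powr_powr abs_of_pos)
      have "(\<lambda>n. real n powr (2*\<beta> / (d + 2*\<beta> + 2))) \<in> O(\<lambda>n. real (M n))"
        using M L by (simp add: bigomega_iff_bigo)
      then have "(\<lambda>n. inverse (real (M n))) \<in> O(\<lambda>n. inverse (real n powr (2*\<beta> / (d + 2*\<beta> + 2))))"
        by (rule landau_o.big.inverse[rotated 2])
          (use eventually_gt_at_top[of "0::nat"] M_pos in \<open>auto elim!: eventually_mono simp: Suc_le_eq\<close>)
      from landau_o.big.mult[OF 1 this] show ?thesis
        by (simp only: rate powr_add powr_minus divide_inverse)
    qed
    \<comment> \<open>The unconditional risk is the instance \<open>A = UNIV\<close>,
      \<open>q = 1\<close>; the conditional one takes for \<open>A\<close> the inner part and for
      \<open>q\<close> its mass under the law of the covariate.\<close>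
    have cond: "(\<lambda>n. (LINT w|Pr n. indicator A (X n w) * squared_error W f n (M n) (X n) (Z n) (H n) w) / q)
        \<in> O(\<lambda>n. L powr (2*d / (d + 2*\<beta> + 2)) * real n powr rate)"
      if A: "A \<in> sets borel" "A = UNIV \<and> \<beta> \<le> 1/2 \<or> (\<exists>\<epsilon>>0. A = inner_part_in S K \<epsilon>)" and q: "q \<ge> 0" for A q
    proof -
      obtain C where C: "C \<ge> 0" "\<And>lam n M (Pr :: 'w measure) X Z H. n \<ge> 1 \<Longrightarrow> lam \<ge> 1 \<Longrightarrow>
          forest_experiment W \<rho> \<phi> lam n M Pr X Z H \<Longrightarrow>
          (LINT w|Pr. indicator A (X w) * squared_error W f n M X Z H w) \<le>
            C * (lam ^ d / n + lam powr (- 2 - 2 * \<beta>) + lam powr (- 2) / M)"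
        using risk_bound_1[OF W(1,2) \<phi>(1) model S \<beta> L f K A, where 'w = 'w] by blast
      show ?thesis
      proof (rule risk_rate[of lam _ a "\<beta> + 1" d _ _ "C / q", OF _ lam_pos _ _ _ _ _ E])
        show "lam \<sim>[at_top] (\<lambda>n. L powr (2 / (d + 2*\<beta> + 2)) * real n powr a)" using lam by (simp add: a_def)
        show "a = 1 / (d + 2 * (\<beta> + 1))" by (simp add: a_def add.assoc)
        show "rate = - 2 * (\<beta> + 1) / (d + 2 * (\<beta> + 1))" by (simp add: rate_def add.assoc)
        show "\<bar>(LINT w|Pr n. indicator A (X n w) * squared_error W f n (M n) (X n) (Z n) (H n) w) / q\<bar> \<le>
            C / q * (lam n ^ d / n + lam n powr (- 2 * (\<beta> + 1)) + lam n powr (- 2) / M n)"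
          if "n \<ge> 1" "lam n \<ge> 1" for n
        proof -
          have ex: "- 2 * (\<beta> + 1) = - 2 - 2 * \<beta>" by simp
          have "0 \<le> (LINT w|Pr n. indicator A (X n w) * squared_error W f n (M n) (X n) (Z n) (H n) w)"
            by (intro Bochner_Integration.integral_nonneg mult_nonneg_nonneg squared_error_nonneg) simp
          then show ?thesis
            using divide_right_mono[OF C(2)[OF that e[rule_format]] q] q unfolding ex by simp
        qed
      qed (use L \<beta> in simp_all)
    qed
    have "(\<lambda>n. expectation_given (Pr n) {w \<in> space (Pr n). X n w \<in> inner_part_in S K \<epsilon>}
            (squared_error W f n (M n) (X n) (Z n) (H n)))
          \<in> O(\<lambda>n. L powr (2*d / (d + 2*\<beta> + 2)) * real n powr rate)" if \<epsilon>: "0 < \<epsilon>" for \<epsilon>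
    proof -
      let ?A = "inner_part_in S K \<epsilon>"
      have "space (covariate_law \<rho>) = UNIV" by (simp add: covariate_law_def)
      then have A: "?A \<in> sets borel" unfolding K(1) by (intro inner_part_borel closed_measure_support)
      \<comment> \<open>The conditioning probability does not depend on \<open>n\<close>, since
        every test point has the law \<open>covariate_law \<rho>\<close>; it only rescales the
        constant.\<close>
      have "expectation_given (Pr n) {w \<in> space (Pr n). X n w \<in> ?A} (squared_error W f n (M n) (X n) (Z n) (H n)) =
          (LINT w|Pr n. indicator ?A (X n w) * squared_error W f n (M n) (X n) (Z n) (H n) w) / measure (covariate_law \<rho>) ?A" for n
      proof -
        have X: "X n \<in> Pr n \<rightarrow>\<^sub>M restrict_space borel W" "distr (Pr n) borel (X n) = covariate_law \<rho>"
          using e by (simp_all add: forest_experiment_def)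
        have "X n \<in> borel_measurable (Pr n)" using X(1) by (simp add: measurable_restrict_space2_iff)
        from measure_distr[OF this A]
        have "measure (Pr n) {w \<in> space (Pr n). X n w \<in> ?A} = measure (covariate_law \<rho>) ?A"
          unfolding X(2) by (simp add: vimage_def Int_def conj_commute)
        moreover have "(LINT w:{w \<in> space (Pr n). X n w \<in> ?A}|Pr n. squared_error W f n (M n) (X n) (Z n) (H n) w) =
            (LINT w|Pr n. indicator ?A (X n w) * squared_error W f n (M n) (X n) (Z n) (H n) w)"
          unfolding set_lebesgue_integral_def
          by (rule Bochner_Integration.integral_cong) (auto simp: indicator_def)
        ultimately show ?thesis by (simp add: expectation_given_def)
      qed
      then show ?thesis using cond[OF A _ measure_nonneg] \<epsilon> by (simp only:) blast
    qed
    moreover have "(\<lambda>n. LINT w|Pr n. squared_error W f n (M n) (X n) (Z n) (H n) w)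
          \<in> O(\<lambda>n. L powr (2*d / (d + 2*\<beta> + 2)) * real n powr rate)" if "\<beta> \<le> 1/2"
      using cond[of UNIV 1] that by simp
    ultimately show "(\<forall>\<epsilon>. 0 < \<epsilon> \<and> \<epsilon> < inradius_in S K \<longrightarrow>
             (\<lambda>n. expectation_given (Pr n) {w \<in> space (Pr n). X n w \<in> inner_part_in S K \<epsilon>}
                     (squared_error W f n (M n) (X n) (Z n) (H n)))
               \<in> O(\<lambda>n. L powr (2*d / (d + 2*\<beta> + 2)) *
                        real n powr (- (2*\<beta> + 2) / (d + 2*\<beta> + 2)))) \<and>
          (\<beta> \<le> 1/2 \<longrightarrow>
             (\<lambda>n. LINT w|Pr n. squared_error W f n (M n) (X n) (Z n) (H n) w)
               \<in> O(\<lambda>n. L powr (2*d / (d + 2*\<beta> + 2)) *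
                        real n powr (- (2*\<beta> + 2) / (d + 2*\<beta> + 2))))"
      unfolding rate_def by simp
  qed
qed

end
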